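(* Leaves of symplectic foliations on closed manifolds are strongly geometrically bounded. That is, if $(\mathcal{F},\omega)$ is a symplectic foliation on a closed manifold $M$ and $L$ is a leaf of $\mathcal{F}$, then the symplectic manifold $(L,\omega|_L)$ is strongly geometrically bounded.
   Context: Foliation always means a smooth codimension-$1$ foliation on a closed ambient manifold. A symplectic foliation $(\mathcal{F},\omega)$ on a closed manifold $M$ is such a foliation $\mathcal{F}$ together with a smooth leafwise $2$-form $\omega\in\Omega^2(\mathcal{F})$ whose restriction to every leaf is a symplectic form; leaves carry their natural (immersed) manifold structure. Geometrically bounded triple: a triple $(\omega,J,g)$ on a manifold $W$, where $\omega$ is a symplectic form, $J$ an almost complex structure and $g$ a complete Riemannian metric, such that: (GB1) there are constants $A,B>0$ with $\omega(u,Ju)\ge A\|u\|_g^2$ and $|\omega(u,v)|\le B\|u\|_g\|v\|_g$ for all tangent vectors $u,v$ at the same point; (GB2) the sectional curvature of $g$ is bounded from above and the injectivity radius of $(W,g)$ is bounded from below by a positive constant. Strongly geometrically bounded: a symplectic manifold $(W,\omega)$ is strongly geometrically bounded if there is an almost complex structure $J$ compatible with $\omega$ such that, with $g_{\omega,J}=\omega(\cdot,J\cdot)$, the triple $(\omega,J,g_{\omega,J})$ is a geometrically bounded triple. *)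

theory Defs
  imports "HOL-Analysis.Analysis"
begin

section \<open>Smooth maps between Euclidean spaces\<close>

text \<open>Both notions are meant for open sets \<^term>\<open>S\<close> only.\<close>

primrec Ck_on :: "nat \<Rightarrow> 'a::real_normed_vector set \<Rightarrow> ('a \<Rightarrow> 'b::real_normed_vector) \<Rightarrow> bool" where
  "Ck_on 0 S f \<longleftrightarrow> continuous_on S f"
| "Ck_on (Suc k) S f \<longleftrightarrow>
     (\<forall>x\<in>S. f differentiable (at x)) \<and>
     (\<forall>v. Ck_on k S (\<lambda>x. frechet_derivative f (at x) v))"

definition smooth_on :: "'a::real_normed_vector set \<Rightarrow> ('a \<Rightarrow> 'b::real_normed_vector) \<Rightarrow> bool" where
  "smooth_on S f \<longleftrightarrow> (\<forall>k. Ck_on k S f)"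


section \<open>Smooth manifolds\<close>

text \<open>
  A manifold modelled on the Euclidean space \<open>'e\<close> is a set of points with an indexed family of
  charts; \<open>coord X i\<close> is only meaningful on \<open>patch X i\<close>. The topology is the one determined by
  the atlas. The same chart may occur under several indices.
\<close>

record ('i, 'a, 'e) atlas =
  points :: "'a set"
  indices :: "'i set"
  patch :: "'i \<Rightarrow> 'a set"
  coord :: "'i \<Rightarrow> 'a \<Rightarrow> 'e"

definition param :: "('i, 'a, 'e) atlas \<Rightarrow> 'i \<Rightarrow> 'e \<Rightarrow> 'a" where
  "param X i = inv_into (patch X i) (coord X i)"

definition charts_at :: "('i, 'a, 'e) atlas \<Rightarrow> 'a \<Rightarrow> 'i set" where
  "charts_at X p = {i \<in> indices X. p \<in> patch X i}"

definition smoothly_compatible ::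
  "('i, 'a, 'e::euclidean_space) atlas \<Rightarrow> ('j, 'a, 'e) atlas \<Rightarrow> bool" where
  "smoothly_compatible X Y \<longleftrightarrow>
     (\<forall>i\<in>indices X. \<forall>j\<in>indices Y.
        let U = patch X i \<inter> patch Y j in
        open (coord X i ` U) \<and> open (coord Y j ` U) \<and>
        smooth_on (coord X i ` U) (coord Y j \<circ> param X i) \<and>
        smooth_on (coord Y j ` U) (coord X i \<circ> param Y j))"

definition smooth_atlas :: "('i, 'a, 'e::euclidean_space) atlas \<Rightarrow> bool" where
  "smooth_atlas X \<longleftrightarrow>
     points X = (\<Union>i\<in>indices X. patch X i) \<and>
     (\<forall>i\<in>indices X. inj_on (coord X i) (patch X i)) \<and>
     smoothly_compatible X X"

definition atlas_topology :: "('i, 'a, 'e::euclidean_space) atlas \<Rightarrow> 'a topology" where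
  "atlas_topology X =
     topology (\<lambda>W. W \<subseteq> points X \<and> (\<forall>i\<in>indices X. open (coord X i ` (W \<inter> patch X i))))"

lemma openin_atlas_topology:
  assumes "smooth_atlas X"
  shows "openin (atlas_topology X) W \<longleftrightarrow>
    W \<subseteq> points X \<and> (\<forall>i\<in>indices X. open (coord X i ` (W \<inter> patch X i)))"
proof -
  have inj: "inj_on (coord X i) (patch X i)" if "i \<in> indices X" for i
    using assms that by (simp add: smooth_atlas_def)
  have "istopology (\<lambda>W. W \<subseteq> points X \<and> (\<forall>i\<in>indices X. open (coord X i ` (W \<inter> patch X i))))"
    unfolding istopology_def
  proof (intro conjI allI impI ballI)
    fix S T i
    assume S: "S \<subseteq> points X \<and> (\<forall>i\<in>indices X. open (coord X i ` (S \<inter> patch X i)))"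
      and T: "T \<subseteq> points X \<and> (\<forall>i\<in>indices X. open (coord X i ` (T \<inter> patch X i)))"
      and i: "i \<in> indices X"
    have "coord X i ` (S \<inter> T \<inter> patch X i) =
        coord X i ` (S \<inter> patch X i) \<inter> coord X i ` (T \<inter> patch X i)"
      using inj[OF i] by (auto simp: inj_on_def)
    then show "open (coord X i ` (S \<inter> T \<inter> patch X i))"
      using S T i by auto
  next
    fix K i
    assume K: "\<forall>S\<in>K. S \<subseteq> points X \<and> (\<forall>i\<in>indices X. open (coord X i ` (S \<inter> patch X i)))"
      and i: "i \<in> indices X"
    have "coord X i ` (\<Union>K \<inter> patch X i) = (\<Union>S\<in>K. coord X i ` (S \<inter> patch X i))"
      by auto
    then show "open (coord X i ` (\<Union>K \<inter> patch X i))"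
      using K i by auto
  qed auto
  then show ?thesis
    by (simp add: atlas_topology_def topology_inverse')
qed

lemma topspace_atlas_topology:
  assumes "smooth_atlas X"
  shows "topspace (atlas_topology X) = points X"
proof -
  have "openin (atlas_topology X) (points X)"
    unfolding openin_atlas_topology[OF assms]
  proof (intro conjI ballI)
    fix i assume i: "i \<in> indices X"
    have "points X \<inter> patch X i = patch X i \<inter> patch X i"
      using assms i by (auto simp: smooth_atlas_def)
    moreover have "open (coord X i ` (patch X i \<inter> patch X i))"
      using assms i unfolding smooth_atlas_def smoothly_compatible_def Let_def by blast
    ultimately show "open (coord X i ` (points X \<inter> patch X i))"
      by simp
  qed simp
  moreover have "W \<subseteq> points X" if "openin (atlas_topology X) W" for W
    using that openin_atlas_topology[OF assms] by blast
  ultimately show ?thesis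
    by (metis openin_subset openin_topspace subset_antisym)
qed

definition countable_basis_space :: "'a topology \<Rightarrow> bool" where
  "countable_basis_space T \<longleftrightarrow>
     (\<exists>B. countable B \<and> (\<forall>V\<in>B. openin T V) \<and>
          (\<forall>U x. openin T U \<and> x \<in> U \<longrightarrow> (\<exists>V\<in>B. x \<in> V \<and> V \<subseteq> U)))"

definition smooth_manifold :: "('i, 'a, 'e::euclidean_space) atlas \<Rightarrow> bool" where
  "smooth_manifold X \<longleftrightarrow>
     smooth_atlas X \<and> Hausdorff_space (atlas_topology X) \<and>
     countable_basis_space (atlas_topology X)"

definition closed_manifold :: "('i, 'a, 'e::euclidean_space) atlas \<Rightarrow> bool" where
  "closed_manifold X \<longleftrightarrow> smooth_manifold X \<and> compact_space (atlas_topology X)"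


section \<open>Tensor fields\<close>

text \<open>
  A tangent vector at \<open>p\<close> is given by its coordinates in every chart at \<open>p\<close>, transforming under
  the differential of the transition maps. Accordingly a tensor field is a family, indexed by
  the charts, of pointwise multilinear maps on \<open>'e\<close> that respects this transformation rule.
  Values at points outside the patch are irrelevant.
\<close>

definition transition_deriv ::
  "('i, 'a, 'e::euclidean_space) atlas \<Rightarrow> 'i \<Rightarrow> 'i \<Rightarrow> 'a \<Rightarrow> 'e \<Rightarrow> 'e" where
  "transition_deriv X i j p =
     frechet_derivative (coord X j \<circ> param X i) (at (coord X i p))"

definition partial_deriv ::
  "('i, 'a, 'e::euclidean_space) atlas \<Rightarrow> 'i \<Rightarrow> ('a \<Rightarrow> 'b::real_normed_vector) \<Rightarrow> 'a \<Rightarrow> 'e \<Rightarrow> 'b" where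
  "partial_deriv X i f p u = frechet_derivative (f \<circ> param X i) (at (coord X i p)) u"

definition smooth_2tensor ::
  "('i, 'a, 'e::euclidean_space) atlas \<Rightarrow> ('i \<Rightarrow> 'a \<Rightarrow> 'e \<Rightarrow> 'e \<Rightarrow> real) \<Rightarrow> bool" where
  "smooth_2tensor X T \<longleftrightarrow>
     (\<forall>i\<in>indices X. \<forall>p\<in>patch X i. bilinear (T i p)) \<and>
     (\<forall>i\<in>indices X. \<forall>u v. smooth_on (coord X i ` patch X i) (\<lambda>x. T i (param X i x) u v)) \<and>
     (\<forall>p. \<forall>i\<in>charts_at X p. \<forall>j\<in>charts_at X p. \<forall>u v.
        T i p u v = T j p (transition_deriv X i j p u) (transition_deriv X i j p v))"

definition smooth_endomorphism ::
  "('i, 'a, 'e::euclidean_space) atlas \<Rightarrow> ('i \<Rightarrow> 'a \<Rightarrow> 'e \<Rightarrow> 'e) \<Rightarrow> bool" where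
  "smooth_endomorphism X J \<longleftrightarrow>
     (\<forall>i\<in>indices X. \<forall>p\<in>patch X i. linear (J i p)) \<and>
     (\<forall>i\<in>indices X. \<forall>u. smooth_on (coord X i ` patch X i) (\<lambda>x. J i (param X i x) u)) \<and>
     (\<forall>p. \<forall>i\<in>charts_at X p. \<forall>j\<in>charts_at X p. \<forall>u.
        transition_deriv X i j p (J i p u) = J j p (transition_deriv X i j p u))"

text \<open>The last conjunct is \<open>d\<omega> = 0\<close>, evaluated on constant coordinate vector fields.\<close>

definition symplectic_form ::
  "('i, 'a, 'e::euclidean_space) atlas \<Rightarrow> ('i \<Rightarrow> 'a \<Rightarrow> 'e \<Rightarrow> 'e \<Rightarrow> real) \<Rightarrow> bool" where
  "symplectic_form X \<omega> \<longleftrightarrow>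
     smooth_2tensor X \<omega> \<and>
     (\<forall>i\<in>indices X. \<forall>p\<in>patch X i. \<forall>u v. \<omega> i p v u = - \<omega> i p u v) \<and>
     (\<forall>i\<in>indices X. \<forall>p\<in>patch X i. \<forall>u. (\<forall>v. \<omega> i p u v = 0) \<longrightarrow> u = 0) \<and>
     (\<forall>i\<in>indices X. \<forall>p\<in>patch X i. \<forall>u v w.
        partial_deriv X i (\<lambda>q. \<omega> i q v w) p u
        - partial_deriv X i (\<lambda>q. \<omega> i q u w) p v
        + partial_deriv X i (\<lambda>q. \<omega> i q u v) p w = 0)"

definition symplectic_manifold ::
  "('i, 'a, 'e::euclidean_space) atlas \<Rightarrow> ('i \<Rightarrow> 'a \<Rightarrow> 'e \<Rightarrow> 'e \<Rightarrow> real) \<Rightarrow> bool" where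
  "symplectic_manifold X \<omega> \<longleftrightarrow> smooth_manifold X \<and> symplectic_form X \<omega>"

definition almost_complex_structure ::
  "('i, 'a, 'e::euclidean_space) atlas \<Rightarrow> ('i \<Rightarrow> 'a \<Rightarrow> 'e \<Rightarrow> 'e) \<Rightarrow> bool" where
  "almost_complex_structure X J \<longleftrightarrow>
     smooth_endomorphism X J \<and>
     (\<forall>i\<in>indices X. \<forall>p\<in>patch X i. \<forall>u. J i p (J i p u) = - u)"

definition compatible_with ::
  "('i, 'a, 'e::euclidean_space) atlas \<Rightarrow> ('i \<Rightarrow> 'a \<Rightarrow> 'e \<Rightarrow> 'e \<Rightarrow> real) \<Rightarrow>
   ('i \<Rightarrow> 'a \<Rightarrow> 'e \<Rightarrow> 'e) \<Rightarrow> bool" where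
  "compatible_with X \<omega> J \<longleftrightarrow>
     (\<forall>i\<in>indices X. \<forall>p\<in>patch X i.
        (\<forall>u v. \<omega> i p (J i p u) (J i p v) = \<omega> i p u v) \<and>
        (\<forall>u. u \<noteq> 0 \<longrightarrow> \<omega> i p u (J i p u) > 0))"


section \<open>Riemannian geometry\<close>

definition riemannian_metric ::
  "('i, 'a, 'e::euclidean_space) atlas \<Rightarrow> ('i \<Rightarrow> 'a \<Rightarrow> 'e \<Rightarrow> 'e \<Rightarrow> real) \<Rightarrow> bool" where
  "riemannian_metric X g \<longleftrightarrow>
     smooth_2tensor X g \<and>
     (\<forall>i\<in>indices X. \<forall>p\<in>patch X i.
        (\<forall>u v. g i p u v = g i p v u) \<and> (\<forall>u. u \<noteq> 0 \<longrightarrow> g i p u u > 0))"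

definition tnorm :: "('i \<Rightarrow> 'a \<Rightarrow> 'e \<Rightarrow> 'e \<Rightarrow> real) \<Rightarrow> 'i \<Rightarrow> 'a \<Rightarrow> 'e \<Rightarrow> real" where
  "tnorm g i p u = sqrt (g i p u u)"

text \<open>
  \<open>christoffel X g i p u v\<close> is \<open>\<nabla>\<^sub>u V\<close> at \<open>p\<close> for the constant coordinate vector field \<open>V = v\<close>
  and the Levi-Civita connection, characterised by the Koszul formula.
\<close>

definition christoffel ::
  "('i, 'a, 'e::euclidean_space) atlas \<Rightarrow> ('i \<Rightarrow> 'a \<Rightarrow> 'e \<Rightarrow> 'e \<Rightarrow> real) \<Rightarrow>
   'i \<Rightarrow> 'a \<Rightarrow> 'e \<Rightarrow> 'e \<Rightarrow> 'e" where
  "christoffel X g i p u v =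
     (THE w. \<forall>z. 2 * g i p w z =
        partial_deriv X i (\<lambda>q. g i q v z) p u
        + partial_deriv X i (\<lambda>q. g i q u z) p v
        - partial_deriv X i (\<lambda>q. g i q u v) p z)"

text \<open>\<open>R(u,v)w = \<nabla>\<^sub>u\<nabla>\<^sub>v w - \<nabla>\<^sub>v\<nabla>\<^sub>u w\<close> for constant coordinate vector fields, which commute.\<close>

definition riemann_curvature ::
  "('i, 'a, 'e::euclidean_space) atlas \<Rightarrow> ('i \<Rightarrow> 'a \<Rightarrow> 'e \<Rightarrow> 'e \<Rightarrow> real) \<Rightarrow>
   'i \<Rightarrow> 'a \<Rightarrow> 'e \<Rightarrow> 'e \<Rightarrow> 'e \<Rightarrow> 'e" where
  "riemann_curvature X g i p u v w =
     partial_deriv X i (\<lambda>q. christoffel X g i q v w) p u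
     - partial_deriv X i (\<lambda>q. christoffel X g i q u w) p v
     + christoffel X g i p u (christoffel X g i p v w)
     - christoffel X g i p v (christoffel X g i p u w)"

definition sectional_curvature ::
  "('i, 'a, 'e::euclidean_space) atlas \<Rightarrow> ('i \<Rightarrow> 'a \<Rightarrow> 'e \<Rightarrow> 'e \<Rightarrow> real) \<Rightarrow>
   'i \<Rightarrow> 'a \<Rightarrow> 'e \<Rightarrow> 'e \<Rightarrow> real" where
  "sectional_curvature X g i p u v =
     g i p (riemann_curvature X g i p u v v) u /
     (g i p u u * g i p v v - (g i p u v)\<^sup>2)"

text \<open>
  Complete geodesics, i.e. those defined on all of \<open>\<real>\<close>: in each chart the curve satisfies
  \<open>c'' = - \<Gamma>(c', c')\<close>.
\<close>

definition geodesic ::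
  "('i, 'a, 'e::euclidean_space) atlas \<Rightarrow> ('i \<Rightarrow> 'a \<Rightarrow> 'e \<Rightarrow> 'e \<Rightarrow> real) \<Rightarrow> (real \<Rightarrow> 'a) \<Rightarrow> bool" where
  "geodesic X g \<gamma> \<longleftrightarrow>
     continuous_map euclideanreal (atlas_topology X) \<gamma> \<and>
     (\<forall>t. \<forall>i\<in>charts_at X (\<gamma> t).
        let c' = (\<lambda>s. vector_derivative (coord X i \<circ> \<gamma>) (at s)) in
        (coord X i \<circ> \<gamma>) differentiable (at t) \<and>
        (c' has_vector_derivative - christoffel X g i (\<gamma> t) (c' t) (c' t)) (at t))"

definition geodesic_from ::
  "('i, 'a, 'e::euclidean_space) atlas \<Rightarrow> ('i \<Rightarrow> 'a \<Rightarrow> 'e \<Rightarrow> 'e \<Rightarrow> real) \<Rightarrow>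
   'i \<Rightarrow> 'a \<Rightarrow> 'e \<Rightarrow> (real \<Rightarrow> 'a) \<Rightarrow> bool" where
  "geodesic_from X g i p v \<gamma> \<longleftrightarrow>
     geodesic X g \<gamma> \<and> \<gamma> 0 = p \<and> vector_derivative (coord X i \<circ> \<gamma>) (at 0) = v"

definition complete_metric ::
  "('i, 'a, 'e::euclidean_space) atlas \<Rightarrow> ('i \<Rightarrow> 'a \<Rightarrow> 'e \<Rightarrow> 'e \<Rightarrow> real) \<Rightarrow> bool" where
  "complete_metric X g \<longleftrightarrow>
     riemannian_metric X g \<and>
     (\<forall>i\<in>indices X. \<forall>p\<in>patch X i. \<forall>v. \<exists>\<gamma>. geodesic_from X g i p v \<gamma>)"

definition riem_exp ::
  "('i, 'a, 'e::euclidean_space) atlas \<Rightarrow> ('i \<Rightarrow> 'a \<Rightarrow> 'e \<Rightarrow> 'e \<Rightarrow> real) \<Rightarrow>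
   'i \<Rightarrow> 'a \<Rightarrow> 'e \<Rightarrow> 'a" where
  "riem_exp X g i p v = (THE \<gamma>. geodesic_from X g i p v \<gamma>) 1"

text \<open>\<open>E\<close> maps the open set \<open>B\<close> diffeomorphically onto an open subset of the manifold.\<close>

definition diffeo_onto_image ::
  "('i, 'a, 'e::euclidean_space) atlas \<Rightarrow> 'e set \<Rightarrow> ('e \<Rightarrow> 'a) \<Rightarrow> bool" where
  "diffeo_onto_image X B E \<longleftrightarrow>
     open B \<and> inj_on E B \<and> openin (atlas_topology X) (E ` B) \<and>
     (\<forall>j\<in>indices X.
        open {v \<in> B. E v \<in> patch X j} \<and>
        smooth_on {v \<in> B. E v \<in> patch X j} (coord X j \<circ> E) \<and>
        smooth_on (coord X j ` (E ` B \<inter> patch X j)) (inv_into B E \<circ> param X j))"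

definition injectivity_radius_at ::
  "('i, 'a, 'e::euclidean_space) atlas \<Rightarrow> ('i \<Rightarrow> 'a \<Rightarrow> 'e \<Rightarrow> 'e \<Rightarrow> real) \<Rightarrow> 'a \<Rightarrow> ereal" where
  "injectivity_radius_at X g p =
     Sup {ereal r | r. r > 0 \<and>
       (\<forall>i\<in>charts_at X p. diffeo_onto_image X {v. tnorm g i p v < r} (riem_exp X g i p))}"

definition injectivity_radius ::
  "('i, 'a, 'e::euclidean_space) atlas \<Rightarrow> ('i \<Rightarrow> 'a \<Rightarrow> 'e \<Rightarrow> 'e \<Rightarrow> real) \<Rightarrow> ereal" where
  "injectivity_radius X g = (INF p\<in>points X. injectivity_radius_at X g p)"


section \<open>Geometric boundedness\<close>

definition GB1 ::
  "('i, 'a, 'e::euclidean_space) atlas \<Rightarrow> ('i \<Rightarrow> 'a \<Rightarrow> 'e \<Rightarrow> 'e \<Rightarrow> real) \<Rightarrow>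
   ('i \<Rightarrow> 'a \<Rightarrow> 'e \<Rightarrow> 'e) \<Rightarrow> ('i \<Rightarrow> 'a \<Rightarrow> 'e \<Rightarrow> 'e \<Rightarrow> real) \<Rightarrow> bool" where
  "GB1 X \<omega> J g \<longleftrightarrow>
     (\<exists>A>0. \<exists>B>0. \<forall>i\<in>indices X. \<forall>p\<in>patch X i. \<forall>u v.
        \<omega> i p u (J i p u) \<ge> A * (tnorm g i p u)\<^sup>2 \<and>
        \<bar>\<omega> i p u v\<bar> \<le> B * tnorm g i p u * tnorm g i p v)"

definition GB2 ::
  "('i, 'a, 'e::euclidean_space) atlas \<Rightarrow> ('i \<Rightarrow> 'a \<Rightarrow> 'e \<Rightarrow> 'e \<Rightarrow> real) \<Rightarrow> bool" where
  "GB2 X g \<longleftrightarrow>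
     (\<exists>K. \<forall>i\<in>indices X. \<forall>p\<in>patch X i. \<forall>u v. u \<noteq> v \<and> independent {u, v} \<longrightarrow>
        sectional_curvature X g i p u v \<le> K) \<and>
     (\<exists>\<epsilon>>0. injectivity_radius X g \<ge> ereal \<epsilon>)"

definition geometrically_bounded_triple ::
  "('i, 'a, 'e::euclidean_space) atlas \<Rightarrow> ('i \<Rightarrow> 'a \<Rightarrow> 'e \<Rightarrow> 'e \<Rightarrow> real) \<Rightarrow>
   ('i \<Rightarrow> 'a \<Rightarrow> 'e \<Rightarrow> 'e) \<Rightarrow> ('i \<Rightarrow> 'a \<Rightarrow> 'e \<Rightarrow> 'e \<Rightarrow> real) \<Rightarrow> bool" where
  "geometrically_bounded_triple X \<omega> J g \<longleftrightarrow>
     symplectic_manifold X \<omega> \<and> almost_complex_structure X J \<and> complete_metric X g \<and>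
     GB1 X \<omega> J g \<and> GB2 X g"

definition strongly_geometrically_bounded ::
  "('i, 'a, 'e::euclidean_space) atlas \<Rightarrow> ('i \<Rightarrow> 'a \<Rightarrow> 'e \<Rightarrow> 'e \<Rightarrow> real) \<Rightarrow> bool" where
  "strongly_geometrically_bounded X \<omega> \<longleftrightarrow>
     symplectic_manifold X \<omega> \<and>
     (\<exists>J. almost_complex_structure X J \<and> compatible_with X \<omega> J \<and>
          geometrically_bounded_triple X \<omega> J (\<lambda>i p u v. \<omega> i p u (J i p v)))"


section \<open>Symplectic foliations of codimension one\<close>

text \<open>
  A foliation of \<open>M\<close> is given by a foliated atlas: charts \<open>(x, t)\<close> of the smooth structure of
  \<open>M\<close> whose transition maps are locally of the form \<open>(x, t) \<mapsto> (f x t, h t)\<close>.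
\<close>

definition foliation ::
  "('k, 'a, 'e::euclidean_space \<times> real) atlas \<Rightarrow> ('i, 'a, 'e \<times> real) atlas \<Rightarrow> bool" where
  "foliation M F \<longleftrightarrow>
     smooth_atlas F \<and> points F = points M \<and> smoothly_compatible M F \<and>
     (\<forall>p. \<forall>i\<in>charts_at F p. \<forall>j\<in>charts_at F p.
        \<exists>A B h. open A \<and> open B \<and> coord F i p \<in> A \<times> B \<and>
          A \<times> B \<subseteq> coord F i ` (patch F i \<inter> patch F j) \<and>
          (\<forall>x\<in>A. \<forall>t\<in>B. snd (coord F j (param F i (x, t))) = h t))"

text \<open>
  The charts of \<open>leaf_manifold F L\<close> are the plaques \<open>t = const\<close> contained in \<open>L\<close>, with
  coordinate \<open>x\<close>. For \<open>L = points F\<close> its topology is the leaf topology.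
\<close>

definition leaf_manifold ::
  "('i, 'a, 'e::euclidean_space \<times> real) atlas \<Rightarrow> 'a set \<Rightarrow> ('i \<times> real, 'a, 'e) atlas" where
  "leaf_manifold F L =
     \<lparr> points = L,
       indices = indices F \<times> UNIV,
       patch = (\<lambda>(i, t). {p \<in> patch F i \<inter> L. snd (coord F i p) = t}),
       coord = (\<lambda>(i, t). fst \<circ> coord F i) \<rparr>"

definition leaves :: "('i, 'a, 'e::euclidean_space \<times> real) atlas \<Rightarrow> 'a set set" where
  "leaves F = connected_components_of (atlas_topology (leaf_manifold F (points F)))"

text \<open>
  In a foliated chart the vectors tangent to the leaves are the \<open>(u, 0)\<close>; a leafwise 2-form is
  given by its values on these. It is smooth on the ambient manifold, also transversely.
\<close>

definition leafwise_2form ::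
  "('i, 'a, 'e::euclidean_space \<times> real) atlas \<Rightarrow> ('i \<Rightarrow> 'a \<Rightarrow> 'e \<Rightarrow> 'e \<Rightarrow> real) \<Rightarrow> bool" where
  "leafwise_2form F \<omega> \<longleftrightarrow>
     (\<forall>i\<in>indices F. \<forall>p\<in>patch F i.
        bilinear (\<omega> i p) \<and> (\<forall>u v. \<omega> i p v u = - \<omega> i p u v)) \<and>
     (\<forall>i\<in>indices F. \<forall>u v. smooth_on (coord F i ` patch F i) (\<lambda>x. \<omega> i (param F i x) u v)) \<and>
     (\<forall>p. \<forall>i\<in>charts_at F p. \<forall>j\<in>charts_at F p. \<forall>u v.
        \<omega> i p u v = \<omega> j p (fst (transition_deriv F i j p (u, 0)))
                          (fst (transition_deriv F i j p (v, 0))))"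

definition leaf_restriction ::
  "('i \<Rightarrow> 'a \<Rightarrow> 'e \<Rightarrow> 'e \<Rightarrow> real) \<Rightarrow> 'i \<times> real \<Rightarrow> 'a \<Rightarrow> 'e \<Rightarrow> 'e \<Rightarrow> real" where
  "leaf_restriction \<omega> = (\<lambda>(i, t). \<omega> i)"

definition symplectic_foliation ::
  "('k, 'a, 'e::euclidean_space \<times> real) atlas \<Rightarrow> ('i, 'a, 'e \<times> real) atlas \<Rightarrow>
   ('i \<Rightarrow> 'a \<Rightarrow> 'e \<Rightarrow> 'e \<Rightarrow> real) \<Rightarrow> bool" where
  "symplectic_foliation M F \<omega> \<longleftrightarrow>
     foliation M F \<and> leafwise_2form F \<omega> \<and>
     (\<forall>L\<in>leaves F. symplectic_form (leaf_manifold F L) (leaf_restriction \<omega>))"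

end

theory Submission
  imports Defs
begin

text \<open>
  A leafwise Riemannian metric, glued from Euclidean metrics in foliated charts, and the form
  \<open>\<omega>\<close> determine by polar decomposition a compatible leafwise almost complex structure \<open>J\<close>, which
  is smooth on the ambient manifold and not only along the leaves. In a foliated chart \<open>(x, t)\<close>
  the Christoffel symbols of the leafwise metric \<open>\<omega>(\<cdot>, J \<cdot>)\<close> are therefore smooth in both
  variables. This bounds the leafwise curvature locally. It also shows that, locally uniformly in
  \<open>(x, t)\<close>, the geodesic equation of the plaque can be solved up to time \<open>2\<close> for all small
  initial velocities \<open>v\<close>, with endpoint map at time \<open>1\<close> so close to \<open>x + v\<close> that it is a
  diffeomorphism onto its image. As plaques meeting a leaf lie in that leaf, these are geodesics
  of the leaf. By compactness of the ambient manifold, both the curvature bound and the radius of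
  admissible velocities can be chosen uniformly, for all leaves at once. The latter bounds the
  injectivity radius from below and, since geodesics have constant speed, allows every geodesic
  to be prolonged indefinitely.
\<close>

section \<open>Finite orders of differentiability and their calculus\<close>

section \<open>Calculus of smooth maps\<close>

text \<open>A leaf need not be compact, and its topology may be strictly finer than the one induced
  from the ambient manifold. So every bound is found in a foliated chart, uniformly in the
  transverse coordinate \<open>t\<close>, before compactness can be used. The injectivity radius
  refers to \<open>riem_exp\<close>, a definite description over geodesics defined for all time,
  which says nothing until completeness and uniqueness are settled. The local statement
  \<open>normal_chart\<close> therefore speaks of solution curves only; their endpoints at time 1
  are identified with \<open>riem_exp\<close> afterwards. The curves run beyond time 1, up to time
  2, so that a piece restarted one unit before the end of a geodesic overlaps it and still adds one
  unit. The leaf must also be shown to be a manifold; the delicate axiom is the countable basis,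
  which holds because a leaf is covered by countably many plaques of finitely many charts.\<close>

lemma Ck_on_imp_continuous_on: "Ck_on k S f \<Longrightarrow> continuous_on S f"
  by (cases k) (auto intro!: differentiable_imp_continuous_on differentiable_at_imp_differentiable_on)

lemma Ck_on_Suc_imp: "Ck_on (Suc k) S f \<Longrightarrow> Ck_on k S f"
proof (induction k arbitrary: f)
  case 0
  from Ck_on_imp_continuous_on[OF this] show ?case by simp
next
  case (Suc k)
  then show ?case by (metis Ck_on.simps(2))
qed

lemma Ck_on_subset: "Ck_on k S f \<Longrightarrow> T \<subseteq> S \<Longrightarrow> Ck_on k T f"
  by (induction k arbitrary: f) (auto intro: continuous_on_subset)

lemma Ck_on_cong:
  assumes "open S" "\<And>x. x \<in> S \<Longrightarrow> f x = g x" "Ck_on k S f"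
  shows "Ck_on k S g"
  using assms(2,3)
proof (induction k arbitrary: f g)
  case 0
  then show ?case by (metis Ck_on.simps(1) continuous_on_cong)
next
  case (Suc k)
  have g: "(g has_derivative frechet_derivative f (at x)) (at x)" if "x \<in> S" for x
    using Suc.prems that assms(1)
    by (meson Ck_on.simps(2) frechet_derivative_works has_derivative_transform_within_open)
  then have eq: "frechet_derivative f (at x) = frechet_derivative g (at x)" if "x \<in> S" for x
    using that frechet_derivative_at by blast
  show ?case
    using g Suc.IH[of "\<lambda>x. frechet_derivative f (at x) v" "\<lambda>x. frechet_derivative g (at x) v" for v]
      Suc.prems(2) eq by (auto simp: differentiable_def)
qed

lemma Ck_on_SucI:
  assumes "open S" "\<And>x. x \<in> S \<Longrightarrow> (f has_derivative f' x) (at x)"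
    and "\<And>v. Ck_on k S (\<lambda>x. f' x v)"
  shows "Ck_on (Suc k) S f"
proof -
  have "f' x = frechet_derivative f (at x)" if "x \<in> S" for x
    using assms(2) that frechet_derivative_at by blast
  then show ?thesis
    using assms Ck_on_cong[OF assms(1), of "\<lambda>x. f' x v" "\<lambda>x. frechet_derivative f (at x) v" for v]
    by (auto simp: differentiable_def)
qed

lemma Ck_on_SucD:
  assumes "Ck_on (Suc k) S f"
  shows "x \<in> S \<Longrightarrow> (f has_derivative frechet_derivative f (at x)) (at x)"
    and "Ck_on k S (\<lambda>x. frechet_derivative f (at x) v)"
  using assms frechet_derivative_works by auto

lemma Ck_on_local:
  assumes "\<And>x. x \<in> S \<Longrightarrow> \<exists>T. open T \<and> x \<in> T \<and> Ck_on k T f"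
  shows "Ck_on k S f"
  using assms
proof (induction k arbitrary: f)
  case 0
  show ?case
    unfolding Ck_on.simps
  proof (intro continuous_at_imp_continuous_on ballI)
    fix x assume "x \<in> S"
    then obtain T where "open T" "x \<in> T" "continuous_on T f" using 0 by auto
    then show "isCont f x" by (simp add: continuous_on_eq_continuous_at)
  qed
next
  case (Suc k)
  have "\<exists>T. open T \<and> x \<in> T \<and> Ck_on k T (\<lambda>x. frechet_derivative f (at x) v)" if "x \<in> S" for x v
    using Suc.prems[OF that] by auto
  then have "Ck_on k S (\<lambda>x. frechet_derivative f (at x) v)" for v
    by (rule Suc.IH)
  moreover have "\<forall>x\<in>S. f differentiable at x"
    using Suc.prems by auto
  ultimately show ?case by simp
qed

lemma Ck_on_const [simp]: "Ck_on k S (\<lambda>x. c)"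
  by (induction k arbitrary: c) (auto simp: frechet_derivative_const)

lemma Ck_on_bounded_linear_self:
  assumes "bounded_linear L" "open S" shows "Ck_on k S L"
proof (cases k)
  case 0
  then show ?thesis using assms linear_continuous_on by auto
next
  case (Suc j)
  have "Ck_on (Suc j) S L"
    by (rule Ck_on_SucI[where f'="\<lambda>x. L"]) (auto simp: assms bounded_linear_imp_has_derivative)
  with Suc show ?thesis by simp
qed

lemma Ck_on_bounded_linear:
  assumes "bounded_linear L" "open S" "Ck_on k S f"
  shows "Ck_on k S (\<lambda>x. L (f x))"
  using assms(3)
proof (induction k arbitrary: f)
  case 0
  then show ?case
    using assms(1) by (auto intro: bounded_linear.continuous_on)
next
  case (Suc k)
  show ?case
    by (rule Ck_on_SucI[where f'="\<lambda>x v. L (frechet_derivative f (at x) v)"])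
      (use assms Suc in \<open>auto intro!: bounded_linear.has_derivative[OF assms(1)] Ck_on_SucD simp del: Ck_on.simps\<close>)
qed

lemma Ck_on_add:
  assumes "open S" "Ck_on k S f" "Ck_on k S g"
  shows "Ck_on k S (\<lambda>x. f x + g x)"
  using assms(2,3)
proof (induction k arbitrary: f g)
  case 0
  then show ?case by (auto intro: continuous_on_add)
next
  case (Suc k)
  show ?case
    by (rule Ck_on_SucI[where f'="\<lambda>x v. frechet_derivative f (at x) v + frechet_derivative g (at x) v"])
      (use assms Suc in \<open>auto intro!: has_derivative_add Ck_on_SucD simp del: Ck_on.simps\<close>)
qed

lemma Ck_on_uminus: "open S \<Longrightarrow> Ck_on k S f \<Longrightarrow> Ck_on k S (\<lambda>x. - f x)"
  using Ck_on_bounded_linear[OF bounded_linear_minus[OF bounded_linear_ident]] by blast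

lemma Ck_on_diff:
  assumes "open S" "Ck_on k S f" "Ck_on k S g"
  shows "Ck_on k S (\<lambda>x. f x - g x)"
  using Ck_on_add[OF assms(1,2) Ck_on_uminus[OF assms(1,3)]] by simp

lemma Ck_on_sum:
  assumes "open S" "\<And>i. i \<in> I \<Longrightarrow> Ck_on k S (f i)"
  shows "Ck_on k S (\<lambda>x. \<Sum>i\<in>I. f i x)"
  using assms(2) by (induction I rule: infinite_finite_induct) (auto intro!: Ck_on_add assms(1))

lemma Ck_on_bilinear:
  assumes "bounded_bilinear prd" "open S" "Ck_on k S f" "Ck_on k S g"
  shows "Ck_on k S (\<lambda>x. prd (f x) (g x))"
  using assms(3,4)
proof (induction k arbitrary: f g)
  case 0
  then show ?case using assms(1) by (auto intro: bounded_bilinear.continuous_on)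
next
  case (Suc k)
  note ks = Ck_on_Suc_imp[OF Suc.prems(1)] Ck_on_Suc_imp[OF Suc.prems(2)]
  show ?case
    by (rule Ck_on_SucI[where f'="\<lambda>x v. prd (f x) (frechet_derivative g (at x) v) + prd (frechet_derivative f (at x) v) (g x)"])
      (use assms Suc ks in \<open>auto intro!: bounded_bilinear.FDERIV[OF assms(1)] Ck_on_add Ck_on_SucD simp del: Ck_on.simps\<close>)
qed

lemma frechet_derivative_basis:
  fixes v :: "'a::euclidean_space"
  assumes "f differentiable at x"
  shows "frechet_derivative f (at x) v = (\<Sum>b\<in>Basis. (v \<bullet> b) *\<^sub>R frechet_derivative f (at x) b)"
proof -
  interpret linear "frechet_derivative f (at x)"
    using assms by (rule linear_frechet_derivative)
  show ?thesis
    by (subst euclidean_representation[of v, symmetric]) (simp add: sum scale)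
qed

text \<open>The chain rule applies the derivative of \<open>f\<close> to a vector that varies with
  the point, while \<open>Ck_on\<close> speaks of fixed directions. Expanding that vector in the
  basis reduces to directional derivatives of \<open>f\<close>, to which the induction hypothesis
  applies.\<close>

lemma Ck_on_compose:
  fixes g :: "'a::real_normed_vector \<Rightarrow> 'b::euclidean_space"
  assumes "open S" "open T" "Ck_on k T f" "Ck_on k S g" "g ` S \<subseteq> T"
  shows "Ck_on k S (\<lambda>x. f (g x))"
  using assms(3,4)
proof (induction k arbitrary: f)
  case 0
  then show ?case
    using assms(5) continuous_on_compose2 by auto
next
  case (Suc k)
  note fS = Ck_on_SucD[OF Suc.prems(1)] and gS = Ck_on_SucD[OF Suc.prems(2)]
  show ?case
  proof (rule Ck_on_SucI[OF assms(1), where f'="\<lambda>x v. \<Sum>b\<in>Basis. (frechet_derivative g (at x) v \<bullet> b) *\<^sub>R frechet_derivative f (at (g x)) b"])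
    fix x assume x: "x \<in> S"
    then have gx: "g x \<in> T" using assms(5) by auto
    then have df: "f differentiable at (g x)" using Suc.prems by auto
    have "((\<lambda>x. f (g x)) has_derivative (\<lambda>v. frechet_derivative f (at (g x)) (frechet_derivative g (at x) v))) (at x)"
      using has_derivative_compose[OF gS(1)[OF x] fS(1)[OF gx]] .
    then show "((\<lambda>x. f (g x)) has_derivative (\<lambda>v. \<Sum>b\<in>Basis. (frechet_derivative g (at x) v \<bullet> b) *\<^sub>R frechet_derivative f (at (g x)) b)) (at x)"
      using frechet_derivative_basis[OF df] by (rule has_derivative_eq_rhs[OF _ ext])
  next
    fix v
    show "Ck_on k S (\<lambda>x. \<Sum>b\<in>Basis. (frechet_derivative g (at x) v \<bullet> b) *\<^sub>R frechet_derivative f (at (g x)) b)"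
      by (intro Ck_on_sum Ck_on_bilinear[OF bounded_bilinear_scaleR] assms(1)
          Ck_on_bounded_linear[OF bounded_linear_inner_left] gS(2)
          Suc.IH[OF fS(2) Ck_on_Suc_imp[OF Suc.prems(2)]])
  qed
qed

text \<open>A product rule in which \<open>w\<close> is merely continuous, possible because
  \<open>A\<close> vanishes at \<open>x\<close>. It serves to differentiate the solution of a linear
  equation before that solution is known to be differentiable.\<close>

lemma has_derivative_vanishing_apply:
  fixes A :: "'a::real_normed_vector \<Rightarrow> ('b::real_normed_vector \<Rightarrow>\<^sub>L 'c::real_normed_vector)"
  assumes A: "(A has_derivative A') (at x)" and A0: "A x = 0" and w: "continuous (at x) w"
  shows "((\<lambda>y. A y (w y)) has_derivative (\<lambda>h. A' h (w x))) (at x)"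
proof -
  have 1: "((\<lambda>y. A y (w x)) has_derivative (\<lambda>h. A' h (w x))) (at x)"
    using bounded_linear.has_derivative[OF blinfun.bounded_linear_left A] .
  have "bounded_linear A'" using A has_derivative_bounded_linear by blast
  then obtain C where C: "0 < C" "\<And>h. norm (A' h) \<le> norm h * C"
    using bounded_linear.pos_bounded by blast
  have 2: "((\<lambda>y. A y (w y - w x)) has_derivative (\<lambda>h. 0)) (at x)"
    unfolding has_derivative_at_alt
  proof (intro conjI allI impI)
    fix e :: real assume e: "0 < e"
    obtain d1 where d1: "0 < d1" "\<And>y. norm (y - x) < d1 \<Longrightarrow> norm (A y - A x - A' (y - x)) \<le> 1 * norm (y - x)"
      using A unfolding has_derivative_at_alt by (meson zero_less_one)
    have "e / (C + 1) > 0" using e C by simp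
    then obtain d2 where d2: "0 < d2" "\<And>y. dist y x < d2 \<Longrightarrow> dist (w y) (w x) < e / (C + 1)"
      using w unfolding continuous_at_eps_delta by (metis dist_commute)
    show "\<exists>d>0. \<forall>y. norm (y - x) < d \<longrightarrow> norm (A y (w y - w x) - A x (w x - w x) - 0) \<le> e * norm (y - x)"
    proof (intro exI[of _ "min d1 d2"] conjI allI impI)
      fix y assume y: "norm (y - x) < min d1 d2"
      have "norm (A y) \<le> norm (A y - A x - A' (y - x)) + norm (A' (y - x))"
        using A0 by (metis add.commute diff_zero norm_triangle_sub)
      also have "\<dots> \<le> norm (y - x) * (C + 1)"
        using d1(2)[of y] C(2)[of "y - x"] y by (simp add: algebra_simps)
      finally have a: "norm (A y) \<le> norm (y - x) * (C + 1)" .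
      have b: "norm (w y - w x) \<le> e / (C + 1)"
        using d2(2)[of y] y by (simp add: dist_norm)
      have "norm (A y (w y - w x)) \<le> norm (A y) * norm (w y - w x)"
        by (rule norm_blinfun)
      also have "\<dots> \<le> (norm (y - x) * (C + 1)) * (e / (C + 1))"
        using a b C by (intro mult_mono) auto
      also have "\<dots> = e * norm (y - x)" using C by simp
      finally show "norm (A y (w y - w x) - A x (w x - w x) - 0) \<le> e * norm (y - x)"
        by simp
    qed (use d1 d2 in auto)
  qed auto
  show ?thesis
    using has_derivative_add[OF 1 2] by (simp add: blinfun.diff_right)
qed

text \<open>Applying the left inverse \<open>B\<close> of \<open>A x\<close> to the difference of
  the equations at \<open>y\<close> and \<open>x\<close> bounds \<open>w y - w x\<close> by a small
  multiple of itself plus terms that tend to 0; once the multiple is below 1/2 it is absorbed on the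
  left.\<close>

lemma linear_solve_continuous:
  fixes A :: "'a::real_normed_vector \<Rightarrow> ('b::real_normed_vector \<Rightarrow>\<^sub>L 'c::real_normed_vector)"
    and B :: "'c \<Rightarrow>\<^sub>L 'b"
  assumes "continuous (at x) A" "continuous (at x) b" "\<And>z. B (A x z) = z"
    and ev: "\<forall>\<^sub>F y in at x. A y (w y) = b y" and Ax: "A x (w x) = b x"
  shows "continuous (at x) w"
proof -
  define e where "e y = norm B * (norm (b y - b x) + norm (A y - A x) * norm (w x))" for y
  have "((\<lambda>y. norm B * norm (A y - A x)) \<longlongrightarrow> norm B * norm (A x - A x)) (at x)"
    using assms(1) unfolding continuous_at by (intro tendsto_intros) auto
  then have "\<forall>\<^sub>F y in at x. norm B * norm (A y - A x) < 1/2"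
    by (intro order_tendstoD(2)) auto
  then have "\<forall>\<^sub>F y in at x. norm (w y - w x) \<le> 2 * e y"
    using ev
  proof eventually_elim
    case (elim y)
    have "w y - w x = B (A x (w y - w x))" using assms(3) by simp
    also have "A x (w y - w x) = b y - b x - (A y - A x) (w y - w x) - (A y - A x) (w x)"
      using elim Ax by (simp add: blinfun.bilinear_simps)
    finally have "norm (w y - w x) = norm (B (b y - b x - (A y - A x) (w y - w x) - (A y - A x) (w x)))"
      by (rule arg_cong)
    also have "\<dots> \<le> norm B * norm (b y - b x - (A y - A x) (w y - w x) - (A y - A x) (w x))"
      by (rule norm_blinfun)
    also have "\<dots> \<le> norm B * (norm (b y - b x) + norm (A y - A x) * norm (w y - w x) + norm (A y - A x) * norm (w x))"
      by (intro mult_left_mono order_trans[OF norm_triangle_ineq4] add_mono norm_blinfun order_refl norm_ge_zero)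
    also have "\<dots> = (norm B * norm (A y - A x)) * norm (w y - w x) + e y"
      by (simp add: e_def algebra_simps)
    also have "\<dots> \<le> 1/2 * norm (w y - w x) + e y"
      using elim by (intro add_right_mono mult_right_mono) auto
    finally show ?case by simp
  qed
  moreover have "((\<lambda>y. 2 * e y) \<longlongrightarrow> 2 * (norm B * (norm (b x - b x) + norm (A x - A x) * norm (w x)))) (at x)"
    unfolding e_def using assms(1,2) unfolding continuous_at by (intro tendsto_intros) auto
  then have "((\<lambda>y. 2 * e y) \<longlongrightarrow> 0) (at x)" by simp
  ultimately have "((\<lambda>y. w y - w x) \<longlongrightarrow> 0) (at x)"
    by (rule Lim_null_comparison)
  then show ?thesis
    unfolding continuous_at by (simp add: LIM_zero_iff)
qed

text \<open>Differentiating \<open>A w = b\<close> gives an equation of the same shape for the derivative of \<open>w\<close>.\<close>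

lemma Ck_on_linear_solve:
  fixes A :: "'a::real_normed_vector \<Rightarrow> ('b::real_normed_vector \<Rightarrow>\<^sub>L 'c::real_normed_vector)"
    and B :: "'a \<Rightarrow> ('c \<Rightarrow>\<^sub>L 'b)"
  assumes S: "open S" and A: "Ck_on k S A" and b: "Ck_on k S b"
    and B: "\<And>x z. x \<in> S \<Longrightarrow> B x (A x z) = z" and w: "\<And>x. x \<in> S \<Longrightarrow> A x (w x) = b x"
    and B': "\<And>x z. x \<in> S \<Longrightarrow> A x (B x z) = z"
  shows "Ck_on k S w"
  using A b w
proof (induction k arbitrary: b w)
  case 0
  have ev: "\<forall>\<^sub>F y in at x. y \<in> S" if "x \<in> S" for x
    using S that eventually_at_topological by blast
  have "continuous (at x) w" if x: "x \<in> S" for x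
    by (rule linear_solve_continuous[where A=A and b=b and B="B x"])
      (use 0 x S B ev[OF x] in \<open>auto simp: continuous_on_eq_continuous_at elim: eventually_mono\<close>)
  then show ?case by (auto intro: continuous_at_imp_continuous_on)
next
  case (Suc k)
  note wk = Suc.IH[OF Ck_on_Suc_imp[OF Suc.prems(1)] Ck_on_Suc_imp[OF Suc.prems(2)] Suc.prems(3)]
  have cont: "continuous (at x) w" if x: "x \<in> S" for x
    using Ck_on_imp_continuous_on[OF wk] S x continuous_on_eq_continuous_at by blast
  note AS = Ck_on_SucD[OF Suc.prems(1)] and bS = Ck_on_SucD[OF Suc.prems(2)]
  let ?A' = "\<lambda>x. frechet_derivative A (at x)" and ?b' = "\<lambda>x. frechet_derivative b (at x)"
  define w' where "w' x h = B x (?b' x h - ?A' x h (w x))" for x h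
  show ?case
  proof (rule Ck_on_SucI[OF S, where f'=w'])
    fix x assume x: "x \<in> S"
    \<comment> \<open>The solution satisfies
      \<open>w y = w x + B x (b y - b x - (A y - A x) (w y))\<close>, where \<open>w y\<close>
      occurs only next to a factor that vanishes at \<open>x\<close>; so continuity of
      \<open>w\<close> is enough to differentiate the right-hand side.\<close>
    have "((\<lambda>y. A y - A x) has_derivative ?A' x) (at x)"
      using has_derivative_diff[OF AS(1)[OF x] has_derivative_const] by simp
    from has_derivative_vanishing_apply[OF this _ cont[OF x]]
    have 1: "((\<lambda>y. (A y - A x) (w y)) has_derivative (\<lambda>h. ?A' x h (w x))) (at x)" by simp
    have "((\<lambda>y. b y - b x - (A y - A x) (w y)) has_derivative (\<lambda>h. ?b' x h - 0 - ?A' x h (w x))) (at x)"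
      by (intro has_derivative_diff bS(1) x 1 has_derivative_const)
    from bounded_linear.has_derivative[OF blinfun.bounded_linear_right this]
    have "((\<lambda>y. w x + B x (b y - b x - (A y - A x) (w y))) has_derivative (\<lambda>h. 0 + w' x h)) (at x)"
      unfolding w'_def by (intro has_derivative_add has_derivative_const) simp
    then have *: "((\<lambda>y. w x + B x (b y - b x - (A y - A x) (w y))) has_derivative w' x) (at x)" by simp
    show "(w has_derivative w' x) (at x)"
    proof (rule has_derivative_transform_within_open[OF * S x])
      fix y assume y: "y \<in> S"
      have "b y - b x - (A y - A x) (w y) = A x (w y - w x)"
        using Suc.prems(3) x y by (simp add: blinfun.bilinear_simps)
      then show "w x + B x (b y - b x - (A y - A x) (w y)) = w y"
        using B[OF x] by simp
    qed
  next
    fix h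
    show "Ck_on k S (\<lambda>x. w' x h)"
    proof (rule Suc.IH[OF Ck_on_Suc_imp[OF Suc.prems(1)]])
      show "Ck_on k S (\<lambda>x. ?b' x h - ?A' x h (w x))"
        by (intro Ck_on_diff S bS(2) Ck_on_bilinear[OF bounded_bilinear_blinfun_apply] AS(2) wk)
      show "A x (w' x h) = ?b' x h - ?A' x h (w x)" if "x \<in> S" for x
        using B'[OF that] by (simp add: w'_def)
    qed
  qed
qed

subsection \<open>Smooth maps\<close>

lemma smooth_on_imp_continuous_on: "smooth_on S f \<Longrightarrow> continuous_on S f"
  using Ck_on_imp_continuous_on smooth_on_def by blast

lemma smooth_on_imp_differentiable: "smooth_on S f \<Longrightarrow> x \<in> S \<Longrightarrow> f differentiable at x"
  unfolding smooth_on_def by (metis Ck_on.simps(2))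

lemma smooth_on_has_derivative:
  "smooth_on S f \<Longrightarrow> x \<in> S \<Longrightarrow> (f has_derivative frechet_derivative f (at x)) (at x)"
  using smooth_on_imp_differentiable frechet_derivative_works by blast

lemma smooth_on_frechet_derivative:
  "smooth_on S f \<Longrightarrow> smooth_on S (\<lambda>x. frechet_derivative f (at x) v)"
  unfolding smooth_on_def by (metis Ck_on.simps(2))

lemma smooth_on_subset: "smooth_on S f \<Longrightarrow> T \<subseteq> S \<Longrightarrow> smooth_on T f"
  unfolding smooth_on_def using Ck_on_subset by blast

lemma smooth_on_cong:
  "open S \<Longrightarrow> smooth_on S f \<Longrightarrow> (\<And>x. x \<in> S \<Longrightarrow> f x = g x) \<Longrightarrow> smooth_on S g"
  unfolding smooth_on_def using Ck_on_cong by blast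

lemma smooth_on_local:
  "(\<And>x. x \<in> S \<Longrightarrow> \<exists>T. open T \<and> x \<in> T \<and> smooth_on T f) \<Longrightarrow> smooth_on S f"
  unfolding smooth_on_def by (meson Ck_on_local)

lemma smooth_on_const [simp]: "smooth_on S (\<lambda>x. c)"
  by (simp add: smooth_on_def)

lemma smooth_on_bounded_linear:
  "bounded_linear L \<Longrightarrow> open S \<Longrightarrow> smooth_on S f \<Longrightarrow> smooth_on S (\<lambda>x. L (f x))"
  unfolding smooth_on_def using Ck_on_bounded_linear by blast

lemma smooth_on_bounded_linear_self: "bounded_linear L \<Longrightarrow> open S \<Longrightarrow> smooth_on S L"
  unfolding smooth_on_def using Ck_on_bounded_linear_self by blast

lemma smooth_on_linear_self:
  fixes L :: "'a::euclidean_space \<Rightarrow> 'b::real_normed_vector"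
  shows "linear L \<Longrightarrow> open S \<Longrightarrow> smooth_on S L"
  by (simp add: linear_conv_bounded_linear smooth_on_bounded_linear_self)

lemma smooth_on_ident: "open S \<Longrightarrow> smooth_on S (\<lambda>x. x)"
  by (simp add: smooth_on_bounded_linear_self)

lemma smooth_on_add:
  "open S \<Longrightarrow> smooth_on S f \<Longrightarrow> smooth_on S g \<Longrightarrow> smooth_on S (\<lambda>x. f x + g x)"
  unfolding smooth_on_def using Ck_on_add by blast

lemma smooth_on_uminus: "open S \<Longrightarrow> smooth_on S f \<Longrightarrow> smooth_on S (\<lambda>x. - f x)"
  unfolding smooth_on_def using Ck_on_uminus by blast

lemma smooth_on_diff:
  "open S \<Longrightarrow> smooth_on S f \<Longrightarrow> smooth_on S g \<Longrightarrow> smooth_on S (\<lambda>x. f x - g x)"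
  unfolding smooth_on_def using Ck_on_diff by blast

lemma smooth_on_sum:
  "open S \<Longrightarrow> (\<And>i. i \<in> I \<Longrightarrow> smooth_on S (f i)) \<Longrightarrow> smooth_on S (\<lambda>x. \<Sum>i\<in>I. f i x)"
  unfolding smooth_on_def by (simp add: Ck_on_sum)

lemma smooth_on_bilinear:
  "bounded_bilinear prd \<Longrightarrow> open S \<Longrightarrow> smooth_on S f \<Longrightarrow> smooth_on S g \<Longrightarrow> smooth_on S (\<lambda>x. prd (f x) (g x))"
  unfolding smooth_on_def using Ck_on_bilinear by blast

lemmas smooth_on_scaleR = smooth_on_bilinear[OF bounded_bilinear_scaleR]
lemmas smooth_on_inner = smooth_on_bilinear[OF bounded_bilinear_inner]
lemmas smooth_on_blinfun_apply = smooth_on_bilinear[OF bounded_bilinear_blinfun_apply]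
lemmas smooth_on_blinfun_compose = smooth_on_bilinear[OF bounded_bilinear_blinfun_compose]

lemma smooth_on_mult:
  fixes f :: "'a::real_normed_vector \<Rightarrow> real"
  shows "open S \<Longrightarrow> smooth_on S f \<Longrightarrow> smooth_on S g \<Longrightarrow> smooth_on S (\<lambda>x. f x * g x)"
  using smooth_on_bilinear[OF bounded_bilinear_mult] by blast

lemma smooth_on_compose:
  fixes g :: "'a::real_normed_vector \<Rightarrow> 'b::euclidean_space"
  shows "open S \<Longrightarrow> open T \<Longrightarrow> smooth_on T f \<Longrightarrow> smooth_on S g \<Longrightarrow> g ` S \<subseteq> T \<Longrightarrow> smooth_on S (\<lambda>x. f (g x))"
  unfolding smooth_on_def using Ck_on_compose by blast

lemma smooth_on_Pair:
  fixes f :: "'a::real_normed_vector \<Rightarrow> 'b::real_normed_vector" and g :: "'a \<Rightarrow> 'c::real_normed_vector"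
  assumes "open S" "smooth_on S f" "smooth_on S g"
  shows "smooth_on S (\<lambda>x. (f x, g x))"
proof -
  have "smooth_on S (\<lambda>x. (f x, 0) + (0, g x))"
    by (intro smooth_on_add assms smooth_on_bounded_linear[where L="\<lambda>x. (x,0)"]
        smooth_on_bounded_linear[where L="\<lambda>x. (0,x)"] bounded_linear_Pair bounded_linear_ident bounded_linear_zero)
  then show ?thesis by simp
qed

text \<open>The inverses are chosen point by point, so smoothness of quotients, of Riesz
  representatives and of inverse operators follows without first studying how an inverse depends on
  the operator.\<close>

lemma smooth_on_linear_solve:
  fixes A :: "'a::real_normed_vector \<Rightarrow> ('b::real_normed_vector \<Rightarrow>\<^sub>L 'c::real_normed_vector)"
  assumes "open S" "smooth_on S A" "smooth_on S b" "\<And>x. x \<in> S \<Longrightarrow> A x (w x) = b x"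
    and "\<And>x. x \<in> S \<Longrightarrow> \<exists>B::'c \<Rightarrow>\<^sub>L 'b. (\<forall>z. B (A x z) = z) \<and> (\<forall>z. A x (B z) = z)"
  shows "smooth_on S w"
proof -
  obtain B :: "'a \<Rightarrow> 'c \<Rightarrow>\<^sub>L 'b" where "\<And>x. x \<in> S \<Longrightarrow> (\<forall>z. B x (A x z) = z) \<and> (\<forall>z. A x (B x z) = z)"
    using assms(5) by metis
  then show ?thesis
    using assms(1-4) unfolding smooth_on_def
    by (intro allI Ck_on_linear_solve[where A=A and b=b and B=B]) auto
qed

lemma smooth_on_divide:
  fixes f g :: "'a::real_normed_vector \<Rightarrow> real"
  assumes "open S" "smooth_on S f" "smooth_on S g" "\<And>x. x \<in> S \<Longrightarrow> g x \<noteq> 0"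
  shows "smooth_on S (\<lambda>x. f x / g x)"
proof (rule smooth_on_linear_solve[where A="\<lambda>x. blinfun_mult_right (g x)" and b=f])
  show "smooth_on S (\<lambda>x. blinfun_mult_right (g x) :: real \<Rightarrow>\<^sub>L real)"
    by (rule smooth_on_bounded_linear[OF bounded_linear_blinfun_mult_right assms(1,3)])
  fix x assume "x \<in> S"
  then show "\<exists>B :: real \<Rightarrow>\<^sub>L real. (\<forall>z. B (blinfun_mult_right (g x) z) = z) \<and> (\<forall>z. blinfun_mult_right (g x) (B z) = z)"
    using assms(4) by (intro exI[of _ "blinfun_mult_right (1 / g x)"]) (auto simp: blinfun_mult_right.rep_eq)
qed (use assms in \<open>auto simp: blinfun_mult_right.rep_eq\<close>)

lemma smooth_on_Blinfun:
  fixes A :: "'a::real_normed_vector \<Rightarrow> 'b::euclidean_space \<Rightarrow> 'c::euclidean_space"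
  assumes "open S" "\<And>x. x \<in> S \<Longrightarrow> linear (A x)" "\<And>u. smooth_on S (\<lambda>x. A x u)"
  shows "smooth_on S (\<lambda>x. Blinfun (A x))"
proof -
  have bl: "bounded_linear (\<lambda>c. blinfun_scaleR_left c o\<^sub>L blinfun_inner_left b :: 'b \<Rightarrow>\<^sub>L 'c)" for b
    by (rule bounded_linear_compose[OF bounded_bilinear.bounded_linear_left[OF bounded_bilinear_blinfun_compose]
          bounded_linear_blinfun_scaleR_left])
  have "smooth_on S (\<lambda>x. \<Sum>b\<in>Basis. blinfun_scaleR_left (A x b) o\<^sub>L blinfun_inner_left b)"
    by (intro smooth_on_sum smooth_on_bounded_linear[OF bl] assms)
  then show ?thesis
  proof (rule smooth_on_cong[OF assms(1)])
    fix x assume x: "x \<in> S"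
    have l: "bounded_linear (A x)" using assms(2)[OF x] by (simp add: linear_conv_bounded_linear)
    show "(\<Sum>b\<in>Basis. blinfun_scaleR_left (A x b) o\<^sub>L blinfun_inner_left b) = Blinfun (A x)"
      by (rule blinfun_euclidean_eqI)
        (simp add: blinfun.sum_left bounded_linear_Blinfun_apply[OF l] inner_Basis if_distrib[of "\<lambda>a. a *\<^sub>R _"] cong: if_cong)
  qed
qed

section \<open>Symmetry of second derivatives\<close>

lemma mvt_from_zero:
  fixes g :: "real \<Rightarrow> real"
  assumes "0 < t" "\<And>s. s \<in> {0..t} \<Longrightarrow> (g has_derivative (\<lambda>h. h * g' s)) (at s)"
  obtains s where "s \<in> {0<..<t}" "g t - g 0 = t * g' s"
proof -
  have "\<exists>s\<in>{0<..<t}. g t - g 0 = (\<lambda>h. h * g' s) (t - 0)"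
    by (rule mvt_simple[OF assms(1)]) (use assms(2) in \<open>auto intro: has_derivative_at_withinI\<close>)
  then show ?thesis using that by auto
qed

lemma symmetric_second_derivative_real:
  fixes f :: "'a::real_normed_vector \<Rightarrow> real"
  assumes S: "open S" "x \<in> S" and f: "Ck_on 2 S f"
  shows "frechet_derivative (\<lambda>y. frechet_derivative f (at y) u) (at x) v =
         frechet_derivative (\<lambda>y. frechet_derivative f (at y) v) (at x) u"
proof -
  let ?D = "\<lambda>u v x. frechet_derivative (\<lambda>y. frechet_derivative f (at y) u) (at x) v"
  have f2: "Ck_on (Suc (Suc 0)) S f" using f by (simp add: numeral_2_eq_2)
  note d1 = Ck_on_SucD(1)[OF f2] and d2 = Ck_on_SucD(1)[OF Ck_on_SucD(2)[OF f2]]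
    and d3 = Ck_on_SucD(2)[OF Ck_on_SucD(2)[OF f2]]
  have cont: "continuous (at x) (?D u v)" for u v
    using d3 S by (simp add: continuous_on_eq_continuous_at)
  text \<open>The second difference quotient is a value of either mixed derivative at an intermediate point.\<close>
  have key: "\<exists>s\<in>{0<..<t}. \<exists>r\<in>{0<..<t}. f (x + t *\<^sub>R u + t *\<^sub>R v) - f (x + t *\<^sub>R u) - f (x + t *\<^sub>R v) + f x
      = t * t * ?D u v (x + s *\<^sub>R u + r *\<^sub>R v)"
    if t: "0 < t" and sub: "\<And>s r. s \<in> {0..t} \<Longrightarrow> r \<in> {0..t} \<Longrightarrow> x + s *\<^sub>R u + r *\<^sub>R v \<in> S" for t u v
  proof -
    have D1: "((\<lambda>s. f (x + s *\<^sub>R u + r *\<^sub>R v)) has_derivative (\<lambda>h. h * frechet_derivative f (at (x + s *\<^sub>R u + r *\<^sub>R v)) u)) (at s)"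
      if "s \<in> {0..t}" "r \<in> {0..t}" for s r
    proof -
      have p: "x + s *\<^sub>R u + r *\<^sub>R v \<in> S" using sub that by auto
      have "((\<lambda>s. x + s *\<^sub>R u + r *\<^sub>R v) has_derivative (\<lambda>h. h *\<^sub>R u)) (at s)"
        by (auto intro!: derivative_eq_intros)
      from has_derivative_compose[OF this d1[OF p]]
      show ?thesis
        using linear_scale[OF has_derivative_linear[OF d1[OF p]]] by simp
    qed
    have D2: "((\<lambda>r. frechet_derivative f (at (x + s *\<^sub>R u + r *\<^sub>R v)) u) has_derivative (\<lambda>h. h * ?D u v (x + s *\<^sub>R u + r *\<^sub>R v))) (at r)"
      if "s \<in> {0..t}" "r \<in> {0..t}" for s r
    proof -
      have p: "x + s *\<^sub>R u + r *\<^sub>R v \<in> S" using sub that by auto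
      have "((\<lambda>r. x + s *\<^sub>R u + r *\<^sub>R v) has_derivative (\<lambda>h. h *\<^sub>R v)) (at r)"
        by (auto intro!: derivative_eq_intros)
      from has_derivative_compose[OF this d2[OF p]]
      show ?thesis
        using linear_scale[OF has_derivative_linear[OF d2[OF p]]] by simp
    qed
    define g where "g s = f (x + s *\<^sub>R u + t *\<^sub>R v) - f (x + s *\<^sub>R u + 0 *\<^sub>R v)" for s
    define G where "G s r = frechet_derivative f (at (x + s *\<^sub>R u + r *\<^sub>R v)) u" for s r
    obtain s where s: "s \<in> {0<..<t}" "g t - g 0 = t * (G s t - G s 0)"
    proof (rule mvt_from_zero[OF t])
      fix s assume "s \<in> {0..t}"
      then show "(g has_derivative (\<lambda>h. h * (G s t - G s 0))) (at s)"
        unfolding g_def G_def right_diff_distrib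
        by (intro has_derivative_diff D1) (use t in auto)
    qed
    obtain r where r: "r \<in> {0<..<t}" "G s t - G s 0 = t * ?D u v (x + s *\<^sub>R u + r *\<^sub>R v)"
    proof (rule mvt_from_zero[OF t])
      fix r assume "r \<in> {0..t}"
      then show "(G s has_derivative (\<lambda>h. h * ?D u v (x + s *\<^sub>R u + r *\<^sub>R v))) (at r)"
        unfolding G_def by (intro D2) (use s in auto)
    qed
    have "f (x + t *\<^sub>R u + t *\<^sub>R v) - f (x + t *\<^sub>R u) - f (x + t *\<^sub>R v) + f x = g t - g 0"
      by (simp add: g_def)
    also have "\<dots> = t * t * ?D u v (x + s *\<^sub>R u + r *\<^sub>R v)"
      unfolding s(2) r(2) by simp
    finally show ?thesis using s(1) r(1) by blast
  qed
  obtain e where e: "e > 0" "ball x e \<subseteq> S" using S openE by blast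
  have "\<bar>?D u v x - ?D v u x\<bar> \<le> 2 * \<epsilon>" if \<epsilon>: "\<epsilon> > 0" for \<epsilon>
  proof -
    obtain d1 where d1: "d1 > 0" "\<And>y. dist y x < d1 \<Longrightarrow> dist (?D u v y) (?D u v x) < \<epsilon>"
      using cont \<epsilon> unfolding continuous_at_eps_delta by meson
    obtain d2 where d2: "d2 > 0" "\<And>y. dist y x < d2 \<Longrightarrow> dist (?D v u y) (?D v u x) < \<epsilon>"
      using cont \<epsilon> unfolding continuous_at_eps_delta by meson
    define m where "m = min e (min d1 d2)"
    define N where "N = norm u + norm v + 1"
    \<comment> \<open>With this step the whole parallelogram at \<open>x\<close> spanned by the
      multiples of \<open>u\<close> and \<open>v\<close> stays within distance \<open>m\<close> of
      \<open>x\<close>; the summand 1 in \<open>N\<close> keeps the denominator positive when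
      \<open>u\<close> and \<open>v\<close> are both 0.\<close>
    define t where "t = m / (2 * N)"
    have m: "m > 0" "m \<le> e" "m \<le> d1" "m \<le> d2" using d1 d2 e by (auto simp: m_def)
    have N: "N \<ge> 1" by (simp add: N_def)
    have t: "t > 0" using m N by (simp add: t_def)
    have tN: "t * N = m / 2" using N by (simp add: t_def)
    have close: "dist (x + s *\<^sub>R u + r *\<^sub>R v) x < m" "dist (x + s *\<^sub>R v + r *\<^sub>R u) x < m" if "s \<in> {0..t}" "r \<in> {0..t}" for s r
    proof -
      have "norm (s *\<^sub>R a + r *\<^sub>R b) \<le> t * norm a + t * norm b" for a b :: 'a
        using that by (intro order_trans[OF norm_triangle_ineq] add_mono) (auto intro: mult_right_mono)
      moreover have "t * norm u + t * norm v < m"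
        using tN m t by (simp add: N_def algebra_simps)
      ultimately have "norm (s *\<^sub>R u + r *\<^sub>R v) < m" "norm (s *\<^sub>R v + r *\<^sub>R u) < m"
        by (smt (verit))+
      then show "dist (x + s *\<^sub>R u + r *\<^sub>R v) x < m" "dist (x + s *\<^sub>R v + r *\<^sub>R u) x < m"
        by (simp_all add: dist_norm add.assoc)
    qed
    have inS: "x + s *\<^sub>R u + r *\<^sub>R v \<in> S" "x + s *\<^sub>R v + r *\<^sub>R u \<in> S" if "s \<in> {0..t}" "r \<in> {0..t}" for s r
      using close[OF that] m e(2) by (auto simp: dist_commute subset_eq)
    obtain s r where sr: "s \<in> {0<..<t}" "r \<in> {0<..<t}"
      "f (x + t *\<^sub>R u + t *\<^sub>R v) - f (x + t *\<^sub>R u) - f (x + t *\<^sub>R v) + f x = t * t * ?D u v (x + s *\<^sub>R u + r *\<^sub>R v)"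
      using key[OF t inS(1)] by blast
    obtain s' r' where sr': "s' \<in> {0<..<t}" "r' \<in> {0<..<t}"
      "f (x + t *\<^sub>R v + t *\<^sub>R u) - f (x + t *\<^sub>R v) - f (x + t *\<^sub>R u) + f x = t * t * ?D v u (x + s' *\<^sub>R v + r' *\<^sub>R u)"
      using key[OF t inS(2)] by blast
    have "t * t * ?D u v (x + s *\<^sub>R u + r *\<^sub>R v) = t * t * ?D v u (x + s' *\<^sub>R v + r' *\<^sub>R u)"
      using sr(3) sr'(3) by (simp add: algebra_simps)
    then have eq: "?D u v (x + s *\<^sub>R u + r *\<^sub>R v) = ?D v u (x + s' *\<^sub>R v + r' *\<^sub>R u)"
      using t by simp
    have "dist (?D u v (x + s *\<^sub>R u + r *\<^sub>R v)) (?D u v x) < \<epsilon>"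
      using close(1)[of s r] sr m by (intro d1(2)) auto
    moreover have "dist (?D v u (x + s' *\<^sub>R v + r' *\<^sub>R u)) (?D v u x) < \<epsilon>"
      using close(2)[of s' r'] sr' m by (intro d2(2)) auto
    ultimately show ?thesis using eq by (auto simp: dist_real_def)
  qed
  note bd = this
  have "\<bar>?D u v x - ?D v u x\<bar> \<le> 0"
  proof (rule field_le_epsilon)
    fix e' :: real assume "e' > 0"
    then show "\<bar>?D u v x - ?D v u x\<bar> \<le> 0 + e'" using bd[of "e'/2"] by simp
  qed
  then show ?thesis by simp
qed

lemma symmetric_second_derivative:
  fixes f :: "'a::real_normed_vector \<Rightarrow> 'b::euclidean_space"
  assumes S: "open S" "x \<in> S" and f: "smooth_on S f"
  shows "frechet_derivative (\<lambda>y. frechet_derivative f (at y) u) (at x) v =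
         frechet_derivative (\<lambda>y. frechet_derivative f (at y) v) (at x) u"
proof (rule euclidean_eqI)
  fix b :: 'b assume "b \<in> Basis"
  have sm: "smooth_on S (\<lambda>y. f y \<bullet> b)"
    by (rule smooth_on_bounded_linear[OF bounded_linear_inner_left S(1) f])
  have in1: "frechet_derivative (\<lambda>y. h y \<bullet> b) (at y) w = frechet_derivative h (at y) w \<bullet> b"
    if "smooth_on S h" "y \<in> S" for h :: "'a \<Rightarrow> 'b" and y w
    using frechet_derivative_at[OF bounded_linear.has_derivative[OF bounded_linear_inner_left smooth_on_has_derivative[OF that]]]
    by metis
  have *: "frechet_derivative (\<lambda>y. frechet_derivative (\<lambda>y. f y \<bullet> b) (at y) u) (at x) v
      = frechet_derivative (\<lambda>y. frechet_derivative f (at y) u) (at x) v \<bullet> b" for u v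
  proof -
    have "frechet_derivative (\<lambda>y. frechet_derivative (\<lambda>y. f y \<bullet> b) (at y) u) (at x)
        = frechet_derivative (\<lambda>y. frechet_derivative f (at y) u \<bullet> b) (at x)"
      by (rule frechet_derivative_transform_within_open[OF _ S])
        (use in1[OF f] smooth_on_imp_differentiable[OF smooth_on_frechet_derivative[OF sm] S(2)] in auto)
    then show ?thesis using in1[OF smooth_on_frechet_derivative[OF f] S(2)] by simp
  qed
  show "frechet_derivative (\<lambda>y. frechet_derivative f (at y) u) (at x) v \<bullet> b =
         frechet_derivative (\<lambda>y. frechet_derivative f (at y) v) (at x) u \<bullet> b"
    using symmetric_second_derivative_real[OF S, of "\<lambda>y. f y \<bullet> b"] sm unfolding * smooth_on_def by blast
qed

section \<open>Flows of smooth vector fields\<close>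

text \<open>Solution curves are found as fixed points in the Banach space of bounded continuous functions.
  Smooth dependence on the initial condition follows since the superposition operator
  \<open>y \<mapsto> F \<circ> y\<close> is smooth there.\<close>

definition bcomp :: "('y::euclidean_space \<Rightarrow> 'v::real_normed_vector) \<Rightarrow> (real \<Rightarrow>\<^sub>C 'y) \<Rightarrow> (real \<Rightarrow>\<^sub>C 'v)" where
  "bcomp F y = Bcontfun (\<lambda>s. F (y s))"

lemma bcomp_apply [simp]:
  assumes "continuous_on UNIV F"
  shows "apply_bcontfun (bcomp F y) s = F (y s)"
proof -
  have "bounded (range y)"
    by (auto simp: bounded_iff intro!: exI[of _ "norm y"] norm_bounded)
  then have "bounded (F ` closure (range y))"
    by (intro compact_imp_bounded compact_continuous_image continuous_on_subset[OF assms])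
      (auto simp: compact_closure)
  then have "bounded (range (\<lambda>s. F (y s)))"
    by (rule bounded_subset) (use closure_subset[of "range y"] in auto)
  moreover have "continuous_on UNIV (\<lambda>s. F (y s))"
    by (rule continuous_on_compose2[OF assms]) auto
  ultimately have "(\<lambda>s. F (y s)) \<in> bcontfun" by (auto simp: bcontfun_def)
  then show ?thesis by (simp add: bcomp_def Bcontfun_inverse)
qed

text \<open>The range of the bounded function \<open>y\<close> lies in a compact ball, on which
  \<open>F\<close> is uniformly continuous; this makes \<open>d\<close> independent of
  \<open>s\<close>. In the proof the radius exceeds \<open>norm y\<close> by 1 to leave room for the
  points \<open>x\<close>.\<close>

lemma continuous_near_bcontfun:
  fixes y :: "real \<Rightarrow>\<^sub>C 'y::euclidean_space"
  assumes "continuous_on UNIV F" "0 < e"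
  obtains d where "0 < d" "\<And>s x. norm (x - y s) < d \<Longrightarrow> norm (F x - F (y s)) < e"
proof -
  have "uniformly_continuous_on (cball 0 (norm y + 1)) F"
    by (intro compact_uniformly_continuous continuous_on_subset[OF assms(1)]) auto
  then obtain d where d: "0 < d" "\<And>x x'. x \<in> cball 0 (norm y + 1) \<Longrightarrow> x' \<in> cball 0 (norm y + 1) \<Longrightarrow> dist x' x < d \<Longrightarrow> dist (F x') (F x) < e"
    using \<open>0 < e\<close> unfolding uniformly_continuous_on_def by meson
  show thesis
  proof (rule that[of "min d 1"])
    fix s x assume x: "norm (x - y s) < min d 1"
    have "norm x \<le> norm (y s) + norm (x - y s)" by (rule norm_triangle_sub)
    then have "norm x \<le> norm y + 1" "norm (y s) \<le> norm y + 1"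
      using x norm_bounded[of y s] by auto
    then show "norm (F x - F (y s)) < e" using d(2)[of "y s" x] x by (auto simp: dist_norm)
  qed (use d in auto)
qed

lemma bcomp_continuous:
  fixes F :: "'y::euclidean_space \<Rightarrow> 'v::real_normed_vector"
  assumes F: "continuous_on UNIV F"
  shows "continuous_on UNIV (bcomp F)"
proof (rule continuous_at_imp_continuous_on, rule ballI)
  fix y :: "real \<Rightarrow>\<^sub>C 'y"
  show "isCont (bcomp F) y"
    unfolding continuous_at_eps_delta
  proof (intro allI impI)
    fix e :: real assume "0 < e"
    then obtain d where d: "0 < d" "\<And>s x. norm (x - y s) < d \<Longrightarrow> norm (F x - F (y s)) < e/2"
      by (rule continuous_near_bcontfun[OF F half_gt_zero, of e y]) auto
    show "\<exists>d>0. \<forall>y'. dist y' y < d \<longrightarrow> dist (bcomp F y') (bcomp F y) < e"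
    proof (intro exI[of _ d] conjI allI impI)
      fix y' assume "dist y' y < d"
      then have "norm (y' s - y s) < d" for s
        using dist_bounded[of y' s y] by (simp add: dist_norm)
      then have "norm (bcomp F y' - bcomp F y) \<le> e/2"
        using d(2) F by (intro norm_bound) (auto intro: less_imp_le)
      then show "dist (bcomp F y') (bcomp F y) < e" using \<open>0 < e\<close> by (simp add: dist_norm)
    qed (rule d)
  qed
qed

lemma bounded_linear_bcomp:
  assumes "bounded_linear L"
  shows "bounded_linear (bcomp L)"
proof -
  interpret bounded_linear L by fact
  have L: "continuous_on UNIV L" by (rule linear_continuous_on) fact
  obtain K where K: "\<And>x. norm (L x) \<le> norm x * K" "0 < K" using pos_bounded by blast
  show ?thesis
  proof (rule bounded_linear_intro[where K=K])
    show "norm (bcomp L y) \<le> norm y * K" for y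
      by (rule norm_bound) (use L K(2) in \<open>auto intro!: order_trans[OF K(1)] mult_right_mono norm_bounded\<close>)
  qed (auto intro!: bcontfun_eqI simp: L add scaleR)
qed

definition bmul :: "(real \<Rightarrow>\<^sub>C real) \<Rightarrow> (real \<Rightarrow>\<^sub>C 'v::real_normed_vector) \<Rightarrow> (real \<Rightarrow>\<^sub>C 'v)" where
  "bmul a z = Bcontfun (\<lambda>s. a s *\<^sub>R z s)"

lemma bmul_apply [simp]: "apply_bcontfun (bmul a z) s = a s *\<^sub>R z s"
proof -
  have "(\<lambda>s. a s *\<^sub>R z s) \<in> bcontfun"
    by (rule bcontfun_normI[where b="norm a * norm z"])
      (auto intro!: continuous_intros mult_mono norm_bounded[of a, unfolded real_norm_def] norm_bounded)
  then show ?thesis by (simp add: bmul_def Bcontfun_inverse)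
qed

lemma bounded_bilinear_bmul: "bounded_bilinear bmul"
proof
  show "\<exists>K. \<forall>a b. norm (bmul a b) \<le> norm a * norm b * K"
    by (intro exI[of _ 1] allI norm_bound)
      (auto intro!: mult_mono norm_bounded[where 'b=real, unfolded real_norm_def] norm_bounded)
qed (auto intro!: bcontfun_eqI simp: algebra_simps)

text \<open>The derivative of \<open>bcomp F\<close> at \<open>y\<close>, pointwise the derivative
  of \<open>F\<close> at \<open>y s\<close> applied to \<open>z s\<close>. It is written as a sum
  over the basis so that each summand is again built from a superposition operator, now with a
  partial derivative of \<open>F\<close>; this is what the induction in \<open>Ck_on_bcomp\<close>
  runs on.\<close>

definition bderiv :: "('y::euclidean_space \<Rightarrow> 'v::real_normed_vector) \<Rightarrow> (real \<Rightarrow>\<^sub>C 'y) \<Rightarrow> (real \<Rightarrow>\<^sub>C 'y) \<Rightarrow> (real \<Rightarrow>\<^sub>C 'v)" where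
  "bderiv F y z = (\<Sum>b\<in>Basis. bmul (bcomp (\<lambda>x. x \<bullet> b) z) (bcomp (\<lambda>x. frechet_derivative F (at x) b) y))"

lemma sum_bcontfun_apply [simp]:
  "apply_bcontfun (\<Sum>i\<in>I. f i) s = (\<Sum>i\<in>I. apply_bcontfun (f i) s)"
  by (induction I rule: infinite_finite_induct) auto

lemma bderiv_apply [simp]:
  assumes "smooth_on UNIV F"
  shows "apply_bcontfun (bderiv F y z) s = frechet_derivative F (at (y s)) (z s)"
proof -
  have "F differentiable at (y s)" using smooth_on_imp_differentiable[OF assms] by simp
  note frechet_derivative_basis[OF this, of "z s"]
  moreover have "continuous_on UNIV (\<lambda>x. frechet_derivative F (at x) b)" for b
    using smooth_on_frechet_derivative[OF assms] by (rule smooth_on_imp_continuous_on)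
  moreover have "continuous_on UNIV (\<lambda>x::'a. x \<bullet> b)" for b by (intro continuous_intros)
  ultimately show ?thesis by (simp add: bderiv_def)
qed

lemma bounded_bilinear_bmul_bcomp_inner:
  "bounded_bilinear (\<lambda>z m. bmul (bcomp (\<lambda>x. x \<bullet> b) z) m)"
  using bounded_bilinear.comp1[OF bounded_bilinear_bmul bounded_linear_bcomp[OF bounded_linear_inner_left]] .

lemma bounded_linear_bderiv: "bounded_linear (bderiv F y)"
  unfolding bderiv_def[abs_def]
  by (intro bounded_linear_sum bounded_bilinear.bounded_linear_left[OF bounded_bilinear_bmul_bcomp_inner])

lemma bcomp_has_derivative:
  fixes F :: "'y::euclidean_space \<Rightarrow> 'v::real_normed_vector"
  assumes F: "smooth_on UNIV F"
  shows "(bcomp F has_derivative bderiv F y) (at y)"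
  unfolding has_derivative_at_alt
proof (intro conjI allI impI bounded_linear_bderiv)
  fix e :: real assume e: "0 < e"
  have F': "continuous_on UNIV (\<lambda>x. frechet_derivative F (at x) b)" for b
    using smooth_on_frechet_derivative[OF F] by (rule smooth_on_imp_continuous_on)
  note FD = smooth_on_has_derivative[OF F UNIV_I]
  \<comment> \<open>The operator norm is estimated by the sum over the basis, hence this share of
    \<open>e\<close> for each direction.\<close>
  have "e / DIM('y) > 0" using e by simp
  then have "\<exists>d>0. \<forall>s x. norm (x - y s) < d \<longrightarrow> norm (frechet_derivative F (at x) b - frechet_derivative F (at (y s)) b) < e / DIM('y)" for b
    by (rule continuous_near_bcontfun[OF F', of "e / DIM('y)" y b]) auto
  then obtain d where d: "\<And>b. d b > 0" "\<And>b s x. norm (x - y s) < d b \<Longrightarrow>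
      norm (frechet_derivative F (at x) b - frechet_derivative F (at (y s)) b) < e / DIM('y)"
    by metis
  define \<delta> where "\<delta> = Min (d ` Basis)"
  have \<delta>: "\<delta> > 0" "\<And>b. b \<in> Basis \<Longrightarrow> \<delta> \<le> d b" using d by (auto simp: \<delta>_def)
  show "\<exists>d>0. \<forall>y'. norm (y' - y) < d \<longrightarrow> norm (bcomp F y' - bcomp F y - bderiv F y (y' - y)) \<le> e * norm (y' - y)"
  proof (intro exI[of _ \<delta>] conjI allI impI \<delta>)
    fix y' assume y': "norm (y' - y) < \<delta>"
    show "norm (bcomp F y' - bcomp F y - bderiv F y (y' - y)) \<le> e * norm (y' - y)"
    proof (rule norm_bound)
      fix s
      let ?F' = "\<lambda>x. frechet_derivative F (at x)"
      have on: "onorm (?F' x - ?F' (y s)) \<le> e" if x: "x \<in> ball (y s) \<delta>" for x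
      proof -
        interpret bounded_linear "?F' x - ?F' (y s)"
          unfolding fun_diff_def by (intro bounded_linear_sub has_derivative_bounded_linear[OF FD])
        have "norm (?F' x b - ?F' (y s) b) \<le> e / DIM('y)" if "b \<in> Basis" for b
          using d(2)[of x s b] \<delta>(2)[OF that] x by (auto simp: dist_norm norm_minus_commute intro: less_imp_le)
        then have "(\<Sum>b\<in>Basis. norm ((?F' x - ?F' (y s)) b)) \<le> (\<Sum>b\<in>(Basis::'y set). e / DIM('y))"
          by (intro sum_mono) auto
        then show ?thesis
          using onorm_componentwise[OF bounded_linear_axioms] by simp
      qed
      have "norm (y' s - y s) \<le> norm (y' - y)" using norm_bounded[of "y' - y" s] by simp
      then have sub: "y s + t *\<^sub>R (y' s - y s) \<in> ball (y s) \<delta>" if "t \<in> {0..1}" for t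
        using that y' mult_left_le_one_le[of "norm (y' s - y s)" t] by (auto simp: dist_norm)
      have "norm (F (y' s) - F (y s) - ?F' (y s) (y' s - y s)) \<le> norm (y' s - y s) * e"
        by (rule differentiable_bound_linearization[where S="ball (y s) \<delta>"])
          (use FD \<delta> sub on in \<open>auto intro: has_derivative_at_withinI\<close>)
      also have "\<dots> \<le> e * norm (y' - y)"
        using \<open>norm (y' s - y s) \<le> norm (y' - y)\<close> e by (simp add: mult.commute)
      finally show "norm (apply_bcontfun (bcomp F y' - bcomp F y - bderiv F y (y' - y)) s) \<le> e * norm (y' - y)"
        using F smooth_on_imp_continuous_on[OF F] by simp
    qed
  qed
qed

lemma Ck_on_bcomp:
  fixes F :: "'y::euclidean_space \<Rightarrow> 'v::real_normed_vector" and y :: "'p::real_normed_vector \<Rightarrow> (real \<Rightarrow>\<^sub>C 'y)"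
  assumes S: "open S" and "smooth_on UNIV F" "Ck_on k S y"
  shows "Ck_on k S (\<lambda>p. bcomp F (y p))"
  using assms(2,3)
proof (induction k arbitrary: F)
  case 0
  have "continuous_on UNIV (bcomp F)"
    using 0 smooth_on_imp_continuous_on bcomp_continuous by blast
  then show ?case using 0 continuous_on_compose2[of UNIV "bcomp F" S y] by simp
next
  case (Suc k)
  note yS = Ck_on_SucD[OF Suc.prems(2)]
  show ?case
  proof (rule Ck_on_SucI[OF S, where f'="\<lambda>p h. bderiv F (y p) (frechet_derivative y (at p) h)"])
    fix p assume "p \<in> S"
    from has_derivative_compose[OF yS(1)[OF this] bcomp_has_derivative[OF Suc.prems(1)]]
    show "((\<lambda>p. bcomp F (y p)) has_derivative (\<lambda>h. bderiv F (y p) (frechet_derivative y (at p) h))) (at p)" .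
  next
    fix h
    show "Ck_on k S (\<lambda>p. bderiv F (y p) (frechet_derivative y (at p) h))"
      unfolding bderiv_def
      by (intro Ck_on_sum S Ck_on_bilinear[OF bounded_bilinear_bmul] yS(2)
          Ck_on_bounded_linear[OF bounded_linear_bcomp[OF bounded_linear_inner_left]]
          Suc.IH smooth_on_frechet_derivative Suc.prems Ck_on_Suc_imp[OF Suc.prems(2)])
  qed
qed

text \<open>The integral of \<open>z\<close> from 0 to \<open>s\<close>, with \<open>s\<close>
  clamped to the interval from -2 to 2 so that the result is bounded on the whole line. Integrals
  starting at -2 avoid a sign convention for negative \<open>s\<close>.\<close>

definition primitive :: "(real \<Rightarrow>\<^sub>C 'y::euclidean_space) \<Rightarrow> real \<Rightarrow>\<^sub>C 'y" where
  "primitive z = Bcontfun (\<lambda>s. integral {-2..max (-2) (min 2 s)} z - integral {-2..0} z)"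

lemma
  fixes z :: "real \<Rightarrow>\<^sub>C 'y::euclidean_space"
  shows primitive_apply [simp]: "apply_bcontfun (primitive z) s = integral {-2..max (-2) (min 2 s)} z - integral {-2..0} z"
    and norm_primitive_le: "norm (primitive z) \<le> 6 * norm z"
proof -
  have int: "z integrable_on {a..b}" for a b :: real
    by (intro integrable_continuous_real) auto
  have bd: "norm (integral {-2..u} z) \<le> norm z * (u + 2)" if "-2 \<le> u" for u
    using integral_bound[OF that, of z "norm z"] norm_bounded[of z] by auto
  \<comment> \<open>The first integral runs over length at most 4 and the second over length 2,
    whence the constant 6.\<close>
  have le: "norm (integral {-2..max (-2) (min 2 s)} z - integral {-2..0} z) \<le> 6 * norm z" for s
  proof -
    have "norm (integral {-2..max (-2) (min 2 s)} z) \<le> norm z * 4"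
      by (rule order_trans[OF bd]) (auto intro!: mult_left_mono)
    then show ?thesis using bd[of 0] norm_triangle_ineq4[of "integral {-2..max (-2) (min 2 s)} z" "integral {-2..0} z"]
      by simp
  qed
  have "continuous_on {-2..2} (\<lambda>u. integral {-2..u} z)"
    by (rule indefinite_integral_continuous_1[OF int])
  then have "continuous_on UNIV (\<lambda>s. integral {-2..max (-2) (min 2 s)} z)"
    by (rule continuous_on_compose2) (auto intro!: continuous_intros)
  then have "(\<lambda>s. integral {-2..max (-2) (min 2 s)} z - integral {-2..0} z) \<in> bcontfun"
    by (intro bcontfun_normI[OF _ le] continuous_intros)
  then show *: "apply_bcontfun (primitive z) s = integral {-2..max (-2) (min 2 s)} z - integral {-2..0} z" for s
    by (simp add: primitive_def Bcontfun_inverse)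
  show "norm (primitive z) \<le> 6 * norm z"
    by (rule norm_bound) (simp only: * le)
qed

lemma bounded_linear_primitive: "bounded_linear primitive"
proof (rule bounded_linear_intro[where K=6])
  fix x y :: "real \<Rightarrow>\<^sub>C 'y::euclidean_space" and r :: real
  have int: "z integrable_on {a..b}" for a b :: real and z :: "real \<Rightarrow>\<^sub>C 'y"
    by (intro integrable_continuous_real) auto
  show "primitive (x + y) = primitive x + primitive y"
    by (rule bcontfun_eqI) (simp add: integral_add int)
  show "primitive (r *\<^sub>R x) = r *\<^sub>R primitive x"
    by (rule bcontfun_eqI) (simp add: algebra_simps)
  show "norm (primitive x) \<le> norm x * 6" using norm_primitive_le[of x] by simp
qed

lemma primitive_has_vector_derivative:
  fixes z :: "real \<Rightarrow>\<^sub>C 'y::euclidean_space"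
  assumes "\<bar>s\<bar> < 2"
  shows "(apply_bcontfun (primitive z) has_vector_derivative z s) (at s)"
proof -
  have s: "s \<in> {-2<..<2}" using assms by auto
  have "((\<lambda>u. integral {-2..u} z) has_vector_derivative z s) (at s within {-2..2})"
    by (rule integral_has_vector_derivative) (use s in auto)
  then have "((\<lambda>u. integral {-2..u} z) has_vector_derivative z s) (at s within {-2<..<2})"
    by (rule has_vector_derivative_within_subset) auto
  then have "((\<lambda>u. integral {-2..u} z) has_vector_derivative z s) (at s)"
    using at_within_open[OF s open_greaterThanLessThan] by simp
  then have "((\<lambda>u. integral {-2..u} z - integral {-2..0} z) has_vector_derivative z s - 0) (at s)"
    by (intro has_vector_derivative_diff has_vector_derivative_const)
  then show ?thesis
    using has_vector_derivative_transform_within_open[OF _ open_greaterThanLessThan s,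
        of "\<lambda>u. integral {-2..u} z - integral {-2..0} z" "z s" "apply_bcontfun (primitive z)"]
    by simp
qed

text \<open>Each equation \<open>z - K z = b\<close> is a fixed point problem for a contraction.
  Uniqueness of the fixed point makes the solution linear in \<open>b\<close>, and
  \<open>1 / (1 - c)\<close> bounds it.\<close>

lemma neumann_inverse:
  fixes K :: "'z::{real_normed_vector,complete_space} \<Rightarrow>\<^sub>L 'z"
  assumes c: "0 \<le> c" "c < 1" and K: "\<And>z. norm (K z) \<le> c * norm z"
  obtains B :: "'z \<Rightarrow>\<^sub>L 'z" where "\<And>z. B (z - K z) = z" "\<And>z. B z - K (B z) = z"
proof -
  have "\<exists>!w. b + K w = w" for b
    by (rule banach_fix_type[where c=c])
      (use c K in \<open>auto simp: dist_norm blinfun.diff_right[symmetric]\<close>)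
  then obtain g where g: "\<And>b. b + K (g b) = g b" and uniq: "\<And>b w. b + K w = w \<Longrightarrow> w = g b"
    by metis
  have "bounded_linear g"
  proof (rule bounded_linear_intro[where K="1 / (1 - c)"])
    show "g (x + y) = g x + g y" for x y
      by (rule uniq[symmetric]) (metis (no_types, lifting) add.assoc add.left_commute blinfun.add_right g)
    show "g (r *\<^sub>R x) = r *\<^sub>R g x" for r x
      by (rule uniq[symmetric]) (metis blinfun.scaleR_right g scaleR_right_distrib)
    show "norm (g x) \<le> norm x * (1 / (1 - c))" for x
    proof -
      have "norm (g x) \<le> norm x + norm (K (g x))" by (metis g norm_triangle_ineq)
      then show ?thesis using K[of "g x"] c by (simp add: field_simps)
    qed
  qed
  note [simp] = bounded_linear_Blinfun_apply[OF this]
  show thesis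
  proof (rule that[of "Blinfun g"])
    show "Blinfun g (z - K z) = z" for z by (simp add: uniq[symmetric])
    show "Blinfun g z - K (Blinfun g z) = z" for z using g[of z] by (simp add: algebra_simps)
  qed
qed

text \<open>A solution curve is a fixed point of the map sending \<open>y\<close> to
  \<open>p\<close> plus the primitive of \<open>f \<circ> y\<close>. As \<open>primitive\<close> has
  norm at most 6, the bound 1/12 makes this a contraction with constant 1/2 on the whole time
  interval at once, and the Lipschitz constant 2 of the flow is the inverse of 1 - 1/2.\<close>

theorem smooth_flow:
  fixes f :: "'y::euclidean_space \<Rightarrow> 'y"
  assumes f: "smooth_on UNIV f" and L: "\<And>x h. norm (frechet_derivative f (at x) h) \<le> 1/12 * norm h"
  obtains \<phi> where "\<And>p. \<phi> p 0 = p"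
    and "\<And>p s. \<bar>s\<bar> < 2 \<Longrightarrow> (\<phi> p has_vector_derivative f (\<phi> p s)) (at s)"
    and "\<And>s. smooth_on UNIV (\<lambda>p. \<phi> p s)"
    and "\<And>p q s. norm (\<phi> p s - \<phi> q s) \<le> 2 * norm (p - q)"
proof -
  have fc: "continuous_on UNIV f" using f by (rule smooth_on_imp_continuous_on)
  have "onorm (frechet_derivative f (at x)) \<le> 1/12" for x
    using L by (rule onorm_le)
  then have f12: "norm (f x - f y) \<le> 1/12 * norm (x - y)" for x y
    by (intro differentiable_bound[where S=UNIV and f'="\<lambda>x. frechet_derivative f (at x)"])
      (use smooth_on_has_derivative[OF f] in auto)
  have N12: "norm (bcomp f y - bcomp f z) \<le> 1/12 * norm (y - z)" for y z
  proof (rule norm_bound)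
    fix s
    show "norm (apply_bcontfun (bcomp f y - bcomp f z) s) \<le> 1/12 * norm (y - z)"
      using f12[of "y s" "z s"] norm_bounded[of "y - z" s] fc by simp
  qed
  have IN: "norm (primitive (bcomp f y) - primitive (bcomp f z)) \<le> 1/2 * norm (y - z)" for y z
    using norm_primitive_le[of "bcomp f y - bcomp f z"] N12[of y z]
    unfolding bounded_linear.linear[OF bounded_linear_primitive, THEN linear_diff] by simp
  define \<Phi> where "\<Phi> y = y - primitive (bcomp f y)" for y
  have "\<exists>!y. c + primitive (bcomp f y) = y" for c
    by (rule banach_fix_type[where c="1/2"]) (use IN in \<open>auto simp: dist_norm\<close>)
  then obtain g where g: "\<And>c. c + primitive (bcomp f (g c)) = g c" by metis
  have \<Phi>g: "\<Phi> (g c) = c" for c using g[of c] by (simp add: \<Phi>_def algebra_simps)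
  have g2: "norm (g c - g d) \<le> 2 * norm (c - d)" for c d
  proof -
    have "norm (g c - g d) = norm ((c - d) + (primitive (bcomp f (g c)) - primitive (bcomp f (g d))))"
      by (metis add_diff_add g)
    also have "\<dots> \<le> norm (c - d) + 1/2 * norm (g c - g d)"
      by (rule order_trans[OF norm_triangle_ineq]) (use IN in auto)
    finally show ?thesis by simp
  qed
  \<comment> \<open>\<open>K y\<close> below is the derivative at \<open>y\<close> of the map
    \<open>\<lambda>y. primitive (bcomp f y)\<close>. Composing it from the operators
    \<open>M b\<close>, which are bounded linear in their coefficient, shows that it depends on
    \<open>y\<close> as smoothly as the superposed partial derivatives of \<open>f\<close>
    do.\<close>
  define M where "M = (\<lambda>b::'y. bounded_bilinear.prod_left (\<lambda>z m :: real \<Rightarrow>\<^sub>C 'y. bmul (bcomp (\<lambda>x. x \<bullet> b) z) m))"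
  have M_apply: "M b m z = bmul (bcomp (\<lambda>x. x \<bullet> b) z) m" for b m z
    unfolding M_def by (simp add: bounded_bilinear.prod_left.rep_eq[OF bounded_bilinear_bmul_bcomp_inner])
  have M_bl: "bounded_linear (M b)" for b
    unfolding M_def by (rule bounded_bilinear.bounded_linear_prod_left[OF bounded_bilinear_bmul_bcomp_inner])
  define K where "K y = Blinfun primitive o\<^sub>L (\<Sum>b\<in>Basis. M b (bcomp (\<lambda>x. frechet_derivative f (at x) b) y))" for y
  have K_apply: "K y z = primitive (bderiv f y z)" for y z
    by (simp add: K_def bderiv_def blinfun.sum_left M_apply bounded_linear_Blinfun_apply[OF bounded_linear_primitive])
  have "norm (bderiv f y z) \<le> 1/12 * norm z" for y z
  proof (rule norm_bound)
    fix s
    show "norm (apply_bcontfun (bderiv f y z) s) \<le> 1/12 * norm z"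
      using L[of "y s" "z s"] norm_bounded[of z s] by (simp add: f)
  qed
  note bd = this
  have K2: "norm (K y z) \<le> 1/2 * norm z" for y z
    unfolding K_apply by (rule order_trans[OF norm_primitive_le]) (use bd[of y z] in linarith)
  have "\<exists>B :: (real \<Rightarrow>\<^sub>C 'y) \<Rightarrow>\<^sub>L (real \<Rightarrow>\<^sub>C 'y). (\<forall>z. B (z - K y z) = z) \<and> (\<forall>z. B z - K y (B z) = z)" for y :: "real \<Rightarrow>\<^sub>C 'y"
    by (rule neumann_inverse[of "1/2" "K y", OF _ _ K2]) (simp, simp, blast)
  then obtain B :: "(real \<Rightarrow>\<^sub>C 'y) \<Rightarrow> (real \<Rightarrow>\<^sub>C 'y) \<Rightarrow>\<^sub>L (real \<Rightarrow>\<^sub>C 'y)" where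
    B: "\<And>y z. B y (z - K y z) = z" "\<And>y z. B y z - K y (B y z) = z" by metis
  have g_der: "(g has_derivative B (g c)) (at c)" for c
  proof (rule has_derivative_inverse_basic[where f=\<Phi> and T=UNIV])
    show "(\<Phi> has_derivative (\<lambda>z. z - K (g c) z)) (at (g c))"
      unfolding \<Phi>_def[abs_def] K_apply
      by (intro has_derivative_diff has_derivative_ident
          bounded_linear.has_derivative[OF bounded_linear_primitive bcomp_has_derivative[OF f]])
    show "continuous (at c) g"
      unfolding continuous_at_eps_delta dist_norm
    proof (intro allI impI)
      fix e :: real assume "0 < e"
      then show "\<exists>d>0. \<forall>x'. norm (x' - c) < d \<longrightarrow> norm (g x' - g c) < e"
        by (intro exI[of _ "e/2"]) (auto intro: le_less_trans[OF g2])
    qed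
  qed (auto simp: \<Phi>g B fun_eq_iff blinfun.bounded_linear_right)
  have const: "bounded_linear (const_bcontfun :: 'y \<Rightarrow> real \<Rightarrow>\<^sub>C 'y)"
    by (rule bounded_linear_intro[where K=1]) (auto intro!: bcontfun_eqI norm_bound)
  define y where "y p = g (const_bcontfun p)" for p
  have y_der: "(y has_derivative (\<lambda>h. B (y p) (const_bcontfun h))) (at p)" for p
    unfolding y_def[abs_def]
    by (rule has_derivative_compose[OF bounded_linear_imp_has_derivative[OF const] g_der])
  \<comment> \<open>The derivative of \<open>y\<close> in direction \<open>h\<close> solves a linear
    equation with operator \<open>id_blinfun - K (y p)\<close>, which is as smooth as
    \<open>y\<close> itself; each step of the induction gains one derivative.\<close>
  have Ck: "Ck_on k UNIV y" for k
  proof (induction k)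
    case 0
    then show ?case
      using has_derivative_continuous[OF y_der] by (simp add: continuous_at_imp_continuous_on)
  next
    case (Suc k)
    show ?case
    proof (rule Ck_on_SucI[OF open_UNIV y_der])
      fix h
      have CK: "Ck_on k UNIV (\<lambda>p. K (y p))"
        unfolding K_def
        by (intro Ck_on_bounded_linear[OF bounded_bilinear.bounded_linear_right[OF bounded_bilinear_blinfun_compose]]
            Ck_on_sum Ck_on_bounded_linear[OF M_bl] Ck_on_bcomp smooth_on_frechet_derivative f Suc.IH open_UNIV)
      show "Ck_on k UNIV (\<lambda>p. B (y p) (const_bcontfun h))"
        by (rule Ck_on_linear_solve[where A="\<lambda>p. id_blinfun - K (y p)" and B="\<lambda>p. B (y p)" and b="\<lambda>p. const_bcontfun h"])
          (auto intro!: Ck_on_diff CK simp: B blinfun.diff_left)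
    qed
  qed
  have y_eq: "y p = const_bcontfun p + primitive (bcomp f (y p))" for p
    using g[of "const_bcontfun p"] by (simp add: y_def)
  show thesis
  proof (rule that[of "\<lambda>p. apply_bcontfun (y p)"])
    show "apply_bcontfun (y p) 0 = p" for p
      by (subst y_eq) simp
    show "(apply_bcontfun (y p) has_vector_derivative f (apply_bcontfun (y p) s)) (at s)" if "\<bar>s\<bar> < 2" for p s
    proof -
      have "((\<lambda>s. p + primitive (bcomp f (y p)) s) has_vector_derivative 0 + bcomp f (y p) s) (at s)"
        by (intro has_vector_derivative_add has_vector_derivative_const primitive_has_vector_derivative that)
      moreover have "(\<lambda>s. p + primitive (bcomp f (y p)) s) = apply_bcontfun (y p)"
        by (subst (2) y_eq) (auto simp: fun_eq_iff)
      ultimately show ?thesis using fc by simp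
    qed
    have ev: "bounded_linear (\<lambda>z::real \<Rightarrow>\<^sub>C 'y. apply_bcontfun z s)" for s
      by (rule bounded_linear_intro[where K=1]) (auto intro: norm_bounded)
    show "smooth_on UNIV (\<lambda>p. apply_bcontfun (y p) s)" for s
      using Ck unfolding smooth_on_def by (auto intro: Ck_on_bounded_linear[OF ev])
    show "norm (apply_bcontfun (y p) s - apply_bcontfun (y q) s) \<le> 2 * norm (p - q)" for p q s
    proof -
      have "norm (const_bcontfun p - const_bcontfun q :: real \<Rightarrow>\<^sub>C 'y) \<le> norm (p - q)"
        by (rule norm_bound) simp
      then show ?thesis
        using norm_bounded[of "y p - y q" s] g2[of "const_bcontfun p" "const_bcontfun q"]
        by (simp add: y_def)
    qed
  qed
qed

subsection \<open>Cutoff functions\<close>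

text \<open>The powers in the denominator make this family closed under differentiation up to linear
  combinations, so smoothness is proved for all \<open>n\<close> at once by induction on the
  order.\<close>

definition exp_tail :: "nat \<Rightarrow> real \<Rightarrow> real" where
  "exp_tail n x = (if x > 0 then exp (- 1 / x) / x ^ n else 0)"

lemma power_le_fact_exp: "0 \<le> y \<Longrightarrow> y ^ k \<le> fact k * exp (y::real)"
proof -
  assume y: "0 \<le> y"
  have "y ^ k /\<^sub>R fact k = (\<Sum>n\<in>{k}. y ^ n /\<^sub>R fact n)" by simp
  also have "\<dots> \<le> exp y"
    unfolding exp_def by (rule sum_le_suminf) (use y summable_exp_generic[of y] in auto)
  finally show ?thesis by (simp add: field_simps)
qed

text \<open>A single term of the exponential series already outweighs the power \<open>n + 2\<close>
  of \<open>1/x\<close>. A bound quadratic in \<open>x\<close> is what forces the derivative 0 at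
  the origin.\<close>

lemma exp_tail_le: "\<bar>exp_tail n x\<bar> \<le> fact (n + 2) * x\<^sup>2"
proof (cases "x > 0")
  case True
  have "(1/x) ^ (n + 2) \<le> fact (n + 2) * exp (1/x)"
    using True by (intro power_le_fact_exp) auto
  moreover define F where "F = (fact (n + 2) :: real)"
  ultimately have "1 \<le> F * exp (1/x) * x ^ (n + 2)"
    using True by (simp add: power_one_over field_simps)
  then have "exp (- 1 / x) * 1 \<le> exp (- 1 / x) * (F * exp (1/x) * x ^ (n + 2))"
    by (intro mult_left_mono) auto
  also have "\<dots> = (exp (- 1 / x) * exp (1/x)) * (F * x\<^sup>2 * x ^ n)"
    by (simp add: power_add power2_eq_square)
  also have "\<dots> = F * x\<^sup>2 * x ^ n"
    by (simp add: exp_add[symmetric])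
  finally show ?thesis
    using True by (simp add: exp_tail_def pos_divide_le_eq F_def)
qed (simp add: exp_tail_def)

lemma exp_tail_has_derivative:
  "(exp_tail n has_real_derivative exp_tail (n + 2) x - n * exp_tail (n + 1) x) (at x)"
proof -
  consider "x > 0" | "x < 0" | "x = 0" by linarith
  then show ?thesis
  proof cases
    case 1
    have "((\<lambda>x. exp (- 1 / x) / x ^ n) has_real_derivative
        (exp (- 1 / x) * (1 / x\<^sup>2) * x ^ n - exp (- 1 / x) * (n * x ^ (n - 1))) / (x ^ n * x ^ n)) (at x)"
      using 1 by (auto intro!: derivative_eq_intros simp: power2_eq_square)
    moreover have "(exp (- 1 / x) * (1 / x\<^sup>2) * x ^ n - exp (- 1 / x) * (n * x ^ (n - 1))) / (x ^ n * x ^ n)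
        = exp_tail (n + 2) x - n * exp_tail (n + 1) x"
      using 1 by (cases n) (simp_all add: exp_tail_def field_simps power2_eq_square)
    ultimately have "((\<lambda>x. exp (- 1 / x) / x ^ n) has_real_derivative exp_tail (n + 2) x - n * exp_tail (n + 1) x) (at x)"
      by simp
    then show ?thesis
      by (rule DERIV_cong_ev[THEN iffD1, OF refl _ refl, rotated])
        (use 1 eventually_nhds_in_open[of "{0<..}" x] in \<open>auto simp: exp_tail_def elim!: eventually_mono\<close>)
  next
    case 2
    have "((\<lambda>x. 0) has_real_derivative 0) (at x)" by simp
    then have "(exp_tail n has_real_derivative 0) (at x)"
      by (rule DERIV_cong_ev[THEN iffD1, OF refl _ refl, rotated])
        (use 2 eventually_nhds_in_open[of "{..<0}" x] in \<open>auto simp: exp_tail_def elim!: eventually_mono\<close>)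
    then show ?thesis using 2 by (simp add: exp_tail_def)
  next
    case 3
    have "((\<lambda>h. exp_tail n h / h) \<longlongrightarrow> 0) (at 0)"
    proof (rule Lim_null_comparison)
      show "\<forall>\<^sub>F h in at 0. norm (exp_tail n h / h) \<le> fact (n + 2) * \<bar>h\<bar>"
      proof (rule always_eventually, rule allI)
        fix h :: real
        have "\<bar>exp_tail n h\<bar> / \<bar>h\<bar> \<le> fact (n + 2) * h\<^sup>2 / \<bar>h\<bar>"
          by (rule divide_right_mono[OF exp_tail_le]) simp
        also have "\<dots> = fact (n + 2) * \<bar>h\<bar>"
          by (simp add: power2_eq_square abs_if)
        finally show "norm (exp_tail n h / h) \<le> fact (n + 2) * \<bar>h\<bar>" by simp
      qed
      show "((\<lambda>h::real. fact (n + 2) * \<bar>h\<bar>) \<longlongrightarrow> 0) (at 0)"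
        by (auto intro!: tendsto_eq_intros)
    qed
    then show ?thesis using 3 by (simp add: has_field_derivative_def[symmetric] DERIV_def exp_tail_def)
  qed
qed

lemma smooth_on_exp_tail: "smooth_on UNIV (exp_tail n)"
  unfolding smooth_on_def
proof
  fix k show "Ck_on k UNIV (exp_tail n)"
  proof (induction k arbitrary: n)
    case 0
    show ?case
      using DERIV_isCont[OF exp_tail_has_derivative] by (simp add: continuous_at_imp_continuous_on)
  next
    case (Suc k)
    show ?case
      by (rule Ck_on_SucI[OF _ exp_tail_has_derivative[THEN has_field_derivative_imp_has_derivative]])
        (auto intro!: Ck_on_bilinear[OF bounded_bilinear_mult] Ck_on_diff Suc)
  qed
qed

lemma exp_tail_pos: "exp_tail n x > 0 \<longleftrightarrow> x > 0" and exp_tail_nonneg: "exp_tail n x \<ge> 0"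
  by (auto simp: exp_tail_def)

definition smooth_step :: "real \<Rightarrow> real" where
  "smooth_step x = exp_tail 0 x / (exp_tail 0 x + exp_tail 0 (1 - x))"

lemma smooth_step_denominator: "exp_tail 0 x + exp_tail 0 (1 - x) > 0"
  using exp_tail_pos[of 0 x] exp_tail_pos[of 0 "1 - x"] exp_tail_nonneg[of 0 x] exp_tail_nonneg[of 0 "1 - x"]
  by (cases "x > 0") (auto simp: add_pos_nonneg add_nonneg_pos)

lemma smooth_on_smooth_step: "smooth_on UNIV smooth_step"
proof -
  have "smooth_on UNIV (\<lambda>x. exp_tail 0 (1 - x))"
    by (rule smooth_on_compose[OF _ _ smooth_on_exp_tail])
      (auto intro!: smooth_on_diff smooth_on_ident)
  then show ?thesis
    unfolding smooth_step_def[abs_def]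
    by (intro smooth_on_divide smooth_on_add smooth_on_exp_tail open_UNIV)
      (use smooth_step_denominator in \<open>auto simp: less_imp_neq[symmetric]\<close>)
qed

lemma smooth_step_simps:
  "x \<le> 0 \<Longrightarrow> smooth_step x = 0" "x \<ge> 1 \<Longrightarrow> smooth_step x = 1" "0 \<le> smooth_step x" "smooth_step x \<le> 1"
  using smooth_step_denominator[of x] exp_tail_nonneg[of 0 x] exp_tail_nonneg[of 0 "1 - x"]
  by (auto simp: smooth_step_def exp_tail_def[of 0 x] exp_tail_def[of 0 "1 - x"] divide_simps)

lemma smooth_cutoff:
  fixes z :: "'a::euclidean_space"
  assumes "r > 0"
  obtains \<beta> :: "'a \<Rightarrow> real" where "smooth_on UNIV \<beta>" "\<And>x. 0 \<le> \<beta> x" "\<And>x. \<beta> x \<le> 1"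
    "\<And>x. dist z x \<le> r / 2 \<Longrightarrow> \<beta> x = 1" "\<And>x. dist z x \<ge> r \<Longrightarrow> \<beta> x = 0"
proof
  \<comment> \<open>The factor makes the argument of \<open>smooth_step\<close> equal to 0 at
    distance \<open>r\<close> and to 1 at distance \<open>r / 2\<close>, since one minus a quarter
    is 3/4. The squared distance is used because it is smooth at \<open>z\<close> as well.\<close>
  let ?c = "4 / (3 * r\<^sup>2)"
  let ?\<beta> = "\<lambda>x. smooth_step (?c * (r\<^sup>2 - (x - z) \<bullet> (x - z)))"
  show "smooth_on UNIV ?\<beta>"
    by (rule smooth_on_compose[OF open_UNIV open_UNIV smooth_on_smooth_step])
      (intro smooth_on_mult smooth_on_diff smooth_on_inner smooth_on_ident smooth_on_const open_UNIV subset_UNIV)+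
  fix x
  show "0 \<le> ?\<beta> x" "?\<beta> x \<le> 1" by (auto simp: smooth_step_simps)
  have sq: "(x - z) \<bullet> (x - z) = (dist z x)\<^sup>2" by (simp add: dist_norm power2_norm_eq_inner norm_minus_commute)
  show "?\<beta> x = 1" if "dist z x \<le> r / 2"
  proof -
    have "(dist z x)\<^sup>2 \<le> (r/2)\<^sup>2" using that by (intro power_mono) auto
    then show ?thesis using assms
      by (intro smooth_step_simps(2)) (simp add: sq field_simps power2_eq_square)
  qed
  show "?\<beta> x = 0" if "dist z x \<ge> r"
  proof -
    have "r\<^sup>2 \<le> (dist z x)\<^sup>2" using that assms by (intro power_mono) auto
    then show ?thesis using assms
      by (intro smooth_step_simps(1)) (simp add: sq mult_nonneg_nonpos divide_nonpos_pos)
  qed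
qed

text \<open>Off \<open>cball z r\<close> the product is 0 whatever values \<open>g\<close> takes
  there, so \<open>U\<close> and the complement of the ball are two open sets of smoothness that
  cover the space.\<close>

lemma smooth_on_cutoff_scaleR:
  fixes g :: "'a::euclidean_space \<Rightarrow> 'b::real_normed_vector"
  assumes "smooth_on UNIV \<beta>" "\<And>x. dist z x \<ge> r \<Longrightarrow> \<beta> x = 0"
    and "open U" "cball z r \<subseteq> U" "smooth_on U g"
  shows "smooth_on UNIV (\<lambda>x. \<beta> x *\<^sub>R g x)"
proof (rule smooth_on_local)
  fix x
  have 1: "smooth_on U (\<lambda>x. \<beta> x *\<^sub>R g x)"
    by (intro smooth_on_scaleR assms smooth_on_subset[OF assms(1)]) auto
  have 2: "smooth_on (- cball z r) (\<lambda>x. \<beta> x *\<^sub>R g x)"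
    by (rule smooth_on_cong[where f="\<lambda>x. 0"]) (use assms(2) in auto)
  show "\<exists>T. open T \<and> x \<in> T \<and> smooth_on T (\<lambda>x. \<beta> x *\<^sub>R g x)"
    using 1 2 assms(3,4) by (cases "x \<in> cball z r") (auto intro: exI[of _ U] exI[of _ "- cball z r"])
qed

subsection \<open>Inverses of perturbations of the identity\<close>

lemma has_derivative_lipschitz_bound:
  fixes f :: "'a::real_normed_vector \<Rightarrow> 'b::real_normed_vector"
  assumes f: "(f has_derivative f') (at x)" and S: "open S" "x \<in> S"
    and L: "\<And>y. y \<in> S \<Longrightarrow> norm (f y - f x) \<le> L * norm (y - x)"
  shows "norm (f' h) \<le> L * norm h"
proof (cases "h = 0")
  case True
  then show ?thesis using linear_0[OF has_derivative_linear[OF f]] by simp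
next
  case False
  show ?thesis
  proof (rule field_le_epsilon)
    fix e' :: real assume "e' > 0"
    define e where "e = e' / norm h"
    have e: "e > 0" "e * norm h = e'" using \<open>e' > 0\<close> False by (auto simp: e_def)
    obtain d where d: "d > 0" "\<And>y. norm (y - x) < d \<Longrightarrow> norm (f y - f x - f' (y - x)) \<le> e * norm (y - x)"
      using f e unfolding has_derivative_at_alt by meson
    obtain r where r: "r > 0" "ball x r \<subseteq> S" using S openE by blast
    define t where "t = min d r / (2 * norm h)"
    have t: "t > 0" using d r False by (simp add: t_def)
    have th: "norm (t *\<^sub>R h) < d" "norm (t *\<^sub>R h) < r" using d r False by (auto simp: t_def)
    let ?y = "x + t *\<^sub>R h"
    have "t * norm (f' h) = norm (f' (t *\<^sub>R h))"
      using t linear_scale[OF has_derivative_linear[OF f], of t h] by simp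
    also have "\<dots> \<le> norm (f ?y - f x) + norm (f ?y - f x - f' (t *\<^sub>R h))"
      by (metis norm_minus_commute norm_triangle_sub)
    also have "\<dots> \<le> L * norm (t *\<^sub>R h) + e * norm (t *\<^sub>R h)"
    proof (rule add_mono)
      have "?y \<in> S" using r(2) th(2) by (auto simp: dist_norm subset_eq)
      from L[OF this] show "norm (f ?y - f x) \<le> L * norm (t *\<^sub>R h)" by simp
      show "norm (f ?y - f x - f' (t *\<^sub>R h)) \<le> e * norm (t *\<^sub>R h)" using d(2)[of ?y] th by simp
    qed
    also have "\<dots> = t * (L * norm h + e')" using t e(2) by (simp add: algebra_simps)
    finally show "norm (f' h) \<le> L * norm h + e'" using t by simp
  qed
qed

text \<open>The hypothesis says that \<open>f\<close> differs from the identity by a map with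
  Lipschitz constant 1/2. As a condition on pairs of points it gives injectivity and a Lipschitz
  inverse directly on any open \<open>B\<close>; invariance of domain gives the open image, and
  every derivative of \<open>f\<close> is within 1/2 of the identity and hence invertible.\<close>

lemma smooth_inverse_near_identity:
  fixes f :: "'a::euclidean_space \<Rightarrow> 'a"
  assumes B: "open B" and f: "smooth_on B f"
    and half: "\<And>x y. x \<in> B \<Longrightarrow> y \<in> B \<Longrightarrow> norm ((f x - f y) - (x - y)) \<le> 1/2 * norm (x - y)"
  shows "inj_on f B" "open (f ` B)" "smooth_on (f ` B) (inv_into B f)"
proof -
  have low: "norm (x - y) \<le> 2 * norm (f x - f y)" if "x \<in> B" "y \<in> B" for x y
    using half[OF that] norm_triangle_ineq4[of "f x - f y" "(f x - f y) - (x - y)"] by simp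
  show inj: "inj_on f B"
  proof (rule inj_onI)
    fix x y assume "x \<in> B" "y \<in> B" "f x = f y"
    then show "x = y" using low[of x y] by simp
  qed
  show op: "open (f ` B)"
    by (rule invariance_of_domain[OF smooth_on_imp_continuous_on[OF f] B inj])
  let ?g = "inv_into B f"
  have g: "?g y \<in> B" "f (?g y) = y" if "y \<in> f ` B" for y
    using that by (auto simp: inv_into_into f_inv_into_f)
  note f_der = smooth_on_has_derivative[OF f]
  define K where "K x h = h - frechet_derivative f (at x) h" for x h
  have blK: "bounded_linear (K x)" if "x \<in> B" for x
    unfolding K_def using has_derivative_bounded_linear[OF f_der[OF that]]
    by (intro bounded_linear_sub bounded_linear_ident)
  have K: "norm (K x h) \<le> 1/2 * norm h" if "x \<in> B" for x h
  proof (rule has_derivative_lipschitz_bound[where f="\<lambda>x. x - f x", OF _ B that])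
    show "((\<lambda>x. x - f x) has_derivative K x) (at x)"
      unfolding K_def by (intro has_derivative_diff has_derivative_ident f_der that)
    show "norm ((y - f y) - (x - f x)) \<le> 1/2 * norm (y - x)" if "y \<in> B" for y
      using half[OF that \<open>x \<in> B\<close>] by (simp add: norm_minus_commute algebra_simps)
  qed
  have "\<exists>N :: 'a \<Rightarrow>\<^sub>L 'a. (\<forall>z. N (frechet_derivative f (at x) z) = z) \<and> (\<forall>z. frechet_derivative f (at x) (N z) = z)"
    if x: "x \<in> B" for x
  proof -
    note ap = bounded_linear_Blinfun_apply[OF blK[OF x]]
    obtain N :: "'a \<Rightarrow>\<^sub>L 'a" where "\<And>z. N (z - Blinfun (K x) z) = z" "\<And>z. N z - Blinfun (K x) (N z) = z"
      by (rule neumann_inverse[of "1/2" "Blinfun (K x)"]) (use K[OF x] ap in auto)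
    then show ?thesis unfolding ap by (intro exI[of _ N]) (simp add: K_def)
  qed
  then obtain N :: "'a \<Rightarrow> 'a \<Rightarrow>\<^sub>L 'a" where
    N: "\<And>x z. x \<in> B \<Longrightarrow> N x (frechet_derivative f (at x) z) = z" "\<And>x z. x \<in> B \<Longrightarrow> frechet_derivative f (at x) (N x z) = z"
    by metis
  have gcont: "continuous (at y) ?g" if y: "y \<in> f ` B" for y
  proof -
    have "continuous_on (f ` B) ?g"
      unfolding continuous_on_iff
    proof (intro ballI allI impI)
      fix y e :: "'a" and e' :: real assume y: "y \<in> f ` B" and "0 < e'"
      then show "\<exists>d>0. \<forall>x'\<in>f ` B. dist x' y < d \<longrightarrow> dist (?g x') (?g y) < e'"
        using low[OF g(1) g(1)] g(2)
        by (intro exI[of _ "e'/2"]) (force simp: dist_norm)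
    qed
    then show ?thesis using op y continuous_on_eq_continuous_at by blast
  qed
  have g_der: "(?g has_derivative N (?g y)) (at y)" if y: "y \<in> f ` B" for y
  proof (rule has_derivative_inverse_basic[where f=f and T="f ` B"])
    show "(f has_derivative frechet_derivative f (at (?g y))) (at (?g y))"
      by (rule f_der[OF g(1)[OF y]])
  qed (use N g y op gcont in \<open>auto simp: blinfun.bounded_linear_right fun_eq_iff\<close>)
  define A where "A x = Blinfun (frechet_derivative f (at x))" for x
  have A_ap: "A x h = frechet_derivative f (at x) h" if "x \<in> B" for x h
    unfolding A_def by (simp add: bounded_linear_Blinfun_apply has_derivative_bounded_linear[OF f_der[OF that]])
  have A: "smooth_on B A"
    unfolding A_def
    by (intro smooth_on_Blinfun B smooth_on_frechet_derivative f has_derivative_linear[OF f_der])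
  show "smooth_on (f ` B) ?g"
    unfolding smooth_on_def
  proof
    fix k show "Ck_on k (f ` B) ?g"
    proof (induction k)
      case 0
      then show ?case using gcont by (simp add: continuous_at_imp_continuous_on)
    next
      case (Suc k)
      have AC: "Ck_on k (f ` B) (\<lambda>y. A (?g y))"
        by (rule Ck_on_compose[OF op B _ Suc.IH]) (use A g in \<open>auto simp: smooth_on_def\<close>)
      show ?case
      proof (rule Ck_on_SucI[OF op g_der])
        show "Ck_on k (f ` B) (\<lambda>y. N (?g y) h)" for h
          by (rule Ck_on_linear_solve[OF op AC Ck_on_const, where B="\<lambda>y. N (?g y)"])
            (simp_all add: A_ap g(1) N del: f_inv_into_f)
      qed
    qed
  qed
qed

subsection \<open>Local solutions of the geodesic equation\<close>

lemma compact_support_bounds: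
  fixes f :: "'a::euclidean_space \<Rightarrow> 'b::real_normed_vector"
  assumes f: "smooth_on UNIV f" and K: "compact K" "\<And>x. x \<notin> K \<Longrightarrow> f x = 0"
  obtains C where "C \<ge> 0" "\<And>x. norm (f x) \<le> C" "\<And>x h. norm (frechet_derivative f (at x) h) \<le> C * norm h"
proof -
  have bd: "\<exists>C\<ge>0. \<forall>x. norm (g x) \<le> C" if g: "smooth_on UNIV g" "\<And>x. x \<notin> K \<Longrightarrow> g x = 0" for g :: "'a \<Rightarrow> 'b"
  proof -
    have "compact (g ` K)"
      using K(1) smooth_on_imp_continuous_on[OF g(1)] by (meson compact_continuous_image continuous_on_subset subset_UNIV)
    then obtain C where "\<And>y. y \<in> g ` K \<Longrightarrow> norm y \<le> C" using compact_imp_bounded bounded_iff by metis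
    then have "norm (g x) \<le> max C 0" for x
      using g(2)[of x] by (cases "x \<in> K") (auto simp: le_max_iff_disj)
    then show ?thesis by (intro exI[of _ "max C 0"]) auto
  qed
  have z: "frechet_derivative f (at x) h = 0" if "x \<notin> K" for x h
  proof -
    have "((\<lambda>x. 0) has_derivative (\<lambda>h. 0)) (at x)" by simp
    then have "(f has_derivative (\<lambda>h. 0)) (at x)"
      by (rule has_derivative_transform_within_open[of _ _ _ _ "- K"]) (use K compact_imp_closed that in auto)
    then show ?thesis using frechet_derivative_at by metis
  qed
  obtain C0 where C0: "C0 \<ge> 0" "\<And>x. norm (f x) \<le> C0" using bd[OF f K(2)] by blast
  have "\<exists>C\<ge>0. \<forall>x. norm (frechet_derivative f (at x) b) \<le> C" for b
    by (rule bd) (use smooth_on_frechet_derivative[OF f] z in auto)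
  then obtain C where C: "\<And>b. C b \<ge> 0" "\<And>b x. norm (frechet_derivative f (at x) b) \<le> C b" by metis
  define D where "D = C0 + (\<Sum>b\<in>Basis. C b)"
  have s: "(\<Sum>b\<in>Basis. C b) \<ge> 0" using C by (simp add: sum_nonneg)
  show thesis
  proof (rule that[of D])
    show "D \<ge> 0" "norm (f x) \<le> D" for x using s C0(1) C0(2)[of x] by (auto simp: D_def)
    show "norm (frechet_derivative f (at x) h) \<le> D * norm h" for x h
    proof -
      have "norm (frechet_derivative f (at x) h) = norm (\<Sum>b\<in>Basis. (h \<bullet> b) *\<^sub>R frechet_derivative f (at x) b)"
        using frechet_derivative_basis[OF smooth_on_imp_differentiable[OF f UNIV_I], of x h] by simp
      also have "\<dots> \<le> (\<Sum>b\<in>Basis. norm ((h \<bullet> b) *\<^sub>R frechet_derivative f (at x) b))" by (rule norm_sum)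
      also have "\<dots> \<le> (\<Sum>b\<in>Basis. norm h * C b)"
        by (intro sum_mono) (auto intro!: mult_mono C Basis_le_norm)
      also have "\<dots> = norm h * (\<Sum>b\<in>Basis. C b)" by (simp add: sum_distrib_left)
      also have "\<dots> \<le> norm h * D" using C0 by (intro mult_left_mono) (auto simp: D_def)
      finally show ?thesis by (simp add: mult.commute)
    qed
  qed
qed

lemma has_vector_derivative_bound:
  fixes f :: "real \<Rightarrow> 'b::real_normed_vector"
  assumes "convex S" "\<And>s. s \<in> S \<Longrightarrow> (f has_vector_derivative f' s) (at s)" "\<And>s. s \<in> S \<Longrightarrow> norm (f' s) \<le> B"
    and "a \<in> S" "b \<in> S"
  shows "norm (f a - f b) \<le> B * \<bar>a - b\<bar>"
proof -
  have "norm (f a - f b) \<le> B * norm (a - b)"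
  proof (rule differentiable_bound[where f'="\<lambda>s h. h *\<^sub>R f' s" and S=S])
    show "(f has_derivative (\<lambda>h. h *\<^sub>R f' s)) (at s within S)" if "s \<in> S" for s
      using assms(2)[OF that] has_derivative_at_withinI by (auto simp: has_vector_derivative_def)
    show "onorm (\<lambda>h. h *\<^sub>R f' s) \<le> B" if "s \<in> S" for s
      by (rule onorm_le) (use mult_right_mono[OF assms(3)[OF that] abs_ge_zero] in \<open>simp add: mult.commute\<close>)
  qed (use assms in auto)
  then show ?thesis by simp
qed

lemma bilinear_euclidean_sum:
  fixes G :: "'a::euclidean_space \<Rightarrow> 'b::euclidean_space \<Rightarrow> 'c::real_vector"
  assumes "bilinear G"
  shows "G u v = (\<Sum>a\<in>Basis. \<Sum>b\<in>Basis. ((u \<bullet> a) * (v \<bullet> b)) *\<^sub>R G a b)"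
proof -
  have l: "linear (\<lambda>u. G u v)" "linear (\<lambda>v. G u v)" for u v using assms by (auto simp: bilinear_def)
  have "G u v = G (\<Sum>a\<in>Basis. (u \<bullet> a) *\<^sub>R a) v" by (simp add: euclidean_representation)
  also have "\<dots> = (\<Sum>a\<in>Basis. (u \<bullet> a) *\<^sub>R G a v)"
    unfolding linear_sum[OF l(1)] linear_scale[OF l(1)] ..
  also have "\<dots> = (\<Sum>a\<in>Basis. (u \<bullet> a) *\<^sub>R G a (\<Sum>b\<in>Basis. (v \<bullet> b) *\<^sub>R b))" by (simp add: euclidean_representation)
  also have "\<dots> = (\<Sum>a\<in>Basis. (u \<bullet> a) *\<^sub>R (\<Sum>b\<in>Basis. (v \<bullet> b) *\<^sub>R G a b))"
    unfolding linear_sum[OF l(2)] linear_scale[OF l(2)] ..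
  finally show ?thesis by (simp add: scaleR_sum_right)
qed

text \<open>With the velocity written as \<open>\<delta>\<close> times \<open>w\<close>, the
  geodesic equation becomes the system x' = \<open>\<delta>\<close> w, w' = -
  \<open>\<delta>\<close> \<open>\<Gamma>\<close>(w, w). Small initial velocities are thus traded
  for a small vector field, to which \<open>smooth_flow\<close> applies up to time 2, with one
  \<open>\<delta>\<close> for all nearby starting points. The transverse coordinate \<open>t\<close>
  is carried along as a coordinate with derivative 0.\<close>

theorem local_geodesics:
  fixes \<Gamma> :: "'e::euclidean_space \<times> real \<Rightarrow> 'e \<Rightarrow> 'e \<Rightarrow> 'e"
  assumes U: "open U" "z0 \<in> U" and bil: "\<And>z. z \<in> U \<Longrightarrow> bilinear (\<Gamma> z)"
    and sm: "\<And>u v. smooth_on U (\<lambda>z. \<Gamma> z u v)"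
  obtains r \<delta> c d where "r > 0" "\<delta> > 0" "ball z0 r \<subseteq> U"
    and "\<And>x t v. (x, t) \<in> ball z0 r \<Longrightarrow> norm v < \<delta> \<Longrightarrow> c x t v 0 = x \<and> d x t v 0 = v"
    and "\<And>x t v s. (x, t) \<in> ball z0 r \<Longrightarrow> norm v < \<delta> \<Longrightarrow> \<bar>s\<bar> < 2 \<Longrightarrow> (c x t v s, t) \<in> U \<and>
        (c x t v has_vector_derivative d x t v s) (at s) \<and>
        (d x t v has_vector_derivative - \<Gamma> (c x t v s, t) (d x t v s) (d x t v s)) (at s)"
    and "\<And>x t. (x, t) \<in> ball z0 r \<Longrightarrow> smooth_on UNIV (\<lambda>v. c x t v 1)"
    and "\<And>x t v w. (x, t) \<in> ball z0 r \<Longrightarrow> norm v < \<delta> \<Longrightarrow> norm w < \<delta> \<Longrightarrow>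
        norm ((c x t v 1 - c x t w 1) - (v - w)) \<le> 1/2 * norm (v - w)"
proof -
  obtain R where R: "R > 0" "cball z0 R \<subseteq> U" using U open_contains_cball by blast
  obtain \<beta> :: "'e \<times> real \<Rightarrow> real" where \<beta>: "smooth_on UNIV \<beta>" and "\<And>x. 0 \<le> \<beta> x" "\<And>x. \<beta> x \<le> 1" and \<beta>': "\<And>x. dist z0 x \<le> R / 2 \<Longrightarrow> \<beta> x = 1" "\<And>x. dist z0 x \<ge> R \<Longrightarrow> \<beta> x = 0"
    by (rule smooth_cutoff[OF R(1), of z0]) blast
  have "(0::real) < 4" by simp
  then obtain \<eta> :: "'e \<Rightarrow> real" where \<eta>: "smooth_on UNIV \<eta>" and "\<And>x. 0 \<le> \<eta> x" "\<And>x. \<eta> x \<le> 1" and \<eta>': "\<And>x. dist 0 x \<le> 4 / 2 \<Longrightarrow> \<eta> x = 1" "\<And>x. dist 0 x \<ge> 4 \<Longrightarrow> \<eta> x = 0"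
    by (rule smooth_cutoff[where z="0::'e"]) blast
  \<comment> \<open>The quadratic term in \<open>w\<close> is not globally Lipschitz. Replacing
    \<open>w\<close> by \<open>\<psi> w\<close>, which is \<open>w\<close> up to norm 2 and 0 from
    norm 4 on, gives a vector field term with compact support and does not alter the equation where
    the solutions live, by \<open>wb\<close>.\<close>
  define \<psi> where "\<psi> w = \<eta> w *\<^sub>R w" for w
  have \<psi>sm: "smooth_on UNIV \<psi>" unfolding \<psi>_def by (intro smooth_on_scaleR \<eta> smooth_on_ident open_UNIV)
  define H where "H a b z = \<beta> z *\<^sub>R - \<Gamma> z a b" for a b z
  define G where "G y = (\<Sum>a\<in>Basis. \<Sum>b\<in>Basis. ((\<psi> (snd y) \<bullet> a) * (\<psi> (snd y) \<bullet> b)) *\<^sub>R H a b (fst y))" for y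
  have fst_sm: "smooth_on UNIV (fst :: ('e \<times> real) \<times> 'e \<Rightarrow> _)" and snd_sm: "smooth_on UNIV (snd :: ('e \<times> real) \<times> 'e \<Rightarrow> _)"
    by (auto intro!: smooth_on_bounded_linear_self bounded_linear_fst bounded_linear_snd)
  have "smooth_on UNIV (H a b)" for a b
    unfolding H_def by (rule smooth_on_cutoff_scaleR[OF \<beta> \<beta>'(2) U(1) R(2)]) (auto intro!: smooth_on_uminus sm U)
  then have "smooth_on UNIV (\<lambda>y :: ('e \<times> real) \<times> 'e. H a b (fst y))" for a b
    by (rule smooth_on_compose[OF open_UNIV open_UNIV _ fst_sm]) auto
  moreover have "smooth_on UNIV (\<lambda>y :: ('e \<times> real) \<times> 'e. \<psi> (snd y))"
    by (rule smooth_on_compose[OF open_UNIV open_UNIV \<psi>sm snd_sm]) auto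
  ultimately have Gsm: "smooth_on UNIV G"
    unfolding G_def
    by (intro smooth_on_sum smooth_on_scaleR smooth_on_mult smooth_on_inner smooth_on_const open_UNIV)
  have G_eq: "G (z, w) = - \<Gamma> z w w" if "dist z0 z \<le> R / 2" "norm w \<le> 2" for z w
  proof -
    have "z \<in> U" using that R by (auto simp: subset_eq)
    then show ?thesis
      using that bilinear_euclidean_sum[OF bil, of z w w] by (simp add: G_def H_def \<psi>_def \<beta>'(1) \<eta>'(1) sum_negf)
  qed
  have "G y = 0" if "y \<notin> cball z0 R \<times> cball 0 4" for y
    using that \<beta>'(2)[of "fst y"] \<eta>'(2)[of "snd y"] by (cases y) (auto simp: G_def H_def \<psi>_def)
  then obtain C where C: "C \<ge> 0" "\<And>y. norm (G y) \<le> C" "\<And>y h. norm (frechet_derivative G (at y) h) \<le> C * norm h"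
    using compact_support_bounds[OF Gsm compact_Times[OF compact_cball compact_cball]] by metis
  have "onorm (frechet_derivative G (at y)) \<le> C" for y using C(3) by (rule onorm_le)
  then have GL: "norm (G y - G y') \<le> C * norm (y - y')" for y y'
    by (intro differentiable_bound[where S=UNIV and f'="\<lambda>x. frechet_derivative G (at x)"])
      (use smooth_on_has_derivative[OF Gsm] in auto)
  \<comment> \<open>The first bound makes the derivative of the vector field \<open>f\<close> at
    most 1/12 in norm; the second limits the displacement up to time 2, which is at most 4
    \<open>\<delta>\<close>, to \<open>R / 4\<close>.\<close>
  define \<delta> where "\<delta> = min (1 / (12 * (1 + C))) (R / 16)"
  have \<delta>: "\<delta> > 0" "\<delta> * (1 + C) \<le> 1 / 12" "\<delta> \<le> R / 16"
    using C R by (auto simp: \<delta>_def min_def field_simps)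
  have \<delta>C: "\<delta> * C \<le> 1/12" using \<delta> C by (simp add: algebra_simps)
  define f where "f y = \<delta> *\<^sub>R ((snd y, 0::real), G y)" for y :: "('e \<times> real) \<times> 'e"
  have f: "smooth_on UNIV f"
    unfolding f_def
    by (intro smooth_on_scaleR smooth_on_Pair Gsm snd_sm smooth_on_const open_UNIV)
  have "norm (frechet_derivative f (at y) h) \<le> 1/12 * norm h" for y h
  proof -
    have "(f has_derivative (\<lambda>h. \<delta> *\<^sub>R ((snd h, 0), frechet_derivative G (at y) h))) (at y)"
      unfolding f_def
      by (intro has_derivative_scaleR_right has_derivative_Pair has_derivative_snd has_derivative_const
          has_derivative_ident smooth_on_has_derivative[OF Gsm] UNIV_I)
    from fun_cong[OF frechet_derivative_at[OF this], of h]
    have "norm (frechet_derivative f (at y) h) = norm (\<delta> *\<^sub>R ((snd h, 0::real), frechet_derivative G (at y) h))"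
      by (rule arg_cong[OF sym])
    also have "\<dots> = \<delta> * norm ((snd h, 0::real), frechet_derivative G (at y) h)"
      unfolding norm_scaleR using \<delta> by simp
    also have "\<dots> \<le> \<delta> * (norm h + C * norm h)"
    proof (intro mult_left_mono order_trans[OF norm_Pair_le add_mono[OF _ C(3)]])
      show "norm (snd h, 0::real) \<le> norm h"
        using norm_snd_le[of "snd h" "fst h"] by (simp add: norm_Pair)
    qed (use \<delta> in auto)
    finally have "norm (frechet_derivative f (at y) h) \<le> \<delta> * ((1 + C) * norm h)"
      by (simp add: algebra_simps)
    also have "\<dots> = \<delta> * (1 + C) * norm h" by simp
    also have "\<dots> \<le> 1/12 * norm h" by (intro mult_right_mono \<delta>) auto
    finally show ?thesis .
  qed
  from smooth_flow[OF f this] obtain \<phi> :: "('e \<times> real) \<times> 'e \<Rightarrow> real \<Rightarrow> ('e \<times> real) \<times> 'e" where \<phi>0: "\<And>p. \<phi> p 0 = p"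
    and \<phi>': "\<And>p s. \<bar>s\<bar> < 2 \<Longrightarrow> (\<phi> p has_vector_derivative f (\<phi> p s)) (at s)"
    and \<phi>sm: "\<And>s. smooth_on UNIV (\<lambda>p. \<phi> p s)"
    and \<phi>L: "\<And>p q s. norm (\<phi> p s - \<phi> q s) \<le> 2 * norm (p - q)"
    by blast
  define P where "P x t v = ((x, t), v /\<^sub>R \<delta>)" for x :: 'e and t :: real and v :: 'e
  define c where "c x t v s = fst (fst (\<phi> (P x t v) s))" for x t v s
  define w where "w x t v s = snd (\<phi> (P x t v) s)" for x t v s
  define d where "d x t v s = \<delta> *\<^sub>R w x t v s" for x t v s
  note fstd = bounded_linear.has_vector_derivative[OF bounded_linear_fst]
    and sndd = bounded_linear.has_vector_derivative[OF bounded_linear_snd]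
  have c': "(c x t v has_vector_derivative d x t v s) (at s)" if "\<bar>s\<bar> < 2" for x t v s
    using fstd[OF fstd[OF \<phi>'[OF that, of "P x t v"]]] unfolding c_def[abs_def] by (simp add: f_def d_def w_def)
  have w': "(w x t v has_vector_derivative \<delta> *\<^sub>R G (\<phi> (P x t v) s)) (at s)" if "\<bar>s\<bar> < 2" for x t v s
    using sndd[OF \<phi>'[OF that, of "P x t v"]] unfolding w_def[abs_def] by (simp add: f_def)
  have t': "((\<lambda>s. snd (fst (\<phi> (P x t v) s))) has_vector_derivative 0) (at s)" if "\<bar>s\<bar> < 2" for x t v s
    using sndd[OF fstd[OF \<phi>'[OF that, of "P x t v"]]] by (simp add: f_def)
  have init: "c x t v 0 = x" "w x t v 0 = v /\<^sub>R \<delta>" "d x t v 0 = v" for x t v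
    using \<delta> by (auto simp: c_def w_def d_def \<phi>0 P_def)
  have cvx: "convex {-2<..<2::real}" by simp
  have tconst: "snd (fst (\<phi> (P x t v) s)) = t" if "\<bar>s\<bar> < 2" for x t v s
  proof -
    have "norm (snd (fst (\<phi> (P x t v) s)) - snd (fst (\<phi> (P x t v) 0))) \<le> 0 * \<bar>s - 0\<bar>"
      by (rule has_vector_derivative_bound[OF cvx t']) (use that in auto)
    then show ?thesis by (simp add: \<phi>0 P_def)
  qed
  have \<phi>_eq: "\<phi> (P x t v) s = ((c x t v s, t), w x t v s)" if "\<bar>s\<bar> < 2" for x t v s
    using tconst[OF that, of x t v] by (simp add: c_def w_def prod_eq_iff)
  have wb: "norm (w x t v s) \<le> 2" if s: "\<bar>s\<bar> < 2" and v: "norm v < \<delta>" for x t v s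
  proof -
    have "norm (w x t v s - w x t v 0) \<le> 1/12 * \<bar>s - 0\<bar>"
    proof (rule has_vector_derivative_bound[OF cvx w'])
      fix s show "norm (\<delta> *\<^sub>R G (\<phi> (P x t v) s)) \<le> 1/12"
        using order_trans[OF mult_left_mono[OF C(2)[of "\<phi> (P x t v) s"] less_imp_le[OF \<delta>(1)]] \<delta>C] \<delta>(1)
        by simp
    qed (use s in auto)
    moreover have "norm (w x t v 0) \<le> 1" using v \<delta> by (simp add: init field_simps)
    ultimately show ?thesis
      using norm_triangle_sub[of "w x t v s" "w x t v 0"] s by auto
  qed
  have cb: "norm (c x t v s - x) \<le> R / 4" if s: "\<bar>s\<bar> < 2" and v: "norm v < \<delta>" for x t v s
  proof -
    have "norm (c x t v s - c x t v 0) \<le> 2 * \<delta> * \<bar>s - 0\<bar>"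
    proof (rule has_vector_derivative_bound[OF cvx c'])
      fix s :: real assume "s \<in> {-2<..<2}"
      then show "norm (d x t v s) \<le> 2 * \<delta>"
        using wb[OF _ v, of s x t] \<delta> by (auto simp: d_def)
    qed (use s in auto)
    also have "\<dots> \<le> 2 * \<delta> * 2" using s \<delta> by (intro mult_left_mono) auto
    finally show ?thesis using \<delta> by (simp add: init)
  qed
  \<comment> \<open>Distance \<open>R / 4\<close> at the start and displacement \<open>R / 4\<close>
    keep the curve within \<open>R / 2\<close> of \<open>z0\<close>, where the cutoff
    \<open>\<beta>\<close> is 1.\<close>
  have cR: "dist z0 (c x t v s, t) \<le> R / 2" if s: "\<bar>s\<bar> < 2" and v: "norm v < \<delta>" and xt: "(x, t) \<in> ball z0 (R/4)" for x t v s
  proof -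
    have "dist (x, t) (c x t v s, t) \<le> R / 4"
      using cb[OF s v, of x t] by (simp add: dist_Pair_Pair dist_norm norm_minus_commute)
    then show ?thesis using xt dist_triangle[of z0 "(c x t v s, t)" "(x, t)"] by simp
  qed
  show thesis
  proof (rule that[of "R/4" \<delta> c d])
    show "ball z0 (R/4) \<subseteq> U" using R by (auto simp: subset_eq)
    fix x t assume xt: "(x, t) \<in> ball z0 (R/4)"
    show "smooth_on UNIV (\<lambda>v. c x t v 1)"
      unfolding c_def P_def
      by (intro smooth_on_bounded_linear[OF bounded_linear_fst] open_UNIV smooth_on_compose[OF _ _ \<phi>sm]
          smooth_on_Pair smooth_on_const smooth_on_scaleR smooth_on_ident subset_UNIV)
    show "(c x t v s, t) \<in> U \<and> (c x t v has_vector_derivative d x t v s) (at s) \<and>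
        (d x t v has_vector_derivative - \<Gamma> (c x t v s, t) (d x t v s) (d x t v s)) (at s)"
      if v: "norm v < \<delta>" and s: "\<bar>s\<bar> < 2" for v s
    proof (intro conjI c' s)
      note b = cR[OF s v xt]
      show U: "(c x t v s, t) \<in> U" using b R by (auto simp: subset_eq)
      have "\<delta> *\<^sub>R (\<delta> *\<^sub>R G (\<phi> (P x t v) s)) = - \<Gamma> (c x t v s, t) (d x t v s) (d x t v s)"
        using G_eq[OF b wb[OF s v, of x t]] by (simp add: \<phi>_eq[OF s] d_def bilinear_lmul[OF bil[OF U]] bilinear_rmul[OF bil[OF U]])
      moreover have "(d x t v has_vector_derivative \<delta> *\<^sub>R (\<delta> *\<^sub>R G (\<phi> (P x t v) s))) (at s)"
        unfolding d_def[abs_def]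
        by (rule bounded_linear.has_vector_derivative[OF bounded_linear_scaleR_right w'[OF s]])
      ultimately show "(d x t v has_vector_derivative - \<Gamma> (c x t v s, t) (d x t v s) (d x t v s)) (at s)" by simp
    qed
    show "norm ((c x t v 1 - c x t u 1) - (v - u)) \<le> 1/2 * norm (v - u)" for v u
    proof -
      have P: "norm (P x t v - P x t u) = norm (v - u) / \<delta>"
      proof -
        have "P x t v - P x t u = (0, (v - u) /\<^sub>R \<delta>)"
          by (simp add: P_def scaleR_diff_right zero_prod_def)
        then have "norm (P x t v - P x t u) = \<bar>inverse \<delta>\<bar> * norm (v - u)"
          by (simp only: norm_Pair1 norm_scaleR)
        then show ?thesis using \<delta> by (simp add: field_simps)
      qed
      \<comment> \<open>The deviation of the endpoint map from translation by the initial velocity.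
        Its time derivative is controlled by the drift of \<open>w\<close>, and since the flow has
        Lipschitz constant 2 and \<open>\<delta> * C \<le> 1/12\<close>, the factor is at most 1/6,
        well below 1/2.\<close>
      let ?q = "\<lambda>s. (c x t v s - c x t u s) - s *\<^sub>R (v - u)"
      have "norm (?q 1 - ?q 0) \<le> 1/2 * norm (v - u) * \<bar>1 - 0\<bar>"
      proof (rule has_vector_derivative_bound[OF convex_closed_interval[of 0 1]])
        fix s :: real assume s: "s \<in> {0..1}"
        then have s2: "\<bar>s\<bar> < 2" by auto
        show "(?q has_vector_derivative (d x t v s - d x t u s) - (v - u)) (at s)"
          by (intro has_vector_derivative_diff c' s2) (auto intro!: derivative_eq_intros)
        have "norm ((w x t v s - w x t u s) - (w x t v 0 - w x t u 0)) \<le> \<delta> * (C * (2 * (norm (v - u) / \<delta>))) * \<bar>s - 0\<bar>"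
        proof (rule has_vector_derivative_bound[OF convex_closed_interval[of 0 1]])
          fix s :: real assume "s \<in> {0..1}"
          then have s2: "\<bar>s\<bar> < 2" by auto
          show "((\<lambda>s. w x t v s - w x t u s) has_vector_derivative \<delta> *\<^sub>R G (\<phi> (P x t v) s) - \<delta> *\<^sub>R G (\<phi> (P x t u) s)) (at s)"
            by (intro has_vector_derivative_diff w' s2)
          have "norm (\<delta> *\<^sub>R G (\<phi> (P x t v) s) - \<delta> *\<^sub>R G (\<phi> (P x t u) s)) = \<delta> * norm (G (\<phi> (P x t v) s) - G (\<phi> (P x t u) s))"
            using \<delta> by (simp flip: scaleR_diff_right)
          also have "\<dots> \<le> \<delta> * (C * (2 * (norm (v - u) / \<delta>)))"
            using order_trans[OF GL mult_left_mono[OF \<phi>L C(1)], of "P x t v" s "P x t u"] \<delta> unfolding P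
            by (intro mult_left_mono) auto
          finally show "norm (\<delta> *\<^sub>R G (\<phi> (P x t v) s) - \<delta> *\<^sub>R G (\<phi> (P x t u) s)) \<le> \<delta> * (C * (2 * (norm (v - u) / \<delta>)))" .
        qed (use s in auto)
        also have "\<dots> = 2 * C * norm (v - u) * \<bar>s\<bar>"
          using \<delta>(1) by simp
        also have "\<dots> \<le> 2 * C * norm (v - u) * 1"
          by (rule mult_left_mono) (use s C(1) in auto)
        finally have W: "norm ((w x t v s - w x t u s) - (w x t v 0 - w x t u 0)) \<le> 2 * C * norm (v - u)" by simp
        have "(d x t v s - d x t u s) - (v - u) = \<delta> *\<^sub>R ((w x t v s - w x t u s) - (w x t v 0 - w x t u 0))"
          using \<delta> by (simp add: d_def init scaleR_diff_right)
        then have "norm ((d x t v s - d x t u s) - (v - u)) \<le> \<delta> * (2 * C * norm (v - u))"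
          using W \<delta> by (simp add: mult_left_mono)
        also have "\<dots> = 2 * (\<delta> * C) * norm (v - u)" by simp
        also have "\<dots> \<le> 1/2 * norm (v - u)"
          using \<delta>C by (intro mult_right_mono) auto
        finally show "norm ((d x t v s - d x t u s) - (v - u)) \<le> 1/2 * norm (v - u)" .
      qed auto
      then show ?thesis by (simp add: init)
    qed
  qed (use R \<delta> init in auto)
qed

section \<open>Charts and transition maps\<close>

locale smooth_atlas_on =
  fixes X :: "('i, 'a, 'e::euclidean_space) atlas"
  assumes atlas: "smooth_atlas X"
begin

lemma inj_coord: "i \<in> indices X \<Longrightarrow> inj_on (coord X i) (patch X i)"
  using atlas by (simp add: smooth_atlas_def)

lemma patch_subset: "i \<in> indices X \<Longrightarrow> patch X i \<subseteq> points X"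
  using atlas by (auto simp: smooth_atlas_def)

lemma points_chart: "p \<in> points X \<Longrightarrow> \<exists>i\<in>indices X. p \<in> patch X i"
  using atlas by (auto simp: smooth_atlas_def)

lemma param_coord [simp]: "i \<in> indices X \<Longrightarrow> p \<in> patch X i \<Longrightarrow> param X i (coord X i p) = p"
  by (simp add: param_def inj_coord)

lemma coord_param [simp]: "x \<in> coord X i ` patch X i \<Longrightarrow> coord X i (param X i x) = x"
  by (simp add: param_def f_inv_into_f)

lemma param_in_patch [simp]: "x \<in> coord X i ` patch X i \<Longrightarrow> param X i x \<in> patch X i"
  by (simp add: param_def inv_into_into)

lemma open_overlap: "i \<in> indices X \<Longrightarrow> j \<in> indices X \<Longrightarrow> open (coord X i ` (patch X i \<inter> patch X j))"
  using atlas unfolding smooth_atlas_def smoothly_compatible_def Let_def by blast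

lemma open_chart: "i \<in> indices X \<Longrightarrow> open (coord X i ` patch X i)"
  using open_overlap[of i i] by simp

lemma overlap_iff:
  "i \<in> indices X \<Longrightarrow> x \<in> coord X i ` (patch X i \<inter> W) \<longleftrightarrow> x \<in> coord X i ` patch X i \<and> param X i x \<in> W"
  by (auto simp: image_iff)

lemma smooth_transition:
  "i \<in> indices X \<Longrightarrow> j \<in> indices X \<Longrightarrow> smooth_on (coord X i ` (patch X i \<inter> patch X j)) (coord X j \<circ> param X i)"
  using atlas unfolding smooth_atlas_def smoothly_compatible_def Let_def by blast

lemma transition_has_derivative:
  assumes "i \<in> charts_at X p" "j \<in> charts_at X p"
  shows "(coord X j \<circ> param X i has_derivative transition_deriv X i j p) (at (coord X i p))"
  unfolding transition_deriv_def
  by (rule smooth_on_has_derivative[OF smooth_transition]) (use assms in \<open>auto simp: charts_at_def\<close>)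

lemma linear_transition_deriv:
  "i \<in> charts_at X p \<Longrightarrow> j \<in> charts_at X p \<Longrightarrow> linear (transition_deriv X i j p)"
  using transition_has_derivative has_derivative_linear by blast

lemma transition_deriv_compose:
  assumes i: "i \<in> charts_at X p" and j: "j \<in> charts_at X p" and k: "k \<in> charts_at X p"
  shows "transition_deriv X j k p (transition_deriv X i j p u) = transition_deriv X i k p u"
proof -
  have idx: "i \<in> indices X" "j \<in> indices X" "k \<in> indices X" "p \<in> patch X i" "p \<in> patch X j" "p \<in> patch X k"
    using assms by (auto simp: charts_at_def)
  have "coord X j p = (coord X j \<circ> param X i) (coord X i p)" using idx by simp
  with transition_has_derivative[OF j k]
  have "((coord X k \<circ> param X j) \<circ> (coord X j \<circ> param X i) has_derivative
      transition_deriv X j k p \<circ> transition_deriv X i j p) (at (coord X i p))"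
    by (intro diff_chain_at transition_has_derivative[OF i j]) simp
  then have "(coord X k \<circ> param X i has_derivative transition_deriv X j k p \<circ> transition_deriv X i j p) (at (coord X i p))"
    by (rule has_derivative_transform_within_open[OF _ open_overlap[OF idx(1,2)]])
      (use idx in \<open>auto simp: overlap_iff\<close>)
  from has_derivative_unique[OF this transition_has_derivative[OF i k]] show ?thesis
    by (simp add: fun_eq_iff)
qed

lemma transition_deriv_same:
  assumes i: "i \<in> charts_at X p"
  shows "transition_deriv X i i p u = u"
proof -
  have idx: "i \<in> indices X" "p \<in> patch X i" using assms by (auto simp: charts_at_def)
  have "((\<lambda>x. x) has_derivative (\<lambda>x. x)) (at (coord X i p))" by simp
  then have "(coord X i \<circ> param X i has_derivative (\<lambda>x. x)) (at (coord X i p))"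
    by (rule has_derivative_transform_within_open[OF _ open_chart[OF idx(1)]]) (use idx in auto)
  from has_derivative_unique[OF this transition_has_derivative[OF i i]] show ?thesis
    by (simp add: fun_eq_iff)
qed

lemma transition_deriv_inverse:
  "i \<in> charts_at X p \<Longrightarrow> j \<in> charts_at X p \<Longrightarrow> transition_deriv X j i p (transition_deriv X i j p u) = u"
  by (simp add: transition_deriv_compose transition_deriv_same)

lemma openin_iff:
  "openin (atlas_topology X) W \<longleftrightarrow> W \<subseteq> points X \<and> (\<forall>i\<in>indices X. open (coord X i ` (W \<inter> patch X i)))"
  by (rule openin_atlas_topology[OF atlas])

lemma topspace_eq: "topspace (atlas_topology X) = points X"
  by (rule topspace_atlas_topology[OF atlas])

lemma openin_coord_image: "openin (atlas_topology X) W \<Longrightarrow> i \<in> indices X \<Longrightarrow> open (coord X i ` (patch X i \<inter> W))"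
  by (simp add: openin_iff Int_commute)

lemma openin_param_image:
  assumes i: "i \<in> indices X" and V: "open V" "V \<subseteq> coord X i ` patch X i"
  shows "openin (atlas_topology X) (param X i ` V)"
  unfolding openin_iff
proof (intro conjI ballI)
  show "param X i ` V \<subseteq> points X"
    using V patch_subset[OF i] param_in_patch by blast
  fix j assume j: "j \<in> indices X"
  have "coord X j ` (param X i ` V \<inter> patch X j) =
      coord X j ` (patch X j \<inter> patch X i) \<inter> (coord X i \<circ> param X j) -` V"
  proof (intro set_eqI iffI)
    fix y assume "y \<in> coord X j ` (param X i ` V \<inter> patch X j)"
    then obtain x where x: "x \<in> V" "param X i x \<in> patch X j" "y = coord X j (param X i x)" by auto
    then have "x \<in> coord X i ` patch X i" using V by auto
    with x j i show "y \<in> coord X j ` (patch X j \<inter> patch X i) \<inter> (coord X i \<circ> param X j) -` V" by auto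
  next
    fix y assume y: "y \<in> coord X j ` (patch X j \<inter> patch X i) \<inter> (coord X i \<circ> param X j) -` V"
    then obtain p where p: "p \<in> patch X j" "p \<in> patch X i" "y = coord X j p" by auto
    then have "coord X i p \<in> V" using y j by simp
    then have "p \<in> param X i ` V" using p i by (metis image_eqI param_coord)
    then show "y \<in> coord X j ` (param X i ` V \<inter> patch X j)" using p by auto
  qed
  moreover have "open (coord X j ` (patch X j \<inter> patch X i) \<inter> (coord X i \<circ> param X j) -` V)"
    using continuous_open_preimage[OF smooth_on_imp_continuous_on[OF smooth_transition[OF j i]] open_overlap[OF j i] V(1)] .
  ultimately show "open (coord X j ` (param X i ` V \<inter> patch X j))" by simp
qed

lemma openin_patch: "i \<in> indices X \<Longrightarrow> openin (atlas_topology X) (patch X i)"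
proof -
  assume i: "i \<in> indices X"
  have "param X i ` coord X i ` patch X i = patch X i"
    using i by (force simp: image_image)
  then show ?thesis using openin_param_image[OF i open_chart[OF i]] by simp
qed

text \<open>Continuity is only given in the chart \<open>i\<close>. The open set \<open>W\<close> is
  therefore read in that chart, and injectivity of the chart brings the conclusion back from
  coordinates to the curve.\<close>

lemma curve_near:
  fixes \<gamma> :: "real \<Rightarrow> 'a"
  assumes i: "i \<in> indices X" and d: "d > 0" "\<And>s. \<bar>s - t\<bar> < d \<Longrightarrow> \<gamma> s \<in> patch X i"
    and cont: "isCont (\<lambda>s. coord X i (\<gamma> s)) t" and W: "openin (atlas_topology X) W" "\<gamma> t \<in> W"
  obtains \<delta> where "\<delta> > 0" "\<delta> \<le> d" "\<forall>s. \<bar>s - t\<bar> < \<delta> \<longrightarrow> \<gamma> s \<in> W"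
proof -
  let ?O = "coord X i ` (patch X i \<inter> W)"
  have "open ?O" "coord X i (\<gamma> t) \<in> ?O"
    using openin_coord_image[OF W(1) i] W(2) d(1) d(2)[of t] by auto
  then have "\<forall>\<^sub>F s in at t. coord X i (\<gamma> s) \<in> ?O"
    using cont by (auto simp: isCont_def intro: topological_tendstoD)
  then obtain e where e: "e > 0" "\<And>s. s \<noteq> t \<Longrightarrow> dist s t < e \<Longrightarrow> coord X i (\<gamma> s) \<in> ?O"
    unfolding eventually_at by auto
  show thesis
  proof (rule that[of "min d e"], safe)
    fix s assume s: "\<bar>s - t\<bar> < min d e"
    show "\<gamma> s \<in> W"
    proof (cases "s = t")
      case False
      then have "coord X i (\<gamma> s) \<in> ?O" using e s by (auto simp: dist_real_def)
      then obtain p where p: "p \<in> patch X i" "p \<in> W" "coord X i (\<gamma> s) = coord X i p" by auto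
      have "\<gamma> s \<in> patch X i" using d(2) s by auto
      then have "\<gamma> s = p" using p inj_coord[OF i] by (auto simp: inj_on_def)
      then show ?thesis using p by simp
    qed (use W in simp)
  qed (use d e in auto)
qed

lemma continuous_map_curve:
  fixes \<gamma> :: "real \<Rightarrow> 'a"
  assumes "\<And>t. \<exists>i\<in>indices X. \<exists>d>0. (\<forall>s. \<bar>s - t\<bar> < d \<longrightarrow> \<gamma> s \<in> patch X i) \<and> isCont (\<lambda>s. coord X i (\<gamma> s)) t"
  shows "continuous_map euclideanreal (atlas_topology X) \<gamma>"
  unfolding continuous_map_def
proof (intro conjI allI impI)
  show "\<gamma> \<in> topspace euclideanreal \<rightarrow> topspace (atlas_topology X)"
  proof
    fix t
    obtain i d where "i \<in> indices X" "d > 0" "\<And>s. \<bar>s - t\<bar> < d \<Longrightarrow> \<gamma> s \<in> patch X i" using assms by meson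
    then show "\<gamma> t \<in> topspace (atlas_topology X)" using patch_subset topspace_eq by force
  qed
  fix W assume W: "openin (atlas_topology X) W"
  have "\<exists>e>0. \<forall>s. dist s t < e \<longrightarrow> \<gamma> s \<in> W" if tW: "\<gamma> t \<in> W" for t
  proof -
    obtain i d where id: "i \<in> indices X" "d > 0" "\<And>s. \<bar>s - t\<bar> < d \<Longrightarrow> \<gamma> s \<in> patch X i"
      "isCont (\<lambda>s. coord X i (\<gamma> s)) t" using assms by meson
    obtain \<delta> where "\<delta> > 0" "\<delta> \<le> d" "\<forall>s. \<bar>s - t\<bar> < \<delta> \<longrightarrow> \<gamma> s \<in> W"
      by (rule curve_near[OF id W tW]) blast
    then show ?thesis by (auto simp: dist_real_def)
  qed
  then show "openin euclideanreal {t \<in> topspace euclideanreal. \<gamma> t \<in> W}"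
    by (simp add: open_dist)
qed

lemma continuous_map_near:
  assumes "continuous_map euclideanreal (atlas_topology X) \<gamma>" "openin (atlas_topology X) W" "\<gamma> t \<in> W"
  obtains d where "d > 0" "\<forall>s. \<bar>s - t\<bar> < d \<longrightarrow> \<gamma> s \<in> W"
proof -
  have "open {s. \<gamma> s \<in> W}"
    using assms(1,2) by (auto simp: continuous_map_def)
  then show thesis using assms(3) that unfolding open_dist by (auto simp: dist_real_def)
qed

end

section \<open>Riemannian metrics in a chart\<close>

abbreviation dd :: "('a::real_normed_vector \<Rightarrow> 'b::real_normed_vector) \<Rightarrow> 'a \<Rightarrow> 'a \<Rightarrow> 'b" where
  "dd f x \<equiv> frechet_derivative f (at x)"

lemma dd_eq: "(f has_derivative f') (at x) \<Longrightarrow> dd f x = f'"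
  using frechet_derivative_at by metis

lemma bilinear_dd:
  fixes H :: "'q::real_normed_vector \<Rightarrow> 'e::euclidean_space \<Rightarrow> 'f::euclidean_space \<Rightarrow> 'c::real_normed_vector"
  assumes D: "open D" "z \<in> D" and bil: "\<And>q. q \<in> D \<Longrightarrow> bilinear (H q)"
    and sm: "\<And>u v. smooth_on D (\<lambda>q. H q u v)"
  shows "bilinear (\<lambda>u v. dd (\<lambda>q. H q u v) z k)"
proof -
  note d = smooth_on_has_derivative[OF sm D(2)]
  have add1: "dd (\<lambda>q. H q (u + u') v) z = (\<lambda>k. dd (\<lambda>q. H q u v) z k + dd (\<lambda>q. H q u' v) z k)" for u u' v
    by (rule dd_eq, rule has_derivative_transform_within_open[OF has_derivative_add[OF d d] D])
      (simp add: bilinear_ladd[OF bil])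
  have add2: "dd (\<lambda>q. H q u (v + v')) z = (\<lambda>k. dd (\<lambda>q. H q u v) z k + dd (\<lambda>q. H q u v') z k)" for u v v'
    by (rule dd_eq, rule has_derivative_transform_within_open[OF has_derivative_add[OF d d] D])
      (simp add: bilinear_radd[OF bil])
  have sc1: "dd (\<lambda>q. H q (c *\<^sub>R u) v) z = (\<lambda>k. c *\<^sub>R dd (\<lambda>q. H q u v) z k)" for c u v
    by (rule dd_eq, rule has_derivative_transform_within_open[OF has_derivative_scaleR_right[OF d] D])
      (simp add: bilinear_lmul[OF bil])
  have sc2: "dd (\<lambda>q. H q u (c *\<^sub>R v)) z = (\<lambda>k. c *\<^sub>R dd (\<lambda>q. H q u v) z k)" for c u v
    by (rule dd_eq, rule has_derivative_transform_within_open[OF has_derivative_scaleR_right[OF d] D])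
      (simp add: bilinear_rmul[OF bil])
  show ?thesis
    unfolding bilinear_def by (auto intro!: linearI simp: add1 add2 sc1 sc2)
qed

text \<open>Expanding both arguments in the basis leaves scalar coefficients times \<open>H\<close>
  in fixed directions, to which the ordinary product and chain rules apply; the sums are then
  reassembled by bilinearity of the derivative of \<open>H\<close>.\<close>

lemma has_derivative_bilinear_field:
  fixes H :: "'q::real_normed_vector \<Rightarrow> 'e::euclidean_space \<Rightarrow> 'f::euclidean_space \<Rightarrow> 'c::real_normed_vector"
  assumes D: "open D" "\<phi> x \<in> D" and bil: "\<And>q. q \<in> D \<Longrightarrow> bilinear (H q)"
    and sm: "\<And>u v. smooth_on D (\<lambda>q. H q u v)"
    and \<phi>: "(\<phi> has_derivative \<phi>') (at x)" and a: "(a has_derivative a') (at x)" and b: "(b has_derivative b') (at x)"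
  shows "((\<lambda>y. H (\<phi> y) (a y) (b y)) has_derivative
     (\<lambda>h. dd (\<lambda>q. H q (a x) (b x)) (\<phi> x) (\<phi>' h) + H (\<phi> x) (a' h) (b x) + H (\<phi> x) (a x) (b' h))) (at x)"
proof -
  let ?F = "\<lambda>y. \<Sum>i\<in>Basis. \<Sum>j\<in>Basis. ((a y \<bullet> i) * (b y \<bullet> j)) *\<^sub>R H (\<phi> y) i j"
  let ?F' = "\<lambda>h. \<Sum>i\<in>Basis. \<Sum>j\<in>Basis. ((a x \<bullet> i) * (b x \<bullet> j)) *\<^sub>R dd (\<lambda>q. H q i j) (\<phi> x) (\<phi>' h) +
     ((a x \<bullet> i) * (b' h \<bullet> j) + (a' h \<bullet> i) * (b x \<bullet> j)) *\<^sub>R H (\<phi> x) i j"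
  have "((\<lambda>y. H (\<phi> y) i j) has_derivative (\<lambda>h. dd (\<lambda>q. H q i j) (\<phi> x) (\<phi>' h))) (at x)" for i j
    by (rule has_derivative_compose[OF \<phi> smooth_on_has_derivative[OF sm D(2)]])
  note H' = this
  have F: "(?F has_derivative ?F') (at x)"
    by (intro H' has_derivative_sum has_derivative_scaleR has_derivative_mult has_derivative_inner_left a b)
  have "\<forall>\<^sub>F y in at x. \<phi> y \<in> D"
    using has_derivative_continuous[OF \<phi>] D unfolding isCont_def by (rule topological_tendstoD)
  then have "\<forall>\<^sub>F y in at x. ?F y = H (\<phi> y) (a y) (b y)"
    by eventually_elim (rule bilinear_euclidean_sum[OF bil, symmetric])
  then have 1: "((\<lambda>y. H (\<phi> y) (a y) (b y)) has_derivative ?F') (at x)"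
    by (rule has_derivative_transform_eventually[OF F])
      (rule bilinear_euclidean_sum[OF bil[OF D(2)], symmetric], rule UNIV_I)
  have "?F' h = dd (\<lambda>q. H q (a x) (b x)) (\<phi> x) (\<phi>' h) + H (\<phi> x) (a' h) (b x) + H (\<phi> x) (a x) (b' h)" for h
    using bilinear_euclidean_sum[OF bilinear_dd[OF D bil sm], of "a x" "b x" "\<phi>' h"]
    unfolding bilinear_euclidean_sum[OF bil[OF D(2)], of "a' h" "b x"] bilinear_euclidean_sum[OF bil[OF D(2)], of "a x" "b' h"]
    by (simp add: sum.distrib scaleR_add_left)
  with 1 show ?thesis by simp
qed

lemma has_derivative_linear_field:
  fixes A :: "'p::real_normed_vector \<Rightarrow> 'e::euclidean_space \<Rightarrow> 'c::real_normed_vector"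
  assumes D: "open D" "x \<in> D" and lin: "\<And>q. q \<in> D \<Longrightarrow> linear (A q)"
    and sm: "\<And>u. smooth_on D (\<lambda>q. A q u)" and a: "(a has_derivative a') (at x)"
  shows "((\<lambda>y. A y (a y)) has_derivative (\<lambda>h. dd (\<lambda>q. A q (a x)) x h + A x (a' h))) (at x)"
proof -
  \<comment> \<open>A dummy scalar as second argument turns the linear field into a bilinear
    one.\<close>
  let ?H = "\<lambda>q u (v::real). v *\<^sub>R A q u"
  have "bilinear (?H q)" if "q \<in> D" for q
    using lin[OF that] unfolding bilinear_def
    by (auto intro!: linearI simp: linear_add linear_scale algebra_simps)
  from has_derivative_bilinear_field[where D=D and H="?H" and \<phi>="\<lambda>x. x" and x=x and \<phi>'="\<lambda>h. h"
      and a=a and a'=a' and b="\<lambda>_. 1" and b'="\<lambda>_. 0", OF D(1) _ this]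
  show ?thesis
    using D a by (simp add: smooth_on_bounded_linear[OF bounded_linear_scaleR_right] sm)
qed

section \<open>Riesz representatives depending smoothly on parameters\<close>

lemma linear_injective_inverse:
  fixes L :: "'e::euclidean_space \<Rightarrow> 'e"
  assumes L: "linear L" "\<And>u. L u = 0 \<Longrightarrow> u = 0"
  obtains N where "linear N" "\<And>u. N (L u) = u" "\<And>u. L (N u) = u"
proof -
  have "inj L" using L by (simp add: linear_injective_0)
  then obtain N where "linear N" "\<forall>u. N (L u) = u" "\<forall>u. L (N u) = u"
    using linear_injective_isomorphism[OF L(1)] by blast
  then show thesis using that by blast
qed

lemma smooth_on_solve_injective:
  fixes L :: "'p::real_normed_vector \<Rightarrow> 'e::euclidean_space \<Rightarrow> 'e"
  assumes W: "open W" and L: "\<And>p. p \<in> W \<Longrightarrow> linear (L p)" "\<And>p u. p \<in> W \<Longrightarrow> L p u = 0 \<Longrightarrow> u = 0"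
    and sm: "\<And>u. smooth_on W (\<lambda>p. L p u)" "smooth_on W b" and w: "\<And>p. p \<in> W \<Longrightarrow> L p (w p) = b p"
  shows "smooth_on W w"
proof (rule smooth_on_linear_solve[where A="\<lambda>p. Blinfun (L p)" and b=b])
  show "smooth_on W (\<lambda>p. Blinfun (L p))" by (rule smooth_on_Blinfun[OF W L(1) sm(1)])
  fix p assume p: "p \<in> W"
  have ap: "blinfun_apply (Blinfun (L p)) = L p"
    using L(1)[OF p] by (simp add: bounded_linear_Blinfun_apply linear_conv_bounded_linear)
  show "Blinfun (L p) (w p) = b p" by (simp add: ap w p)
  obtain N where N: "linear N" "\<And>u. N (L p u) = u" "\<And>u. L p (N u) = u"
    using linear_injective_inverse[OF L(1)[OF p] L(2)[OF p]] by blast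
  have "blinfun_apply (Blinfun N) = N"
    using N(1) by (simp add: bounded_linear_Blinfun_apply linear_conv_bounded_linear)
  then show "\<exists>B::'e \<Rightarrow>\<^sub>L 'e. (\<forall>z. B (Blinfun (L p) z) = z) \<and> (\<forall>z. Blinfun (L p) (B z) = z)"
    using N by (intro exI[of _ "Blinfun N"]) (simp add: ap)
qed (use W sm in auto)

definition riesz_op :: "('e::euclidean_space \<Rightarrow> 'e \<Rightarrow> real) \<Rightarrow> 'e \<Rightarrow> 'e" where
  "riesz_op a w = (\<Sum>b\<in>Basis. a w b *\<^sub>R b)"

lemma
  assumes "bilinear a"
  shows riesz_op_inner: "riesz_op a w \<bullet> z = a w z" and linear_riesz_op: "linear (riesz_op a)"
proof -
  have l: "linear (a w)" "linear (\<lambda>w. a w z)" for w z using assms by (auto simp: bilinear_def)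
  have "riesz_op a w \<bullet> z = (\<Sum>b\<in>Basis. (z \<bullet> b) * a w b)"
    by (simp add: riesz_op_def inner_sum_left) (simp add: inner_commute mult.commute)
  also have "\<dots> = a w (\<Sum>b\<in>Basis. (z \<bullet> b) *\<^sub>R b)" by (simp add: linear_sum[OF l(1)] linear_scale[OF l(1)])
  finally show "riesz_op a w \<bullet> z = a w z" by (simp add: euclidean_representation)
  show "linear (riesz_op a)"
    unfolding riesz_op_def
    by (intro linearI) (simp_all add: linear_add[OF l(2)] linear_scale[OF l(2)] scaleR_add_left sum.distrib scaleR_sum_right)
qed

lemma riesz_op_injective:
  assumes "bilinear a" "\<And>u. u \<noteq> 0 \<Longrightarrow> a u u > 0" "riesz_op a u = 0"
  shows "u = 0"
  using riesz_op_inner[OF assms(1), of u u] assms(2)[of u] assms(3) by fastforce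

lemma riesz_ex1:
  fixes a :: "'e::euclidean_space \<Rightarrow> 'e \<Rightarrow> real"
  assumes a: "bilinear a" "\<And>u. u \<noteq> 0 \<Longrightarrow> a u u > 0" and k: "linear k"
  shows "\<exists>!w. \<forall>z. a w z = k z"
proof -
  obtain N where N: "linear N" "\<And>u. N (riesz_op a u) = u" "\<And>u. riesz_op a (N u) = u"
    using linear_injective_inverse[OF linear_riesz_op[OF a(1)] riesz_op_injective[OF a]] by blast
  let ?k = "\<Sum>b\<in>Basis. k b *\<^sub>R b"
  have "?k \<bullet> z = k z" for z
  proof -
    have "?k \<bullet> z = k (\<Sum>b\<in>Basis. (z \<bullet> b) *\<^sub>R b)"
      by (simp add: linear_sum[OF k] linear_scale[OF k] inner_sum_left) (simp add: inner_commute mult.commute)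
    then show ?thesis by (simp add: euclidean_representation)
  qed
  then have "a (N ?k) z = k z" for z using riesz_op_inner[OF a(1), of "N ?k" z] N(3) by simp
  moreover have "w = w'" if "\<forall>z. a w z = k z" "\<forall>z. a w' z = k z" for w w'
  proof -
    have "riesz_op a w = riesz_op a w'" using that by (simp add: riesz_op_def)
    then show ?thesis using N(2) by metis
  qed
  ultimately show ?thesis by blast
qed

text \<open>Through \<open>riesz_op\<close> the condition on \<open>w p\<close> becomes a linear
  equation in the Euclidean space; positivity of \<open>a p\<close> makes the operator injective,
  hence invertible in finite dimension.\<close>

lemma smooth_on_riesz:
  fixes a :: "'p::real_normed_vector \<Rightarrow> 'e::euclidean_space \<Rightarrow> 'e \<Rightarrow> real"
  assumes W: "open W" and a: "\<And>p. p \<in> W \<Longrightarrow> bilinear (a p)" "\<And>p u. p \<in> W \<Longrightarrow> u \<noteq> 0 \<Longrightarrow> a p u u > 0"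
    and sm: "\<And>u v. smooth_on W (\<lambda>p. a p u v)" "\<And>z. smooth_on W (\<lambda>p. k p z)"
    and w: "\<And>p z. p \<in> W \<Longrightarrow> a p (w p) z = k p z"
  shows "smooth_on W w"
proof (rule smooth_on_solve_injective[where L="\<lambda>p. riesz_op (a p)" and b="\<lambda>p. \<Sum>b\<in>Basis. k p b *\<^sub>R b", OF W])
  show "smooth_on W (\<lambda>p. riesz_op (a p) u)" for u
    unfolding riesz_op_def by (intro smooth_on_sum smooth_on_scaleR smooth_on_const sm W)
  show "smooth_on W (\<lambda>p. \<Sum>b\<in>Basis. k p b *\<^sub>R b)"
    by (intro smooth_on_sum smooth_on_scaleR smooth_on_const sm W)
qed (use w in \<open>auto simp: linear_riesz_op a riesz_op_def[of _ "w _"] dest: riesz_op_injective[OF a]\<close>)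

text \<open>\<open>koszul\<close>, \<open>chr\<close> and \<open>rcurv\<close> are the coordinate
  expressions behind \<open>christoffel\<close> and \<open>riemann_curvature\<close>, detached from
  an atlas. They can thus be applied to the slices of a foliated chart as well as to the charts of a
  leaf.\<close>

definition koszul :: "('e::euclidean_space \<Rightarrow> 'e \<Rightarrow> 'e \<Rightarrow> real) \<Rightarrow> 'e \<Rightarrow> 'e \<Rightarrow> 'e \<Rightarrow> 'e \<Rightarrow> real" where
  "koszul G x u v z = dd (\<lambda>y. G y v z) x u + dd (\<lambda>y. G y u z) x v - dd (\<lambda>y. G y u v) x z"

definition chr :: "('e::euclidean_space \<Rightarrow> 'e \<Rightarrow> 'e \<Rightarrow> real) \<Rightarrow> 'e \<Rightarrow> 'e \<Rightarrow> 'e \<Rightarrow> 'e" where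
  "chr G x u v = (THE w. \<forall>z. 2 * G x w z = koszul G x u v z)"

definition rcurv :: "('e::euclidean_space \<Rightarrow> 'e \<Rightarrow> 'e \<Rightarrow> 'e) \<Rightarrow> 'e \<Rightarrow> 'e \<Rightarrow> 'e \<Rightarrow> 'e \<Rightarrow> 'e" where
  "rcurv \<Gamma> x u v w = dd (\<lambda>y. \<Gamma> y v w) x u - dd (\<lambda>y. \<Gamma> y u w) x v + \<Gamma> x u (\<Gamma> x v w) - \<Gamma> x v (\<Gamma> x u w)"

section \<open>Levi-Civita connection and curvature of a metric on an open subset of Euclidean
  space\<close>

locale chart_metric =
  fixes U :: "'e::euclidean_space set" and G :: "'e \<Rightarrow> 'e \<Rightarrow> 'e \<Rightarrow> real"
  assumes open_U: "open U" and bil: "\<And>x. x \<in> U \<Longrightarrow> bilinear (G x)"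
    and smooth_G: "\<And>u v. smooth_on U (\<lambda>x. G x u v)"
    and G_sym: "\<And>x u v. x \<in> U \<Longrightarrow> G x u v = G x v u"
    and G_pos: "\<And>x u. x \<in> U \<Longrightarrow> u \<noteq> 0 \<Longrightarrow> G x u u > 0"
begin

lemma dd_G_has: "x \<in> U \<Longrightarrow> ((\<lambda>y. G y u v) has_derivative dd (\<lambda>y. G y u v) x) (at x)"
  by (rule smooth_on_has_derivative[OF smooth_G])

lemma dd_G_sym: "x \<in> U \<Longrightarrow> dd (\<lambda>y. G y u v) x h = dd (\<lambda>y. G y v u) x h"
  using frechet_derivative_transform_within_open[OF smooth_on_imp_differentiable[OF smooth_G] open_U] G_sym by metis

lemma dd_G_bilinear: "x \<in> U \<Longrightarrow> bilinear (\<lambda>u v. dd (\<lambda>y. G y u v) x h)"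
  by (rule bilinear_dd[OF open_U _ bil smooth_G])

lemma dd_G_linear: "x \<in> U \<Longrightarrow> linear (dd (\<lambda>y. G y u v) x)"
  by (rule has_derivative_linear[OF dd_G_has])

lemma koszul_linear:
  assumes x: "x \<in> U"
  shows "linear (koszul G x u v)" "linear (\<lambda>v. koszul G x u v z)" "linear (\<lambda>u. koszul G x u v z)"
  unfolding koszul_def
  by (auto intro!: linearI simp: bilinear_ladd[OF dd_G_bilinear[OF x]] bilinear_radd[OF dd_G_bilinear[OF x]]
      bilinear_lmul[OF dd_G_bilinear[OF x]] bilinear_rmul[OF dd_G_bilinear[OF x]]
      linear_add[OF dd_G_linear[OF x]] linear_scale[OF dd_G_linear[OF x]] algebra_simps)

text \<open>Positivity of the metric makes the definite description meaningful. Identities for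
  \<open>chr\<close> are proved from here on by checking the Koszul formula for the
  candidate.\<close>

lemma chr_iff:
  assumes x: "x \<in> U"
  shows "w = chr G x u v \<longleftrightarrow> (\<forall>z. 2 * G x w z = koszul G x u v z)"
proof -
  have "bilinear (\<lambda>u v. 2 * G x u v)"
    unfolding bilinear_def by (auto intro!: linearI simp: bilinear_ladd[OF bil[OF x]] bilinear_radd[OF bil[OF x]]
        bilinear_lmul[OF bil[OF x]] bilinear_rmul[OF bil[OF x]])
  from riesz_ex1[OF this _ koszul_linear(1)[OF x]]
  have ex1: "\<exists>!w. \<forall>z. 2 * G x w z = koszul G x u v z" using G_pos[OF x] by simp
  show ?thesis
    unfolding chr_def using theI'[OF ex1] the1_equality[OF ex1] by blast
qed

lemma chr_koszul: "x \<in> U \<Longrightarrow> 2 * G x (chr G x u v) z = koszul G x u v z"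
  using chr_iff by blast

lemma bilinear_chr: "x \<in> U \<Longrightarrow> bilinear (chr G x)"
proof -
  assume x: "x \<in> U"
  note k = koszul_linear[OF x] and g = bilinear_ladd[OF bil[OF x]] bilinear_lmul[OF bil[OF x]]
  show ?thesis
    unfolding bilinear_def
  proof (intro conjI allI linearI)
    fix u v w :: 'e and c :: real
    show "chr G x u (v + w) = chr G x u v + chr G x u w"
      by (rule sym, subst chr_iff[OF x]) (simp add: g ring_distribs chr_koszul[OF x] linear_add[OF k(2)])
    show "chr G x u (c *\<^sub>R v) = c *\<^sub>R chr G x u v"
      by (rule sym, subst chr_iff[OF x]) (simp add: g chr_koszul[OF x] linear_scale[OF k(2)] mult.left_commute[of 2])
    show "chr G x (v + w) u = chr G x v u + chr G x w u"
      by (rule sym, subst chr_iff[OF x]) (simp add: g ring_distribs chr_koszul[OF x] linear_add[OF k(3)])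
    show "chr G x (c *\<^sub>R v) u = c *\<^sub>R chr G x v u"
      by (rule sym, subst chr_iff[OF x]) (simp add: g chr_koszul[OF x] linear_scale[OF k(3)] mult.left_commute[of 2])
  qed
qed

lemma smooth_chr: "smooth_on U (\<lambda>x. chr G x u v)"
proof (rule smooth_on_riesz[where a=G and k="\<lambda>x z. 1/2 * koszul G x u v z", OF open_U bil G_pos smooth_G])
  show "smooth_on U (\<lambda>x. 1/2 * koszul G x u v z)" for z
    unfolding koszul_def
    by (intro smooth_on_mult smooth_on_const smooth_on_diff smooth_on_add smooth_on_frechet_derivative smooth_G open_U)
  show "G x (chr G x u v) z = 1/2 * koszul G x u v z" if "x \<in> U" for x z
    using chr_koszul[OF that, of u v z] by simp
qed

text \<open>Adding the Koszul formulas for the pairs \<open>u\<close>, \<open>a\<close> against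
  \<open>b\<close> and \<open>u\<close>, \<open>b\<close> against \<open>a\<close> cancels
  everything except twice the derivative of the metric in direction \<open>u\<close>.\<close>

lemma metric_compatible:
  assumes x: "x \<in> U"
  shows "dd (\<lambda>y. G y a b) x u = G x (chr G x u a) b + G x a (chr G x u b)"
proof -
  have "2 * G x (chr G x u a) b + 2 * G x (chr G x u b) a = 2 * dd (\<lambda>y. G y a b) x u"
    unfolding chr_koszul[OF x] koszul_def using dd_G_sym[OF x] by simp
  then show ?thesis using G_sym[OF x, of a] by simp
qed

lemma rcurv_linear:
  assumes x: "x \<in> U"
  shows "linear (\<lambda>u. rcurv (chr G) x u v w)" "linear (\<lambda>v. rcurv (chr G) x u v w)" "linear (\<lambda>w. rcurv (chr G) x u v w)"
proof -
  note B = bilinear_chr[OF x] and B' = bilinear_dd[OF open_U x bilinear_chr smooth_chr]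
  note L = has_derivative_linear[OF smooth_on_has_derivative[OF smooth_chr x]]
  note simps = bilinear_ladd[OF B] bilinear_radd[OF B] bilinear_lmul[OF B] bilinear_rmul[OF B]
    bilinear_ladd[OF B'] bilinear_radd[OF B'] bilinear_lmul[OF B'] bilinear_rmul[OF B'] linear_add[OF L] linear_scale[OF L]
  show "linear (\<lambda>u. rcurv (chr G) x u v w)" "linear (\<lambda>v. rcurv (chr G) x u v w)" "linear (\<lambda>w. rcurv (chr G) x u v w)"
    unfolding rcurv_def by (rule linearI; simp add: simps algebra_simps)+
qed

text \<open>The second derivatives of the function \<open>\<lambda>y. G y w w\<close> commute.
  Expressed through metric compatibility, the difference of the two orders is twice the left-hand
  side.\<close>

lemma rcurv_skew:
  assumes x: "x \<in> U"
  shows "G x (rcurv (chr G) x u v w) w = 0"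
proof -
  let ?\<Gamma> = "chr G"
  let ?q = "\<lambda>y. G y w w"
  note B = bil[OF x]
  have dq: "dd ?q y v = 2 * G y (?\<Gamma> y v w) w" if "y \<in> U" for y v
    using metric_compatible[OF that, of w w v] G_sym[OF that, of w] by simp
  have D: "dd (\<lambda>y. dd ?q y v) x u = 2 * (dd (\<lambda>y. G y (?\<Gamma> x v w) w) x u + G x (dd (\<lambda>y. ?\<Gamma> y v w) x u) w)" for u v
  proof -
    have "((\<lambda>y. 2 * G y (?\<Gamma> y v w) w) has_derivative
        (\<lambda>h. 2 * (dd (\<lambda>q. G q (?\<Gamma> x v w) w) x h + G x (dd (\<lambda>y. ?\<Gamma> y v w) x h) w + G x (?\<Gamma> x v w) 0))) (at x)"
      by (intro has_derivative_mult_right has_derivative_bilinear_field[where D=U and H=G and \<phi>="\<lambda>x. x"] open_U x bil smooth_G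
          has_derivative_ident has_derivative_const smooth_on_has_derivative[OF smooth_chr x])
    then have "((\<lambda>y. dd ?q y v) has_derivative
        (\<lambda>h. 2 * (dd (\<lambda>q. G q (?\<Gamma> x v w) w) x h + G x (dd (\<lambda>y. ?\<Gamma> y v w) x h) w + G x (?\<Gamma> x v w) 0))) (at x)"
      by (rule has_derivative_transform_within_open[OF _ open_U x]) (simp add: dq)
    from dd_eq[OF this] show ?thesis by (simp add: bilinear_rzero[OF B])
  qed
  have "dd (\<lambda>y. dd ?q y v) x u = dd (\<lambda>y. dd ?q y u) x v"
    by (rule symmetric_second_derivative[OF open_U x smooth_G])
  then have "dd (\<lambda>y. G y (?\<Gamma> x v w) w) x u + G x (dd (\<lambda>y. ?\<Gamma> y v w) x u) w =
      dd (\<lambda>y. G y (?\<Gamma> x u w) w) x v + G x (dd (\<lambda>y. ?\<Gamma> y u w) x v) w"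
    unfolding D by simp
  then show ?thesis
    unfolding rcurv_def metric_compatible[OF x]
    by (simp add: bilinear_ladd[OF B] bilinear_lsub[OF B] G_sym[OF x, of "?\<Gamma> x v w"] )
qed

text \<open>Nearly parallel \<open>u\<close> and \<open>v\<close> make the denominator small, so
  numerator and denominator cannot be estimated separately as they stand. Replacing \<open>v\<close>
  by its component \<open>v'\<close> orthogonal to \<open>u\<close> changes neither of them, by
  \<open>rcurv_skew\<close> and antisymmetry in the first two arguments, and turns the denominator
  into a product that \<open>m\<close> bounds from below.\<close>

lemma sectional_bound:
  assumes x: "x \<in> U" and m: "m > 0" "\<And>u. m * (norm u)\<^sup>2 \<le> G x u u"
    and C: "C \<ge> 0" "\<And>u v. G x (rcurv (chr G) x u v v) u \<le> C * (norm u)\<^sup>2 * (norm v)\<^sup>2"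
    and uv: "u \<noteq> v" "independent {u, v}"
  shows "G x (rcurv (chr G) x u v v) u / (G x u u * G x v v - (G x u v)\<^sup>2) \<le> C / m\<^sup>2"
proof -
  let ?R = "rcurv (chr G) x"
  note B = bil[OF x] and L = rcurv_linear[OF x]
  note bs = bilinear_ladd[OF B] bilinear_radd[OF B] bilinear_lsub[OF B] bilinear_rsub[OF B] bilinear_lmul[OF B] bilinear_rmul[OF B]
  have u0: "u \<noteq> 0" using uv(2) dependent_zero by auto
  then have guu: "G x u u > 0" using G_pos[OF x] by auto
  define c where "c = G x u v / G x u u"
  define v' where "v' = v - c *\<^sub>R u"
  have v'0: "v' \<noteq> 0"
  proof
    assume "v' = 0"
    then have "v = c *\<^sub>R u" by (simp add: v'_def)
    then have "v \<in> span {u}" by (simp add: span_mul span_base)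
    moreover have "{u, v} - {v} = {u}" using uv(1) by auto
    ultimately show False using uv(2) by (auto simp: dependent_def)
  qed
  then have gv': "G x v' v' > 0" using G_pos[OF x] by auto
  have den: "G x u u * G x v v - (G x u v)\<^sup>2 = G x u u * G x v' v'"
    using guu G_sym[OF x, of v u] by (simp add: v'_def c_def bs field_simps power2_eq_square)
  have Ruu: "?R u u w = 0" for w by (simp add: rcurv_def)
  have "?R u v' v' = ?R u v v - c *\<^sub>R ?R u v u"
    by (simp add: v'_def linear_diff[OF L(2)] linear_scale[OF L(2)] Ruu linear_diff[OF L(3)] linear_scale[OF L(3)])
  then have num: "G x (?R u v v) u = G x (?R u v' v') u"
    by (simp add: bs rcurv_skew[OF x])
  have "(m * (norm u)\<^sup>2) * (m * (norm v')\<^sup>2) \<le> G x u u * G x v' v'"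
    using m guu by (intro mult_mono) auto
  then have mm: "(norm u)\<^sup>2 * (norm v')\<^sup>2 \<le> (G x u u * G x v' v') / m\<^sup>2"
    using m by (simp add: field_simps power2_eq_square)
  have "G x (?R u v' v') u \<le> C * ((norm u)\<^sup>2 * (norm v')\<^sup>2)"
    using C(2)[of u v'] by (simp add: mult.assoc)
  also have "\<dots> \<le> C * ((G x u u * G x v' v') / m\<^sup>2)"
    by (rule mult_left_mono[OF mm C(1)])
  finally show ?thesis
    unfolding den num using guu gv' by (simp add: field_simps)
qed

end

section \<open>Behaviour of connection and curvature under local isometries\<close>

locale metric_map = src: chart_metric U G + tgt: chart_metric U' G'
  for U :: "'e::euclidean_space set" and G U' and G' :: "'e \<Rightarrow> 'e \<Rightarrow> 'e \<Rightarrow> real" +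
  fixes \<phi> :: "'e \<Rightarrow> 'e"
  assumes smooth_\<phi>: "smooth_on U \<phi>" and \<phi>_U: "\<And>x. x \<in> U \<Longrightarrow> \<phi> x \<in> U'"
    and surj_\<phi>: "\<And>x z. x \<in> U \<Longrightarrow> \<exists>u. dd \<phi> x u = z"
    and isom: "\<And>x u v. x \<in> U \<Longrightarrow> G x u v = G' (\<phi> x) (dd \<phi> x u) (dd \<phi> x v)"
begin

abbreviation "d2 x u v \<equiv> dd (\<lambda>y. dd \<phi> y v) x u"

lemma \<phi>_has: "x \<in> U \<Longrightarrow> (\<phi> has_derivative dd \<phi> x) (at x)"
  by (rule smooth_on_has_derivative[OF smooth_\<phi>])

lemma d\<phi>_linear: "x \<in> U \<Longrightarrow> linear (dd \<phi> x)"
  by (rule has_derivative_linear[OF \<phi>_has])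

lemma d\<phi>_has: "x \<in> U \<Longrightarrow> ((\<lambda>y. dd \<phi> y v) has_derivative (\<lambda>h. d2 x h v)) (at x)"
  by (rule smooth_on_has_derivative[OF smooth_on_frechet_derivative[OF smooth_\<phi>]])

lemma d2_sym: "x \<in> U \<Longrightarrow> d2 x u v = d2 x v u"
  by (rule symmetric_second_derivative[OF src.open_U _ smooth_\<phi>])

text \<open>Differentiating the isometry relation adds six terms with second derivatives of
  \<open>\<phi>\<close> to the Koszul expression of the target; by their symmetry four cancel and
  two add up to the correction. Surjectivity of the differential allows testing on images of vectors
  only.\<close>

lemma chr_transform:
  assumes x: "x \<in> U"
  shows "chr G' (\<phi> x) (dd \<phi> x u) (dd \<phi> x v) = dd \<phi> x (chr G x u v) - d2 x u v"
proof -
  note y = \<phi>_U[OF x] and B = tgt.bil[OF \<phi>_U[OF x]]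
  have DG: "dd (\<lambda>y. G y a b) x h = dd (\<lambda>q. G' q (dd \<phi> x a) (dd \<phi> x b)) (\<phi> x) (dd \<phi> x h)
      + G' (\<phi> x) (d2 x h a) (dd \<phi> x b) + G' (\<phi> x) (dd \<phi> x a) (d2 x h b)" for a b h
  proof -
    note has_derivative_bilinear_field[OF tgt.open_U y tgt.bil tgt.smooth_G \<phi>_has[OF x] d\<phi>_has[OF x] d\<phi>_has[OF x], of a b]
    then have "((\<lambda>y. G y a b) has_derivative (\<lambda>h. dd (\<lambda>q. G' q (dd \<phi> x a) (dd \<phi> x b)) (\<phi> x) (dd \<phi> x h)
      + G' (\<phi> x) (d2 x h a) (dd \<phi> x b) + G' (\<phi> x) (dd \<phi> x a) (d2 x h b))) (at x)"
      by (rule has_derivative_transform_within_open[OF _ src.open_U x]) (simp_all add: isom[symmetric])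
    from dd_eq[OF this] show ?thesis by simp
  qed
  have "2 * G' (\<phi> x) (dd \<phi> x (chr G x u v) - d2 x u v) z' = koszul G' (\<phi> x) (dd \<phi> x u) (dd \<phi> x v) z'" for z'
  proof -
    obtain z where z: "z' = dd \<phi> x z" using surj_\<phi>[OF x] by metis
    have "2 * G' (\<phi> x) (dd \<phi> x (chr G x u v)) z' = koszul G x u v z"
      unfolding z isom[OF x, symmetric] by (rule src.chr_koszul[OF x])
    also have "\<dots> = koszul G' (\<phi> x) (dd \<phi> x u) (dd \<phi> x v) z' + 2 * G' (\<phi> x) (d2 x u v) z'"
      unfolding koszul_def DG z
      using d2_sym[OF x] tgt.G_sym[OF y] by (simp add: algebra_simps)
    finally show ?thesis by (simp add: bilinear_lsub[OF B] algebra_simps)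
  qed
  then show ?thesis using tgt.chr_iff[OF y] by metis
qed

text \<open>Differentiate \<open>chr_transform\<close> once more. The third derivatives of
  \<open>\<phi>\<close> are symmetric in \<open>u\<close> and \<open>v\<close> and drop out of the
  antisymmetric combination, as do the remaining terms with second derivatives.\<close>

lemma rcurv_transform:
  assumes x: "x \<in> U"
  shows "rcurv (chr G') (\<phi> x) (dd \<phi> x u) (dd \<phi> x v) (dd \<phi> x w) = dd \<phi> x (rcurv (chr G) x u v w)"
proof -
  let ?\<Gamma> = "chr G" and ?\<Gamma>' = "chr G'"
  note y = \<phi>_U[OF x] and B = tgt.bilinear_chr[OF \<phi>_U[OF x]]
  note T = chr_transform[OF x]
  have sm2: "smooth_on U (\<lambda>y. d2 y v w)" for v w
    by (intro smooth_on_frechet_derivative smooth_\<phi>)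
  have d3: "dd (\<lambda>y. d2 y v w) x u = dd (\<lambda>y. d2 y u w) x v" for u v w
    by (rule symmetric_second_derivative[OF src.open_U x smooth_on_frechet_derivative[OF smooth_\<phi>]])
  have key: "dd (\<lambda>q. ?\<Gamma>' q (dd \<phi> x v) (dd \<phi> x w)) (\<phi> x) (dd \<phi> x u) + ?\<Gamma>' (\<phi> x) (d2 x u v) (dd \<phi> x w) + ?\<Gamma>' (\<phi> x) (dd \<phi> x v) (d2 x u w)
      = d2 x u (?\<Gamma> x v w) + dd \<phi> x (dd (\<lambda>y. ?\<Gamma> y v w) x u) - dd (\<lambda>y. d2 y v w) x u" for u v w
  proof -
    have "((\<lambda>y. ?\<Gamma>' (\<phi> y) (dd \<phi> y v) (dd \<phi> y w)) has_derivative (\<lambda>h. dd (\<lambda>q. ?\<Gamma>' q (dd \<phi> x v) (dd \<phi> x w)) (\<phi> x) (dd \<phi> x h)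
       + ?\<Gamma>' (\<phi> x) (d2 x h v) (dd \<phi> x w) + ?\<Gamma>' (\<phi> x) (dd \<phi> x v) (d2 x h w))) (at x)"
      by (rule has_derivative_bilinear_field[OF tgt.open_U y tgt.bilinear_chr tgt.smooth_chr \<phi>_has[OF x] d\<phi>_has[OF x] d\<phi>_has[OF x]])
    moreover have "((\<lambda>y. dd \<phi> y (?\<Gamma> y v w) - d2 y v w) has_derivative
        (\<lambda>h. (d2 x h (?\<Gamma> x v w) + dd \<phi> x (dd (\<lambda>y. ?\<Gamma> y v w) x h)) - dd (\<lambda>y. d2 y v w) x h)) (at x)"
      by (intro has_derivative_diff has_derivative_linear_field[OF src.open_U x d\<phi>_linear]
          smooth_on_frechet_derivative smooth_\<phi> smooth_on_has_derivative[OF src.smooth_chr x] smooth_on_has_derivative[OF sm2 x])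
    then have "((\<lambda>y. ?\<Gamma>' (\<phi> y) (dd \<phi> y v) (dd \<phi> y w)) has_derivative
        (\<lambda>h. (d2 x h (?\<Gamma> x v w) + dd \<phi> x (dd (\<lambda>y. ?\<Gamma> y v w) x h)) - dd (\<lambda>y. d2 y v w) x h)) (at x)"
      by (rule has_derivative_transform_within_open[OF _ src.open_U x]) (simp add: chr_transform)
    ultimately show ?thesis using has_derivative_unique by (metis (no_types, lifting))
  qed
  have TT: "?\<Gamma>' (\<phi> x) (dd \<phi> x u) (?\<Gamma>' (\<phi> x) (dd \<phi> x v) (dd \<phi> x w)) =
      dd \<phi> x (?\<Gamma> x u (?\<Gamma> x v w)) - d2 x u (?\<Gamma> x v w) - ?\<Gamma>' (\<phi> x) (dd \<phi> x u) (d2 x v w)" for u v w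
    by (simp add: T bilinear_rsub[OF B])
  have K: "dd (\<lambda>q. ?\<Gamma>' q (dd \<phi> x v) (dd \<phi> x w)) (\<phi> x) (dd \<phi> x u)
      = d2 x u (?\<Gamma> x v w) + dd \<phi> x (dd (\<lambda>y. ?\<Gamma> y v w) x u) - dd (\<lambda>y. d2 y v w) x u
        - ?\<Gamma>' (\<phi> x) (d2 x u v) (dd \<phi> x w) - ?\<Gamma>' (\<phi> x) (dd \<phi> x v) (d2 x u w)" for u v w
    using key[of v w u] by (simp add: algebra_simps)
  show ?thesis
    using d3[where u=u and v=v and w=w]
    unfolding rcurv_def TT K d2_sym[OF x, of u v] linear_add[OF d\<phi>_linear[OF x]] linear_diff[OF d\<phi>_linear[OF x]]
    by (simp add: algebra_simps)
qed

end

section \<open>Geodesics\<close>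

text \<open>After a cutoff the field has a global Lipschitz constant \<open>C\<close>. On an
  interval of radius \<open>\<delta>\<close> with \<open>C * \<delta> \<le> 1/2\<close>, the maximum
  \<open>M\<close> of the distance between the two solutions satisfies
  \<open>M \<le> 1/2 * M\<close>.\<close>

lemma ode_unique_local:
  fixes f :: "'y::euclidean_space \<Rightarrow> 'y"
  assumes f: "open \<Omega>" "smooth_on \<Omega> f" and e: "e > 0"
    and y: "\<And>s. \<bar>s - t\<bar> < e \<Longrightarrow> (y has_vector_derivative f (y s)) (at s)"
    and z: "\<And>s. \<bar>s - t\<bar> < e \<Longrightarrow> (z has_vector_derivative f (z s)) (at s)"
    and init: "y t = z t" "z t \<in> \<Omega>"
  obtains \<delta> where "\<delta> > 0" "\<forall>s. \<bar>s - t\<bar> < \<delta> \<longrightarrow> y s = z s"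
proof -
  obtain r where r: "r > 0" "cball (z t) r \<subseteq> \<Omega>" using f(1) init(2) open_contains_cball by blast
  obtain \<beta> :: "'y \<Rightarrow> real" where \<beta>: "smooth_on UNIV \<beta>" and "\<And>x. 0 \<le> \<beta> x" "\<And>x. \<beta> x \<le> 1"
    and \<beta>1: "\<And>x. dist (z t) x \<le> r / 2 \<Longrightarrow> \<beta> x = 1" and \<beta>0: "\<And>x. dist (z t) x \<ge> r \<Longrightarrow> \<beta> x = 0"
    by (rule smooth_cutoff[OF r(1), of "z t"]) blast
  define h where "h x = \<beta> x *\<^sub>R f x" for x
  have h: "smooth_on UNIV h" unfolding h_def by (rule smooth_on_cutoff_scaleR[OF \<beta> \<beta>0 f(1) r(2) f(2)])
  have "h x = 0" if "x \<notin> cball (z t) r" for x using that \<beta>0[of x] by (auto simp: h_def)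
  then obtain C where C: "C \<ge> 0" "\<And>x k. norm (frechet_derivative h (at x) k) \<le> C * norm k"
    using compact_support_bounds[OF h compact_cball] by metis
  have "onorm (frechet_derivative h (at x)) \<le> C" for x using C(2) by (rule onorm_le)
  then have hL: "norm (h x - h y) \<le> C * norm (x - y)" for x y
    by (intro differentiable_bound[where S=UNIV and f'="\<lambda>x. frechet_derivative h (at x)"])
      (use smooth_on_has_derivative[OF h] in auto)
  have cont: "isCont y s" "isCont z s" if "\<bar>s - t\<bar> < e" for s
    using y[OF that] z[OF that] has_vector_derivative_continuous by blast+
  obtain d1 where d1: "d1 > 0" "\<And>s. dist s t < d1 \<Longrightarrow> dist (y s) (z t) < r / 2"
    using cont(1)[of t] e init(1) r(1) unfolding continuous_at_eps_delta by (metis abs_zero diff_self half_gt_zero)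
  obtain d2 where d2: "d2 > 0" "\<And>s. dist s t < d2 \<Longrightarrow> dist (z s) (z t) < r / 2"
    using cont(2)[of t] e r(1) unfolding continuous_at_eps_delta by (metis abs_zero diff_self half_gt_zero)
  define \<delta> where "\<delta> = Min {e/2, d1/2, d2/2, 1 / (2 * (C + 1))}"
  have \<delta>: "\<delta> > 0" "\<delta> < e" "\<delta> < d1" "\<delta> < d2" "\<delta> \<le> 1 / (2 * (C + 1))"
    using e d1 d2 C by (auto simp: \<delta>_def)
  have C\<delta>: "C * \<delta> \<le> 1/2"
  proof -
    have "C * \<delta> \<le> C * (1 / (2 * (C + 1)))" using \<delta>(5) C(1) by (rule mult_left_mono)
    also have "\<dots> \<le> 1/2" using C(1) by (simp add: field_simps)
    finally show ?thesis .
  qed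
  let ?I = "{t - \<delta>..t + \<delta>}"
  have near: "\<bar>s - t\<bar> < e" "dist s t < d1" "dist s t < d2" if "s \<in> ?I" for s
    using that \<delta> by (auto simp: dist_real_def abs_less_iff)
  have "continuous_on ?I (\<lambda>s. norm (y s - z s))"
    using cont near by (intro continuous_intros continuous_at_imp_continuous_on) auto
  then obtain s0 where s0: "s0 \<in> ?I" "\<And>s. s \<in> ?I \<Longrightarrow> norm (y s - z s) \<le> norm (y s0 - z s0)"
    using continuous_attains_sup[of ?I "\<lambda>s. norm (y s - z s)"] \<delta>(1) by auto
  define M where "M = norm (y s0 - z s0)"
  have yh: "f (y s) = h (y s)" "f (z s) = h (z s)" if "s \<in> ?I" for s
    using d1(2)[OF near(2)[OF that]] d2(2)[OF near(3)[OF that]] \<beta>1[of "y s"] \<beta>1[of "z s"]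
    by (simp_all add: h_def dist_commute)
  have "norm ((y s0 - z s0) - (y t - z t)) \<le> (C * M) * \<bar>s0 - t\<bar>"
  proof (rule has_vector_derivative_bound[OF convex_closed_interval])
    fix s assume s: "s \<in> ?I"
    show "((\<lambda>s. y s - z s) has_vector_derivative f (y s) - f (z s)) (at s)"
      by (intro has_vector_derivative_diff y z near(1) s)
    have "norm (f (y s) - f (z s)) \<le> C * norm (y s - z s)" unfolding yh[OF s] by (rule hL)
    also have "\<dots> \<le> C * M" using s0(2)[OF s] C(1) by (simp add: M_def mult_left_mono)
    finally show "norm (f (y s) - f (z s)) \<le> C * M" .
  qed (use s0 \<delta> in auto)
  also have "\<dots> \<le> (C * M) * \<delta>"
    using s0(1) C(1) by (intro mult_left_mono) (auto simp: M_def abs_le_iff)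
  also have "\<dots> = (C * \<delta>) * M" by simp
  also have "\<dots> \<le> 1/2 * M" using C\<delta> by (rule mult_right_mono) (simp add: M_def)
  finally have "M = 0" by (simp add: init M_def)
  show thesis
  proof (rule that[OF \<delta>(1)], intro allI impI)
    fix s assume "\<bar>s - t\<bar> < \<delta>"
    then have "s \<in> ?I" by (auto simp: abs_less_iff)
    from s0(2)[OF this] show "y s = z s" using \<open>M = 0\<close> by (simp add: M_def)
  qed
qed

section \<open>Geodesics near one time, in one chart\<close>

definition vel :: "('i, 'a, 'e::euclidean_space) atlas \<Rightarrow> 'i \<Rightarrow> (real \<Rightarrow> 'a) \<Rightarrow> real \<Rightarrow> 'e" where
  "vel X i \<gamma> s = vector_derivative (\<lambda>s. coord X i (\<gamma> s)) (at s)"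

text \<open>\<open>geodesic\<close> concerns curves on the whole real line and all charts at once.
  This local form can be asserted for pieces that are still to be glued, and for a single
  chart.\<close>

definition geodesic_near ::
  "('i, 'a, 'e::euclidean_space) atlas \<Rightarrow> ('i \<Rightarrow> 'a \<Rightarrow> 'e \<Rightarrow> 'e \<Rightarrow> real) \<Rightarrow> 'i \<Rightarrow> (real \<Rightarrow> 'a) \<Rightarrow> real \<Rightarrow> bool" where
  "geodesic_near X g i \<gamma> t \<longleftrightarrow> i \<in> indices X \<and> (\<exists>\<delta>>0. \<forall>s. \<bar>s - t\<bar> < \<delta> \<longrightarrow> \<gamma> s \<in> patch X i \<and>
     ((\<lambda>s. coord X i (\<gamma> s)) has_vector_derivative vel X i \<gamma> s) (at s) \<and>
     (vel X i \<gamma> has_vector_derivative - christoffel X g i (\<gamma> s) (vel X i \<gamma> s) (vel X i \<gamma> s)) (at s))"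

lemma geodesic_nearI:
  assumes "i \<in> indices X" "\<delta> > 0" "\<And>s. \<bar>s - t\<bar> < \<delta> \<Longrightarrow> \<gamma> s \<in> patch X i"
    and c: "\<And>s. \<bar>s - t\<bar> < \<delta> \<Longrightarrow> ((\<lambda>s. coord X i (\<gamma> s)) has_vector_derivative d s) (at s)"
    and d: "\<And>s. \<bar>s - t\<bar> < \<delta> \<Longrightarrow> (d has_vector_derivative - christoffel X g i (\<gamma> s) (d s) (d s)) (at s)"
  shows "geodesic_near X g i \<gamma> t" "vel X i \<gamma> t = d t"
proof -
  have eq: "vel X i \<gamma> s = d s" if "\<bar>s - t\<bar> < \<delta>" for s
    unfolding vel_def using c[OF that] by (rule vector_derivative_at)
  have "(vel X i \<gamma> has_vector_derivative - christoffel X g i (\<gamma> s) (d s) (d s)) (at s)" if s: "\<bar>s - t\<bar> < \<delta>" for s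
    by (rule has_vector_derivative_transform_within_open[OF d[OF s], of "{t - \<delta><..<t + \<delta>}"])
      (use s eq in \<open>auto simp: abs_less_iff\<close>)
  then show "geodesic_near X g i \<gamma> t"
    unfolding geodesic_near_def using assms eq by auto
  show "vel X i \<gamma> t = d t" using eq assms(2) by simp
qed

lemma geodesic_nearE:
  assumes "geodesic_near X g i \<gamma> t"
  obtains \<delta> where "i \<in> indices X" "\<delta> > 0" "\<forall>s. \<bar>s - t\<bar> < \<delta> \<longrightarrow> \<gamma> s \<in> patch X i"
    "\<forall>s. \<bar>s - t\<bar> < \<delta> \<longrightarrow> ((\<lambda>s. coord X i (\<gamma> s)) has_vector_derivative vel X i \<gamma> s) (at s)"
    "\<forall>s. \<bar>s - t\<bar> < \<delta> \<longrightarrow> (vel X i \<gamma> has_vector_derivative - christoffel X g i (\<gamma> s) (vel X i \<gamma> s) (vel X i \<gamma> s)) (at s)"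
  using assms unfolding geodesic_near_def by blast

lemma vel_cong:
  assumes "\<delta> > 0" "\<And>s. \<bar>s - t\<bar> < \<delta> \<Longrightarrow> \<gamma> s = \<gamma>' s"
  shows "vel X i \<gamma> t = vel X i \<gamma>' t"
  unfolding vel_def
proof (rule vector_derivative_cong_eq)
  show "\<forall>\<^sub>F s in nhds t. s \<in> UNIV \<longrightarrow> coord X i (\<gamma> s) = coord X i (\<gamma>' s)"
    unfolding eventually_nhds_metric using assms by (auto simp: dist_real_def)
qed auto

lemma geodesic_near_cong:
  assumes "geodesic_near X g i \<gamma> t" "\<epsilon> > 0" "\<And>s. \<bar>s - t\<bar> < \<epsilon> \<Longrightarrow> \<gamma> s = \<gamma>' s"
  shows "geodesic_near X g i \<gamma>' t"
proof -
  obtain \<delta> where \<delta>: "i \<in> indices X" "\<delta> > 0" "\<forall>s. \<bar>s - t\<bar> < \<delta> \<longrightarrow> \<gamma> s \<in> patch X i"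
    "\<forall>s. \<bar>s - t\<bar> < \<delta> \<longrightarrow> ((\<lambda>s. coord X i (\<gamma> s)) has_vector_derivative vel X i \<gamma> s) (at s)"
    "\<forall>s. \<bar>s - t\<bar> < \<delta> \<longrightarrow> (vel X i \<gamma> has_vector_derivative - christoffel X g i (\<gamma> s) (vel X i \<gamma> s) (vel X i \<gamma> s)) (at s)"
    using assms(1) by (rule geodesic_nearE)
  show ?thesis
  proof (rule geodesic_nearI(1)[OF \<delta>(1), where \<delta>="min \<delta> \<epsilon>" and d="vel X i \<gamma>"])
    fix s assume s: "\<bar>s - t\<bar> < min \<delta> \<epsilon>"
    have eq: "\<gamma>' s = \<gamma> s" using s assms(3) by simp
    show "\<gamma>' s \<in> patch X i" using \<delta> s eq by auto
    show "((\<lambda>s. coord X i (\<gamma>' s)) has_vector_derivative vel X i \<gamma> s) (at s)"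
      by (rule has_vector_derivative_transform_within_open[of "\<lambda>s. coord X i (\<gamma> s)" _ _ "{t - \<epsilon><..<t + \<epsilon>}"])
        (use \<delta> s assms(3) in \<open>auto simp: abs_less_iff\<close>)
    show "(vel X i \<gamma> has_vector_derivative - christoffel X g i (\<gamma>' s) (vel X i \<gamma> s) (vel X i \<gamma> s)) (at s)"
      using \<delta> s eq by auto
  qed (use \<delta> assms in auto)
qed

lemma geodesic_near_at:
  assumes "geodesic_near X g i \<gamma> t"
  shows "i \<in> charts_at X (\<gamma> t)"
    and "((\<lambda>s. coord X i (\<gamma> s)) has_vector_derivative vel X i \<gamma> t) (at t)"
    and "(vel X i \<gamma> has_vector_derivative - christoffel X g i (\<gamma> t) (vel X i \<gamma> t) (vel X i \<gamma> t)) (at t)"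
  using assms by (auto simp: geodesic_near_def charts_at_def)

section \<open>Metric, curvature and geodesics under a change of chart\<close>

locale riemannian = smooth_atlas_on X
  for X :: "('i, 'a, 'e::euclidean_space) atlas" +
  fixes g :: "'i \<Rightarrow> 'a \<Rightarrow> 'e \<Rightarrow> 'e \<Rightarrow> real"
  assumes riemannian: "riemannian_metric X g"
begin

abbreviation "chart i \<equiv> coord X i ` patch X i"
abbreviation "G i x \<equiv> g i (param X i x)"

lemma metric_transform:
  "i \<in> charts_at X p \<Longrightarrow> j \<in> charts_at X p \<Longrightarrow>
    g i p u v = g j p (transition_deriv X i j p u) (transition_deriv X i j p v)"
  using riemannian unfolding riemannian_metric_def smooth_2tensor_def by blast

lemma chart_metric: "i \<in> indices X \<Longrightarrow> chart_metric (chart i) (G i)"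
proof -
  assume i: "i \<in> indices X"
  show ?thesis
    by (rule chart_metric.intro[OF open_chart[OF i]])
      (use riemannian i in \<open>auto simp: riemannian_metric_def smooth_2tensor_def\<close>)
qed

lemma bilinear_metric: "i \<in> charts_at X p \<Longrightarrow> bilinear (g i p)"
  using riemannian by (auto simp: riemannian_metric_def smooth_2tensor_def charts_at_def)

lemma christoffel_eq:
  assumes "i \<in> indices X" "p \<in> patch X i"
  shows "christoffel X g i p = chr (G i) (coord X i p)"
  using assms by (simp add: fun_eq_iff christoffel_def chr_def koszul_def partial_deriv_def o_def)

lemma riemann_curvature_eq:
  assumes i: "i \<in> indices X" and p: "p \<in> patch X i"
  shows "riemann_curvature X g i p = rcurv (chr (G i)) (coord X i p)"
proof -
  interpret chart_metric "chart i" "G i" by (rule chart_metric[OF i])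
  have x: "coord X i p \<in> chart i" using p by auto
  have "partial_deriv X i (\<lambda>q. christoffel X g i q u v) p = dd (\<lambda>y. chr (G i) y u v) (coord X i p)" for u v
    unfolding partial_deriv_def
    by (rule ext, rule fun_cong[OF sym[OF frechet_derivative_transform_within_open[OF
      smooth_on_imp_differentiable[OF smooth_chr x] open_chart[OF i] x]]])
      (simp add: christoffel_eq[OF i])
  then show ?thesis
    unfolding fun_eq_iff riemann_curvature_def rcurv_def by (simp add: christoffel_eq[OF i p])
qed

lemma transition_metric_map:
  assumes i: "i \<in> indices X" and j: "j \<in> indices X"
  shows "metric_map (coord X i ` (patch X i \<inter> patch X j)) (G i) (chart j) (G j) (coord X j \<circ> param X i)"
proof -
  interpret ci: chart_metric "chart i" "G i" by (rule chart_metric[OF i])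
  interpret cj: chart_metric "chart j" "G j" by (rule chart_metric[OF j])
  let ?D = "coord X i ` (patch X i \<inter> patch X j)"
  have sub: "?D \<subseteq> chart i" by auto
  have D: "chart_metric ?D (G i)"
    by (rule chart_metric.intro[OF open_overlap[OF i j]])
      (use sub ci.bil ci.G_sym ci.G_pos smooth_on_subset[OF ci.smooth_G sub] in auto)
  have at: "i \<in> charts_at X (param X i x)" "j \<in> charts_at X (param X i x)" "coord X i (param X i x) = x"
    if "x \<in> ?D" for x
    using that i j by (auto simp: charts_at_def)
  have T: "dd (coord X j \<circ> param X i) x = transition_deriv X i j (param X i x)" if "x \<in> ?D" for x
    unfolding transition_deriv_def at(3)[OF that] ..
  show ?thesis
  proof (rule metric_map.intro[OF D cj.chart_metric_axioms metric_map_axioms.intro])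
    show "smooth_on ?D (coord X j \<circ> param X i)" by (rule smooth_transition[OF i j])
    fix x assume x: "x \<in> ?D"
    then show "(coord X j \<circ> param X i) x \<in> chart j" using i by auto
    show "\<exists>u. dd (coord X j \<circ> param X i) x u = z" for z
      unfolding T[OF x] using transition_deriv_inverse[OF at(2)[OF x] at(1)[OF x]] by blast
    have "param X j ((coord X j \<circ> param X i) x) = param X i x" using x i j by auto
    then show "G i x u v = G j ((coord X j \<circ> param X i) x) (dd (coord X j \<circ> param X i) x u) (dd (coord X j \<circ> param X i) x v)" for u v
      unfolding T[OF x] using metric_transform[OF at(1,2)[OF x], of u v] by simp
  qed
qed

lemma sectional_curvature_transform:
  assumes "i \<in> charts_at X p" "j \<in> charts_at X p"
  shows "sectional_curvature X g j p (transition_deriv X i j p u) (transition_deriv X i j p v) = sectional_curvature X g i p u v"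
proof -
  have i: "i \<in> indices X" "p \<in> patch X i" and j: "j \<in> indices X" "p \<in> patch X j"
    using assms by (auto simp: charts_at_def)
  interpret metric_map "coord X i ` (patch X i \<inter> patch X j)" "G i" "chart j" "G j" "coord X j \<circ> param X i"
    by (rule transition_metric_map[OF i(1) j(1)])
  have x: "coord X i p \<in> coord X i ` (patch X i \<inter> patch X j)" using i j by auto
  have "(coord X j \<circ> param X i) (coord X i p) = coord X j p" using i by simp
  with rcurv_transform[OF x]
  have "riemann_curvature X g j p (transition_deriv X i j p u) (transition_deriv X i j p v) (transition_deriv X i j p w)
    = transition_deriv X i j p (riemann_curvature X g i p u v w)" for u v w
    unfolding riemann_curvature_eq[OF i] riemann_curvature_eq[OF j] transition_deriv_def by simp
  then show ?thesis
    unfolding sectional_curvature_def by (simp add: metric_transform[OF assms, symmetric])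
qed

text \<open>The second derivative of the transition map that the chain rule produces is exactly the
  correction term of \<open>chr_transform\<close>.\<close>

lemma geodesic_near_transform:
  assumes gi: "geodesic_near X g i \<gamma> t" and j: "j \<in> charts_at X (\<gamma> t)"
  shows "geodesic_near X g j \<gamma> t" "vel X j \<gamma> t = transition_deriv X i j (\<gamma> t) (vel X i \<gamma> t)"
proof -
  obtain \<delta> where \<delta>: "i \<in> indices X" "\<delta> > 0" "\<forall>s. \<bar>s - t\<bar> < \<delta> \<longrightarrow> \<gamma> s \<in> patch X i"
    "\<forall>s. \<bar>s - t\<bar> < \<delta> \<longrightarrow> ((\<lambda>s. coord X i (\<gamma> s)) has_vector_derivative vel X i \<gamma> s) (at s)"
    "\<forall>s. \<bar>s - t\<bar> < \<delta> \<longrightarrow> (vel X i \<gamma> has_vector_derivative - christoffel X g i (\<gamma> s) (vel X i \<gamma> s) (vel X i \<gamma> s)) (at s)"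
    using gi by (rule geodesic_nearE)
  have jX: "j \<in> indices X" "\<gamma> t \<in> patch X j" using j by (auto simp: charts_at_def)
  have cont: "isCont (\<lambda>s. coord X i (\<gamma> s)) t"
    using geodesic_near_at(2)[OF gi] by (rule has_vector_derivative_continuous)
  have "\<gamma> s \<in> patch X i" if "\<bar>s - t\<bar> < \<delta>" for s using \<delta>(3) that by blast
  then obtain e where e: "e > 0" "e \<le> \<delta>" "\<forall>s. \<bar>s - t\<bar> < e \<longrightarrow> \<gamma> s \<in> patch X j"
    by (rule curve_near[OF \<delta>(1,2) _ cont openin_patch[OF jX(1)] jX(2)]) blast
  interpret metric_map "coord X i ` (patch X i \<inter> patch X j)" "G i" "chart j" "G j" "coord X j \<circ> param X i"
    by (rule transition_metric_map[OF \<delta>(1) jX(1)])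
  let ?D = "coord X i ` (patch X i \<inter> patch X j)" and ?\<phi> = "coord X j \<circ> param X i"
  define x where "x s = coord X i (\<gamma> s)" for s
  define v where "v = vel X i \<gamma>"
  define d where "d s = dd ?\<phi> (x s) (v s)" for s
  have ij: "\<gamma> s \<in> patch X i" "\<gamma> s \<in> patch X j" "x s \<in> ?D" "?\<phi> (x s) = coord X j (\<gamma> s)"
    "param X i (x s) = \<gamma> s" if "\<bar>s - t\<bar> < e" for s
    using \<delta> e that by (auto simp: x_def)
  have x': "(x has_derivative (\<lambda>h. h *\<^sub>R v s)) (at s)"
    and v': "(v has_derivative (\<lambda>h. h *\<^sub>R - chr (G i) (x s) (v s) (v s))) (at s)" if s: "\<bar>s - t\<bar> < e" for s
  proof -
    have s': "\<bar>s - t\<bar> < \<delta>" using e(2) s by simp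
    show "(x has_derivative (\<lambda>h. h *\<^sub>R v s)) (at s)"
      using \<delta>(4)[rule_format, OF s'] unfolding x_def[abs_def] v_def has_vector_derivative_def .
    show "(v has_derivative (\<lambda>h. h *\<^sub>R - chr (G i) (x s) (v s) (v s))) (at s)"
      using \<delta>(5)[rule_format, OF s'] unfolding christoffel_eq[OF \<delta>(1) ij(1)[OF s]] x_def v_def has_vector_derivative_def .
  qed
  have c: "((\<lambda>s. coord X j (\<gamma> s)) has_vector_derivative d s) (at s)" if s: "\<bar>s - t\<bar> < e" for s
  proof -
    have "((\<lambda>s. ?\<phi> (x s)) has_derivative (\<lambda>h. dd ?\<phi> (x s) (h *\<^sub>R v s))) (at s)"
      by (rule has_derivative_compose[OF x'[OF s] \<phi>_has[OF ij(3)[OF s]]])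
    then have "((\<lambda>s. ?\<phi> (x s)) has_vector_derivative d s) (at s)"
      unfolding has_vector_derivative_def d_def by (simp add: linear_scale[OF d\<phi>_linear[OF ij(3)[OF s]]])
    then show ?thesis
      by (rule has_vector_derivative_transform_within_open[of _ _ _ "{t - e<..<t + e}"])
        (use s ij(4) in \<open>auto simp: abs_less_iff\<close>)
  qed
  have d': "(d has_vector_derivative - christoffel X g j (\<gamma> s) (d s) (d s)) (at s)" if s: "\<bar>s - t\<bar> < e" for s
  proof -
    note xD = ij(3)[OF s]
    \<comment> \<open>Again a dummy scalar makes the differential of the transition map a bilinear
      field.\<close>
    let ?H = "\<lambda>q u (r::real). r *\<^sub>R dd ?\<phi> q u"
    have B: "bilinear (?H q)" if "q \<in> ?D" for q
      unfolding bilinear_def using d\<phi>_linear[OF that] by (auto intro!: linearI simp: linear_add linear_scale algebra_simps)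
    have "((\<lambda>s. 1 *\<^sub>R dd ?\<phi> (x s) (v s)) has_derivative
       (\<lambda>h. dd (\<lambda>q. 1 *\<^sub>R dd ?\<phi> q (v s)) (x s) (h *\<^sub>R v s) + 1 *\<^sub>R dd ?\<phi> (x s) (h *\<^sub>R - chr (G i) (x s) (v s) (v s)) + 0 *\<^sub>R dd ?\<phi> (x s) (v s))) (at s)"
      by (rule has_derivative_bilinear_field[where D="?D" and H="?H", OF src.open_U xD B _ x'[OF s] v'[OF s] has_derivative_const])
        (auto intro!: smooth_on_scaleR smooth_on_frechet_derivative smooth_\<phi> src.open_U)
    then have "(d has_derivative (\<lambda>h. d2 (x s) (h *\<^sub>R v s) (v s) + dd ?\<phi> (x s) (h *\<^sub>R - chr (G i) (x s) (v s) (v s)))) (at s)"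
      unfolding d_def[abs_def] by simp
    moreover have "d2 (x s) (h *\<^sub>R v s) (v s) + dd ?\<phi> (x s) (h *\<^sub>R - chr (G i) (x s) (v s) (v s))
       = h *\<^sub>R - christoffel X g j (\<gamma> s) (d s) (d s)" for h
    proof -
      have "christoffel X g j (\<gamma> s) (d s) (d s) = chr (G j) (?\<phi> (x s)) (dd ?\<phi> (x s) (v s)) (dd ?\<phi> (x s) (v s))"
        unfolding christoffel_eq[OF jX(1) ij(2)[OF s]] ij(4)[OF s] d_def ..
      also have "\<dots> = dd ?\<phi> (x s) (chr (G i) (x s) (v s) (v s)) - d2 (x s) (v s) (v s)"
        by (rule chr_transform[OF xD])
      finally have c: "christoffel X g j (\<gamma> s) (d s) (d s) = dd ?\<phi> (x s) (chr (G i) (x s) (v s) (v s)) - d2 (x s) (v s) (v s)" .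
      show ?thesis
        unfolding c using linear_scale[OF has_derivative_linear[OF d\<phi>_has[OF xD]]]
        by (simp add: linear_scale[OF d\<phi>_linear[OF xD]] linear_neg[OF d\<phi>_linear[OF xD]] algebra_simps)
    qed
    ultimately show ?thesis unfolding has_vector_derivative_def by simp
  qed
  have pj: "\<gamma> s \<in> patch X j" if "\<bar>s - t\<bar> < e" for s using ij that by blast
  note nI = geodesic_nearI[OF jX(1) e(1) pj c d']
  show "geodesic_near X g j \<gamma> t" by (rule nI(1))
  have "vel X j \<gamma> t = d t" by (rule nI(2))
  then show "vel X j \<gamma> t = transition_deriv X i j (\<gamma> t) (vel X i \<gamma> t)"
    by (simp add: d_def transition_deriv_def x_def v_def)
qed

text \<open>By \<open>geodesic_near_transform\<close> the equation in one chart at each time implies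
  it in all charts, and continuity in the atlas topology is recovered from differentiability in
  these charts.\<close>

lemma geodesic_iff: "geodesic X g \<gamma> \<longleftrightarrow> (\<forall>t. \<exists>i. geodesic_near X g i \<gamma> t)"
proof
  assume geo: "geodesic X g \<gamma>"
  then have cont: "continuous_map euclideanreal (atlas_topology X) \<gamma>" by (simp add: geodesic_def)
  show "\<forall>t. \<exists>i. geodesic_near X g i \<gamma> t"
  proof
    fix t
    have "\<gamma> t \<in> points X" using cont topspace_eq unfolding continuous_map_def by auto
    then obtain i where i: "i \<in> indices X" "\<gamma> t \<in> patch X i" using points_chart by blast
    obtain d where d: "d > 0" "\<forall>s. \<bar>s - t\<bar> < d \<longrightarrow> \<gamma> s \<in> patch X i"
      by (rule continuous_map_near[OF cont openin_patch[OF i(1)] i(2)]) blast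
    have "((\<lambda>s. coord X i (\<gamma> s)) has_vector_derivative vel X i \<gamma> s) (at s) \<and>
     (vel X i \<gamma> has_vector_derivative - christoffel X g i (\<gamma> s) (vel X i \<gamma> s) (vel X i \<gamma> s)) (at s)"
      if "\<bar>s - t\<bar> < d" for s
    proof -
      have "i \<in> charts_at X (\<gamma> s)" using d that i by (auto simp: charts_at_def)
      then have "(coord X i \<circ> \<gamma>) differentiable (at s)"
        "((\<lambda>s. vector_derivative (coord X i \<circ> \<gamma>) (at s)) has_vector_derivative
          - christoffel X g i (\<gamma> s) (vector_derivative (coord X i \<circ> \<gamma>) (at s)) (vector_derivative (coord X i \<circ> \<gamma>) (at s))) (at s)"
        using geo unfolding geodesic_def Let_def by blast+
      then show ?thesis
        using vector_derivative_works unfolding vel_def[abs_def] o_def by auto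
    qed
    then show "\<exists>i. geodesic_near X g i \<gamma> t" unfolding geodesic_near_def using d i by auto
  qed
next
  assume near: "\<forall>t. \<exists>i. geodesic_near X g i \<gamma> t"
  show "geodesic X g \<gamma>"
    unfolding geodesic_def Let_def
  proof (intro conjI allI ballI)
    show "continuous_map euclideanreal (atlas_topology X) \<gamma>"
    proof (rule continuous_map_curve)
      fix t
      obtain i where i: "geodesic_near X g i \<gamma> t" using near by blast
      have "isCont (\<lambda>s. coord X i (\<gamma> s)) t"
        using geodesic_near_at(2)[OF i] by (rule has_vector_derivative_continuous)
      then show "\<exists>i\<in>indices X. \<exists>d>0. (\<forall>s. \<bar>s - t\<bar> < d \<longrightarrow> \<gamma> s \<in> patch X i) \<and> isCont (\<lambda>s. coord X i (\<gamma> s)) t"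
        using i unfolding geodesic_near_def by blast
    qed
    fix t i assume i: "i \<in> charts_at X (\<gamma> t)"
    then have n: "geodesic_near X g i \<gamma> t" using near geodesic_near_transform(1) by blast
    have v: "(\<lambda>s. vector_derivative (coord X i \<circ> \<gamma>) (at s)) = vel X i \<gamma>" by (simp add: vel_def[abs_def] o_def)
    show "(coord X i \<circ> \<gamma>) differentiable (at t)"
      using geodesic_near_at(2)[OF n] unfolding o_def by (rule differentiableI_vector)
    show "((\<lambda>s. vector_derivative (coord X i \<circ> \<gamma>) (at s)) has_vector_derivative
          - christoffel X g i (\<gamma> t) (vector_derivative (coord X i \<circ> \<gamma>) (at t)) (vector_derivative (coord X i \<circ> \<gamma>) (at t))) (at t)"
      using geodesic_near_at(3)[OF n] unfolding v fun_cong[OF v] .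
  qed
qed

lemma geodesic_from_iff:
  "geodesic_from X g i p v \<gamma> \<longleftrightarrow> (\<forall>t. \<exists>i. geodesic_near X g i \<gamma> t) \<and> \<gamma> 0 = p \<and> vel X i \<gamma> 0 = v"
  unfolding geodesic_from_def geodesic_iff vel_def o_def ..

lemma geodesic_unique_local:
  assumes g1: "geodesic_near X g i \<gamma>1 t" and g2: "geodesic_near X g i \<gamma>2 t"
    and eq: "\<gamma>1 t = \<gamma>2 t" "vel X i \<gamma>1 t = vel X i \<gamma>2 t"
  obtains \<delta> where "\<delta> > 0" "\<forall>s. \<bar>s - t\<bar> < \<delta> \<longrightarrow> \<gamma>1 s = \<gamma>2 s"
proof -
  obtain \<delta>1 where \<delta>1: "i \<in> indices X" "\<delta>1 > 0" "\<forall>s. \<bar>s - t\<bar> < \<delta>1 \<longrightarrow> \<gamma>1 s \<in> patch X i"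
    "\<forall>s. \<bar>s - t\<bar> < \<delta>1 \<longrightarrow> ((\<lambda>s. coord X i (\<gamma>1 s)) has_vector_derivative vel X i \<gamma>1 s) (at s)"
    "\<forall>s. \<bar>s - t\<bar> < \<delta>1 \<longrightarrow> (vel X i \<gamma>1 has_vector_derivative - christoffel X g i (\<gamma>1 s) (vel X i \<gamma>1 s) (vel X i \<gamma>1 s)) (at s)"
    using g1 by (rule geodesic_nearE)
  obtain \<delta>2 where \<delta>2: "i \<in> indices X" "\<delta>2 > 0" "\<forall>s. \<bar>s - t\<bar> < \<delta>2 \<longrightarrow> \<gamma>2 s \<in> patch X i"
    "\<forall>s. \<bar>s - t\<bar> < \<delta>2 \<longrightarrow> ((\<lambda>s. coord X i (\<gamma>2 s)) has_vector_derivative vel X i \<gamma>2 s) (at s)"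
    "\<forall>s. \<bar>s - t\<bar> < \<delta>2 \<longrightarrow> (vel X i \<gamma>2 has_vector_derivative - christoffel X g i (\<gamma>2 s) (vel X i \<gamma>2 s) (vel X i \<gamma>2 s)) (at s)"
    using g2 by (rule geodesic_nearE)
  interpret chart_metric "chart i" "G i" by (rule chart_metric[OF \<delta>1(1)])
  let ?\<Omega> = "chart i \<times> (UNIV :: 'e set)"
  let ?f = "\<lambda>y. (snd y, - chr (G i) (fst y) (snd y) (snd y))"
  have op: "open ?\<Omega>" by (intro open_Times open_U open_UNIV)
  have s1: "smooth_on ?\<Omega> (\<lambda>y. chr (G i) (fst y) a b)" for a b
    by (rule smooth_on_compose[OF op open_U smooth_chr smooth_on_bounded_linear_self[OF bounded_linear_fst op]]) auto
  have s2: "smooth_on ?\<Omega> (\<lambda>y. snd y)" by (rule smooth_on_bounded_linear_self[OF bounded_linear_snd op])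
  have "smooth_on ?\<Omega> (\<lambda>y. \<Sum>a\<in>Basis. \<Sum>b\<in>Basis. ((snd y \<bullet> a) * (snd y \<bullet> b)) *\<^sub>R chr (G i) (fst y) a b)"
    by (intro smooth_on_sum smooth_on_scaleR smooth_on_mult smooth_on_inner smooth_on_const s1 s2 op)
  then have "smooth_on ?\<Omega> (\<lambda>y. chr (G i) (fst y) (snd y) (snd y))"
    by (rule smooth_on_cong[OF op]) (auto simp: bilinear_euclidean_sum[OF bilinear_chr, symmetric])
  then have f: "smooth_on ?\<Omega> ?f" by (intro smooth_on_Pair smooth_on_uminus op s2)
  let ?y = "\<lambda>\<gamma> s. (coord X i (\<gamma> s), vel X i \<gamma> s)"
  have y: "(?y \<gamma> has_vector_derivative ?f (?y \<gamma> s)) (at s)"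
    if "\<gamma> s \<in> patch X i" "((\<lambda>s. coord X i (\<gamma> s)) has_vector_derivative vel X i \<gamma> s) (at s)"
      "(vel X i \<gamma> has_vector_derivative - christoffel X g i (\<gamma> s) (vel X i \<gamma> s) (vel X i \<gamma> s)) (at s)" for \<gamma> s
    using has_vector_derivative_Pair[OF that(2,3)] by (simp add: christoffel_eq[OF \<delta>1(1) that(1)])
  obtain \<delta> where \<delta>: "\<delta> > 0" "\<forall>s. \<bar>s - t\<bar> < \<delta> \<longrightarrow> ?y \<gamma>1 s = ?y \<gamma>2 s"
  proof (rule ode_unique_local[OF op f, where e="min \<delta>1 \<delta>2" and t=t and y="?y \<gamma>1" and z="?y \<gamma>2"])
    fix s assume s: "\<bar>s - t\<bar> < min \<delta>1 \<delta>2"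
    show "(?y \<gamma>1 has_vector_derivative ?f (?y \<gamma>1 s)) (at s)" by (rule y) (use s \<delta>1 in auto)
    show "(?y \<gamma>2 has_vector_derivative ?f (?y \<gamma>2 s)) (at s)" by (rule y) (use s \<delta>2 in auto)
  qed (use eq \<delta>1 \<delta>2 in auto)
  show thesis
  proof (rule that[of "min \<delta> (min \<delta>1 \<delta>2)"], safe)
    fix s assume s: "\<bar>s - t\<bar> < min \<delta> (min \<delta>1 \<delta>2)"
    then have "coord X i (\<gamma>1 s) = coord X i (\<gamma>2 s)" "\<gamma>1 s \<in> patch X i" "\<gamma>2 s \<in> patch X i"
      using \<delta> \<delta>1 \<delta>2 by auto
    then show "\<gamma>1 s = \<gamma>2 s" using inj_coord[OF \<delta>1(1)] by (auto simp: inj_on_def)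
  qed (use \<delta> \<delta>1 \<delta>2 in auto)
qed

lemma geodesic_near_openin:
  assumes gi: "geodesic_near X g i \<gamma> t" and W: "openin (atlas_topology X) W" "\<gamma> t \<in> W"
  obtains \<delta> where "\<delta> > 0" "\<forall>s. \<bar>s - t\<bar> < \<delta> \<longrightarrow> \<gamma> s \<in> W"
proof -
  obtain d where d: "i \<in> indices X" "d > 0" "\<And>s. \<bar>s - t\<bar> < d \<Longrightarrow> \<gamma> s \<in> patch X i"
    using gi unfolding geodesic_near_def by blast
  have "isCont (\<lambda>s. coord X i (\<gamma> s)) t"
    using geodesic_near_at(2)[OF gi] by (rule has_vector_derivative_continuous)
  from curve_near[OF d this W] that show thesis by blast
qed

definition geodesic_on :: "real set \<Rightarrow> (real \<Rightarrow> 'a) \<Rightarrow> bool" where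
  "geodesic_on I \<gamma> \<longleftrightarrow> (\<forall>t\<in>I. \<exists>i. geodesic_near X g i \<gamma> t)"

lemma geodesic_onD: "geodesic_on I \<gamma> \<Longrightarrow> t \<in> I \<Longrightarrow> i \<in> charts_at X (\<gamma> t) \<Longrightarrow> geodesic_near X g i \<gamma> t"
  unfolding geodesic_on_def using geodesic_near_transform(1) by blast

lemma geodesic_on_chart: "geodesic_on I \<gamma> \<Longrightarrow> t \<in> I \<Longrightarrow> \<exists>i. i \<in> charts_at X (\<gamma> t)"
  unfolding geodesic_on_def by (auto dest: geodesic_near_at(1))

end

section \<open>Reparametrisation and constant speed\<close>

context riemannian begin

lemma geodesic_on_subset: "geodesic_on I \<gamma> \<Longrightarrow> J \<subseteq> I \<Longrightarrow> geodesic_on J \<gamma>"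
  by (auto simp: geodesic_on_def)

lemma geodesic_on_cong:
  assumes "geodesic_on I \<gamma>" "open I" "\<And>t. t \<in> I \<Longrightarrow> \<gamma> t = \<gamma>' t"
  shows "geodesic_on I \<gamma>'"
  unfolding geodesic_on_def
proof
  fix t assume t: "t \<in> I"
  then obtain i where i: "geodesic_near X g i \<gamma> t" using assms(1) by (auto simp: geodesic_on_def)
  obtain e where e: "e > 0" "ball t e \<subseteq> I" using t assms(2) openE by blast
  have "geodesic_near X g i \<gamma>' t"
    by (rule geodesic_near_cong[OF i e(1)]) (use e(2) assms(3) in \<open>auto simp: dist_real_def subset_eq abs_minus_commute\<close>)
  then show "\<exists>i. geodesic_near X g i \<gamma>' t" ..
qed

lemma vel_cong_open:
  assumes "open I" "t \<in> I" "\<And>s. s \<in> I \<Longrightarrow> \<gamma> s = \<gamma>' s"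
  shows "vel X i \<gamma> t = vel X i \<gamma>' t"
proof -
  obtain e where e: "e > 0" "ball t e \<subseteq> I" using assms openE by blast
  show ?thesis
    by (rule vel_cong[OF e(1)]) (use e(2) assms(3) in \<open>auto simp: dist_real_def subset_eq abs_minus_commute\<close>)
qed

text \<open>Both sides of the geodesic equation scale with the square of \<open>a\<close>. This
  covers rescaling, time shift and, with \<open>a\<close> equal to -1, time reversal.\<close>

lemma geodesic_affine:
  assumes gi: "geodesic_near X g i \<gamma> (a * t + b)" and a: "a \<noteq> 0"
  shows "geodesic_near X g i (\<lambda>s. \<gamma> (a * s + b)) t" "vel X i (\<lambda>s. \<gamma> (a * s + b)) t = a *\<^sub>R vel X i \<gamma> (a * t + b)"
proof -
  obtain \<delta> where \<delta>: "i \<in> indices X" "\<delta> > 0" "\<forall>s. \<bar>s - (a * t + b)\<bar> < \<delta> \<longrightarrow> \<gamma> s \<in> patch X i"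
    "\<forall>s. \<bar>s - (a * t + b)\<bar> < \<delta> \<longrightarrow> ((\<lambda>s. coord X i (\<gamma> s)) has_vector_derivative vel X i \<gamma> s) (at s)"
    "\<forall>s. \<bar>s - (a * t + b)\<bar> < \<delta> \<longrightarrow> (vel X i \<gamma> has_vector_derivative - christoffel X g i (\<gamma> s) (vel X i \<gamma> s) (vel X i \<gamma> s)) (at s)"
    using gi by (rule geodesic_nearE)
  have near: "\<bar>(a * s + b) - (a * t + b)\<bar> < \<delta>" if "\<bar>s - t\<bar> < \<delta> / \<bar>a\<bar>" for s
  proof -
    have "\<bar>(a * s + b) - (a * t + b)\<bar> = \<bar>a\<bar> * \<bar>s - t\<bar>" by (simp add: abs_mult[symmetric] algebra_simps)
    then show ?thesis using that a by (simp add: field_simps)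
  qed
  have lin: "((\<lambda>s. a * s + b) has_vector_derivative a) (at s)" for s
    by (auto intro!: derivative_eq_intros simp: has_real_derivative_iff_has_vector_derivative[symmetric])
  have *: "((\<lambda>s. f (a * s + b)) has_vector_derivative a *\<^sub>R f') (at s)"
    if "(f has_vector_derivative f') (at (a * s + b))" for f :: "real \<Rightarrow> 'e" and f' s
    using vector_diff_chain_at[OF lin that] by (simp add: o_def)
  have p: "\<gamma> (a * s + b) \<in> patch X i" if "\<bar>s - t\<bar> < \<delta> / \<bar>a\<bar>" for s
    using \<delta>(3) near[OF that] by blast
  have c: "((\<lambda>s. coord X i (\<gamma> (a * s + b))) has_vector_derivative a *\<^sub>R vel X i \<gamma> (a * s + b)) (at s)"
    if "\<bar>s - t\<bar> < \<delta> / \<bar>a\<bar>" for s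
    by (rule *[OF \<delta>(4)[rule_format, OF near[OF that]]])
  have d: "((\<lambda>s. a *\<^sub>R vel X i \<gamma> (a * s + b)) has_vector_derivative
      - christoffel X g i (\<gamma> (a * s + b)) (a *\<^sub>R vel X i \<gamma> (a * s + b)) (a *\<^sub>R vel X i \<gamma> (a * s + b))) (at s)"
    if s: "\<bar>s - t\<bar> < \<delta> / \<bar>a\<bar>" for s
  proof -
    have B: "bilinear (christoffel X g i (\<gamma> (a * s + b)))"
      unfolding christoffel_eq[OF \<delta>(1) p[OF s]]
      by (rule chart_metric.bilinear_chr[OF chart_metric[OF \<delta>(1)]]) (use p[OF s] in auto)
    have "((\<lambda>s. a *\<^sub>R vel X i \<gamma> (a * s + b)) has_vector_derivative a *\<^sub>R (a *\<^sub>R - christoffel X g i (\<gamma> (a * s + b)) (vel X i \<gamma> (a * s + b)) (vel X i \<gamma> (a * s + b)))) (at s)"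
      by (rule bounded_linear.has_vector_derivative[OF bounded_linear_scaleR_right *[OF \<delta>(5)[rule_format, OF near[OF s]]]])
    then show ?thesis by (simp add: bilinear_lmul[OF B] bilinear_rmul[OF B])
  qed
  have "0 < \<delta> / \<bar>a\<bar>" using \<delta>(2) a by simp
  note nI = geodesic_nearI[OF \<delta>(1) this p c d]
  show "geodesic_near X g i (\<lambda>s. \<gamma> (a * s + b)) t" by (rule nI(1))
  show "vel X i (\<lambda>s. \<gamma> (a * s + b)) t = a *\<^sub>R vel X i \<gamma> (a * t + b)" by (rule nI(2))
qed

lemma geodesic_on_affine:
  assumes "geodesic_on I \<gamma>" "a \<noteq> 0" "\<And>t. t \<in> J \<Longrightarrow> a * t + b \<in> I"
  shows "geodesic_on J (\<lambda>s. \<gamma> (a * s + b))"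
  unfolding geodesic_on_def
proof
  fix t assume "t \<in> J"
  then obtain i where "geodesic_near X g i \<gamma> (a * t + b)" using assms unfolding geodesic_on_def by blast
  then show "\<exists>i. geodesic_near X g i (\<lambda>s. \<gamma> (a * s + b)) t" using geodesic_affine(1) assms(2) by blast
qed

lemma tnorm_transform:
  "i \<in> charts_at X p \<Longrightarrow> j \<in> charts_at X p \<Longrightarrow> tnorm g j p (transition_deriv X i j p u) = tnorm g i p u"
  by (simp add: tnorm_def metric_transform[symmetric])

lemma tnorm_scaleR: "i \<in> charts_at X p \<Longrightarrow> tnorm g i p (a *\<^sub>R u) = \<bar>a\<bar> * tnorm g i p u"
  by (simp add: tnorm_def bilinear_lmul[OF bilinear_metric] bilinear_rmul[OF bilinear_metric] real_sqrt_mult mult.assoc[symmetric])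

text \<open>Along the curve the derivative of the metric cancels against the two Christoffel terms,
  by \<open>metric_compatible\<close>.\<close>

lemma speed_locally_constant:
  assumes gi: "geodesic_near X g i \<gamma> t"
  obtains \<delta> where "\<delta> > 0" "\<forall>s. \<bar>s - t\<bar> < \<delta> \<longrightarrow> i \<in> charts_at X (\<gamma> s) \<and> tnorm g i (\<gamma> s) (vel X i \<gamma> s) = tnorm g i (\<gamma> t) (vel X i \<gamma> t)"
proof -
  obtain \<delta> where \<delta>: "i \<in> indices X" "\<delta> > 0" "\<forall>s. \<bar>s - t\<bar> < \<delta> \<longrightarrow> \<gamma> s \<in> patch X i"
    "\<forall>s. \<bar>s - t\<bar> < \<delta> \<longrightarrow> ((\<lambda>s. coord X i (\<gamma> s)) has_vector_derivative vel X i \<gamma> s) (at s)"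
    "\<forall>s. \<bar>s - t\<bar> < \<delta> \<longrightarrow> (vel X i \<gamma> has_vector_derivative - christoffel X g i (\<gamma> s) (vel X i \<gamma> s) (vel X i \<gamma> s)) (at s)"
    using gi by (rule geodesic_nearE)
  interpret chart_metric "chart i" "G i" by (rule chart_metric[OF \<delta>(1)])
  define x where "x s = coord X i (\<gamma> s)" for s
  define v where "v = vel X i \<gamma>"
  have der: "((\<lambda>s. G i (x s) (v s) (v s)) has_vector_derivative 0) (at s)" if s: "\<bar>s - t\<bar> < \<delta>" for s
  proof -
    have p: "\<gamma> s \<in> patch X i" using \<delta>(3) s by blast
    then have xU: "x s \<in> chart i" by (auto simp: x_def)
    note B = bil[OF xU]
    have "(x has_derivative (\<lambda>h. h *\<^sub>R v s)) (at s)"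
      using \<delta>(4)[rule_format, OF s] unfolding x_def[abs_def] v_def has_vector_derivative_def .
    moreover have v': "(v has_derivative (\<lambda>h. h *\<^sub>R - chr (G i) (x s) (v s) (v s))) (at s)"
      using \<delta>(5)[rule_format, OF s] unfolding christoffel_eq[OF \<delta>(1) p] x_def v_def has_vector_derivative_def .
    ultimately have "((\<lambda>s. G i (x s) (v s) (v s)) has_derivative (\<lambda>h. dd (\<lambda>q. G i q (v s) (v s)) (x s) (h *\<^sub>R v s)
        + G i (x s) (h *\<^sub>R - chr (G i) (x s) (v s) (v s)) (v s) + G i (x s) (v s) (h *\<^sub>R - chr (G i) (x s) (v s) (v s)))) (at s)"
      by (intro has_derivative_bilinear_field[where D="chart i" and H="G i"] open_U xU bil smooth_G v')
    moreover have "dd (\<lambda>q. G i q (v s) (v s)) (x s) (h *\<^sub>R v s)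
        + G i (x s) (h *\<^sub>R - chr (G i) (x s) (v s) (v s)) (v s) + G i (x s) (v s) (h *\<^sub>R - chr (G i) (x s) (v s) (v s)) = 0" for h
      by (simp add: linear_scale[OF dd_G_linear[OF xU]] metric_compatible[OF xU] bilinear_lmul[OF B] bilinear_rmul[OF B]
          bilinear_lneg[OF B] bilinear_rneg[OF B] bilinear_lmul[OF bilinear_chr[OF xU]] algebra_simps)
    ultimately show ?thesis unfolding has_vector_derivative_def by simp
  qed
  have cst: "G i (x s) (v s) (v s) = G i (x t) (v t) (v t)" if s: "\<bar>s - t\<bar> < \<delta>" for s
  proof -
    have "norm (G i (x s) (v s) (v s) - G i (x t) (v t) (v t)) \<le> 0 * \<bar>s - t\<bar>"
      by (rule has_vector_derivative_bound[where S="{t - \<delta><..<t + \<delta>}" and f'="\<lambda>_. 0"])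
        (use s \<delta>(2) der in \<open>auto simp: abs_less_iff\<close>)
    then show ?thesis by simp
  qed
  show thesis
  proof (rule that[OF \<delta>(2)], intro allI impI conjI)
    fix s assume s: "\<bar>s - t\<bar> < \<delta>"
    have "\<gamma> s \<in> patch X i" "\<gamma> t \<in> patch X i" using \<delta>(2,3) s by auto
    then show "i \<in> charts_at X (\<gamma> s)" "tnorm g i (\<gamma> s) (vel X i \<gamma> s) = tnorm g i (\<gamma> t) (vel X i \<gamma> t)"
      using cst[OF s] \<delta>(1) by (auto simp: tnorm_def x_def v_def charts_at_def)
  qed
qed

lemma speed_constant:
  assumes geo: "geodesic_on I \<gamma>" and I: "convex I" "s \<in> I" "t \<in> I"
    and i: "i \<in> charts_at X (\<gamma> s)" and j: "j \<in> charts_at X (\<gamma> t)"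
  shows "tnorm g i (\<gamma> s) (vel X i \<gamma> s) = tnorm g j (\<gamma> t) (vel X j \<gamma> t)"
proof -
  \<comment> \<open>An arbitrary choice of chart at each time turns the speed into one function on
    \<open>I\<close>; by \<open>tnorm_transform\<close> its value does not depend on the choice, so
    locally it can be computed in a fixed chart.\<close>
  define speed where "speed t = (let i = SOME i. i \<in> charts_at X (\<gamma> t) in tnorm g i (\<gamma> t) (vel X i \<gamma> t))" for t
  have sp: "speed t = tnorm g i (\<gamma> t) (vel X i \<gamma> t)" if t: "t \<in> I" and i: "i \<in> charts_at X (\<gamma> t)" for t i
  proof -
    define k where "k = (SOME i. i \<in> charts_at X (\<gamma> t))"
    have k: "k \<in> charts_at X (\<gamma> t)" unfolding k_def using i by (rule someI)
    have "vel X k \<gamma> t = transition_deriv X i k (\<gamma> t) (vel X i \<gamma> t)"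
      by (rule geodesic_near_transform(2)[OF geodesic_onD[OF geo t i] k])
    then show ?thesis unfolding speed_def Let_def k_def[symmetric] using tnorm_transform[OF i k] by simp
  qed
  have der: "(speed has_vector_derivative 0) (at t within I)" if t: "t \<in> I" for t
  proof -
    obtain i where i: "i \<in> charts_at X (\<gamma> t)" using geodesic_on_chart[OF geo t] by blast
    obtain \<delta> where \<delta>: "\<delta> > 0" "\<forall>s. \<bar>s - t\<bar> < \<delta> \<longrightarrow> i \<in> charts_at X (\<gamma> s) \<and> tnorm g i (\<gamma> s) (vel X i \<gamma> s) = tnorm g i (\<gamma> t) (vel X i \<gamma> t)"
      by (rule speed_locally_constant[OF geodesic_onD[OF geo t i]]) blast
    have eq: "speed t = speed s" if s: "s \<in> I" "dist s t < \<delta>" for s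
    proof -
      have "i \<in> charts_at X (\<gamma> s)" "tnorm g i (\<gamma> s) (vel X i \<gamma> s) = tnorm g i (\<gamma> t) (vel X i \<gamma> t)"
        using \<delta>(2) s(2) unfolding dist_real_def by blast+
      then show ?thesis using sp[OF s(1)] sp[OF t i] by simp
    qed
    show ?thesis
      by (rule has_vector_derivative_transform_within[OF has_vector_derivative_const \<delta>(1) t eq])
  qed
  have "\<exists>c. \<forall>x\<in>I. speed x = c"
  proof (rule has_derivative_zero_constant[OF I(1)])
    fix t assume "t \<in> I"
    from der[OF this] show "(speed has_derivative (\<lambda>h. 0)) (at t within I)"
      by (simp add: has_vector_derivative_def)
  qed
  then have "speed s = speed t" using I by auto
  then show ?thesis using sp[OF I(2) i] sp[OF I(3) j] by simp
qed

end

section \<open>Global uniqueness of geodesics\<close>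

locale riemannian_hausdorff = riemannian +
  assumes hausdorff: "Hausdorff_space (atlas_topology X)"
begin

text \<open>The set of times at which points and velocities agree is open by local uniqueness. Its
  complement in \<open>I\<close> is open too: distinct points are separated by the Hausdorff
  property, distinct velocities by continuity. Connectedness of \<open>I\<close> decides.\<close>

lemma geodesic_unique:
  assumes geo: "geodesic_on I \<gamma>1" "geodesic_on I \<gamma>2" and I: "open I" "connected I" "t0 \<in> I"
    and init: "\<gamma>1 t0 = \<gamma>2 t0" "i0 \<in> charts_at X (\<gamma>1 t0)" "vel X i0 \<gamma>1 t0 = vel X i0 \<gamma>2 t0"
    and t: "t \<in> I"
  shows "\<gamma>1 t = \<gamma>2 t"
proof -
  define A where "A = {t \<in> I. \<gamma>1 t = \<gamma>2 t \<and> (\<forall>i\<in>charts_at X (\<gamma>1 t). vel X i \<gamma>1 t = vel X i \<gamma>2 t)}"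
  have AI: "t \<in> A" if "t \<in> I" "\<gamma>1 t = \<gamma>2 t" "i \<in> charts_at X (\<gamma>1 t)" "vel X i \<gamma>1 t = vel X i \<gamma>2 t" for t i
  proof -
    note n1 = geodesic_onD[OF geo(1) that(1,3)]
    have n2: "geodesic_near X g i \<gamma>2 t" using geodesic_onD[OF geo(2) that(1)] that by simp
    have "vel X j \<gamma>1 t = vel X j \<gamma>2 t" if "j \<in> charts_at X (\<gamma>1 t)" for j
      using geodesic_near_transform(2)[OF n1 that] geodesic_near_transform(2)[OF n2, of j] that
        \<open>\<gamma>1 t = \<gamma>2 t\<close> \<open>vel X i \<gamma>1 t = vel X i \<gamma>2 t\<close> by simp
    then show ?thesis using that by (simp add: A_def)
  qed
  have openA: "open A"
    unfolding open_dist
  proof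
    fix t assume t: "t \<in> A"
    then have tI: "t \<in> I" and eq: "\<gamma>1 t = \<gamma>2 t" by (auto simp: A_def)
    obtain i where i: "i \<in> charts_at X (\<gamma>1 t)" using geodesic_on_chart[OF geo(1) tI] by blast
    have n: "geodesic_near X g i \<gamma>1 t" "geodesic_near X g i \<gamma>2 t"
      using geodesic_onD[OF geo(1) tI i] geodesic_onD[OF geo(2) tI] i eq by auto
    have v: "vel X i \<gamma>1 t = vel X i \<gamma>2 t" using t i by (simp add: A_def)
    obtain \<delta> where \<delta>: "\<delta> > 0" "\<forall>s. \<bar>s - t\<bar> < \<delta> \<longrightarrow> \<gamma>1 s = \<gamma>2 s"
      by (rule geodesic_unique_local[OF n eq v]) blast
    obtain e where e: "e > 0" "ball t e \<subseteq> I" using tI I(1) openE by blast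
    have "s \<in> A" if s: "dist s t < min \<delta> e" for s
    proof -
      have sI: "s \<in> I" using s e(2) by (auto simp: dist_commute subset_eq)
      obtain j where j: "j \<in> charts_at X (\<gamma>1 s)" using geodesic_on_chart[OF geo(1) sI] by blast
      have "vel X j \<gamma>1 s = vel X j \<gamma>2 s"
        by (rule vel_cong_open[of "{t - \<delta><..<t + \<delta>}"]) (use s \<delta> in \<open>auto simp: dist_real_def abs_less_iff\<close>)
      then show ?thesis using AI[OF sI _ j] \<delta> s by (auto simp: dist_real_def)
    qed
    then show "\<exists>e>0. \<forall>s. dist s t < e \<longrightarrow> s \<in> A" using \<delta> e by (intro exI[of _ "min \<delta> e"]) auto
  qed
  have openC: "open (I - A)"
    unfolding open_dist
  proof
    fix t assume t: "t \<in> I - A"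
    then have tI: "t \<in> I" by auto
    obtain e where e: "e > 0" "ball t e \<subseteq> I" using tI I(1) openE by blast
    have "\<exists>\<delta>>0. \<forall>s. \<bar>s - t\<bar> < \<delta> \<longrightarrow> s \<notin> A"
    proof (cases "\<gamma>1 t = \<gamma>2 t")
      case False
      obtain i j where i: "i \<in> charts_at X (\<gamma>1 t)" and j: "j \<in> charts_at X (\<gamma>2 t)"
        using geodesic_on_chart[OF geo(1) tI] geodesic_on_chart[OF geo(2) tI] by blast
      have "\<gamma>1 t \<in> topspace (atlas_topology X)" "\<gamma>2 t \<in> topspace (atlas_topology X)"
        using i j patch_subset topspace_eq by (auto simp: charts_at_def)
      then obtain W1 W2 where W: "openin (atlas_topology X) W1" "openin (atlas_topology X) W2" "\<gamma>1 t \<in> W1" "\<gamma>2 t \<in> W2" "disjnt W1 W2"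
        using hausdorff False unfolding Hausdorff_space_def by blast
      obtain d1 where d1: "d1 > 0" "\<forall>s. \<bar>s - t\<bar> < d1 \<longrightarrow> \<gamma>1 s \<in> W1"
        by (rule geodesic_near_openin[OF geodesic_onD[OF geo(1) tI i] W(1,3)]) blast
      obtain d2 where d2: "d2 > 0" "\<forall>s. \<bar>s - t\<bar> < d2 \<longrightarrow> \<gamma>2 s \<in> W2"
        by (rule geodesic_near_openin[OF geodesic_onD[OF geo(2) tI j] W(2,4)]) blast
      have "s \<notin> A" if s: "\<bar>s - t\<bar> < min d1 d2" for s
      proof -
        have "\<gamma>1 s \<in> W1" "\<gamma>2 s \<in> W2" using s d1 d2 by auto
        then show ?thesis using W(5) unfolding A_def disjnt_def by auto
      qed
      then show ?thesis using d1 d2 by (intro exI[of _ "min d1 d2"]) auto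
    next
      case True
      with t obtain i where i: "i \<in> charts_at X (\<gamma>1 t)" "vel X i \<gamma>1 t \<noteq> vel X i \<gamma>2 t" by (auto simp: A_def)
      have n1: "geodesic_near X g i \<gamma>1 t" and n2: "geodesic_near X g i \<gamma>2 t"
        using geodesic_onD[OF geo(1) tI] geodesic_onD[OF geo(2) tI] i(1) True by auto
      have "isCont (vel X i \<gamma>1) t" "isCont (vel X i \<gamma>2) t"
        using geodesic_near_at(3)[OF n1] geodesic_near_at(3)[OF n2] has_vector_derivative_continuous by blast+
      then have "isCont (\<lambda>s. vel X i \<gamma>1 s - vel X i \<gamma>2 s) t" by (rule isCont_diff)
      then obtain d where d: "d > 0" "\<And>s. dist s t < d \<Longrightarrow> vel X i \<gamma>1 s - vel X i \<gamma>2 s \<noteq> 0"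
        using continuous_at_avoid[of t "\<lambda>s. vel X i \<gamma>1 s - vel X i \<gamma>2 s" 0] i(2)
        by (metis dist_commute right_minus_eq)
      \<comment> \<open>This supplies that \<open>i\<close> remains a chart at the nearby points of
        \<open>\<gamma>1\<close>, so that membership in \<open>A\<close> would force equal
        velocities in chart \<open>i\<close>.\<close>
      obtain d' where d': "d' > 0" "\<forall>s. \<bar>s - t\<bar> < d' \<longrightarrow> i \<in> charts_at X (\<gamma>1 s)
          \<and> tnorm g i (\<gamma>1 s) (vel X i \<gamma>1 s) = tnorm g i (\<gamma>1 t) (vel X i \<gamma>1 t)"
        by (rule speed_locally_constant[OF n1]) blast
      have "s \<notin> A" if s: "\<bar>s - t\<bar> < min d d'" for s
      proof -
        have "i \<in> charts_at X (\<gamma>1 s)" using d'(2) s by simp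
        moreover have "vel X i \<gamma>1 s - vel X i \<gamma>2 s \<noteq> 0" using d(2)[of s] s by (simp add: dist_real_def)
        ultimately show ?thesis unfolding A_def by auto
      qed
      then show ?thesis using d d' by (intro exI[of _ "min d d'"]) auto
    qed
    then obtain \<delta> where \<delta>: "\<delta> > 0" "\<forall>s. \<bar>s - t\<bar> < \<delta> \<longrightarrow> s \<notin> A" by blast
    show "\<exists>e>0. \<forall>s. dist s t < e \<longrightarrow> s \<in> I - A"
      using \<delta> e by (intro exI[of _ "min \<delta> e"]) (auto simp: dist_real_def subset_eq abs_minus_commute)
  qed
  have "t0 \<in> A" by (rule AI[OF I(3) init])
  moreover have "A \<inter> I = {} \<or> (I - A) \<inter> I = {}"
    by (rule connectedD[OF I(2) openA openC]) auto
  ultimately have "I \<subseteq> A" using I(3) by auto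
  then show ?thesis using t by (auto simp: A_def)
qed

end

subsection \<open>Completeness and injectivity radius\<close>

text \<open>\<open>c v\<close> is the coordinate expression of the geodesic with initial velocity
  \<open>v\<close>, \<open>d v\<close> is its velocity, and \<open>c v 1\<close> is to become the
  exponential map read in the chart \<open>i\<close>.\<close>

definition normal_chart ::
  "('i, 'a, 'e::euclidean_space) atlas \<Rightarrow> ('i \<Rightarrow> 'a \<Rightarrow> 'e \<Rightarrow> 'e \<Rightarrow> real) \<Rightarrow> 'i \<Rightarrow> 'a \<Rightarrow> real \<Rightarrow> bool" where
  "normal_chart X g i p \<epsilon> \<longleftrightarrow> i \<in> charts_at X p \<and>
     (\<exists>c d. (\<forall>v. tnorm g i p v < \<epsilon> \<longrightarrow> c v 0 = coord X i p \<and> d v 0 = v \<and>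
         (\<forall>s. \<bar>s\<bar> < 2 \<longrightarrow> c v s \<in> coord X i ` patch X i \<and> (c v has_vector_derivative d v s) (at s) \<and>
            (d v has_vector_derivative - christoffel X g i (param X i (c v s)) (d v s) (d v s)) (at s))) \<and>
       inj_on (\<lambda>v. c v 1) {v. tnorm g i p v < \<epsilon>} \<and> open ((\<lambda>v. c v 1) ` {v. tnorm g i p v < \<epsilon>}) \<and>
       smooth_on {v. tnorm g i p v < \<epsilon>} (\<lambda>v. c v 1) \<and>
       smooth_on ((\<lambda>v. c v 1) ` {v. tnorm g i p v < \<epsilon>}) (inv_into {v. tnorm g i p v < \<epsilon>} (\<lambda>v. c v 1)))"

context riemannian_hausdorff begin

lemma geodesic_glue:
  assumes g1: "geodesic_on {a<..<b} \<gamma>1" and g2: "geodesic_on {c<..<d} \<gamma>2"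
    and t0: "a < t0" "t0 < b" "c < t0" "b < d"
    and eq: "\<gamma>1 t0 = \<gamma>2 t0" "i \<in> charts_at X (\<gamma>1 t0)" "vel X i \<gamma>1 t0 = vel X i \<gamma>2 t0"
  obtains \<gamma> where "geodesic_on {a<..<d} \<gamma>" "\<forall>t<b. \<gamma> t = \<gamma>1 t"
proof -
  let ?\<gamma> = "\<lambda>t. if t < b then \<gamma>1 t else \<gamma>2 t"
  let ?m = "max a c"
  \<comment> \<open>Switching at \<open>b\<close> does no harm: on the overlap to its left both
    curves agree, so around \<open>b\<close> the glued curve coincides with
    \<open>\<gamma>2\<close>.\<close>
  have agree: "\<gamma>1 t = \<gamma>2 t" if "t \<in> {?m<..<b}" for t
    by (rule geodesic_unique[OF geodesic_on_subset[OF g1] geodesic_on_subset[OF g2] open_greaterThanLessThan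
          connected_Ioo, of ?m b t0 i]) (use t0 eq that in auto)
  have 1: "geodesic_on {a<..<b} ?\<gamma>"
    by (rule geodesic_on_cong[OF g1]) auto
  have "geodesic_on {?m<..<d} \<gamma>2" by (rule geodesic_on_subset[OF g2]) auto
  then have 2: "geodesic_on {?m<..<d} ?\<gamma>"
    by (rule geodesic_on_cong) (use agree in auto)
  have "geodesic_on {a<..<d} ?\<gamma>"
    unfolding geodesic_on_def
  proof
    fix t assume "t \<in> {a<..<d}"
    then have "t \<in> {a<..<b} \<or> t \<in> {?m<..<d}" using t0 by (auto simp: less_max_iff_disj max_less_iff_conj)
    then show "\<exists>i. geodesic_near X g i ?\<gamma> t" using 1 2 unfolding geodesic_on_def by blast
  qed
  then show thesis by (rule that) auto
qed

end

section \<open>Completeness and the exponential map from normal charts of uniform size\<close>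

locale uniformly_normal = riemannian_hausdorff +
  fixes \<epsilon> :: real
  assumes \<epsilon>: "\<epsilon> > 0" and normal: "\<And>p. p \<in> points X \<Longrightarrow> \<exists>i. normal_chart X g i p \<epsilon>"
begin

lemma geodesic_local_in_normal_chart:
  assumes i: "i \<in> charts_at X p" and v: "c 0 = coord X i p" "d 0 = v"
    and c: "\<And>s. \<bar>s\<bar> < 2 \<Longrightarrow> c s \<in> chart i \<and> (c has_vector_derivative d s) (at s) \<and>
            (d has_vector_derivative - christoffel X g i (param X i (c s)) (d s) (d s)) (at s)"
  shows "geodesic_on {-2<..<2} (\<lambda>s. param X i (c s))" "param X i (c 0) = p" "vel X i (\<lambda>s. param X i (c s)) 0 = v"
proof -
  have iX: "i \<in> indices X" "p \<in> patch X i" using i by (auto simp: charts_at_def)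
  have n: "geodesic_near X g i (\<lambda>s. param X i (c s)) t \<and> vel X i (\<lambda>s. param X i (c s)) t = d t" if t: "\<bar>t\<bar> < 2" for t
  proof -
    have near: "\<bar>s\<bar> < 2" if "\<bar>s - t\<bar> < 2 - \<bar>t\<bar>" for s using that by linarith
    have pos: "2 - \<bar>t\<bar> > 0" using t by simp
    have p: "param X i (c s) \<in> patch X i" if "\<bar>s - t\<bar> < 2 - \<bar>t\<bar>" for s
      using c[OF near[OF that]] param_in_patch by blast
    have c': "((\<lambda>s. coord X i (param X i (c s))) has_vector_derivative d s) (at s)" if s: "\<bar>s - t\<bar> < 2 - \<bar>t\<bar>" for s
    proof (rule has_vector_derivative_transform_within_open[of c _ _ "{-2<..<2}"])
      show "(c has_vector_derivative d s) (at s)" using c[OF near[OF s]] by blast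
      show "c r = coord X i (param X i (c r))" if "r \<in> {-2<..<2}" for r
        using c[of r] that coord_param by (auto simp: abs_less_iff)
    qed (use near[OF s] in \<open>auto simp: abs_less_iff\<close>)
    have d': "(d has_vector_derivative - christoffel X g i (param X i (c s)) (d s) (d s)) (at s)" if s: "\<bar>s - t\<bar> < 2 - \<bar>t\<bar>" for s
      using c[OF near[OF s]] by blast
    show ?thesis using geodesic_nearI[OF iX(1) pos p c' d'] by blast
  qed
  show "geodesic_on {-2<..<2} (\<lambda>s. param X i (c s))" unfolding geodesic_on_def
  proof
    fix t :: real assume "t \<in> {-2<..<2}"
    then have "\<bar>t\<bar> < 2" by (auto simp: abs_less_iff)
    then show "\<exists>i'. geodesic_near X g i' (\<lambda>s. param X i (c s)) t" using n by blast
  qed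
  show "param X i (c 0) = p" using iX v by simp
  show "vel X i (\<lambda>s. param X i (c s)) 0 = v" using n[of 0] v by simp
qed

lemma geodesic_local_exists:
  assumes j: "j \<in> charts_at X p" and u: "tnorm g j p u < \<epsilon>"
  obtains \<gamma> where "geodesic_on {-2<..<2} \<gamma>" "\<gamma> 0 = p" "vel X j \<gamma> 0 = u"
proof -
  have "p \<in> points X" using j patch_subset by (auto simp: charts_at_def)
  then obtain i where "normal_chart X g i p \<epsilon>" using normal by blast
  then obtain c d where i: "i \<in> charts_at X p" and cd: "\<forall>v. tnorm g i p v < \<epsilon> \<longrightarrow> c v 0 = coord X i p \<and> d v 0 = v \<and>
         (\<forall>s. \<bar>s\<bar> < 2 \<longrightarrow> c v s \<in> coord X i ` patch X i \<and> (c v has_vector_derivative d v s) (at s) \<and>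
            (d v has_vector_derivative - christoffel X g i (param X i (c v s)) (d v s) (d v s)) (at s))"
    unfolding normal_chart_def by blast
  define v where "v = transition_deriv X j i p u"
  have v: "tnorm g i p v < \<epsilon>" using u tnorm_transform[OF j i] by (simp add: v_def)
  have c0: "c v 0 = coord X i p" "d v 0 = v" using cd v by auto
  have c: "c v s \<in> chart i \<and> (c v has_vector_derivative d v s) (at s) \<and>
            (d v has_vector_derivative - christoffel X g i (param X i (c v s)) (d v s) (d v s)) (at s)" if "\<bar>s\<bar> < 2" for s
    using cd v that by blast
  let ?\<gamma> = "\<lambda>s. param X i (c v s)"
  note L = geodesic_local_in_normal_chart[OF i c0 c]
  have n: "geodesic_near X g i ?\<gamma> 0" by (rule geodesic_onD[OF L(1)]) (use L(2) i in auto)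
  have "vel X j ?\<gamma> 0 = transition_deriv X i j (?\<gamma> 0) (vel X i ?\<gamma> 0)"
    by (rule geodesic_near_transform(2)[OF n]) (use L(2) j in simp)
  then have "vel X j ?\<gamma> 0 = u" using L(2,3) transition_deriv_inverse[OF j i] by (simp add: v_def)
  with L(1,2) show thesis by (rule that)
qed

text \<open>At time \<open>b - 1\<close> the speed is still below \<open>\<epsilon>\<close>, as it
  is constant. A new geodesic started there lives on an interval of radius 2, so it reaches back
  into the old interval and forward to \<open>b + 1\<close>. The gain does not depend on how far the
  geodesic has come.\<close>

lemma geodesic_extend_right:
  assumes geo: "geodesic_on {-a<..<b} \<gamma>" and ab: "a \<ge> 2" "b \<ge> 2"
    and i: "i \<in> charts_at X (\<gamma> 0)" and slow: "tnorm g i (\<gamma> 0) (vel X i \<gamma> 0) < \<epsilon>"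
  obtains \<gamma>' where "geodesic_on {-a<..<b+1} \<gamma>'" "\<forall>t<b. \<gamma>' t = \<gamma> t"
proof -
  have mem: "b - 1 \<in> {-a<..<b}" "0 \<in> {-a<..<b}" using ab by auto
  obtain j where j: "j \<in> charts_at X (\<gamma> (b - 1))" using geodesic_on_chart[OF geo mem(1)] by blast
  have "tnorm g j (\<gamma> (b - 1)) (vel X j \<gamma> (b - 1)) < \<epsilon>"
    using speed_constant[OF geo _ mem j i] slow by simp
  then obtain \<eta> where \<eta>: "geodesic_on {-2<..<2} \<eta>" "\<eta> 0 = \<gamma> (b - 1)" "vel X j \<eta> 0 = vel X j \<gamma> (b - 1)"
    by (rule geodesic_local_exists[OF j])
  let ?\<eta> = "\<lambda>s. \<eta> (1 * s + (1 - b))"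
  have 1: "geodesic_on {b - 3<..<b + 1} ?\<eta>" by (rule geodesic_on_affine[OF \<eta>(1)]) auto
  have "geodesic_near X g j \<eta> (1 * (b - 1) + (1 - b))"
    using geodesic_onD[OF \<eta>(1), of 0 j] j \<eta>(2) by simp
  from geodesic_affine(2)[OF this]
  have v: "vel X j ?\<eta> (b - 1) = vel X j \<gamma> (b - 1)" using \<eta>(3) by simp
  obtain \<gamma>' where "geodesic_on {-a<..<b + 1} \<gamma>'" "\<forall>t<b. \<gamma>' t = \<gamma> t"
    by (rule geodesic_glue[OF geo 1, of "b - 1" j]) (use ab j \<eta>(2) v in auto)
  then show thesis by (rule that)
qed

text \<open>Extend to the right, reverse time, extend to the right again, and reverse back.\<close>

lemma geodesic_extend:
  assumes geo: "geodesic_on {-a<..<a} \<gamma>" and a: "a \<ge> 2"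
    and i: "i \<in> charts_at X (\<gamma> 0)" and slow: "tnorm g i (\<gamma> 0) (vel X i \<gamma> 0) < \<epsilon>"
  obtains \<gamma>' where "geodesic_on {-(a+1)<..<a+1} \<gamma>'" "\<gamma>' 0 = \<gamma> 0" "vel X i \<gamma>' 0 = vel X i \<gamma> 0"
proof -
  obtain \<gamma>1 where \<gamma>1: "geodesic_on {-a<..<a+1} \<gamma>1" "\<forall>t<a. \<gamma>1 t = \<gamma> t"
    by (rule geodesic_extend_right[OF geo a a i slow]) blast
  have v1: "\<gamma>1 0 = \<gamma> 0" "vel X i \<gamma>1 0 = vel X i \<gamma> 0"
    using \<gamma>1(2) a vel_cong_open[of "{..<a}" 0 \<gamma>1 \<gamma>] by auto
  have n1: "geodesic_near X g i \<gamma>1 0" by (rule geodesic_onD[OF \<gamma>1(1)]) (use a i v1 in auto)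
  let ?r = "\<lambda>s. \<gamma>1 ((-1) * s + 0)"
  have r: "geodesic_on {-(a+1)<..<a} ?r" by (rule geodesic_on_affine[OF \<gamma>1(1)]) auto
  have "geodesic_near X g i \<gamma>1 ((-1) * 0 + 0)" using n1 by simp
  from geodesic_affine(2)[OF this] have vr: "vel X i ?r 0 = (-1) *\<^sub>R vel X i \<gamma>1 0" by simp
  have "tnorm g i (?r 0) (vel X i ?r 0) < \<epsilon>" "i \<in> charts_at X (?r 0)"
    unfolding vr using slow i v1 tnorm_scaleR[OF i, of "-1"] by simp_all
  then obtain \<gamma>2 where \<gamma>2: "geodesic_on {-(a+1)<..<a+1} \<gamma>2" "\<forall>t<a. \<gamma>2 t = ?r t"
    using geodesic_extend_right[OF r, of i] a by auto
  have v2: "\<gamma>2 0 = \<gamma> 0" "vel X i \<gamma>2 0 = - vel X i \<gamma> 0"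
    using \<gamma>2(2) a vel_cong_open[of "{..<a}" 0 \<gamma>2 ?r] vr v1 by auto
  have n2: "geodesic_near X g i \<gamma>2 ((-1) * 0 + 0)"
    using geodesic_onD[OF \<gamma>2(1), of 0 i] a i v2 by simp
  show thesis
  proof (rule that)
    show "geodesic_on {-(a+1)<..<a+1} (\<lambda>s. \<gamma>2 ((-1) * s + 0))" by (rule geodesic_on_affine[OF \<gamma>2(1)]) auto
    show "vel X i (\<lambda>s. \<gamma>2 ((-1) * s + 0)) 0 = vel X i \<gamma> 0"
      using geodesic_affine(2)[OF n2] v2 by simp
  qed (use v2 in auto)
qed

lemma slow_geodesic_exists:
  assumes i: "i \<in> charts_at X p" and slow: "tnorm g i p v < \<epsilon>"
  obtains \<gamma> where "geodesic_on UNIV \<gamma>" "\<gamma> 0 = p" "vel X i \<gamma> 0 = v"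
proof -
  have "\<exists>\<gamma>. geodesic_on {-(real n + 2)<..<real n + 2} \<gamma> \<and> \<gamma> 0 = p \<and> vel X i \<gamma> 0 = v" for n
  proof (induction n)
    case 0
    obtain \<gamma> where "geodesic_on {-2<..<2} \<gamma>" "\<gamma> 0 = p" "vel X i \<gamma> 0 = v" by (rule geodesic_local_exists[OF i slow])
    then show ?case by auto
  next
    case (Suc n)
    then obtain \<gamma> where \<gamma>: "geodesic_on {-(real n + 2)<..<real n + 2} \<gamma>" "\<gamma> 0 = p" "vel X i \<gamma> 0 = v" by blast
    obtain \<gamma>' where "geodesic_on {-(real n + 2 + 1)<..<real n + 2 + 1} \<gamma>'" "\<gamma>' 0 = \<gamma> 0" "vel X i \<gamma>' 0 = vel X i \<gamma> 0"
      by (rule geodesic_extend[OF \<gamma>(1)]) (use \<gamma> i slow in auto)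
    then show ?case using \<gamma> by (auto simp: algebra_simps)
  qed
  then obtain \<eta> where \<eta>: "\<And>n. geodesic_on {-(real n + 2)<..<real n + 2} (\<eta> n)" "\<And>n. \<eta> n 0 = p" "\<And>n. vel X i (\<eta> n) 0 = v"
    by metis
  have agree: "\<eta> m t = \<eta> n t" if "m \<le> n" "\<bar>t\<bar> < real m + 2" for m n t
    by (rule geodesic_unique[OF \<eta>(1) geodesic_on_subset[OF \<eta>(1)] open_greaterThanLessThan connected_Ioo, of m n 0 i])
      (use that i \<eta>(2,3) in \<open>auto simp: abs_less_iff\<close>)
  \<comment> \<open>\<open>\<eta> n\<close> is a geodesic on the interval of radius
    \<open>n + 2\<close>. At time \<open>t\<close> the curve with index \<open>N t\<close> is
    evaluated, whose interval contains \<open>t\<close>; by \<open>agree\<close> every later curve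
    has the same value there.\<close>
  define N where "N t = nat \<lceil>\<bar>t\<bar>\<rceil>" for t :: real
  have N: "\<bar>t\<bar> < real (N t) + 2" for t unfolding N_def by linarith
  define \<gamma> where "\<gamma> t = \<eta> (N t) t" for t
  have \<gamma>_eq: "\<gamma> t = \<eta> n t" if "\<bar>t\<bar> < real n" for n t
  proof -
    have "N t \<le> n" using that unfolding N_def by (simp add: ceiling_le_iff less_imp_le nat_le_iff)
    then show ?thesis unfolding \<gamma>_def using agree N by blast
  qed
  have on: "geodesic_on {-real n<..<real n} \<gamma>" for n
  proof (rule geodesic_on_cong)
    show "geodesic_on {-real n<..<real n} (\<eta> n)" by (rule geodesic_on_subset[OF \<eta>(1)[of n]]) auto
    show "\<eta> n t = \<gamma> t" if "t \<in> {-real n<..<real n}" for t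
      using \<gamma>_eq[of t n] that by (simp add: abs_less_iff)
  qed simp
  show thesis
  proof (rule that[of \<gamma>])
    show "geodesic_on UNIV \<gamma>" unfolding geodesic_on_def
    proof
      fix t :: real
      obtain n where "\<bar>t\<bar> < real n" using reals_Archimedean2 by blast
      then have "t \<in> {-real n<..<real n}" by (auto simp: abs_less_iff)
      then show "\<exists>i. geodesic_near X g i \<gamma> t" using on unfolding geodesic_on_def by blast
    qed
    show "\<gamma> 0 = p" using \<gamma>_eq[of 0 1] \<eta>(2) by simp
    have "vel X i \<gamma> 0 = vel X i (\<eta> 1) 0"
      by (rule vel_cong_open[of "{-1<..<1}"]) (use \<gamma>_eq[of _ 1] in \<open>auto simp: abs_less_iff\<close>)
    then show "vel X i \<gamma> 0 = v" using \<eta>(3) by simp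
  qed
qed

lemma geodesic_from_exists:
  assumes i: "i \<in> charts_at X p"
  shows "\<exists>\<gamma>. geodesic_from X g i p v \<gamma>"
proof -
  \<comment> \<open>The factor slows \<open>v\<close> down to a speed below
    \<open>\<epsilon>\<close>; the summand 1 keeps the denominator positive. The resulting geodesic
    is afterwards run faster by \<open>1 / a\<close>.\<close>
  define a where "a = \<epsilon> / (2 * (tnorm g i p v + 1))"
  have t0: "tnorm g i p v \<ge> 0"
  proof (cases "v = 0")
    case True
    then show ?thesis by (simp add: tnorm_def bilinear_lzero[OF bilinear_metric[OF i]])
  next
    case False
    have "g i p v v > 0" using riemannian i False by (auto simp: riemannian_metric_def charts_at_def)
    then show ?thesis by (simp add: tnorm_def)
  qed
  have a: "a > 0" using \<epsilon> t0 by (simp add: a_def)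
  have "tnorm g i p (a *\<^sub>R v) < \<epsilon>"
  proof -
    have "tnorm g i p (a *\<^sub>R v) = a * tnorm g i p v" using tnorm_scaleR[OF i] a by simp
    also have "\<dots> < \<epsilon>" unfolding a_def using \<epsilon> t0 by (simp add: field_simps) (smt (verit) mult_nonneg_nonneg)
    finally show ?thesis .
  qed
  then obtain \<gamma> where \<gamma>: "geodesic_on UNIV \<gamma>" "\<gamma> 0 = p" "vel X i \<gamma> 0 = a *\<^sub>R v"
    by (rule slow_geodesic_exists[OF i])
  let ?\<gamma> = "\<lambda>s. \<gamma> ((1 / a) * s + 0)"
  have "geodesic_on UNIV ?\<gamma>" by (rule geodesic_on_affine[OF \<gamma>(1)]) (use a in auto)
  moreover have "geodesic_near X g i \<gamma> ((1 / a) * 0 + 0)" using geodesic_onD[OF \<gamma>(1), of 0 i] \<gamma>(2) i by simp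
  from geodesic_affine(2)[OF this] have "vel X i ?\<gamma> 0 = v" using \<gamma>(3) a by simp
  ultimately have "geodesic_from X g i p v ?\<gamma>"
    unfolding geodesic_from_iff geodesic_on_def using \<gamma>(2) by simp
  then show ?thesis by blast
qed

theorem complete: "complete_metric X g"
  unfolding complete_metric_def using riemannian geodesic_from_exists by (auto simp: charts_at_def)

text \<open>Uniqueness identifies the complete geodesic in the definition of \<open>riem_exp\<close>
  with the given piece on the piece's interval, which contains 1. Thus the curves of a normal chart
  compute the exponential map.\<close>

lemma riem_exp_eq:
  assumes i: "i \<in> charts_at X p" and \<gamma>: "geodesic_on {-2<..<2} \<gamma>" "\<gamma> 0 = p" "vel X i \<gamma> 0 = v"
  shows "riem_exp X g i p v = \<gamma> 1"
proof -
  obtain \<eta> where \<eta>: "geodesic_from X g i p v \<eta>" using geodesic_from_exists[OF i] by blast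
  then have \<eta>': "geodesic_on UNIV \<eta>" "\<eta> 0 = p" "vel X i \<eta> 0 = v" by (auto simp: geodesic_from_iff geodesic_on_def)
  have "\<eta>' = \<eta>" if "geodesic_from X g i p v \<eta>'" for \<eta>'
  proof
    fix t
    have "geodesic_on UNIV \<eta>'" "\<eta>' 0 = p" "vel X i \<eta>' 0 = v" using that by (auto simp: geodesic_from_iff geodesic_on_def)
    then show "\<eta>' t = \<eta> t"
      using geodesic_unique[of UNIV \<eta>' \<eta> 0 i t] \<eta>' i by auto
  qed
  with \<eta> have "(THE \<gamma>. geodesic_from X g i p v \<gamma>) = \<eta>" by (rule the_equality)
  moreover have "\<eta> 1 = \<gamma> 1"
    by (rule geodesic_unique[OF geodesic_on_subset[OF \<eta>'(1)] \<gamma>(1) open_greaterThanLessThan connected_Ioo, of 0 i])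
      (use \<eta>' \<gamma> i in auto)
  ultimately show ?thesis by (simp add: riem_exp_def)
qed

lemma riem_exp_transform:
  assumes i: "i \<in> charts_at X p" and j: "j \<in> charts_at X p"
  shows "riem_exp X g j p u = riem_exp X g i p (transition_deriv X j i p u)"
proof -
  obtain \<eta> where \<eta>: "geodesic_from X g j p u \<eta>" using geodesic_from_exists[OF j] by blast
  then have \<eta>': "geodesic_on UNIV \<eta>" "\<eta> 0 = p" "vel X j \<eta> 0 = u" by (auto simp: geodesic_from_iff geodesic_on_def)
  have "geodesic_near X g j \<eta> 0" using geodesic_onD[OF \<eta>'(1)] \<eta>'(2) j by auto
  from geodesic_near_transform(2)[OF this] have "vel X i \<eta> 0 = transition_deriv X j i p u"
    using \<eta>'(2,3) i by auto
  note e = geodesic_on_subset[OF \<eta>'(1) subset_UNIV]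
  show ?thesis
    using riem_exp_eq[OF j e \<eta>'(2,3)] riem_exp_eq[OF i e \<eta>'(2) \<open>vel X i \<eta> 0 = _\<close>] by simp
qed

text \<open>\<open>injectivity_radius_at\<close> quantifies over all charts at \<open>p\<close>,
  whereas a normal chart is given for one index \<open>i\<close>. In the chart \<open>j\<close> the
  exponential map is that of \<open>i\<close> preceded by the transition differential
  \<open>T\<close>, which is linear and maps the ball \<open>B'\<close> onto
  \<open>B\<close>.\<close>

lemma diffeo_exp:
  assumes j: "j \<in> charts_at X p"
  shows "diffeo_onto_image X {u. tnorm g j p u < \<epsilon>} (riem_exp X g j p)"
proof -
  have "p \<in> points X" using j patch_subset by (auto simp: charts_at_def)
  then obtain i where "normal_chart X g i p \<epsilon>" using normal by blast
  then obtain c d where i: "i \<in> charts_at X p" and cd: "\<forall>v. tnorm g i p v < \<epsilon> \<longrightarrow> c v 0 = coord X i p \<and> d v 0 = v \<and>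
         (\<forall>s. \<bar>s\<bar> < 2 \<longrightarrow> c v s \<in> coord X i ` patch X i \<and> (c v has_vector_derivative d v s) (at s) \<and>
            (d v has_vector_derivative - christoffel X g i (param X i (c v s)) (d v s) (d v s)) (at s))"
    and e: "inj_on (\<lambda>v. c v 1) {v. tnorm g i p v < \<epsilon>}" "open ((\<lambda>v. c v 1) ` {v. tnorm g i p v < \<epsilon>})"
       "smooth_on {v. tnorm g i p v < \<epsilon>} (\<lambda>v. c v 1)"
       "smooth_on ((\<lambda>v. c v 1) ` {v. tnorm g i p v < \<epsilon>}) (inv_into {v. tnorm g i p v < \<epsilon>} (\<lambda>v. c v 1))"
    unfolding normal_chart_def by blast
  define e where "e v = c v 1" for v
  define B where "B = {v. tnorm g i p v < \<epsilon>}"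
  define B' where "B' = {u. tnorm g j p u < \<epsilon>}"
  define T where "T = transition_deriv X j i p"
  define S where "S = transition_deriv X i j p"
  let ?E = "riem_exp X g j p"
  have iX: "i \<in> indices X" "p \<in> patch X i" using i by (auto simp: charts_at_def)
  note e = e[folded e_def[abs_def] B_def]
  have TS: "T (S v) = v" "S (T u) = u" for u v
    using transition_deriv_inverse[OF i j] transition_deriv_inverse[OF j i] by (auto simp: T_def S_def)
  have lin: "linear T" "linear S" using linear_transition_deriv i j by (auto simp: T_def S_def)
  have TB: "T u \<in> B \<longleftrightarrow> u \<in> B'" for u
    using tnorm_transform[OF j i] by (simp add: B_def B'_def T_def)
  have imB: "T ` B' = B"
  proof (intro set_eqI iffI)
    fix v assume "v \<in> B"
    then have "S v \<in> B'" using TB[of "S v"] TS(1) by simp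
    then show "v \<in> T ` B'" using TS(1)[of v] by force
  qed (use TB in auto)
  have e_chart: "e v \<in> chart i" and E: "riem_exp X g i p v = param X i (e v)" if v: "v \<in> B" for v
  proof -
    have v': "tnorm g i p v < \<epsilon>" using v by (simp add: B_def)
    have c0: "c v 0 = coord X i p" "d v 0 = v" using cd v' by auto
    have c: "c v s \<in> chart i \<and> (c v has_vector_derivative d v s) (at s) \<and>
            (d v has_vector_derivative - christoffel X g i (param X i (c v s)) (d v s) (d v s)) (at s)" if "\<bar>s\<bar> < 2" for s
      using cd v' that by blast
    show "e v \<in> chart i" using c[of 1] by (simp add: e_def)
    note L = geodesic_local_in_normal_chart[OF i c0 c]
    show "riem_exp X g i p v = param X i (e v)"
      using riem_exp_eq[OF i L] by (simp add: e_def)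
  qed
  have E': "?E u = param X i (e (T u))" if "u \<in> B'" for u
    using riem_exp_transform[OF i j, of u] E TB that by (simp add: T_def)
  have opB': "open B'"
  proof -
    have "bounded_bilinear (g j p)" using bilinear_metric[OF j] by (simp add: bilinear_conv_bounded_bilinear)
    from bounded_bilinear.continuous_on[OF this continuous_on_id continuous_on_id]
    have "continuous_on UNIV (\<lambda>u. sqrt (g j p u u))" by (rule continuous_on_real_sqrt)
    then show ?thesis
      unfolding B'_def tnorm_def by (intro open_Collect_less continuous_on_const)
  qed
  have opB: "open B"
  proof -
    have "B = S -` B'" using TB[of "S _"] TS(1) by auto
    then show ?thesis using opB' lin(2) by (simp add: continuous_open_vimage linear_continuous_at linear_conv_bounded_linear)
  qed
  have Einj: "inj_on ?E B'"
  proof (rule inj_onI)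
    fix u v assume uv: "u \<in> B'" "v \<in> B'" "?E u = ?E v"
    then have "coord X i (param X i (e (T u))) = coord X i (param X i (e (T v)))" by (simp add: E')
    then have "e (T u) = e (T v)" using e_chart TB uv by simp
    then have "T u = T v" using e(1) TB uv by (auto simp: inj_on_def)
    then have "S (T u) = S (T v)" by simp
    then show "u = v" by (simp add: TS)
  qed
  have im: "?E ` B' = param X i ` (e ` B)"
    unfolding imB[symmetric] image_image using E' by (rule image_cong[OF refl])
  have opE: "openin (atlas_topology X) (?E ` B')"
    unfolding im by (rule openin_param_image[OF iX(1) e(2)]) (use e_chart in auto)
  have eT: "smooth_on B' (\<lambda>u. e (T u))"
    by (rule smooth_on_compose[OF opB' opB e(3) smooth_on_linear_self[OF lin(1) opB']]) (use imB in auto)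
  have eTc: "continuous_on B' (\<lambda>u. e (T u))" using eT by (rule smooth_on_imp_continuous_on)
  show ?thesis
    unfolding diffeo_onto_image_def B'_def[symmetric]
  proof (intro conjI ballI opB' Einj opE)
    fix k assume k: "k \<in> indices X"
    let ?D = "coord X i ` (patch X i \<inter> patch X k)"
    have D: "{u \<in> B'. ?E u \<in> patch X k} = B' \<inter> (\<lambda>u. e (T u)) -` ?D"
    proof (rule set_eqI)
      fix u
      show "u \<in> {u \<in> B'. ?E u \<in> patch X k} \<longleftrightarrow> u \<in> B' \<inter> (\<lambda>u. e (T u)) -` ?D"
        using E'[of u] e_chart[of "T u"] TB[of u] overlap_iff[OF iX(1), of "e (T u)" "patch X k"]
        by (cases "u \<in> B'") simp_all
    qed
    show opD: "open {u \<in> B'. ?E u \<in> patch X k}"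
      unfolding D by (rule continuous_open_preimage[OF eTc opB' open_overlap[OF iX(1) k]])
    have "smooth_on {u \<in> B'. ?E u \<in> patch X k} (\<lambda>u. (coord X k \<circ> param X i) (e (T u)))"
      by (rule smooth_on_compose[OF opD open_overlap[OF iX(1) k] smooth_transition[OF iX(1) k] smooth_on_subset[OF eT]])
        (auto simp: D)
    then show "smooth_on {u \<in> B'. ?E u \<in> patch X k} (coord X k \<circ> ?E)"
      by (rule smooth_on_cong[OF opD]) (use E' in auto)
    let ?O = "coord X k ` (?E ` B' \<inter> patch X k)"
    have opO: "open ?O" using openin_coord_image[OF opE k] by (simp add: Int_commute)
    have O1: "param X k y \<in> patch X k \<inter> patch X i" "coord X i (param X k y) \<in> e ` B" "y \<in> coord X k ` (patch X k \<inter> patch X i)"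
      if y: "y \<in> ?O" for y
    proof -
      obtain v where v: "v \<in> B" "y = coord X k (param X i (e v))" "param X i (e v) \<in> patch X k" using y unfolding im by auto
      have "param X k y = param X i (e v)" using v k by simp
      then show "param X k y \<in> patch X k \<inter> patch X i" "coord X i (param X k y) \<in> e ` B"
        using v e_chart[OF v(1)] by auto
      then show "y \<in> coord X k ` (patch X k \<inter> patch X i)" using v k e_chart[OF v(1)] by auto
    qed
    have "smooth_on ?O (\<lambda>y. S (inv_into B e ((coord X i \<circ> param X k) y)))"
    proof (rule smooth_on_bounded_linear[where L=S, OF _ opO])
      show "bounded_linear S" using lin(2) by (simp add: linear_conv_bounded_linear)
      show "smooth_on ?O (\<lambda>y. inv_into B e ((coord X i \<circ> param X k) y))"
        by (rule smooth_on_compose[OF opO e(2) e(4) smooth_on_subset[OF smooth_transition[OF k iX(1)]]])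
          (use O1 in auto)
    qed
    then show "smooth_on ?O (inv_into B' ?E \<circ> param X k)"
    proof (rule smooth_on_cong[OF opO])
      fix y assume y: "y \<in> ?O"
      obtain v where v: "v \<in> B" "e v = coord X i (param X k y)" using O1(2)[OF y] by auto
      have "inv_into B e (coord X i (param X k y)) = v" using v e(1) by (metis inv_into_f_f)
      moreover have "?E (S v) = param X k y"
      proof -
        have "S v \<in> B'" using v TB[of "S v"] TS(1) by simp
        then have "?E (S v) = param X i (e v)" using E' TS by simp
        then show ?thesis using v O1(1)[OF y] iX by simp
      qed
      then have "inv_into B' ?E (param X k y) = S v" using Einj v TB[of "S v"] TS(1) by (metis inv_into_f_f)
      ultimately show "S (inv_into B e ((coord X i \<circ> param X k) y)) = (inv_into B' ?E \<circ> param X k) y" by simp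
    qed
  qed
qed

theorem injectivity_radius_ge: "injectivity_radius X g \<ge> ereal \<epsilon>"
  unfolding injectivity_radius_def
proof (rule INF_greatest)
  fix p assume "p \<in> points X"
  show "ereal \<epsilon> \<le> injectivity_radius_at X g p"
    unfolding injectivity_radius_at_def
    by (rule Sup_upper) (use \<epsilon> diffeo_exp in blast)
qed

end

section \<open>Leaves of a foliation\<close>

lemma smoothly_compatible_sym: "smoothly_compatible X Y \<Longrightarrow> smoothly_compatible Y X"
  unfolding smoothly_compatible_def Let_def by (metis Int_commute)

lemma compatible_openin:
  assumes X: "smooth_atlas X" and Y: "smooth_atlas Y" and pts: "points X = points Y"
    and comp: "smoothly_compatible X Y" and W: "openin (atlas_topology X) W"
  shows "openin (atlas_topology Y) W"
proof -
  interpret X: smooth_atlas_on X by (rule smooth_atlas_on.intro[OF X])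
  interpret Y: smooth_atlas_on Y by (rule smooth_atlas_on.intro[OF Y])
  show ?thesis
    unfolding Y.openin_iff
  proof (intro conjI ballI)
    show "W \<subseteq> points Y" using W pts by (auto simp: X.openin_iff)
    fix j assume j: "j \<in> indices Y"
    show "open (coord Y j ` (W \<inter> patch Y j))"
    proof (subst open_subopen, rule ballI)
      fix y assume "y \<in> coord Y j ` (W \<inter> patch Y j)"
      then obtain p where p: "p \<in> W" "p \<in> patch Y j" "y = coord Y j p" by auto
      then obtain i where i: "i \<in> indices X" "p \<in> patch X i"
        using X.points_chart pts Y.patch_subset[OF j] by blast
      let ?T = "coord Y j ` (patch X i \<inter> patch Y j) \<inter> (coord X i \<circ> param Y j) -` (coord X i ` (W \<inter> patch X i))"
      have "smooth_on (coord Y j ` (patch X i \<inter> patch Y j)) (coord X i \<circ> param Y j)" "open (coord Y j ` (patch X i \<inter> patch Y j))"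
        using comp i j unfolding smoothly_compatible_def Let_def by blast+
      moreover have "open (coord X i ` (W \<inter> patch X i))" using W i by (auto simp: X.openin_iff)
      ultimately have "open ?T" using continuous_open_preimage smooth_on_imp_continuous_on by blast
      moreover have "y \<in> ?T" using p i j by auto
      moreover have "?T \<subseteq> coord Y j ` (W \<inter> patch Y j)"
      proof
        fix z assume "z \<in> ?T"
        then obtain q where q: "q \<in> patch X i" "q \<in> patch Y j" "z = coord Y j q" "coord X i q \<in> coord X i ` (W \<inter> patch X i)"
          using j by auto
        then have "q \<in> W" using X.inj_coord[OF i(1)] by (auto simp: inj_on_def)
        then show "z \<in> coord Y j ` (W \<inter> patch Y j)" using q by auto
      qed
      ultimately show "\<exists>T. open T \<and> y \<in> T \<and> T \<subseteq> coord Y j ` (W \<inter> patch Y j)" by blast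
    qed
  qed
qed

text \<open>Carries compactness and the Hausdorff property from the atlas of the ambient manifold
  over to the foliated atlas.\<close>

lemma compatible_topology_eq:
  assumes "smooth_atlas X" "smooth_atlas Y" "points X = points Y" "smoothly_compatible X Y"
  shows "atlas_topology X = atlas_topology Y"
  using compatible_openin[OF assms] compatible_openin[OF assms(2,1) assms(3)[symmetric] smoothly_compatible_sym[OF assms(4)]]
  by (auto simp: topology_eq)

context smooth_atlas_on begin

lemma continuous_map_param:
  assumes i: "i \<in> indices X" and C: "C \<subseteq> coord X i ` patch X i"
  shows "continuous_map (top_of_set C) (atlas_topology X) (param X i)"
  unfolding continuous_map_def
proof (intro conjI allI impI)
  show "param X i \<in> topspace (top_of_set C) \<rightarrow> topspace (atlas_topology X)"
  proof
    fix x assume "x \<in> topspace (top_of_set C)"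
    then have "param X i x \<in> patch X i" using C by (intro param_in_patch) auto
    then show "param X i x \<in> topspace (atlas_topology X)" using patch_subset[OF i] topspace_eq by blast
  qed
  fix W assume W: "openin (atlas_topology X) W"
  have "x \<in> C \<and> param X i x \<in> W \<longleftrightarrow> x \<in> C \<inter> coord X i ` (patch X i \<inter> W)" for x
    using overlap_iff[OF i, of x W] subsetD[OF C, of x] by (cases "x \<in> C") simp_all
  then have "{x \<in> topspace (top_of_set C). param X i x \<in> W} = C \<inter> coord X i ` (patch X i \<inter> W)"
    unfolding topspace_euclidean_subtopology by blast
  then show "openin (top_of_set C) {x \<in> topspace (top_of_set C). param X i x \<in> W}"
    using openin_coord_image[OF W i] by (simp add: openin_open_Int)
qed

lemma connectedin_param_image:
  assumes i: "i \<in> indices X" and C: "connected C" "C \<subseteq> coord X i ` patch X i"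
  shows "connectedin (atlas_topology X) (param X i ` C)"
proof (rule connectedin_continuous_map_image[OF continuous_map_param[OF i C(2)]])
  show "connectedin (top_of_set C) C" using C(1) by (simp add: connectedin_subtopology)
qed

lemma compactin_param_image:
  assumes i: "i \<in> indices X" and C: "compact C" "C \<subseteq> coord X i ` patch X i"
  shows "compactin (atlas_topology X) (param X i ` C)"
proof (rule image_compactin[OF _ continuous_map_param[OF i C(2)]])
  show "compactin (top_of_set C) C" using C(1) by (simp add: compactin_subtopology)
qed

text \<open>Coordinate balls are connected, so each lies in the component of its centre. Applied to
  the leaf topology, this makes leaves open.\<close>

lemma openin_component:
  assumes L: "L \<in> connected_components_of (atlas_topology X)"
  shows "openin (atlas_topology X) L"
proof (subst openin_subopen, rule ballI)
  fix p assume p: "p \<in> L"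
  then have "p \<in> points X" using L connected_components_of_subset topspace_eq by fastforce
  then obtain i where i: "i \<in> indices X" "p \<in> patch X i" using points_chart by blast
  obtain e where e: "e > 0" "ball (coord X i p) e \<subseteq> coord X i ` patch X i"
    using open_chart[OF i(1)] i(2) openE by blast
  let ?V = "param X i ` ball (coord X i p) e"
  have pV: "p \<in> ?V" using i e by (auto intro!: image_eqI[of _ _ "coord X i p"])
  have "connectedin (atlas_topology X) ?V" by (rule connectedin_param_image[OF i(1) _ e(2)]) simp
  then have "?V \<subseteq> L" using connected_components_of_maximal[OF L] p pV by (auto simp: disjnt_def)
  then show "\<exists>T. openin (atlas_topology X) T \<and> p \<in> T \<and> T \<subseteq> L"
    using openin_param_image[OF i(1) open_ball e(2)] pV by blast
qed

end

section \<open>The leaf atlas\<close>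

locale foliated = smooth_atlas_on F
  for F :: "('i, 'a, 'e::euclidean_space \<times> real) atlas" +
  assumes local_product: "\<And>p i j. i \<in> charts_at F p \<Longrightarrow> j \<in> charts_at F p \<Longrightarrow>
        \<exists>A B h. open A \<and> open B \<and> coord F i p \<in> A \<times> B \<and>
          A \<times> B \<subseteq> coord F i ` (patch F i \<inter> patch F j) \<and>
          (\<forall>x\<in>A. \<forall>t\<in>B. snd (coord F j (param F i (x, t))) = h t)"
begin

text \<open>Openness in the leaf topology, read off slice by slice. It avoids the topology of
  \<open>leaf_manifold\<close> because it is the condition under which that structure is shown to be
  an atlas; both \<open>points F\<close> and every leaf satisfy it.\<close>

definition leaf_open :: "'a set \<Rightarrow> bool" where
  "leaf_open L \<longleftrightarrow> L \<subseteq> points F \<and> (\<forall>i\<in>indices F. \<forall>t. open {x. (x, t) \<in> coord F i ` (patch F i \<inter> L)})"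

lemma open_slice: "open W \<Longrightarrow> open {x. (x, t) \<in> W}"
proof -
  assume "open W"
  then have "open ((\<lambda>x. (x, t)) -` W)" by (intro open_vimage continuous_intros)
  then show ?thesis by (simp add: vimage_def)
qed

lemma leaf_open_points: "leaf_open (points F)"
  unfolding leaf_open_def
proof (intro conjI ballI allI)
  fix i t assume i: "i \<in> indices F"
  then have "patch F i \<inter> points F = patch F i" using patch_subset by auto
  then show "open {x. (x, t) \<in> coord F i ` (patch F i \<inter> points F)}" using open_slice[OF open_chart[OF i]] by simp
qed simp

abbreviation "leafX L \<equiv> leaf_manifold F L"

lemma leaf_simps [simp]:
  "points (leafX L) = L" "indices (leafX L) = indices F \<times> UNIV"
  "patch (leafX L) (i, t) = {p \<in> patch F i \<inter> L. snd (coord F i p) = t}"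
  "coord (leafX L) (i, t) p = fst (coord F i p)"
  by (auto simp: leaf_manifold_def)

lemma leaf_chart: "i \<in> indices F \<Longrightarrow> coord (leafX L) (i, t) ` (patch (leafX L) (i, t) \<inter> W) = {x. (x, t) \<in> coord F i ` (patch F i \<inter> L \<inter> W)}"
  unfolding image_iff by (auto simp: prod_eq_iff)

lemma leaf_chart': "i \<in> indices F \<Longrightarrow> coord (leafX L) (i, t) ` patch (leafX L) (i, t) = {x. (x, t) \<in> coord F i ` (patch F i \<inter> L)}"
  using leaf_chart[of i L t UNIV] by simp

lemma leaf_inj: "i \<in> indices F \<Longrightarrow> inj_on (coord (leafX L) (i, t)) (patch (leafX L) (i, t))"
  using inj_coord[of i] by (auto simp: inj_on_def prod_eq_iff)

lemma leaf_param:
  assumes i: "i \<in> indices F" and x: "(x, t) \<in> coord F i ` (patch F i \<inter> L)"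
  shows "param (leafX L) (i, t) x = param F i (x, t)"
proof -
  obtain p where p: "p \<in> patch F i" "p \<in> L" "coord F i p = (x, t)" using x by force
  have "param (leafX L) (i, t) (coord (leafX L) (i, t) p) = p"
    unfolding param_def by (rule inv_into_f_f[OF leaf_inj[OF i]]) (use p in auto)
  moreover have "param F i (x, t) = p" using p i by (metis param_coord)
  ultimately show ?thesis using p by simp
qed

text \<open>By the local product form, the transverse coordinate of chart \<open>j\<close> is
  constant on a neighbourhood within a plaque of chart \<open>i\<close>. So plaques that meet share
  an open piece, which makes the overlaps open; smoothness is inherited from the ambient transition
  maps.\<close>

lemma leaf_smooth_atlas:
  assumes L: "leaf_open L"
  shows "smooth_atlas (leafX L)"
  unfolding smooth_atlas_def
proof (intro conjI ballI)
  have "L \<subseteq> points F" using L by (simp add: leaf_open_def)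
  then show "points (leafX L) = (\<Union>i\<in>indices (leafX L). patch (leafX L) i)"
    using points_chart by fastforce
  show "inj_on (coord (leafX L) i) (patch (leafX L) i)" if "i \<in> indices (leafX L)" for i
    using that leaf_inj by (cases i) (simp del: leaf_simps(3,4))
  show "smoothly_compatible (leafX L) (leafX L)"
  proof -
    have key: "open (coord (leafX L) (i, t) ` (patch (leafX L) (i, t) \<inter> patch (leafX L) (j, s))) \<and>
        smooth_on (coord (leafX L) (i, t) ` (patch (leafX L) (i, t) \<inter> patch (leafX L) (j, s))) (coord (leafX L) (j, s) \<circ> param (leafX L) (i, t))"
      if i: "i \<in> indices F" and j: "j \<in> indices F" for i j t s
    proof -
      let ?D = "coord (leafX L) (i, t) ` (patch (leafX L) (i, t) \<inter> patch (leafX L) (j, s))"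
      have D: "x \<in> ?D \<longleftrightarrow> (x, t) \<in> coord F i ` (patch F i \<inter> L) \<and> param F i (x, t) \<in> patch F j \<and> snd (coord F j (param F i (x, t))) = s" for x
        unfolding leaf_chart[OF i] overlap_iff[OF i] Int_assoc by auto
      have op: "open ?D"
      proof (subst open_subopen, rule ballI)
        fix x assume x: "x \<in> ?D"
        define p where "p = param F i (x, t)"
        have xt: "(x, t) \<in> coord F i ` (patch F i \<inter> L)" using x D by blast
        have "(x, t) \<in> coord F i ` patch F i" "p \<in> L" using xt overlap_iff[OF i, of _ L] unfolding p_def by blast+
        then have p: "p \<in> patch F i" "p \<in> patch F j" "p \<in> L" "coord F i p = (x, t)" "snd (coord F j p) = s"
          using x unfolding D p_def by (blast intro: param_in_patch coord_param)+
        then have "i \<in> charts_at F p" "j \<in> charts_at F p" using i j by (auto simp: charts_at_def)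
        from local_product[OF this] obtain A B h where AB: "open A" "coord F i p \<in> A \<times> B"
          "A \<times> B \<subseteq> coord F i ` (patch F i \<inter> patch F j)" "\<forall>x\<in>A. \<forall>t\<in>B. snd (coord F j (param F i (x, t))) = h t"
          by (elim exE conjE)
        have tB: "t \<in> B" "x \<in> A" using AB(2) p(4) by auto
        have hs: "h t = s" using AB(4) tB p(5) unfolding p_def by auto
        let ?T = "A \<inter> {x. (x, t) \<in> coord F i ` (patch F i \<inter> L)}"
        have "open ?T" using AB(1) L i by (auto simp: leaf_open_def)
        moreover have "x \<in> ?T" using tB xt by auto
        moreover have "?T \<subseteq> ?D"
        proof
          fix y assume y: "y \<in> ?T"
          then have "(y, t) \<in> coord F i ` (patch F i \<inter> patch F j)" using AB(3) tB by auto
          then have "param F i (y, t) \<in> patch F j" using overlap_iff[OF i] by blast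
          moreover have "snd (coord F j (param F i (y, t))) = s" using AB(4) y tB hs by auto
          ultimately show "y \<in> ?D" unfolding D using y by auto
        qed
        ultimately show "\<exists>T. open T \<and> x \<in> T \<and> T \<subseteq> ?D" by blast
      qed
      have "smooth_on ?D (\<lambda>x. fst ((coord F j \<circ> param F i) (x, t)))"
      proof (rule smooth_on_bounded_linear[OF bounded_linear_fst op])
        show "smooth_on ?D (\<lambda>x. (coord F j \<circ> param F i) (x, t))"
        proof (rule smooth_on_compose[OF op open_overlap[OF i j] smooth_transition[OF i j]])
          show "smooth_on ?D (\<lambda>x. (x, t))" by (intro smooth_on_Pair smooth_on_ident smooth_on_const op)
          show "(\<lambda>x. (x, t)) ` ?D \<subseteq> coord F i ` (patch F i \<inter> patch F j)"
            using D overlap_iff[OF i, of _ "patch F j"] overlap_iff[OF i, of _ L] by blast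
        qed
      qed
      then have "smooth_on ?D (coord (leafX L) (j, s) \<circ> param (leafX L) (i, t))"
        by (rule smooth_on_cong[OF op]) (use D leaf_param[OF i] in auto)
      with op show ?thesis by blast
    qed
    show ?thesis
      unfolding smoothly_compatible_def Let_def
    proof (intro ballI)
      fix I J assume IJ: "I \<in> indices (leafX L)" "J \<in> indices (leafX L)"
      obtain i t j s where e: "I = (i, t)" "J = (j, s)" by (cases I, cases J) auto
      have i: "i \<in> indices F" and j: "j \<in> indices F" using IJ e by auto
      show "open (coord (leafX L) I ` (patch (leafX L) I \<inter> patch (leafX L) J)) \<and>
          open (coord (leafX L) J ` (patch (leafX L) I \<inter> patch (leafX L) J)) \<and>
          smooth_on (coord (leafX L) I ` (patch (leafX L) I \<inter> patch (leafX L) J)) (coord (leafX L) J \<circ> param (leafX L) I) \<and>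
          smooth_on (coord (leafX L) J ` (patch (leafX L) I \<inter> patch (leafX L) J)) (coord (leafX L) I \<circ> param (leafX L) J)"
        unfolding e
        using key[OF i j, of t s] key[OF j i, of s t, unfolded Int_commute[of "patch (leafX L) (j, s)" "patch (leafX L) (i, t)"]]
        by (elim conjE) (intro conjI)
    qed
  qed
qed

lemma tangent_transition:
  assumes i: "i \<in> charts_at F p" and j: "j \<in> charts_at F p"
  shows "snd (transition_deriv F i j p (u, 0)) = 0"
proof -
  from local_product[OF i j] obtain A B h where AB: "open A" "open B" "coord F i p \<in> A \<times> B"
    "A \<times> B \<subseteq> coord F i ` (patch F i \<inter> patch F j)" "\<forall>x\<in>A. \<forall>t\<in>B. snd (coord F j (param F i (x, t))) = h t"
    by (elim exE conjE)
  obtain x t where xt: "coord F i p = (x, t)" "x \<in> A" "t \<in> B" using AB(3) by (cases "coord F i p") auto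
  have 1: "((\<lambda>y. (y, t)) has_derivative (\<lambda>u. (u, 0))) (at x)" by (auto intro!: derivative_eq_intros)
  have "((\<lambda>y. (coord F j \<circ> param F i) (y, t)) has_derivative (\<lambda>u. transition_deriv F i j p (u, 0))) (at x)"
    by (rule has_derivative_compose[OF 1]) (rule transition_has_derivative[OF i j, unfolded xt(1)])
  then have "((\<lambda>y. snd ((coord F j \<circ> param F i) (y, t))) has_derivative (\<lambda>u. snd (transition_deriv F i j p (u, 0)))) (at x)"
    by (rule has_derivative_snd)
  moreover have "((\<lambda>y. h t) has_derivative (\<lambda>u. 0)) (at x)" by simp
  then have "((\<lambda>y. snd ((coord F j \<circ> param F i) (y, t))) has_derivative (\<lambda>u. 0)) (at x)"
    by (rule has_derivative_transform_within_open[OF _ AB(1) xt(2)]) (use AB(5) xt(3) in auto)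
  ultimately show ?thesis using has_derivative_unique by metis
qed

lemma leaf_charts_at: "(i, t) \<in> charts_at (leafX L) p \<longleftrightarrow> i \<in> charts_at F p \<and> p \<in> L \<and> snd (coord F i p) = t"
  by (auto simp: charts_at_def)

lemma leaf_transition_deriv:
  assumes L: "leaf_open L" and i: "(i, t) \<in> charts_at (leafX L) p" and j: "(j, s) \<in> charts_at (leafX L) p"
  shows "transition_deriv (leafX L) (i, t) (j, s) p u = fst (transition_deriv F i j p (u, 0))"
proof -
  interpret X: smooth_atlas_on "leafX L" by (rule smooth_atlas_on.intro[OF leaf_smooth_atlas[OF L]])
  have i': "i \<in> charts_at F p" "p \<in> L" "snd (coord F i p) = t" and j': "j \<in> charts_at F p" "snd (coord F j p) = s"
    using i j by (auto simp: leaf_charts_at)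
  then have iF: "i \<in> indices F" "p \<in> patch F i" and jF: "j \<in> indices F" "p \<in> patch F j" by (auto simp: charts_at_def)
  define x where "x = fst (coord F i p)"
  have xt: "coord F i p = (x, t)" using i' by (simp add: prod_eq_iff x_def)
  have 1: "((\<lambda>y. (y, t)) has_derivative (\<lambda>u. (u, 0))) (at x)" by (auto intro!: derivative_eq_intros)
  have "((\<lambda>y. (coord F j \<circ> param F i) (y, t)) has_derivative (\<lambda>u. transition_deriv F i j p (u, 0))) (at x)"
    by (rule has_derivative_compose[OF 1]) (rule transition_has_derivative[OF i'(1) j'(1), unfolded xt])
  then have "((\<lambda>y. fst ((coord F j \<circ> param F i) (y, t))) has_derivative (\<lambda>u. fst (transition_deriv F i j p (u, 0)))) (at x)"
    by (rule has_derivative_fst)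
  then have "(coord (leafX L) (j, s) \<circ> param (leafX L) (i, t) has_derivative (\<lambda>u. fst (transition_deriv F i j p (u, 0)))) (at x)"
  proof (rule has_derivative_transform_within_open)
    show "open {x. (x, t) \<in> coord F i ` (patch F i \<inter> L)}" using L iF by (simp add: leaf_open_def)
    show "x \<in> {x. (x, t) \<in> coord F i ` (patch F i \<inter> L)}" using i' iF xt by (auto intro!: image_eqI[of _ _ p])
  qed (use leaf_param[OF iF(1)] in auto)
  moreover have "(coord (leafX L) (j, s) \<circ> param (leafX L) (i, t) has_derivative transition_deriv (leafX L) (i, t) (j, s) p) (at x)"
    using X.transition_has_derivative[OF i j] xt by simp
  ultimately show ?thesis by (metis has_derivative_unique)
qed

lemma openin_leaf:
  assumes L: "leaf_open L" and W: "openin (atlas_topology F) W"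
  shows "openin (atlas_topology (leafX L)) (W \<inter> L)"
proof -
  interpret X: smooth_atlas_on "leafX L" by (rule smooth_atlas_on.intro[OF leaf_smooth_atlas[OF L]])
  show ?thesis
    unfolding X.openin_iff
  proof (intro conjI ballI)
    fix I assume I: "I \<in> indices (leafX L)"
    obtain i t where e: "I = (i, t)" by (cases I)
    have i: "i \<in> indices F" using I e by simp
    have "coord (leafX L) I ` (W \<inter> L \<inter> patch (leafX L) I) = coord (leafX L) (i, t) ` (patch (leafX L) (i, t) \<inter> W)"
      unfolding e by auto
    also have "\<dots> = {x. (x, t) \<in> coord F i ` (patch F i \<inter> L)} \<inter> {x. (x, t) \<in> coord F i ` (patch F i \<inter> W)}"
      unfolding leaf_chart[OF i] overlap_iff[OF i] Int_assoc by auto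
    finally show "open (coord (leafX L) I ` (W \<inter> L \<inter> patch (leafX L) I))"
      using L i open_slice[OF openin_coord_image[OF W i]] by (simp add: leaf_open_def open_Int)
  qed simp
qed

lemma leaf_Hausdorff:
  assumes L: "leaf_open L" and H: "Hausdorff_space (atlas_topology F)"
  shows "Hausdorff_space (atlas_topology (leafX L))"
proof -
  interpret X: smooth_atlas_on "leafX L" by (rule smooth_atlas_on.intro[OF leaf_smooth_atlas[OF L]])
  have sub: "L \<subseteq> points F" using L by (simp add: leaf_open_def)
  show ?thesis
    unfolding Hausdorff_space_def
  proof (intro allI impI)
    fix x y assume "x \<in> topspace (atlas_topology (leafX L)) \<and> y \<in> topspace (atlas_topology (leafX L)) \<and> x \<noteq> y"
    then have xy: "x \<in> L" "y \<in> L" "x \<noteq> y" by (auto simp: X.topspace_eq)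
    then have "x \<in> topspace (atlas_topology F) \<and> y \<in> topspace (atlas_topology F) \<and> x \<noteq> y"
      using sub topspace_eq by auto
    from H[unfolded Hausdorff_space_def, rule_format, OF this] obtain U V where
      "openin (atlas_topology F) U" "openin (atlas_topology F) V" "x \<in> U" "y \<in> V" "disjnt U V" by (elim exE conjE)
    then show "\<exists>U V. openin (atlas_topology (leafX L)) U \<and> openin (atlas_topology (leafX L)) V \<and> x \<in> U \<and> y \<in> V \<and> disjnt U V"
      using openin_leaf[OF L] xy by (intro exI[of _ "U \<inter> L"] exI[of _ "V \<inter> L"]) (auto simp: disjnt_def)
  qed
qed

sublocale X0: smooth_atlas_on "leafX (points F)"
  by (rule smooth_atlas_on.intro[OF leaf_smooth_atlas[OF leaf_open_points]])

lemma leaf_is_open: "L \<in> leaves F \<Longrightarrow> leaf_open L"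
proof -
  assume "L \<in> leaves F"
  then have L: "openin (atlas_topology (leafX (points F))) L" unfolding leaves_def by (rule X0.openin_component)
  then have sub: "L \<subseteq> points F" using X0.openin_iff by simp
  show ?thesis
    unfolding leaf_open_def
  proof (intro conjI sub ballI allI)
    fix i t assume i: "i \<in> indices F"
    have "open (coord (leafX (points F)) (i, t) ` (patch (leafX (points F)) (i, t) \<inter> L))"
      by (rule X0.openin_coord_image[OF L]) (use i in simp)
    moreover have "patch F i \<inter> points F \<inter> L = patch F i \<inter> L" using sub by auto
    ultimately show "open {x. (x, t) \<in> coord F i ` (patch F i \<inter> L)}"
      unfolding leaf_chart[OF i] by simp
  qed
qed

text \<open>A connected part of a slice is connected in the leaf topology, and a leaf is a component
  there. This is what keeps a geodesic constructed in a foliated chart inside the leaf of its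
  starting point.\<close>

lemma plaque_in_leaf:
  assumes L: "L \<in> leaves F" and i: "i \<in> indices F" and C: "connected C" "\<And>x. x \<in> C \<Longrightarrow> (x, t) \<in> coord F i ` patch F i"
    and x: "x \<in> C" "param F i (x, t) \<in> L" and y: "y \<in> C"
  shows "param F i (y, t) \<in> L"
proof -
  have pp: "patch F i \<inter> points F = patch F i" using patch_subset[OF i] by auto
  have sub: "C \<subseteq> coord (leafX (points F)) (i, t) ` patch (leafX (points F)) (i, t)"
    unfolding leaf_chart'[OF i] pp using C(2) by auto
  have con: "connectedin (atlas_topology (leafX (points F))) (param (leafX (points F)) (i, t) ` C)"
    by (rule X0.connectedin_param_image[OF _ C(1) sub]) (use i in simp)
  have eq: "param (leafX (points F)) (i, t) z = param F i (z, t)" if "z \<in> C" for z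
    by (rule leaf_param[OF i]) (use C(2)[OF that] pp in simp)
  have "param (leafX (points F)) (i, t) ` C \<subseteq> L"
    by (rule connected_components_of_maximal[OF L[unfolded leaves_def] con])
      (use x eq in \<open>auto simp: disjnt_def\<close>)
  then show ?thesis using y eq by auto
qed

text \<open>Different values \<open>s\<close> yield disjoint nonempty open subsets of a Euclidean
  space, and there can be only countably many of these.\<close>

lemma countable_meeting_slices:
  assumes i: "i \<in> indices F" and j: "j \<in> indices F"
  shows "countable {s. patch (leafX (points F)) (i, t) \<inter> patch (leafX (points F)) (j, s) \<noteq> {}}" (is "countable ?T")
proof -
  let ?X = "leafX (points F)"
  let ?O = "\<lambda>s. coord ?X (i, t) ` (patch ?X (i, t) \<inter> patch ?X (j, s))"
  have disj: "?O s \<inter> ?O s' = {}" if "s \<noteq> s'" for s s'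
  proof (rule ccontr)
    assume "?O s \<inter> ?O s' \<noteq> {}"
    then obtain p q where pq: "p \<in> patch ?X (i, t) \<inter> patch ?X (j, s)" "q \<in> patch ?X (i, t) \<inter> patch ?X (j, s')"
      "coord ?X (i, t) p = coord ?X (i, t) q" by blast
    then have "p = q" using leaf_inj[OF i, of "points F" t] by (auto simp: inj_on_def simp del: leaf_simps)
    then show False using pq that by simp
  qed
  have "countable (?O ` ?T)"
  proof (rule countable_disjoint_open_subsets)
    show "open S" if S: "S \<in> ?O ` ?T" for S
    proof -
      obtain s where "S = ?O s" using S by blast
      then show ?thesis using X0.open_overlap[of "(i, t)" "(j, s)"] i j by (simp del: leaf_simps(3,4))
    qed
    show "disjoint (?O ` ?T)"
      unfolding disjoint_def
    proof (intro ballI impI)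
      fix A B assume "A \<in> ?O ` ?T" "B \<in> ?O ` ?T" "A \<noteq> B"
      then obtain s s' where e: "A = ?O s" "B = ?O s'" by (elim imageE)
      then have "s \<noteq> s'" using \<open>A \<noteq> B\<close> by (auto simp del: leaf_simps)
      then show "A \<inter> B = {}" unfolding e by (rule disj)
    qed
  qed
  moreover have "inj_on ?O ?T"
  proof (rule inj_onI)
    fix s s' assume s: "s \<in> ?T" "s' \<in> ?T" "?O s = ?O s'"
    have "?O s \<noteq> {}" using s(1) unfolding mem_Collect_eq image_is_empty .
    then have "?O s \<inter> ?O s' \<noteq> {}" unfolding s(3)[symmetric] Int_absorb .
    then show "s = s'" using disj by metis
  qed
  ultimately show ?thesis by (rule countable_image_inj_on)
qed

text \<open>Start with one plaque and repeatedly pass to all plaques of the finite cover that meet a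
  plaque already reached. Each stage is countable, and the union of all stages is open and closed in
  the leaf topology, hence contains the connected leaf.\<close>

lemma leaf_countable_slices:
  assumes I0: "finite I0" "I0 \<subseteq> indices F" "points F \<subseteq> (\<Union>i\<in>I0. patch F i)" and L: "L \<in> leaves F"
  obtains P where "countable P" "P \<subseteq> indices F \<times> UNIV" "L \<subseteq> (\<Union>k\<in>P. patch (leafX (points F)) k)"
proof -
  let ?X = "leafX (points F)"
  have "L \<noteq> {}" and Lsub: "L \<subseteq> points F" and Lcon: "connectedin (atlas_topology ?X) L"
    using L nonempty_connected_components_of leaf_is_open[OF L] connectedin_connected_components_of
    by (auto simp: leaves_def leaf_open_def)
  then obtain p0 where p0: "p0 \<in> L" by auto
  then obtain i0 where i0: "i0 \<in> I0" "p0 \<in> patch F i0" using I0(3) Lsub by blast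
  define step where "step Q = (\<Union>(i, t)\<in>Q. \<Union>j\<in>I0. Pair j ` {s. patch ?X (i, t) \<inter> patch ?X (j, s) \<noteq> {}})" for Q
  define P where "P n = (step ^^ n) {(i0, snd (coord F i0 p0))}" for n
  have sub: "P n \<subseteq> I0 \<times> UNIV" for n
    by (induction n) (use i0 in \<open>auto simp: P_def step_def\<close>)
  have cnt: "countable (P n)" for n
  proof (induction n)
    case 0
    then show ?case by (simp add: P_def)
  next
    case (Suc n)
    have "countable (step (P n))"
      unfolding step_def
    proof (rule countable_UN[OF Suc], clarify)
      fix i t assume "(i, t) \<in> P n"
      then have i: "i \<in> indices F" using sub I0(2) by blast
      show "countable (\<Union>j\<in>I0. Pair j ` {s. patch ?X (i, t) \<inter> patch ?X (j, s) \<noteq> {}})"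
        by (intro countable_UN countable_finite[OF I0(1)] countable_image countable_meeting_slices[OF i]) (use I0(2) in auto)
    qed
    then show ?case by (simp add: P_def)
  qed
  define W where "W = (\<Union>n. \<Union>k\<in>P n. patch ?X k)"
  have opk: "openin (atlas_topology ?X) (patch ?X k)" if "k \<in> P n" for k n
    by (rule X0.openin_patch) (use sub[of n] that I0(2) in auto)
  have opW: "openin (atlas_topology ?X) W"
    unfolding W_def by (intro openin_Union ballI) (auto intro: opk)
  have "openin (atlas_topology ?X) (points F - W)"
  proof (subst openin_subopen, rule ballI)
    fix p assume p: "p \<in> points F - W"
    then obtain j where j: "j \<in> I0" "p \<in> patch F j" using I0(3) by blast
    let ?S = "patch ?X (j, snd (coord F j p))"
    have pS: "p \<in> ?S" using j p by simp
    \<comment> \<open>A plaque that meets \<open>W\<close> meets a plaque of some stage and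
      therefore belongs to the next stage.\<close>
    have "?S \<inter> W = {}"
    proof (rule ccontr)
      assume "?S \<inter> W \<noteq> {}"
      then obtain n k where k: "k \<in> P n" "?S \<inter> patch ?X k \<noteq> {}" unfolding W_def by blast
      obtain i t where e: "k = (i, t)" by (cases k)
      have "(j, snd (coord F j p)) \<in> step (P n)"
        unfolding step_def using k j(1) unfolding e by blast
      then have "(j, snd (coord F j p)) \<in> P (Suc n)" by (simp add: P_def)
      then have "p \<in> W" unfolding W_def using pS by blast
      then show False using p by simp
    qed
    moreover have "?S \<subseteq> points F" by auto
    moreover have "openin (atlas_topology ?X) ?S" by (rule X0.openin_patch) (use j I0(2) in auto)
    ultimately show "\<exists>T. openin (atlas_topology ?X) T \<and> p \<in> T \<and> T \<subseteq> points F - W"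
      using pS by (intro exI[of _ ?S]) blast
  qed
  then have clW: "closedin (atlas_topology ?X) W"
    using openin_subset[OF opW] by (simp add: closedin_def X0.topspace_eq)
  have "p0 \<in> W"
    unfolding W_def using i0 p0 Lsub by (intro UN_I[of 0] UN_I[of "(i0, snd (coord F i0 p0))"]) (auto simp: P_def)
  then have "L \<subseteq> W"
    using connectedin_clopen_cases[OF Lcon clW opW] p0 by (auto simp: disjnt_def)
  show thesis
  proof (rule that[of "\<Union>n. P n"])
    show "countable (\<Union>n. P n)" using cnt by auto
    show "(\<Union>n. P n) \<subseteq> indices F \<times> UNIV" using sub I0(2) by blast
    show "L \<subseteq> (\<Union>k\<in>\<Union>n. P n. patch ?X k)" using \<open>L \<subseteq> W\<close> unfolding W_def by blast
  qed
qed

lemma leaf_countable_basis: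
  assumes I0: "finite I0" "I0 \<subseteq> indices F" "points F \<subseteq> (\<Union>i\<in>I0. patch F i)" and L: "L \<in> leaves F"
  shows "countable_basis_space (atlas_topology (leafX L))"
proof -
  note Lo = leaf_is_open[OF L]
  interpret X: smooth_atlas_on "leafX L" by (rule smooth_atlas_on.intro[OF leaf_smooth_atlas[OF Lo]])
  obtain P where P: "countable P" "P \<subseteq> indices F \<times> UNIV" "L \<subseteq> (\<Union>k\<in>P. patch (leafX (points F)) k)"
    by (rule leaf_countable_slices[OF I0 L])
  obtain \<O> :: "'e set set" where \<O>: "countable \<O>" "topological_basis \<O>"
    using ex_countable_basis by blast
  define \<B> where "\<B> = (\<lambda>(k, S). param (leafX L) k ` (S \<inter> coord (leafX L) k ` patch (leafX L) k)) ` (P \<times> \<O>)"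
  show ?thesis
    unfolding countable_basis_space_def
  proof (intro exI[of _ \<B>] conjI ballI allI impI)
    show "countable \<B>" unfolding \<B>_def using P \<O> by (intro countable_image countable_SIGMA) auto
    fix V assume "V \<in> \<B>"
    then obtain k S where V: "k \<in> P" "S \<in> \<O>" "V = param (leafX L) k ` (S \<inter> coord (leafX L) k ` patch (leafX L) k)"
      unfolding \<B>_def by auto
    have k: "k \<in> indices (leafX L)" using V P by auto
    show "openin (atlas_topology (leafX L)) V"
      unfolding V(3) by (rule X.openin_param_image[OF k]) (use X.open_chart[OF k] topological_basis_open[OF \<O>(2) V(2)] in auto)
  next
    fix U x assume Ux: "openin (atlas_topology (leafX L)) U \<and> x \<in> U"
    then have xL: "x \<in> L" using X.openin_iff by auto
    then obtain k where k: "k \<in> P" "x \<in> patch (leafX (points F)) k" using P(3) by blast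
    have kX: "k \<in> indices (leafX L)" using k P by auto
    have xk: "x \<in> patch (leafX L) k" using k(2) xL by (cases k) auto
    have "open (coord (leafX L) k ` (patch (leafX L) k \<inter> U))" using X.openin_coord_image kX Ux by blast
    moreover have "coord (leafX L) k x \<in> coord (leafX L) k ` (patch (leafX L) k \<inter> U)" using xk Ux by auto
    ultimately obtain S where S: "S \<in> \<O>" "coord (leafX L) k x \<in> S" "S \<subseteq> coord (leafX L) k ` (patch (leafX L) k \<inter> U)"
      by (rule topological_basisE[OF \<O>(2)])
    have m1: "param (leafX L) k ` (S \<inter> coord (leafX L) k ` patch (leafX L) k) \<in> \<B>"
      unfolding \<B>_def using k S by force
    have m2: "x \<in> param (leafX L) k ` (S \<inter> coord (leafX L) k ` patch (leafX L) k)"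
      using xk S kX by (intro image_eqI[of _ _ "coord (leafX L) k x"]) auto
    have m3: "param (leafX L) k ` (S \<inter> coord (leafX L) k ` patch (leafX L) k) \<subseteq> U"
    proof (rule image_subsetI)
      fix y assume "y \<in> S \<inter> coord (leafX L) k ` patch (leafX L) k"
      then have "y \<in> coord (leafX L) k ` (patch (leafX L) k \<inter> U)" using S(3) by auto
      then show "param (leafX L) k y \<in> U" unfolding X.overlap_iff[OF kX] by (rule conjunct2)
    qed
    show "\<exists>V\<in>\<B>. x \<in> V \<and> V \<subseteq> U" by (intro bexI[OF _ m1] conjI m2 m3)
  qed
qed

end

section \<open>Compatible almost complex structures\<close>

subsection \<open>Smooth square roots of positive operators\<close>

definition symmetric_op :: "('e::euclidean_space \<Rightarrow>\<^sub>L 'e) \<Rightarrow> bool" where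
  "symmetric_op T \<longleftrightarrow> (\<forall>u v. T u \<bullet> v = u \<bullet> T v)"

definition positive_op :: "('e::euclidean_space \<Rightarrow>\<^sub>L 'e) \<Rightarrow> bool" where
  "positive_op T \<longleftrightarrow> symmetric_op T \<and> (\<forall>u. u \<noteq> 0 \<longrightarrow> T u \<bullet> u > 0)"

text \<open>Polarisation turns the bound on the quadratic form into a bound on
  \<open>T u \<bullet> v\<close>, which is then tested on a multiple of \<open>T u\<close>.\<close>

lemma symmetric_op_norm_le:
  assumes T: "symmetric_op T" and \<rho>: "\<rho> \<ge> 0" "\<And>u. \<bar>T u \<bullet> u\<bar> \<le> \<rho> * (norm u)\<^sup>2"
  shows "norm T \<le> \<rho>"
proof (rule norm_blinfun_bound[OF \<rho>(1)])
  fix u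
  have bil: "T u \<bullet> v \<le> \<rho> / 2 * ((norm u)\<^sup>2 + (norm v)\<^sup>2)" for u v
  proof -
    have "4 * (T u \<bullet> v) = T (u + v) \<bullet> (u + v) - T (u - v) \<bullet> (u - v)"
      using T unfolding symmetric_op_def
      by (simp add: blinfun.add_right blinfun.diff_right inner_add_left inner_add_right inner_diff_left inner_diff_right inner_commute)
    also have "\<dots> \<le> \<rho> * (norm (u + v))\<^sup>2 + \<rho> * (norm (u - v))\<^sup>2"
      using \<rho>(2)[of "u + v"] \<rho>(2)[of "u - v"] by linarith
    also have "\<dots> = 2 * \<rho> * ((norm u)\<^sup>2 + (norm v)\<^sup>2)"
      by (simp add: power2_norm_eq_inner inner_add_left inner_add_right inner_diff_left inner_diff_right inner_commute algebra_simps)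
    finally show ?thesis by simp
  qed
  show "norm (T u) \<le> \<rho> * norm u"
  proof (cases "u = 0 \<or> T u = 0")
    case True
    then show ?thesis using \<rho>(1) by auto
  next
    case False
    \<comment> \<open>Scaling \<open>T u\<close> to the length of \<open>u\<close> makes the two
      squares in \<open>bil\<close> equal, which loses no constant.\<close>
    define a where "a = norm u / norm (T u)"
    have a: "a > 0" "a * norm (T u) = norm u" using False by (auto simp: a_def)
    have "a * (norm (T u))\<^sup>2 = T u \<bullet> (a *\<^sub>R T u)" by (simp add: power2_norm_eq_inner)
    also have "\<dots> \<le> \<rho> / 2 * ((norm u)\<^sup>2 + (norm (a *\<^sub>R T u))\<^sup>2)" by (rule bil)
    also have "\<dots> = \<rho> * (a * norm (T u)) * norm u" using a by (simp add: power2_eq_square)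
    finally have "(a * norm (T u)) * norm (T u) \<le> (a * norm (T u)) * (\<rho> * norm u)"
      by (simp add: power2_eq_square algebra_simps)
    then show ?thesis using a False by (simp add: mult_le_cancel_left)
  qed
qed

text \<open>If the quadratic form of \<open>G\<close> lies between \<open>m\<close> and
  \<open>c\<close> on the unit sphere, that of the identity minus \<open>G / c\<close> lies between
  0 and \<open>1 - m / c\<close>, which is below 1. The proof takes for \<open>m\<close> the minimum
  on the sphere and for \<open>c\<close> a number above both \<open>norm G\<close> and
  \<open>m\<close>.\<close>

lemma positive_op_near_identity:
  fixes G :: "'e::euclidean_space \<Rightarrow>\<^sub>L 'e"
  assumes G: "positive_op G"
  obtains c where "c > 0" "norm (id_blinfun - G /\<^sub>R c) < 1"
proof -
  have G0: "G u \<bullet> u > 0" if "u \<noteq> 0" for u using G that by (auto simp: positive_op_def)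
  have c: "continuous_on (sphere 0 1) (\<lambda>u. G u \<bullet> u)" by (intro continuous_intros)
  have "sphere (0::'e) 1 \<noteq> {}" by simp
  from continuous_attains_inf[OF compact_sphere this c]
  obtain u0 where u0: "u0 \<in> sphere 0 1" "\<And>u. u \<in> sphere 0 1 \<Longrightarrow> G u0 \<bullet> u0 \<le> G u \<bullet> u" by blast
  define m where "m = G u0 \<bullet> u0"
  define c where "c = norm G + m + 1"
  have "u0 \<noteq> 0" using u0(1) by auto
  then have m: "m > 0" using G0 by (simp add: m_def)
  have c: "c > 0" "m < c" using m by (auto simp: c_def add_pos_nonneg add_nonneg_pos add.commute)
  have mG: "m * (norm u)\<^sup>2 \<le> G u \<bullet> u" for u
  proof (cases "u = 0")
    case False
    have "m \<le> G (u /\<^sub>R norm u) \<bullet> (u /\<^sub>R norm u)" unfolding m_def by (rule u0(2)) (use False in simp)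
    also have "\<dots> = (G u \<bullet> u) / (norm u)\<^sup>2" by (simp add: blinfun.scaleR_right power2_eq_square divide_inverse)
    finally show ?thesis using False by (simp add: field_simps)
  qed simp
  have Gc: "G u \<bullet> u \<le> c * (norm u)\<^sup>2" for u
  proof -
    have "G u \<bullet> u \<le> norm (G u) * norm u" by (rule norm_cauchy_schwarz)
    also have "\<dots> \<le> norm G * norm u * norm u" by (intro mult_right_mono norm_blinfun) auto
    also have "\<dots> \<le> c * (norm u)\<^sup>2" using m unfolding c_def power2_eq_square mult.assoc by (intro mult_right_mono) auto
    finally show ?thesis .
  qed
  define T where "T = id_blinfun - G /\<^sub>R c"
  have Tu: "T u \<bullet> u = (norm u)\<^sup>2 - (G u \<bullet> u) / c" for u
    by (simp add: T_def blinfun.diff_left blinfun.scaleR_left inner_diff_left power2_norm_eq_inner divide_inverse mult.commute)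
  have "norm T \<le> 1 - m / c"
  proof (rule symmetric_op_norm_le)
    show "symmetric_op T" using G unfolding positive_op_def symmetric_op_def T_def
      by (simp add: blinfun.diff_left blinfun.scaleR_left inner_diff_left inner_diff_right)
    show "0 \<le> 1 - m / c" using c by simp
    fix u
    have "(G u \<bullet> u) / c \<le> (norm u)\<^sup>2" using Gc[of u] c by (simp add: pos_divide_le_eq mult.commute)
    moreover have "(m / c) * (norm u)\<^sup>2 \<le> (G u \<bullet> u) / c" using mG[of u] c by (simp add: divide_right_mono)
    ultimately show "\<bar>T u \<bullet> u\<bar> \<le> (1 - m / c) * (norm u)\<^sup>2" unfolding Tu by (simp add: left_diff_distrib)
  qed
  also have "\<dots> < 1" using m c by simp
  finally show thesis using that[OF c(1)] by (simp add: T_def)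
qed

text \<open>For \<open>norm T < 1\<close> the operator \<open>1 - half_root T\<close> is the square root of \<open>1 - T\<close>.\<close>

definition half_root :: "('e::euclidean_space \<Rightarrow>\<^sub>L 'e) \<Rightarrow> ('e \<Rightarrow>\<^sub>L 'e)" where
  "half_root T = (THE Y. norm Y < 1 \<and> Y = (T + (Y o\<^sub>L Y)) /\<^sub>R 2)"

lemma compose_diff_le:
  fixes Y Z :: "'e::real_normed_vector \<Rightarrow>\<^sub>L 'e"
  shows "norm ((Y o\<^sub>L Y) - (Z o\<^sub>L Z)) \<le> (norm Y + norm Z) * norm (Y - Z)"
proof -
  have "(Y o\<^sub>L Y) - (Z o\<^sub>L Z) = (Y o\<^sub>L (Y - Z)) + ((Y - Z) o\<^sub>L Z)"
    by (rule blinfun_eqI) (simp add: blinfun.bilinear_simps)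
  then have "norm ((Y o\<^sub>L Y) - (Z o\<^sub>L Z)) \<le> norm Y * norm (Y - Z) + norm (Y - Z) * norm Z"
    by (metis add_mono norm_blinfun_compose norm_triangle_le)
  then show ?thesis by (simp add: algebra_simps)
qed

text \<open>On the closed ball of radius \<open>norm T\<close> the map sending \<open>Y\<close> to
  half of \<open>T\<close> plus the square of \<open>Y\<close> is a contraction with constant
  \<open>norm T\<close>. Symmetry and commutation are closed conditions preserved by this map, so
  they are built into the complete set \<open>s\<close> and passed on to the fixed point.\<close>

lemma half_root:
  fixes T :: "'e::euclidean_space \<Rightarrow>\<^sub>L 'e"
  assumes T: "norm T < 1"
  shows half_root_eq: "half_root T = (T + (half_root T o\<^sub>L half_root T)) /\<^sub>R 2"
    and half_root_norm: "norm (half_root T) \<le> norm T"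
    and half_root_symmetric: "symmetric_op T \<Longrightarrow> symmetric_op (half_root T)"
    and half_root_commute: "X o\<^sub>L T = T o\<^sub>L X \<Longrightarrow> X o\<^sub>L half_root T = half_root T o\<^sub>L X"
proof -
  define f where "f Y = (T + (Y o\<^sub>L Y)) /\<^sub>R 2" for Y
  define s where "s = {Y :: 'e \<Rightarrow>\<^sub>L 'e. norm Y \<le> norm T \<and> (symmetric_op T \<longrightarrow> (\<forall>u v. blinfun_apply Y u \<bullet> v = u \<bullet> blinfun_apply Y v)) \<and>
     (\<forall>X. X o\<^sub>L T = T o\<^sub>L X \<longrightarrow> X o\<^sub>L Y = Y o\<^sub>L X)}"
  have fd: "norm (f Y - f Z) \<le> (norm Y + norm Z) / 2 * norm (Y - Z)" for Y Z
  proof -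
    have "f Y - f Z = ((Y o\<^sub>L Y) - (Z o\<^sub>L Z)) /\<^sub>R 2" by (simp add: f_def algebra_simps)
    then show ?thesis using compose_diff_le[of Y Z] by simp
  qed
  have uniq: "Y = Z" if "norm Y < 1" "norm Z < 1" "f Y = Y" "f Z = Z" for Y Z
  proof (rule ccontr)
    assume "Y \<noteq> Z"
    then have "(norm Y + norm Z) / 2 * norm (Y - Z) < 1 * norm (Y - Z)" using that by (intro mult_strict_right_mono) auto
    then show False using fd[of Y Z] that by simp
  qed
  have com: "continuous_on UNIV (\<lambda>Y. X o\<^sub>L Y)" "continuous_on UNIV (\<lambda>Y. Y o\<^sub>L X)" for X :: "'e \<Rightarrow>\<^sub>L 'e"
    by (intro continuous_intros)+
  have "closed s"
    unfolding s_def
    by (intro closed_Collect_conj closed_Collect_le closed_Collect_imp closed_Collect_all closed_Collect_eq open_Collect_const com continuous_intros)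
  then have "complete s" by (simp add: complete_eq_closed)
  moreover have "s \<noteq> {}"
  proof -
    have "0 \<in> s" by (simp add: s_def)
    then show ?thesis by blast
  qed
  moreover have "f ` s \<subseteq> s"
  proof (rule image_subsetI)
    fix Y assume Y: "Y \<in> s"
    then have n: "norm Y \<le> norm T" by (simp add: s_def)
    have "norm (Y o\<^sub>L Y) \<le> norm Y * norm Y" by (rule norm_blinfun_compose)
    also have "\<dots> \<le> 1 * norm T" using n T by (intro mult_mono) auto
    finally have "norm (T + (Y o\<^sub>L Y)) \<le> 2 * norm T" by (intro norm_triangle_le) simp
    then have 1: "norm (f Y) \<le> norm T" by (simp add: f_def)
    have 2: "f Y u \<bullet> v = u \<bullet> f Y v" if "symmetric_op T" for u v
    proof -
      have "blinfun_apply Y a \<bullet> b = a \<bullet> blinfun_apply Y b" "T a \<bullet> b = a \<bullet> T b" for a b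
        using that Y unfolding s_def symmetric_op_def by blast+
      then show ?thesis by (simp add: f_def blinfun.bilinear_simps inner_add_left inner_add_right)
    qed
    have 3: "X o\<^sub>L f Y = f Y o\<^sub>L X" if X: "X o\<^sub>L T = T o\<^sub>L X" for X
    proof (rule blinfun_eqI)
      fix u
      have c: "X (T v) = T (X v)" for v using arg_cong[OF X, of "\<lambda>Z. blinfun_apply Z v"] by simp
      have "X o\<^sub>L Y = Y o\<^sub>L X" using X Y unfolding s_def by blast
      from arg_cong[OF this, of "\<lambda>Z. blinfun_apply Z v" for v]
      have d: "X (Y v) = Y (X v)" for v by simp
      show "(X o\<^sub>L f Y) u = (f Y o\<^sub>L X) u" by (simp add: f_def blinfun.bilinear_simps c d)
    qed
    show "f Y \<in> s" unfolding s_def using 1 2 3 by simp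
  qed
  moreover have "\<forall>x\<in>s. \<forall>y\<in>s. dist (f x) (f y) \<le> norm T * dist x y"
  proof (intro ballI)
    fix x y assume "x \<in> s" "y \<in> s"
    then have "(norm x + norm y) / 2 \<le> norm T" by (simp add: s_def)
    then have "(norm x + norm y) / 2 * norm (x - y) \<le> norm T * norm (x - y)" by (rule mult_right_mono) simp
    then show "dist (f x) (f y) \<le> norm T * dist x y" using fd[of x y] by (simp add: dist_norm)
  qed
  ultimately obtain Y0 where Y0: "Y0 \<in> s" "f Y0 = Y0"
    using Banach_fix[of s "norm T" f] T by auto
  have n: "norm Y0 \<le> norm T" using Y0(1) by (simp add: s_def)
  then have n1: "norm Y0 < 1" using T by simp
  have h: "half_root T = Y0"
    unfolding half_root_def
  proof (rule the_equality)
    show "norm Y0 < 1 \<and> Y0 = (T + (Y0 o\<^sub>L Y0)) /\<^sub>R 2" using n1 Y0(2) by (simp add: f_def)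
    show "Z = Y0" if "norm Z < 1 \<and> Z = (T + (Z o\<^sub>L Z)) /\<^sub>R 2" for Z
      using uniq[of Z Y0] that n1 Y0(2) by (simp add: f_def)
  qed
  show "half_root T = (T + (half_root T o\<^sub>L half_root T)) /\<^sub>R 2" using Y0(2) unfolding h f_def by (rule sym)
  show "norm (half_root T) \<le> norm T" unfolding h by (rule n)
  show "symmetric_op (half_root T)" if "symmetric_op T"
    using Y0(1) that unfolding h s_def symmetric_op_def by blast
  show "X o\<^sub>L half_root T = half_root T o\<^sub>L X" if "X o\<^sub>L T = T o\<^sub>L X"
    using Y0(1) that unfolding h s_def by blast
qed

lemma half_root_lipschitz:
  fixes S T :: "'e::euclidean_space \<Rightarrow>\<^sub>L 'e"
  assumes S: "norm S < 1" and T: "norm T < 1"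
  shows "(2 - norm S - norm T) * norm (half_root S - half_root T) \<le> norm (S - T)"
proof -
  let ?Y = "half_root S" and ?Z = "half_root T"
  have "2 *\<^sub>R (?Y - ?Z) = (S - T) + ((?Y o\<^sub>L ?Y) - (?Z o\<^sub>L ?Z))"
    using half_root_eq[OF S] half_root_eq[OF T]
    by (metis (no_types, lifting) add_diff_add divideR_right scaleR_right_diff_distrib zero_neq_numeral)
  then have "2 * norm (?Y - ?Z) \<le> norm (S - T) + norm ((?Y o\<^sub>L ?Y) - (?Z o\<^sub>L ?Z))"
    by (metis norm_scaleR norm_triangle_ineq abs_numeral)
  also have "\<dots> \<le> norm (S - T) + (norm S + norm T) * norm (?Y - ?Z)"
    using compose_diff_le[of ?Y ?Z] half_root_norm[OF S] half_root_norm[OF T]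
    by (intro add_left_mono order_trans[OF compose_diff_le] mult_right_mono add_mono) auto
  finally show ?thesis by (simp add: algebra_simps)
qed

text \<open>\<open>half_root\<close> inverts the map sending \<open>Y\<close> to twice
  \<open>Y\<close> minus its square. The derivative of that map at \<open>Y\<close> is twice the
  identity minus \<open>K Y\<close>, where \<open>K Y\<close> has norm at most
  \<open>norm Y\<close>, so it is invertible for \<open>norm Y < 1\<close>. Higher orders follow
  from the linear equation for the derivative.\<close>

lemma smooth_on_half_root:
  fixes T :: "'p::real_normed_vector \<Rightarrow> ('e::euclidean_space \<Rightarrow>\<^sub>L 'e)"
  assumes V: "open V" and T: "smooth_on V T" "\<And>p. p \<in> V \<Longrightarrow> norm (T p) < 1"
  shows "smooth_on V (\<lambda>p. half_root (T p))"
proof -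
  let ?Z = "ball 0 1 :: ('e \<Rightarrow>\<^sub>L 'e) set"
  define Lm :: "('e \<Rightarrow>\<^sub>L 'e) \<Rightarrow> ('e \<Rightarrow>\<^sub>L 'e) \<Rightarrow>\<^sub>L ('e \<Rightarrow>\<^sub>L 'e)" where
    "Lm = bounded_bilinear.prod_right (o\<^sub>L)"
  define Rm :: "('e \<Rightarrow>\<^sub>L 'e) \<Rightarrow> ('e \<Rightarrow>\<^sub>L 'e) \<Rightarrow>\<^sub>L ('e \<Rightarrow>\<^sub>L 'e)" where
    "Rm = bounded_bilinear.prod_left (o\<^sub>L)"
  have Lm: "Lm Y w = Y o\<^sub>L w" and Rm: "Rm Y w = w o\<^sub>L Y" for Y w
    unfolding Lm_def Rm_def
    by (simp_all add: bounded_bilinear.prod_right.rep_eq[OF bounded_bilinear_blinfun_compose]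
        bounded_bilinear.prod_left.rep_eq[OF bounded_bilinear_blinfun_compose])
  have LRbl: "bounded_linear Lm" "bounded_linear Rm"
    unfolding Lm_def Rm_def
    by (rule bounded_bilinear.bounded_linear_prod_right[OF bounded_bilinear_blinfun_compose]
        bounded_bilinear.bounded_linear_prod_left[OF bounded_bilinear_blinfun_compose])+
  define K where "K Y = (Lm Y + Rm Y) /\<^sub>R 2" for Y
  have K_apply: "K Y w = ((Y o\<^sub>L w) + (w o\<^sub>L Y)) /\<^sub>R 2" for Y w
    by (simp add: K_def blinfun.bilinear_simps Lm Rm)
  have Kn: "norm (K Y w) \<le> norm Y * norm w" for Y w
  proof -
    have "norm ((Y o\<^sub>L w) + (w o\<^sub>L Y)) \<le> norm Y * norm w + norm w * norm Y"
      by (intro norm_triangle_mono norm_blinfun_compose)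
    then show ?thesis by (simp add: K_apply)
  qed
  have n1: "norm (half_root T) < 1" if "T \<in> ?Z" for T using that half_root_norm[of T] by simp
  have "\<exists>B :: ('e \<Rightarrow>\<^sub>L 'e) \<Rightarrow>\<^sub>L ('e \<Rightarrow>\<^sub>L 'e). (\<forall>z. B (z - K (half_root T) z) = z) \<and> (\<forall>z. B z - K (half_root T) (B z) = z)"
    if "T \<in> ?Z" for T
    by (rule neumann_inverse[of "norm (half_root T)" "K (half_root T)", OF _ n1[OF that] Kn]) (simp, blast)
  then obtain B :: "('e \<Rightarrow>\<^sub>L 'e) \<Rightarrow> ('e \<Rightarrow>\<^sub>L 'e) \<Rightarrow>\<^sub>L ('e \<Rightarrow>\<^sub>L 'e)" where
    B: "\<And>T z. T \<in> ?Z \<Longrightarrow> B T (z - K (half_root T) z) = z" "\<And>T z. T \<in> ?Z \<Longrightarrow> B T z - K (half_root T) (B T z) = z"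
    by metis
  have cont: "isCont half_root T" if T: "T \<in> ?Z" for T
    unfolding continuous_at_eps_delta
  proof (intro allI impI)
    fix e :: real assume e: "e > 0"
    define r where "r = (1 - norm T) / 2"
    have r: "r > 0" using T by (simp add: r_def)
    show "\<exists>d>0. \<forall>S. dist S T < d \<longrightarrow> dist (half_root S) (half_root T) < e"
    proof (intro exI[of _ "min r (r * e)"] conjI allI impI)
      fix S assume S: "dist S T < min r (r * e)"
      have "norm S \<le> norm T + norm (S - T)" by (rule norm_triangle_sub)
      then have nS: "norm S < norm T + r" using S by (simp add: dist_norm)
      then have S1: "norm S < 1" using T by (simp add: r_def field_simps)
      have "r * norm (half_root S - half_root T) \<le> (2 - norm S - norm T) * norm (half_root S - half_root T)"
        using nS T by (intro mult_right_mono) (auto simp: r_def field_simps)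
      also have "\<dots> \<le> norm (S - T)" by (rule half_root_lipschitz[OF S1]) (use T in simp)
      also have "\<dots> < r * e" using S by (simp add: dist_norm)
      finally show "dist (half_root S) (half_root T) < e" using r by (simp add: dist_norm)
    qed (use r e in auto)
  qed
  have der: "(half_root has_derivative (\<lambda>h. B T (h /\<^sub>R 2))) (at T)" if T: "T \<in> ?Z" for T
  proof (rule has_derivative_inverse_basic[where f="\<lambda>Y. 2 *\<^sub>R Y - (Y o\<^sub>L Y)" and T="?Z"])
    show "((\<lambda>Y. 2 *\<^sub>R Y - (Y o\<^sub>L Y)) has_derivative (\<lambda>w. 2 *\<^sub>R (w - K (half_root T) w))) (at (half_root T))"
      by (rule has_derivative_eq_rhs, (rule derivative_intros)+) (auto simp: K_apply algebra_simps)
    show "bounded_linear (\<lambda>h. B T (h /\<^sub>R 2))"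
      by (intro bounded_linear_compose[OF blinfun.bounded_linear_right] bounded_linear_scaleR_right)
    show "(\<lambda>h. B T (h /\<^sub>R 2)) \<circ> (\<lambda>w. 2 *\<^sub>R (w - K (half_root T) w)) = id"
      using B(1)[OF T] by (auto simp: fun_eq_iff)
    show "2 *\<^sub>R half_root S - (half_root S o\<^sub>L half_root S) = S" if S: "S \<in> ?Z" for S
    proof -
      have "2 *\<^sub>R half_root S = 2 *\<^sub>R ((S + (half_root S o\<^sub>L half_root S)) /\<^sub>R 2)"
        using S by (subst half_root_eq) auto
      then show ?thesis by simp
    qed
  qed (use T cont in auto)
  have TZ: "T p \<in> ?Z" if "p \<in> V" for p using T(2)[OF that] by simp
  have Yder: "((\<lambda>p. half_root (T p)) has_derivative (\<lambda>h. B (T p) (frechet_derivative T (at p) h /\<^sub>R 2))) (at p)" if p: "p \<in> V" for p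
    by (rule has_derivative_compose[OF smooth_on_has_derivative[OF T(1) p] der[OF TZ[OF p]]])
  show ?thesis
    unfolding smooth_on_def
  proof
    fix k show "Ck_on k V (\<lambda>p. half_root (T p))"
    proof (induction k)
      case 0
      have "isCont (\<lambda>p. half_root (T p)) p" if "p \<in> V" for p using has_derivative_continuous[OF Yder[OF that]] .
      then show ?case by (simp add: continuous_at_imp_continuous_on)
    next
      case (Suc k)
      show ?case
      proof (rule Ck_on_SucI[OF V Yder])
        fix h
        have CK: "Ck_on k V (\<lambda>p. K (half_root (T p)))"
          unfolding K_def
          by (intro Ck_on_bounded_linear[OF bounded_linear_scaleR_right] Ck_on_add Ck_on_bounded_linear[OF LRbl(1)]
              Ck_on_bounded_linear[OF LRbl(2)] Suc.IH V)
        have Cb: "Ck_on k V (\<lambda>p. frechet_derivative T (at p) h /\<^sub>R 2)"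
          using smooth_on_frechet_derivative[OF T(1), of h] unfolding smooth_on_def
          by (intro Ck_on_bounded_linear[OF bounded_linear_scaleR_right] V) blast
        show "Ck_on k V (\<lambda>p. B (T p) (frechet_derivative T (at p) h /\<^sub>R 2))"
          by (rule Ck_on_linear_solve[where A="\<lambda>p. id_blinfun - K (half_root (T p))" and B="\<lambda>p. B (T p)", OF V _ Cb])
            (auto intro!: Ck_on_diff CK V simp: B(1)[OF TZ] B(2)[OF TZ] blinfun.diff_left)
      qed
    qed
  qed
qed

text \<open>One scaling factor \<open>c\<close> brings \<open>G p\<close> into the domain of
  \<open>half_root\<close> only for \<open>p\<close> near \<open>p0\<close>, hence the neighbourhood
  \<open>V\<close>. The commutation clause is used to let an antisymmetric operator commute with the
  square root of minus its square.\<close>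

lemma smooth_sqrt:
  fixes G :: "'p::real_normed_vector \<Rightarrow> ('e::euclidean_space \<Rightarrow>\<^sub>L 'e)"
  assumes W: "open W" "p0 \<in> W" and sm: "smooth_on W G" and pos: "\<And>p. p \<in> W \<Longrightarrow> positive_op (G p)"
  obtains V R where "open V" "p0 \<in> V" "V \<subseteq> W" "smooth_on V R" "\<And>p. p \<in> V \<Longrightarrow> positive_op (R p)"
    "\<And>p. p \<in> V \<Longrightarrow> R p o\<^sub>L R p = G p"
    "\<And>p X. p \<in> V \<Longrightarrow> X o\<^sub>L G p = G p o\<^sub>L X \<Longrightarrow> X o\<^sub>L R p = R p o\<^sub>L X"
proof -
  obtain c where c: "c > 0" "norm (id_blinfun - G p0 /\<^sub>R c) < 1"
    using positive_op_near_identity[OF pos[OF W(2)]] .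
  define T where "T p = id_blinfun - G p /\<^sub>R c" for p
  have Tsm: "smooth_on W T"
    unfolding T_def by (intro smooth_on_diff smooth_on_const smooth_on_bounded_linear[OF bounded_linear_scaleR_right] sm W)
  define V where "V = W \<inter> T -` ball 0 1"
  have V: "open V" "p0 \<in> V" "V \<subseteq> W"
    using continuous_open_preimage[OF smooth_on_imp_continuous_on[OF Tsm] W(1) open_ball] W(2) c(2)
    by (auto simp: V_def T_def)
  have n: "norm (T p) < 1" if "p \<in> V" for p using that by (simp add: V_def)
  define Y where "Y p = half_root (T p)" for p
  define R where "R p = sqrt c *\<^sub>R (id_blinfun - Y p)" for p
  show thesis
  proof (rule that[OF V])
    show "smooth_on V R"
      unfolding R_def Y_def
      by (intro smooth_on_bounded_linear[OF bounded_linear_scaleR_right] smooth_on_diff smooth_on_const V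
          smooth_on_half_root smooth_on_subset[OF Tsm V(3)] n)
    fix p assume p: "p \<in> V"
    note hr = half_root_eq[OF n[OF p], folded Y_def] half_root_norm[OF n[OF p], folded Y_def]
    have G: "positive_op (G p)" using pos p V by auto
    have "symmetric_op (T p)" using G unfolding positive_op_def symmetric_op_def T_def
      by (simp add: blinfun.diff_left blinfun.scaleR_left inner_diff_left inner_diff_right)
    then have Ysym: "symmetric_op (Y p)" unfolding Y_def by (rule half_root_symmetric[OF n[OF p]])
    show "positive_op (R p)"
      unfolding positive_op_def
    proof (intro conjI allI impI)
      show "symmetric_op (R p)" using Ysym unfolding symmetric_op_def R_def
        by (simp add: blinfun.diff_left blinfun.scaleR_left inner_diff_left inner_diff_right)
      fix u :: 'e assume u: "u \<noteq> 0"
      have "Y p u \<bullet> u \<le> norm (Y p u) * norm u" by (rule norm_cauchy_schwarz)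
      also have "\<dots> \<le> norm (Y p) * norm u * norm u" by (intro mult_right_mono norm_blinfun) auto
      also have "\<dots> < 1 * (norm u * norm u)"
        unfolding mult.assoc using hr(2) n[OF p] u by (intro mult_strict_right_mono) auto
      finally have "Y p u \<bullet> u < u \<bullet> u" by (simp add: power2_norm_eq_inner[symmetric] power2_eq_square)
      then show "R p u \<bullet> u > 0"
        using c(1) by (simp add: R_def blinfun.diff_left blinfun.scaleR_left inner_diff_left)
    qed
    have "T p + (Y p o\<^sub>L Y p) = 2 *\<^sub>R Y p"
      by (subst (3) hr(1)) simp
    then have T2: "T p = 2 *\<^sub>R Y p - (Y p o\<^sub>L Y p)" by (simp add: algebra_simps)
    have "R p o\<^sub>L R p = c *\<^sub>R (id_blinfun - (2 *\<^sub>R Y p - (Y p o\<^sub>L Y p)))"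
      by (rule blinfun_eqI) (use c(1) in \<open>simp add: R_def blinfun.bilinear_simps scaleR_2 algebra_simps\<close>)
    also have "\<dots> = G p" unfolding T2[symmetric] T_def using c(1) by simp
    finally show "R p o\<^sub>L R p = G p" .
    fix X assume X: "X o\<^sub>L G p = G p o\<^sub>L X"
    have "X o\<^sub>L T p = T p o\<^sub>L X"
    proof (rule blinfun_eqI)
      fix u
      have "X (G p u) = G p (X u)" using X by (metis blinfun_apply_blinfun_compose)
      then show "(X o\<^sub>L T p) u = (T p o\<^sub>L X) u" by (simp add: T_def blinfun.bilinear_simps)
    qed
    then have XY: "X o\<^sub>L Y p = Y p o\<^sub>L X" unfolding Y_def by (rule half_root_commute[OF n[OF p]])
    show "X o\<^sub>L R p = R p o\<^sub>L X"
    proof (rule blinfun_eqI)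
      fix u
      have "X (Y p u) = Y p (X u)" using XY by (metis blinfun_apply_blinfun_compose)
      then show "(X o\<^sub>L R p) u = (R p o\<^sub>L X) u" by (simp add: R_def blinfun.bilinear_simps)
    qed
  qed
qed

subsection \<open>The polar almost complex structure\<close>

text \<open>With \<open>w u v = g (A u) v\<close>, such a \<open>J\<close> is the orthogonal factor
  in the polar decomposition of \<open>A\<close>. Compatibility with \<open>w\<close> leaves many
  choices; the last clause, that \<open>J\<close> is an isometry of \<open>g\<close>, singles out
  one of them.\<close>

definition polar_J :: "('e::euclidean_space \<Rightarrow> 'e \<Rightarrow> real) \<Rightarrow> ('e \<Rightarrow> 'e \<Rightarrow> real) \<Rightarrow> ('e \<Rightarrow> 'e) \<Rightarrow> bool" where
  "polar_J w g J \<longleftrightarrow> linear J \<and> (\<forall>u. J (J u) = - u) \<and> (\<forall>u v. w (J u) (J v) = w u v) \<and>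
     (\<forall>u. u \<noteq> 0 \<longrightarrow> w u (J u) > 0) \<and> (\<forall>u v. g (J u) (J v) = g u v)"

lemma continuous_on_quadratic:
  fixes b :: "'e::euclidean_space \<Rightarrow> 'e \<Rightarrow> real"
  assumes "bilinear b" shows "continuous_on S (\<lambda>u. b u u)"
proof -
  have "bounded_bilinear b" using assms by (simp add: bilinear_conv_bounded_bilinear)
  from bounded_bilinear.continuous_on[OF this continuous_on_id continuous_on_id] show ?thesis .
qed

text \<open>A maximiser of the quotient of the two quadratic forms on the unit sphere is an
  eigenvector of \<open>b\<close> relative to \<open>g\<close>, and the maximum is the eigenvalue
  \<open>m\<close>.\<close>

lemma top_eigenvector:
  fixes b g :: "'e::euclidean_space \<Rightarrow> 'e \<Rightarrow> real"
  assumes b: "bilinear b" "\<And>u v. b u v = b v u" and g: "bilinear g" "\<And>u v. g u v = g v u" "\<And>u. u \<noteq> 0 \<Longrightarrow> g u u > 0"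
  obtains u m where "u \<noteq> 0" "\<And>v. b u v = m * g u v" "\<And>v. b v v \<le> m * g v v"
proof -
  note bs = bilinear_ladd[OF b(1)] bilinear_radd[OF b(1)] bilinear_lmul[OF b(1)] bilinear_rmul[OF b(1)]
  note gs = bilinear_ladd[OF g(1)] bilinear_radd[OF g(1)] bilinear_lmul[OF g(1)] bilinear_rmul[OF g(1)]
  have g0: "g u u \<noteq> 0" if "u \<in> sphere 0 1" for u
  proof -
    have "u \<noteq> 0" using that by auto
    then show ?thesis using g(3)[of u] by simp
  qed
  have c: "continuous_on (sphere 0 1) (\<lambda>u. b u u / g u u)"
    using g0 by (intro continuous_on_divide continuous_on_quadratic b g) auto
  have "sphere (0::'e) 1 \<noteq> {}" by simp
  from continuous_attains_sup[OF compact_sphere this c]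
  obtain u where u: "u \<in> sphere 0 1" "\<And>v. v \<in> sphere 0 1 \<Longrightarrow> b v v / g v v \<le> b u u / g u u" by blast
  define m where "m = b u u / g u u"
  have le: "b v v \<le> m * g v v" for v
  proof (cases "v = 0")
    case True
    then show ?thesis by (simp add: bilinear_lzero[OF b(1)] bilinear_lzero[OF g(1)])
  next
    case False
    have "b (v /\<^sub>R norm v) (v /\<^sub>R norm v) / g (v /\<^sub>R norm v) (v /\<^sub>R norm v) \<le> m"
      unfolding m_def by (rule u(2)) (use False in simp)
    then have "b v v / g v v \<le> m" using False by (simp add: bs gs)
    then show ?thesis using g(3)[OF False] by (simp add: field_simps)
  qed
  have uu: "b u u = m * g u u" using g0[OF u(1)] by (simp add: m_def)
  have "b u v = m * g u v" for v
  proof (rule ccontr)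
    define q where "q = m * g u v - b u v"
    define r where "r = m * g v v - b v v"
    assume "b u v \<noteq> m * g u v"
    then have q: "q \<noteq> 0" by (simp add: q_def)
    have r: "r \<ge> 0" using le[of v] by (simp add: r_def)
    \<comment> \<open>Near the maximiser, \<open>m\<close> times \<open>g\<close> minus
      \<open>b\<close> behaves like \<open>t * t * r + 2 * t * q\<close>, which must not be
      negative. This \<open>t\<close> makes it negative unless \<open>q\<close> is 0; the summand 1
      covers \<open>r = 0\<close>.\<close>
    define t where "t = - q / (r + 1)"
    have "0 \<le> m * g (u + t *\<^sub>R v) (u + t *\<^sub>R v) - b (u + t *\<^sub>R v) (u + t *\<^sub>R v)"
      using le[of "u + t *\<^sub>R v"] by simp
    also have "\<dots> = t * t * r + 2 * t * q"
      using uu b(2)[of v u] g(2)[of v u] by (simp add: bs gs q_def r_def algebra_simps)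
    also have "q = - (t * (r + 1))" using r by (simp add: t_def)
    also have "t * t * r + 2 * t * - (t * (r + 1)) = - (t * t * (r + 2))" by (simp add: algebra_simps)
    also have "\<dots> < 0"
    proof -
      have "t \<noteq> 0" using q r by (simp add: t_def)
      then have "0 < t * t" using not_real_square_gt_zero[of t] by blast
      then have "0 < t * t * (r + 2)" using r mult_pos_pos[of "t * t" "r + 2"] by simp
      then show ?thesis by simp
    qed
    finally show False by simp
  qed
  moreover have "u \<noteq> 0" using u(1) by auto
  ultimately show thesis using le that by blast
qed

lemma polar_J_symmetric:
  assumes w: "bilinear w" "\<And>u v. w v u = - w u v" and J: "polar_J w g J"
  shows "w u (J v) = w v (J u)"
proof -
  have "w (J u) (J (J v)) = w u (J v)" using J unfolding polar_J_def by blast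
  then have "w u (J v) = w (J u) (J (J v))" by (rule sym)
  also have "\<dots> = - w (J u) v" using J by (simp add: polar_J_def bilinear_rneg[OF w(1)])
  finally show ?thesis using w(2)[of "J u" v] by simp
qed

text \<open>Let \<open>m\<close> be the largest relative eigenvalue of the difference of the two
  forms, with eigenvector \<open>u\<close>. The vectors that represent the forms at \<open>u\<close>
  with respect to \<open>g\<close> are images of one vector \<open>a\<close> under isometries, so
  they have equal length, and they differ by \<open>m\<close> times \<open>u\<close>. Expanding the
  difference of the squared lengths gives 0 as \<open>m\<close> times a positive number, so
  \<open>m\<close> is 0.\<close>

lemma polar_J_quadratic_le:
  assumes w: "bilinear w" "\<And>u v. w v u = - w u v"
    and g: "bilinear g" "\<And>u v. g u v = g v u" "\<And>u. u \<noteq> 0 \<Longrightarrow> g u u > 0"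
    and J: "polar_J w g J" and K: "polar_J w g K"
  shows "w v (J v) \<le> w v (K v)"
proof -
  have lin: "linear J" "linear K" using J K by (auto simp: polar_J_def)
  let ?b = "\<lambda>u v. w u (J v) - w u (K v)"
  have "bilinear ?b"
    unfolding bilinear_def using lin
    by (auto intro!: linearI simp: bilinear_ladd[OF w(1)] bilinear_radd[OF w(1)] bilinear_lmul[OF w(1)] bilinear_rmul[OF w(1)]
        linear_add linear_scale algebra_simps)
  moreover have "?b u v = ?b v u" for u v
    using polar_J_symmetric[OF w J, of u v] polar_J_symmetric[OF w K, of u v] by simp
  ultimately obtain u m where u: "u \<noteq> 0" "\<And>v. ?b u v = m * g u v" "\<And>v. ?b v v \<le> m * g v v"
    using top_eigenvector[of ?b g] g by blast
  have "linear (w u)" using w(1) by (simp add: bilinear_def)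
  from riesz_ex1[OF g(1,3) this] obtain a where a: "\<And>z. g a z = w u z" by metis
  define p where "p J = - J a" for J :: "'a \<Rightarrow> 'a"
  have p: "g (p J) z = w u (J z)" "g (p J) (p J) = g a a" if "polar_J w g J" for J z
  proof -
    have "g (p J) z = g (J (p J)) (J z)" "g (p J) (p J) = g (J (p J)) (J (p J))" using that by (simp_all add: polar_J_def)
    moreover have "J (p J) = a" using that by (simp add: polar_J_def p_def linear_neg)
    ultimately show "g (p J) z = w u (J z)" "g (p J) (p J) = g a a" using a by simp_all
  qed
  note gs = bilinear_ladd[OF g(1)] bilinear_radd[OF g(1)] bilinear_lmul[OF g(1)] bilinear_rmul[OF g(1)] bilinear_lsub[OF g(1)] bilinear_rsub[OF g(1)]
  define e where "e = p J - p K - m *\<^sub>R u"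
  have "g e z = 0" for z using u(2)[of z] p(1)[OF J, of z] p(1)[OF K, of z] by (simp add: e_def gs)
  then have "e = 0" using g(3)[of e] by fastforce
  then have e: "p J = p K + m *\<^sub>R u" by (simp add: e_def algebra_simps)
  have "0 = g (p J - p K) (p J + p K)"
    using p(2)[OF J] p(2)[OF K] g(2)[of "p K" "p J"] by (simp add: gs)
  also have "p J - p K = m *\<^sub>R u" using e by simp
  also have "g (m *\<^sub>R u) (p J + p K) = m * (g (p J) u + g (p K) u)"
    using g(2)[of u "p J"] g(2)[of u "p K"] by (simp add: gs distrib_left)
  also have "\<dots> = m * (w u (J u) + w u (K u))" using p(1)[OF J] p(1)[OF K] by simp
  finally have "m = 0 \<or> w u (J u) + w u (K u) = 0" by auto
  moreover have "w u (J u) > 0" "w u (K u) > 0" using J K u(1) by (auto simp: polar_J_def)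
  ultimately have "m = 0" by auto
  then show ?thesis using u(3)[of v] by simp
qed

text \<open>The inequality in both directions makes the quadratic forms of \<open>J\<close> and
  \<open>K\<close> equal, polarisation the bilinear ones. For \<open>z = J v - K v\<close> this
  gives \<open>w z (J z) = 0\<close>, which positivity allows only for \<open>z = 0\<close>.\<close>

lemma polar_J_unique:
  assumes w: "bilinear w" "\<And>u v. w v u = - w u v"
    and g: "bilinear g" "\<And>u v. g u v = g v u" "\<And>u. u \<noteq> 0 \<Longrightarrow> g u u > 0"
    and J: "polar_J w g J" and K: "polar_J w g K"
  shows "J = K"
proof
  fix v
  have lin: "linear J" "linear K" using J K by (auto simp: polar_J_def)
  have q: "w u (J u) = w u (K u)" for u
    using polar_J_quadratic_le[OF w g J K, of u] polar_J_quadratic_le[OF w g K J, of u] by simp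
  have eq: "w u (J v) = w u (K v)" for u
    using q[of "u + v"] q[of u] q[of v] polar_J_symmetric[OF w J, of u v] polar_J_symmetric[OF w K, of u v]
    by (simp add: bilinear_ladd[OF w(1)] bilinear_radd[OF w(1)] linear_add[OF lin(1)] linear_add[OF lin(2)])
  define z where "z = J v - K v"
  have "w z (J z) = 0"
    using eq[of "J z"] w(2)[of "J z" z] by (simp add: z_def bilinear_rsub[OF w(1)])
  then have "z = 0" using J unfolding polar_J_def by force
  then show "J v = K v" by (simp add: z_def)
qed

text \<open>The pointwise inverse is smooth as the solution of a linear equation in the space of
  operators: its composition with \<open>R p\<close> is the identity.\<close>

lemma smooth_inverse_op:
  fixes R :: "'p::real_normed_vector \<Rightarrow> ('e::euclidean_space \<Rightarrow>\<^sub>L 'e)"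
  assumes V: "open V" and R: "smooth_on V R" "\<And>p u. p \<in> V \<Longrightarrow> R p u = 0 \<Longrightarrow> u = 0"
  obtains S :: "'p \<Rightarrow> 'e \<Rightarrow>\<^sub>L 'e" where "smooth_on V S" "\<And>p u. p \<in> V \<Longrightarrow> S p (R p u) = u" "\<And>p u. p \<in> V \<Longrightarrow> R p (S p u) = u"
proof -
  have "\<exists>S :: 'e \<Rightarrow>\<^sub>L 'e. (\<forall>u. S (R p u) = u) \<and> (\<forall>u. R p (S u) = u)" if p: "p \<in> V" for p
  proof -
    obtain N where N: "linear N" "\<And>u. N (R p u) = u" "\<And>u. R p (N u) = u"
      by (rule linear_injective_inverse[of "blinfun_apply (R p)"])
        (use R(2)[OF p] in \<open>auto simp: blinfun.bounded_linear_right bounded_linear.linear\<close>)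
    then show ?thesis
      by (intro exI[of _ "Blinfun N"]) (simp add: bounded_linear_Blinfun_apply linear_conv_bounded_linear)
  qed
  then obtain S :: "'p \<Rightarrow> 'e \<Rightarrow>\<^sub>L 'e" where S: "\<And>p. p \<in> V \<Longrightarrow> (\<forall>u. S p (R p u) = u) \<and> (\<forall>u. R p (S p u) = u)"
    by metis
  define Lm :: "('e \<Rightarrow>\<^sub>L 'e) \<Rightarrow> ('e \<Rightarrow>\<^sub>L 'e) \<Rightarrow>\<^sub>L ('e \<Rightarrow>\<^sub>L 'e)" where
    "Lm = bounded_bilinear.prod_right (o\<^sub>L)"
  have Lm: "Lm Y w = Y o\<^sub>L w" for Y w
    unfolding Lm_def by (simp add: bounded_bilinear.prod_right.rep_eq[OF bounded_bilinear_blinfun_compose])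
  have Lbl: "bounded_linear Lm"
    unfolding Lm_def by (rule bounded_bilinear.bounded_linear_prod_right[OF bounded_bilinear_blinfun_compose])
  have "smooth_on V S"
  proof (rule smooth_on_linear_solve[where A="\<lambda>p. Lm (R p)" and b="\<lambda>p. id_blinfun", OF V])
    show "smooth_on V (\<lambda>p. Lm (R p))" by (rule smooth_on_bounded_linear[OF Lbl V R(1)])
    fix p assume p: "p \<in> V"
    show "Lm (R p) (S p) = id_blinfun" by (rule blinfun_eqI) (simp add: Lm S[OF p])
    show "\<exists>B :: ('e \<Rightarrow>\<^sub>L 'e) \<Rightarrow>\<^sub>L ('e \<Rightarrow>\<^sub>L 'e). (\<forall>z. B (Lm (R p) z) = z) \<and> (\<forall>z. Lm (R p) (B z) = z)"
      by (intro exI[of _ "Lm (S p)"] conjI allI; rule blinfun_eqI) (simp_all add: Lm S[OF p])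
  qed simp
  then show thesis using that S by blast
qed

locale polar_field =
  fixes W :: "'p::real_normed_vector set" and w g :: "'p \<Rightarrow> 'e::euclidean_space \<Rightarrow> 'e \<Rightarrow> real"
  assumes W: "open W"
    and w: "\<And>p. p \<in> W \<Longrightarrow> bilinear (w p)" "\<And>p u v. p \<in> W \<Longrightarrow> w p v u = - w p u v"
      "\<And>p u. p \<in> W \<Longrightarrow> (\<And>v. w p u v = 0) \<Longrightarrow> u = 0" "\<And>u v. smooth_on W (\<lambda>p. w p u v)"
    and g: "\<And>p. p \<in> W \<Longrightarrow> bilinear (g p)" "\<And>p u v. p \<in> W \<Longrightarrow> g p u v = g p v u"
      "\<And>p u. p \<in> W \<Longrightarrow> u \<noteq> 0 \<Longrightarrow> g p u u > 0" "\<And>u v. smooth_on W (\<lambda>p. g p u v)"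
begin

text \<open>In the frame given by the square root \<open>R\<close> of the metric, \<open>g\<close>
  becomes the Euclidean product and \<open>w\<close> an antisymmetric operator \<open>B\<close>.
  Dividing \<open>B\<close> by the positive square root \<open>P\<close> of minus its square leaves
  an orthogonal complex structure \<open>K\<close>, and \<open>J\<close> is \<open>K\<close> carried
  back by \<open>R\<close>.\<close>

lemma polar_J_local:
  assumes p0: "p0 \<in> W"
  obtains V J where "open V" "p0 \<in> V" "V \<subseteq> W" "\<forall>p\<in>V. polar_J (w p) (g p) (J p)" "\<forall>u. smooth_on V (\<lambda>p. J p u)"
proof -
  have rz: "smooth_on W (\<lambda>p. riesz_op (b p) u)" if "\<And>u v. smooth_on W (\<lambda>p. b p u v)" for b :: "'p \<Rightarrow> 'e \<Rightarrow> 'e \<Rightarrow> real" and u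
    unfolding riesz_op_def by (intro smooth_on_sum smooth_on_scaleR smooth_on_const that W)
  define G where "G p = Blinfun (riesz_op (g p))" for p
  define \<Omega> where "\<Omega> p = Blinfun (riesz_op (w p))" for p
  have Gsm: "smooth_on W G" unfolding G_def by (rule smooth_on_Blinfun[OF W(1) linear_riesz_op[OF g(1)] rz[OF g(4)]])
  have \<Omega>sm: "smooth_on W \<Omega>" unfolding \<Omega>_def by (rule smooth_on_Blinfun[OF W(1) linear_riesz_op[OF w(1)] rz[OF w(4)]])
  have Gi: "G p u \<bullet> v = g p u v" and \<Omega>i: "\<Omega> p u \<bullet> v = w p u v" if p: "p \<in> W" for p u v
    unfolding G_def \<Omega>_def using linear_riesz_op[OF g(1)[OF p]] linear_riesz_op[OF w(1)[OF p]]
    by (simp_all add: bounded_linear_Blinfun_apply linear_conv_bounded_linear riesz_op_inner g(1)[OF p] w(1)[OF p])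
  have "positive_op (G p)" if p: "p \<in> W" for p
    unfolding positive_op_def symmetric_op_def using g(2,3)[OF p] by (simp add: Gi[OF p] inner_commute[of _ "blinfun_apply (G p) _"])
  then obtain V1 and R :: "'p \<Rightarrow> 'e \<Rightarrow>\<^sub>L 'e" where V1: "open V1" "p0 \<in> V1" "V1 \<subseteq> W" and R: "smooth_on V1 R" "\<And>p. p \<in> V1 \<Longrightarrow> positive_op (R p)"
    "\<And>p. p \<in> V1 \<Longrightarrow> R p o\<^sub>L R p = G p"
    using smooth_sqrt[OF W p0 Gsm] by metis
  have pos_inj: "u = 0" if "positive_op A" "A u = 0" for A :: "'e \<Rightarrow>\<^sub>L 'e" and u
    using that by (auto simp: positive_op_def)
  obtain S :: "'p \<Rightarrow> 'e \<Rightarrow>\<^sub>L 'e" where S: "smooth_on V1 S" "\<And>p u. p \<in> V1 \<Longrightarrow> S p (R p u) = u" "\<And>p u. p \<in> V1 \<Longrightarrow> R p (S p u) = u"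
    using smooth_inverse_op[OF V1(1) R(1)] pos_inj R(2) by blast
  have Rsym: "R p u \<bullet> v = u \<bullet> R p v" if "p \<in> V1" for p u v
    using R(2)[OF that] by (simp add: positive_op_def symmetric_op_def)
  have Ssym: "S p u \<bullet> v = u \<bullet> S p v" if "p \<in> V1" for p u v
    using Rsym[OF that, of "S p u" "S p v"] S(3)[OF that] by simp
  define B where "B p = S p o\<^sub>L (\<Omega> p o\<^sub>L S p)" for p
  have Bsm: "smooth_on V1 B"
    unfolding B_def by (intro smooth_on_blinfun_compose V1 S smooth_on_subset[OF \<Omega>sm V1(3)])
  have Banti: "B p u \<bullet> v = - (u \<bullet> B p v)" if p: "p \<in> V1" for p u v
  proof -
    have pW: "p \<in> W" using p V1 by auto
    have "B p u \<bullet> v = w p (S p u) (S p v)" by (simp add: B_def Ssym[OF p] \<Omega>i[OF pW])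
    also have "\<dots> = - w p (S p v) (S p u)" by (rule w(2)[OF pW])
    also have "w p (S p v) (S p u) = B p v \<bullet> u" by (simp add: B_def Ssym[OF p] \<Omega>i[OF pW])
    finally show ?thesis by (simp add: inner_commute)
  qed
  have w_eq: "w p u v = B p (R p u) \<bullet> R p v" if p: "p \<in> V1" for p u v
  proof -
    have pW: "p \<in> W" using p V1 by auto
    have "B p (R p u) \<bullet> R p v = S p (\<Omega> p u) \<bullet> R p v" by (simp add: B_def S(2)[OF p])
    also have "\<dots> = \<Omega> p u \<bullet> v" using Rsym[OF p, of "S p (\<Omega> p u)" v] by (simp add: S(3)[OF p])
    finally show ?thesis by (simp add: \<Omega>i[OF pW])
  qed
  have g_eq: "g p u v = R p u \<bullet> R p v" if p: "p \<in> V1" for p u v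
  proof -
    have pW: "p \<in> W" using p V1 by auto
    have "G p u = R p (R p u)" using R(3)[OF p] by (metis blinfun_apply_blinfun_compose)
    then show ?thesis using Gi[OF pW, of u v] Rsym[OF p, of "R p u" v] by simp
  qed
  have Binj: "u = 0" if p: "p \<in> V1" and u: "B p u = 0" for p u
  proof -
    have pW: "p \<in> W" using p V1 by auto
    have "w p (S p u) v = 0" for v unfolding w_eq[OF p] S(3)[OF p] u by simp
    then have "S p u = 0" by (rule w(3)[OF pW])
    then show ?thesis using S(3)[OF p, of u] by simp
  qed
  define Q where "Q p = - (B p o\<^sub>L B p)" for p
  have Qsm: "smooth_on V1 Q" unfolding Q_def by (intro smooth_on_uminus smooth_on_blinfun_compose V1 Bsm)
  have "positive_op (Q p)" if p: "p \<in> V1" for p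
    unfolding positive_op_def symmetric_op_def
  proof (intro conjI allI impI)
    show "Q p u \<bullet> v = u \<bullet> Q p v" for u v
      by (simp add: Q_def blinfun.minus_left Banti[OF p])
    fix u :: 'e assume "u \<noteq> 0"
    then have "B p u \<noteq> 0" using Binj[OF p] by blast
    then have "B p u \<bullet> B p u > 0" by simp
    moreover have "B p (B p u) \<bullet> u = - (B p u \<bullet> B p u)" by (rule Banti[OF p])
    ultimately show "Q p u \<bullet> u > 0" by (simp add: Q_def blinfun.minus_left)
  qed
  then obtain V and P :: "'p \<Rightarrow> 'e \<Rightarrow>\<^sub>L 'e" where V: "open V" "p0 \<in> V" "V \<subseteq> V1" and P: "smooth_on V P" "\<And>p. p \<in> V \<Longrightarrow> positive_op (P p)"
    "\<And>p. p \<in> V \<Longrightarrow> P p o\<^sub>L P p = Q p" "\<And>p X. p \<in> V \<Longrightarrow> X o\<^sub>L Q p = Q p o\<^sub>L X \<Longrightarrow> X o\<^sub>L P p = P p o\<^sub>L X"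
    using smooth_sqrt[OF V1(1,2) Qsm] by metis
  obtain N :: "'p \<Rightarrow> 'e \<Rightarrow>\<^sub>L 'e" where N: "smooth_on V N" "\<And>p u. p \<in> V \<Longrightarrow> N p (P p u) = u" "\<And>p u. p \<in> V \<Longrightarrow> P p (N p u) = u"
    using smooth_inverse_op[OF V(1) P(1)] pos_inj P(2) by blast
  define J where "J p u = S p (N p (B p (R p u)))" for p u
  show thesis
  proof (rule that[OF V(1,2)], goal_cases)
    case 1
    show "V \<subseteq> W" using V V1 by auto
  next
    case 3
    show "\<forall>u. smooth_on V (\<lambda>p. J p u)"
      unfolding J_def
      by (intro allI smooth_on_blinfun_apply V N smooth_on_const smooth_on_subset[OF S(1) V(3)] smooth_on_subset[OF Bsm V(3)]
          smooth_on_subset[OF R(1) V(3)])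
  next
    case 2
    show "\<forall>p\<in>V. polar_J (w p) (g p) (J p)"
  proof
    fix p assume p: "p \<in> V"
    then have p1: "p \<in> V1" using V by auto
    have "B p o\<^sub>L Q p = Q p o\<^sub>L B p" by (rule blinfun_eqI) (simp add: Q_def blinfun.bilinear_simps)
    from arg_cong[OF P(4)[OF p this], of "\<lambda>Z. blinfun_apply Z u" for u]
    have BP: "B p (P p u) = P p (B p u)" for u by simp
    have BN: "B p (N p u) = N p (B p u)" for u
      using BP[of "N p u"] N(2,3)[OF p] by metis
    have PP: "P p (P p u) = - B p (B p u)" for u
      using arg_cong[OF P(3)[OF p], of "\<lambda>Z. blinfun_apply Z u"] by (simp add: Q_def blinfun.minus_left)
    have Psym: "P p u \<bullet> v = u \<bullet> P p v" for u v
      using P(2)[OF p] by (simp add: positive_op_def symmetric_op_def)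
    have Nsym: "N p u \<bullet> v = u \<bullet> N p v" for u v
      using Psym[of "N p u" "N p v"] N(3)[OF p] by simp
    define K where "K u = N p (B p u)" for u
    have KK: "K (K u) = - u" for u
    proof -
      have "K (K u) = N p (N p (B p (B p u)))" by (simp add: K_def BN)
      also have "B p (B p u) = - P p (P p u)" by (simp add: PP)
      finally show ?thesis by (simp add: blinfun.minus_right N(2)[OF p])
    qed
    have BK: "B p (K u) = K (B p u)" for u by (simp add: K_def BN)
    have Kanti: "K u \<bullet> v = - (u \<bullet> K v)" for u v
      by (simp add: K_def Nsym Banti[OF p1] BN)
    have RJ: "R p (J p u) = K (R p u)" for u by (simp add: J_def K_def S(3)[OF p1])
    show "polar_J (w p) (g p) (J p)"
      unfolding polar_J_def
    proof (intro conjI allI impI)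
      show "linear (J p)" unfolding J_def by (intro linearI) (simp_all add: blinfun.add_right blinfun.scaleR_right)
      have "J p (J p u) = S p (K (K (R p u)))" for u by (simp add: J_def K_def S(3)[OF p1])
      then show "J p (J p u) = - u" for u by (simp add: KK blinfun.minus_right S(2)[OF p1])
      show "w p (J p u) (J p v) = w p u v" for u v
      proof -
        have "w p (J p u) (J p v) = K (B p (R p u)) \<bullet> K (R p v)" unfolding w_eq[OF p1] RJ BK ..
        also have "\<dots> = - (B p (R p u) \<bullet> K (K (R p v)))" by (rule Kanti)
        finally show ?thesis by (simp add: KK w_eq[OF p1])
      qed
      show "g p (J p u) (J p v) = g p u v" for u v
        unfolding g_eq[OF p1] RJ by (simp add: Kanti KK)
      fix u :: 'e assume u: "u \<noteq> 0"
      define a where "a = B p (R p u)"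
      have "R p u \<noteq> 0" using pos_inj[OF R(2)[OF p1]] u by blast
      then have "a \<noteq> 0" unfolding a_def using Binj[OF p1] by blast
      then have "N p a \<noteq> 0" using N(3)[OF p, of a] by auto
      then have "P p (N p a) \<bullet> N p a > 0" using P(2)[OF p] by (simp add: positive_op_def)
      then have "a \<bullet> N p a > 0" by (simp add: N(3)[OF p])
      then show "w p u (J p u) > 0" unfolding w_eq[OF p1] RJ K_def a_def .
    qed
  qed
qed
qed

lemma polar_J_ex1: "p \<in> W \<Longrightarrow> \<exists>!J. polar_J (w p) (g p) J"
proof -
  assume p: "p \<in> W"
  obtain V K where "p \<in> V" "\<forall>p\<in>V. polar_J (w p) (g p) (K p)"
    by (rule polar_J_local[OF p])
  then have "polar_J (w p) (g p) (K p)" by blast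
  then show ?thesis using polar_J_unique[OF w(1,2) g(1,2,3)] p by blast
qed

text \<open>By uniqueness any pointwise choice coincides near each point with the smooth one of
  \<open>polar_J_local\<close>.\<close>

theorem smooth_polar_J:
  assumes J: "\<And>p. p \<in> W \<Longrightarrow> polar_J (w p) (g p) (J p)"
  shows "smooth_on W (\<lambda>p. J p u)"
proof (rule smooth_on_local)
  fix p assume p: "p \<in> W"
  obtain V K where V: "open V" "p \<in> V" "V \<subseteq> W" and K: "\<forall>p\<in>V. polar_J (w p) (g p) (K p)" "\<forall>u. smooth_on V (\<lambda>p. K p u)"
    by (rule polar_J_local[OF p])
  have "K q u = J q u" if "q \<in> V" for q
  proof -
    have q: "q \<in> W" using V(3) that by auto
    have "K q = J q"
      by (rule polar_J_unique[OF w(1)[OF q] w(2)[OF q] g(1)[OF q] g(2)[OF q] g(3)[OF q] K(1)[rule_format, OF that] J[OF q]])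
    then show ?thesis by simp
  qed
  then have "smooth_on V (\<lambda>p. J p u)" by (rule smooth_on_cong[OF V(1) K(2)[rule_format]])
  then show "\<exists>T. open T \<and> p \<in> T \<and> smooth_on T (\<lambda>p. J p u)" using V by blast
qed

end

section \<open>Leafwise metrics on closed foliated manifolds\<close>

lemma smooth_on_linear_field:
  fixes A :: "'p::real_normed_vector \<Rightarrow> 'e::euclidean_space \<Rightarrow> 'c::real_normed_vector"
  assumes W: "open W" and A: "\<And>p. p \<in> W \<Longrightarrow> linear (A p)" "\<And>u. smooth_on W (\<lambda>p. A p u)" and w: "smooth_on W w"
  shows "smooth_on W (\<lambda>p. A p (w p))"
proof (rule smooth_on_cong[OF W])
  show "smooth_on W (\<lambda>p. \<Sum>a\<in>Basis. (w p \<bullet> a) *\<^sub>R A p a)"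
    by (intro smooth_on_sum smooth_on_scaleR smooth_on_inner smooth_on_const W A w)
  fix p assume p: "p \<in> W"
  have "A p (\<Sum>a\<in>Basis. (w p \<bullet> a) *\<^sub>R a) = (\<Sum>a\<in>Basis. (w p \<bullet> a) *\<^sub>R A p a)"
    by (simp add: linear_sum[OF A(1)[OF p]] linear_scale[OF A(1)[OF p]])
  then show "(\<Sum>a\<in>Basis. (w p \<bullet> a) *\<^sub>R A p a) = A p (w p)" by (simp add: euclidean_representation)
qed

lemma (in smooth_atlas_on) smooth_transition_deriv:
  assumes i: "i \<in> indices X" and j: "j \<in> indices X"
  shows "smooth_on (coord X i ` (patch X i \<inter> patch X j)) (\<lambda>x. transition_deriv X i j (param X i x) u)"
proof (rule smooth_on_cong[OF open_overlap[OF i j] smooth_on_frechet_derivative[OF smooth_transition[OF i j]]])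
  fix x assume "x \<in> coord X i ` (patch X i \<inter> patch X j)"
  then have "x \<in> coord X i ` patch X i" by auto
  then show "frechet_derivative (coord X j \<circ> param X i) (at x) u = transition_deriv X i j (param X i x) u"
    by (simp add: transition_deriv_def)
qed

section \<open>Leafwise differentials, metrics and forms\<close>

context foliated begin

definition leaf_deriv :: "'i \<Rightarrow> 'i \<Rightarrow> 'a \<Rightarrow> 'e \<Rightarrow> 'e" where
  "leaf_deriv i j p u = fst (transition_deriv F i j p (u, 0))"

lemma leaf_deriv_pair:
  "i \<in> charts_at F p \<Longrightarrow> j \<in> charts_at F p \<Longrightarrow> transition_deriv F i j p (u, 0) = (leaf_deriv i j p u, 0)"
  using tangent_transition[of i p j u] by (simp add: leaf_deriv_def prod_eq_iff)

lemma linear_leaf_deriv: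
  assumes "i \<in> charts_at F p" "j \<in> charts_at F p"
  shows "linear (leaf_deriv i j p)"
proof -
  have "linear (\<lambda>u::'e. (u, 0::real))" by (rule linearI) auto
  from linear_compose[OF linear_compose[OF this linear_transition_deriv[OF assms]] linear_fst]
  show ?thesis by (simp add: leaf_deriv_def[abs_def] o_def)
qed

lemma leaf_deriv_compose:
  assumes "i \<in> charts_at F p" "j \<in> charts_at F p" "k \<in> charts_at F p"
  shows "leaf_deriv j k p (leaf_deriv i j p u) = leaf_deriv i k p u"
  using transition_deriv_compose[OF assms, of "(u, 0)"]
  by (simp add: leaf_deriv_pair[OF assms(1,2)] leaf_deriv_pair[OF assms(2,3)] leaf_deriv_pair[OF assms(1,3)])

lemma leaf_deriv_same: "i \<in> charts_at F p \<Longrightarrow> leaf_deriv i i p u = u"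
  by (simp add: leaf_deriv_def transition_deriv_same)

lemma leaf_deriv_inverse:
  "i \<in> charts_at F p \<Longrightarrow> j \<in> charts_at F p \<Longrightarrow> leaf_deriv j i p (leaf_deriv i j p u) = u"
  by (simp add: leaf_deriv_compose leaf_deriv_same)

lemma leaf_deriv_eq_0:
  assumes "i \<in> charts_at F p" "j \<in> charts_at F p" "leaf_deriv i j p u = 0"
  shows "u = 0"
  using leaf_deriv_inverse[OF assms(1,2), of u] assms(3) linear_0[OF linear_leaf_deriv[OF assms(2,1)]] by simp

lemma smooth_leaf_deriv:
  assumes i: "i \<in> indices F" and j: "j \<in> indices F"
  shows "smooth_on (coord F i ` (patch F i \<inter> patch F j)) (\<lambda>x. leaf_deriv i j (param F i x) u)"
  unfolding leaf_deriv_def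
  by (rule smooth_on_bounded_linear[OF bounded_linear_fst open_overlap[OF i j] smooth_transition_deriv[OF i j]])

definition leaf_metric :: "('i \<Rightarrow> 'a \<Rightarrow> 'e \<Rightarrow> 'e \<Rightarrow> real) \<Rightarrow> bool" where
  "leaf_metric b \<longleftrightarrow>
     (\<forall>i\<in>indices F. \<forall>p\<in>patch F i. bilinear (b i p) \<and> (\<forall>u v. b i p u v = b i p v u) \<and> (\<forall>u. u \<noteq> 0 \<longrightarrow> b i p u u > 0)) \<and>
     (\<forall>i\<in>indices F. \<forall>u v. smooth_on (coord F i ` patch F i) (\<lambda>z. b i (param F i z) u v)) \<and>
     (\<forall>p. \<forall>i\<in>charts_at F p. \<forall>j\<in>charts_at F p. \<forall>u v.
        b i p u v = b j p (leaf_deriv i j p u) (leaf_deriv i j p v))"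

lemma leaf_metricD:
  assumes b: "leaf_metric b" and i: "i \<in> charts_at F p"
  shows "bilinear (b i p)" "b i p u v = b i p v u" "u \<noteq> 0 \<Longrightarrow> b i p u u > 0"
    "j \<in> charts_at F p \<Longrightarrow> b i p u v = b j p (leaf_deriv i j p u) (leaf_deriv i j p v)"
proof -
  have "i \<in> indices F" "p \<in> patch F i" using i by (auto simp: charts_at_def)
  then show "bilinear (b i p)" "b i p u v = b i p v u" "u \<noteq> 0 \<Longrightarrow> b i p u u > 0"
    using b unfolding leaf_metric_def by blast+
  show "j \<in> charts_at F p \<Longrightarrow> b i p u v = b j p (leaf_deriv i j p u) (leaf_deriv i j p v)"
    using b i unfolding leaf_metric_def by blast
qed

lemma smooth_leaf_metric: "leaf_metric b \<Longrightarrow> i \<in> indices F \<Longrightarrow> smooth_on (coord F i ` patch F i) (\<lambda>z. b i (param F i z) u v)"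
  unfolding leaf_metric_def by blast

lemma leafwise_2formD:
  assumes w: "leafwise_2form F \<omega>" and i: "i \<in> charts_at F p"
  shows "bilinear (\<omega> i p)" "\<omega> i p v u = - \<omega> i p u v"
    "j \<in> charts_at F p \<Longrightarrow> \<omega> i p u v = \<omega> j p (leaf_deriv i j p u) (leaf_deriv i j p v)"
proof -
  have "i \<in> indices F" "p \<in> patch F i" using i by (auto simp: charts_at_def)
  then show "bilinear (\<omega> i p)" "\<omega> i p v u = - \<omega> i p u v"
    using w unfolding leafwise_2form_def by blast+
  show "j \<in> charts_at F p \<Longrightarrow> \<omega> i p u v = \<omega> j p (leaf_deriv i j p u) (leaf_deriv i j p v)"
    using w i unfolding leafwise_2form_def leaf_deriv_def by blast
qed

lemma smooth_leafwise_2form: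
  "leafwise_2form F \<omega> \<Longrightarrow> i \<in> indices F \<Longrightarrow> smooth_on (coord F i ` patch F i) (\<lambda>z. \<omega> i (param F i z) u v)"
  unfolding leafwise_2form_def by blast

text \<open>A point outside the patch of \<open>q\<close> has a neighbourhood that misses the image
  of \<open>cball z r\<close>, off which the cutoff vanishes. This image is compact, and it is
  closed because the space is Hausdorff.\<close>

lemma local_leaf_product:
  assumes q: "q \<in> indices F" and r: "cball z r \<subseteq> coord F q ` patch F q"
    and \<beta>: "smooth_on UNIV \<beta>" "\<And>x. dist z x \<ge> r \<Longrightarrow> \<beta> x = 0" and H: "Hausdorff_space (atlas_topology F)"
    and j: "j \<in> indices F"
  shows "smooth_on (coord F j ` patch F j) (\<lambda>x. if param F j x \<in> patch F q
      then \<beta> (coord F q (param F j x)) * (leaf_deriv j q (param F j x) u \<bullet> leaf_deriv j q (param F j x) v) else 0)"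
    (is "smooth_on _ ?f")
proof (rule smooth_on_local)
  let ?K = "param F q ` cball z r"
  fix x assume x: "x \<in> coord F j ` patch F j"
  let ?p = "param F j x"
  show "\<exists>T. open T \<and> x \<in> T \<and> smooth_on T ?f"
  proof (cases "?p \<in> patch F q")
    case True
    let ?T = "coord F j ` (patch F j \<inter> patch F q)"
    have "smooth_on ?T (\<lambda>x. \<beta> ((coord F q \<circ> param F j) x))"
      by (rule smooth_on_compose[OF open_overlap[OF j q] open_UNIV \<beta>(1) smooth_transition[OF j q]]) simp
    then have "smooth_on ?T (\<lambda>x. \<beta> ((coord F q \<circ> param F j) x) * (leaf_deriv j q (param F j x) u \<bullet> leaf_deriv j q (param F j x) v))"
      by (intro smooth_on_mult smooth_on_inner smooth_leaf_deriv open_overlap j q)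
    then have "smooth_on ?T ?f"
      by (rule smooth_on_cong[OF open_overlap[OF j q]]) (simp add: overlap_iff[OF j])
    moreover have "x \<in> ?T" using x True by (simp add: overlap_iff[OF j])
    ultimately show ?thesis using open_overlap[OF j q] by blast
  next
    case False
    let ?O = "points F - ?K"
    have "closedin (atlas_topology F) ?K"
      by (rule compactin_imp_closedin[OF H compactin_param_image[OF q compact_cball r]])
    then have O: "openin (atlas_topology F) ?O"
      by (simp add: closedin_def topspace_eq)
    let ?T = "coord F j ` (patch F j \<inter> ?O)"
    have oT: "open ?T" by (rule openin_coord_image[OF O j])
    have "?K \<subseteq> patch F q" using r param_in_patch by blast
    then have xT: "x \<in> ?T" using x False patch_subset[OF j] param_in_patch[OF x] by (auto simp: overlap_iff[OF j])
    have "smooth_on ?T ?f"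
    proof (rule smooth_on_cong[OF oT smooth_on_const[of _ 0]])
      fix y assume "y \<in> ?T"
      then have y: "param F j y \<notin> ?K" by (simp add: overlap_iff[OF j])
      show "0 = ?f y"
      proof (cases "param F j y \<in> patch F q")
        case True
        then have "coord F q (param F j y) \<notin> cball z r" using y q by (metis image_eqI param_coord)
        then show ?thesis using \<beta>(2) by simp
      qed simp
    qed
    then show ?thesis using oT xT by blast
  qed
qed

text \<open>Euclidean inner products in finitely many charts are added up with cutoff functions as weights.\<close>

theorem leaf_metric_exists:
  assumes H: "Hausdorff_space (atlas_topology F)" and K: "compact_space (atlas_topology F)"
  obtains b where "leaf_metric b"
proof -
  have "\<exists>i r. i \<in> indices F \<and> q \<in> patch F i \<and> r > 0 \<and> cball (coord F i q) r \<subseteq> coord F i ` patch F i" if q: "q \<in> points F" for q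
  proof -
    obtain i where i: "i \<in> indices F" "q \<in> patch F i" using points_chart[OF q] by blast
    then obtain r where "r > 0" "cball (coord F i q) r \<subseteq> coord F i ` patch F i"
      using open_chart[OF i(1)] open_contains_cball by blast
    then show ?thesis using i by blast
  qed
  then obtain c r where cr: "\<And>q. q \<in> points F \<Longrightarrow> c q \<in> indices F \<and> q \<in> patch F (c q) \<and> r q > 0 \<and>
      cball (coord F (c q) q) (r q) \<subseteq> coord F (c q) ` patch F (c q)"
    by metis
  \<comment> \<open>On the ball of half the radius the cutoff is 1. Finitely many of these sets
    cover the space, so at every point some weight is 1 and the sum is positive definite.\<close>
  define V where "V q = param F (c q) ` ball (coord F (c q) q) (r q / 2)" for q
  have Vb: "ball (coord F (c q) q) (r q / 2) \<subseteq> coord F (c q) ` patch F (c q)" if "q \<in> points F" for q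
    using cr[OF that] by (auto simp: subset_eq)
  have qV: "q \<in> V q" if "q \<in> points F" for q
    unfolding V_def using cr[OF that] by (intro image_eqI[of _ _ "coord F (c q) q"]) auto
  have "\<forall>U\<in>V ` points F. openin (atlas_topology F) U"
    unfolding V_def using openin_param_image cr Vb by (auto intro!: openin_param_image)
  moreover have "topspace (atlas_topology F) \<subseteq> \<Union>(V ` points F)" using qV topspace_eq by auto
  ultimately obtain \<V> where \<V>: "finite \<V>" "\<V> \<subseteq> V ` points F" "topspace (atlas_topology F) \<subseteq> \<Union>\<V>"
    using K unfolding compact_space_alt by meson
  obtain Q where Q: "finite Q" "Q \<subseteq> points F" "\<V> = V ` Q"
    using finite_subset_image[OF \<V>(1,2)] by blast
  have "\<exists>\<beta> :: 'e \<times> real \<Rightarrow> real. smooth_on UNIV \<beta> \<and> (\<forall>x. 0 \<le> \<beta> x) \<and> (\<forall>x. dist (coord F (c q) q) x \<le> r q / 2 \<longrightarrow> \<beta> x = 1) \<and>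
      (\<forall>x. dist (coord F (c q) q) x \<ge> r q \<longrightarrow> \<beta> x = 0)" if "q \<in> points F" for q
  proof -
    have "r q > 0" using cr[OF that] by simp
    from smooth_cutoff[OF this, of "coord F (c q) q"] show ?thesis by metis
  qed
  then obtain \<beta> :: "'a \<Rightarrow> 'e \<times> real \<Rightarrow> real" where \<beta>: "\<And>q. q \<in> points F \<Longrightarrow> smooth_on UNIV (\<beta> q) \<and> (\<forall>x. 0 \<le> \<beta> q x) \<and>
      (\<forall>x. dist (coord F (c q) q) x \<le> r q / 2 \<longrightarrow> \<beta> q x = 1) \<and> (\<forall>x. dist (coord F (c q) q) x \<ge> r q \<longrightarrow> \<beta> q x = 0)"
    by metis
  define f where "f q p = (if p \<in> patch F (c q) then \<beta> q (coord F (c q) p) else 0)" for q p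
  have f0: "0 \<le> f q p" if "q \<in> Q" for q p using \<beta>[of q] that Q(2) unfolding f_def by (simp del: split_paired_All add: subset_iff)
  define b where "b j p u v = (\<Sum>q\<in>Q. f q p * (leaf_deriv j (c q) p u \<bullet> leaf_deriv j (c q) p v))" for j p u v
  have ch: "c q \<in> charts_at F p" if "q \<in> Q" "f q p \<noteq> 0" for q p
    using that Q(2) cr unfolding f_def charts_at_def by (auto split: if_splits)
  have inv: "b i p u v = b j p (leaf_deriv i j p u) (leaf_deriv i j p v)" if "i \<in> charts_at F p" "j \<in> charts_at F p" for i j p u v
    unfolding b_def
  proof (rule sum.cong[OF refl])
    fix q assume q: "q \<in> Q"
    show "f q p * (leaf_deriv i (c q) p u \<bullet> leaf_deriv i (c q) p v) =
        f q p * (leaf_deriv j (c q) p (leaf_deriv i j p u) \<bullet> leaf_deriv j (c q) p (leaf_deriv i j p v))"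
      using ch[OF q, of p] leaf_deriv_compose[OF that] by (cases "f q p = 0") auto
  qed
  have bil: "bilinear (b j p)" if j: "j \<in> charts_at F p" for j p
  proof -
    have add: "leaf_deriv j (c q) p (u + v) = leaf_deriv j (c q) p u + leaf_deriv j (c q) p v"
      and scale: "leaf_deriv j (c q) p (a *\<^sub>R u) = a *\<^sub>R leaf_deriv j (c q) p u" if "q \<in> Q" "f q p \<noteq> 0" for q u v a
      using linear_leaf_deriv[OF j ch[OF that]] by (auto simp: linear_add linear_scale)
    have "b j p (u + u') v = b j p u v + b j p u' v" for u u' v
      unfolding b_def sum.distrib[symmetric]
    proof (rule sum.cong[OF refl])
      fix q assume q: "q \<in> Q"
      show "f q p * (leaf_deriv j (c q) p (u + u') \<bullet> leaf_deriv j (c q) p v) =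
          f q p * (leaf_deriv j (c q) p u \<bullet> leaf_deriv j (c q) p v) + f q p * (leaf_deriv j (c q) p u' \<bullet> leaf_deriv j (c q) p v)"
        using add[OF q] by (cases "f q p = 0") (auto simp: inner_add_left distrib_left)
    qed
    moreover have "b j p (a *\<^sub>R u) v = a * b j p u v" for a u v
      unfolding b_def sum_distrib_left
    proof (rule sum.cong[OF refl])
      fix q assume q: "q \<in> Q"
      show "f q p * (leaf_deriv j (c q) p (a *\<^sub>R u) \<bullet> leaf_deriv j (c q) p v) =
          a * (f q p * (leaf_deriv j (c q) p u \<bullet> leaf_deriv j (c q) p v))"
        using scale[OF q] by (cases "f q p = 0") auto
    qed
    moreover have "b j p u v = b j p v u" for u v unfolding b_def by (simp add: inner_commute)
    ultimately have "linear (\<lambda>u. b j p u v)" "linear (b j p v)" for v by (auto intro!: linearI)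
    then show ?thesis by (simp add: bilinear_def)
  qed
  have pos: "b j p u u > 0" if j: "j \<in> charts_at F p" and u: "u \<noteq> 0" for j p u
  proof -
    have pF: "p \<in> points F" using j patch_subset by (auto simp: charts_at_def)
    then obtain q where q: "q \<in> Q" "p \<in> V q" using \<V>(3) Q(3) topspace_eq by auto
    have qF: "q \<in> points F" using q Q by auto
    obtain x where x: "x \<in> ball (coord F (c q) q) (r q / 2)" "p = param F (c q) x" using q(2) by (auto simp: V_def)
    have x': "x \<in> coord F (c q) ` patch F (c q)" using x(1) Vb[OF qF] by blast
    have "dist (coord F (c q) q) x \<le> r q / 2" using x(1) by simp
    then have "\<beta> q x = 1" using \<beta>[OF qF] by blast
    then have f1: "f q p = 1" using x' x(2) by (simp add: f_def)
    have "leaf_deriv j (c q) p u \<noteq> 0" using leaf_deriv_eq_0[OF j ch[OF q(1)]] f1 u by auto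
    then have "0 < f q p * (leaf_deriv j (c q) p u \<bullet> leaf_deriv j (c q) p u)" using f1 by simp
    then show ?thesis unfolding b_def
      by (intro sum_pos2[OF Q(1) q(1)]) (use f0 in auto)
  qed
  have sm: "smooth_on (coord F j ` patch F j) (\<lambda>x. b j (param F j x) u v)" if j: "j \<in> indices F" for j u v
    unfolding b_def
  proof (rule smooth_on_sum[OF open_chart[OF j]])
    fix q assume "q \<in> Q"
    then have q: "q \<in> points F" using Q by auto
    have *: "smooth_on (coord F j ` patch F j) (\<lambda>x. if param F j x \<in> patch F (c q)
        then \<beta> q (coord F (c q) (param F j x)) * (leaf_deriv j (c q) (param F j x) u \<bullet> leaf_deriv j (c q) (param F j x) v) else 0)"
      by (rule local_leaf_product[OF _ _ _ _ H j]) (use cr[OF q] \<beta>[OF q] in blast)+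
    show "smooth_on (coord F j ` patch F j) (\<lambda>x. f q (param F j x) * (leaf_deriv j (c q) (param F j x) u \<bullet> leaf_deriv j (c q) (param F j x) v))"
      by (rule smooth_on_cong[OF open_chart[OF j] *]) (simp add: f_def)
  qed
  have "leaf_metric b"
    unfolding leaf_metric_def
  proof (intro conjI ballI allI impI)
    fix i p u assume "i \<in> indices F" "p \<in> patch F i"
    then have i: "i \<in> charts_at F p" by (simp add: charts_at_def)
    show "bilinear (b i p)" by (rule bil[OF i])
    show "b i p u v = b i p v u" for v unfolding b_def by (simp add: inner_commute)
    show "u \<noteq> 0 \<Longrightarrow> 0 < b i p u u" by (rule pos[OF i])
  qed (use sm inv in blast)+
  then show thesis by (rule that)
qed

text \<open>
  Averaging is not possible for almost complex structures; instead the polar decomposition of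
  the form relative to an auxiliary metric makes a choice that is canonical, hence independent
  of the chart.
\<close>

theorem leafwise_polar_exists:
  assumes b: "leaf_metric b" and w: "leafwise_2form F \<omega>"
    and nd: "\<And>i p u. i \<in> charts_at F p \<Longrightarrow> (\<And>v. \<omega> i p u v = 0) \<Longrightarrow> u = 0"
  obtains J where "\<And>i p. i \<in> charts_at F p \<Longrightarrow> polar_J (\<omega> i p) (b i p) (J i p)"
    "\<And>i u. i \<in> indices F \<Longrightarrow> smooth_on (coord F i ` patch F i) (\<lambda>z. J i (param F i z) u)"
    "\<And>i j p u. i \<in> charts_at F p \<Longrightarrow> j \<in> charts_at F p \<Longrightarrow> leaf_deriv i j p (J i p u) = J j p (leaf_deriv i j p u)"
proof -
  note bD = leaf_metricD(1-3)[OF b] and wD = leafwise_2formD(1,2)[OF w] and inv = leaf_metricD(4)[OF b] leafwise_2formD(3)[OF w]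
  define J where "J i p = (THE J. polar_J (\<omega> i p) (b i p) J)" for i p
  have pf: "polar_field (coord F i ` patch F i) (\<lambda>z. \<omega> i (param F i z)) (\<lambda>z. b i (param F i z))" if i: "i \<in> indices F" for i
  proof
    show "open (coord F i ` patch F i)" by (rule open_chart[OF i])
    fix z assume "z \<in> coord F i ` patch F i"
    then have z: "i \<in> charts_at F (param F i z)" using i by (simp add: charts_at_def)
    show "bilinear (\<omega> i (param F i z))" "bilinear (b i (param F i z))" by (rule wD[OF z] bD[OF z])+
    fix u v
    show "\<omega> i (param F i z) v u = - \<omega> i (param F i z) u v" by (rule wD[OF z])
    show "b i (param F i z) u v = b i (param F i z) v u" by (rule bD[OF z])
    show "u \<noteq> 0 \<Longrightarrow> 0 < b i (param F i z) u u" by (rule bD[OF z])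
    show "(\<And>v. \<omega> i (param F i z) u v = 0) \<Longrightarrow> u = 0" by (rule nd[OF z])
  next
    fix u v
    show "smooth_on (coord F i ` patch F i) (\<lambda>z. \<omega> i (param F i z) u v)"
      "smooth_on (coord F i ` patch F i) (\<lambda>z. b i (param F i z) u v)"
      by (intro smooth_leafwise_2form[OF w i] smooth_leaf_metric[OF b i])+
  qed
  have J: "polar_J (\<omega> i p) (b i p) (J i p)" if ip: "i \<in> charts_at F p" for i p
  proof -
    have i: "i \<in> indices F" "p \<in> patch F i" using ip by (auto simp: charts_at_def)
    interpret polar_field "coord F i ` patch F i" "\<lambda>z. \<omega> i (param F i z)" "\<lambda>z. b i (param F i z)" by (rule pf[OF i(1)])
    have "\<exists>!J. polar_J (\<omega> i p) (b i p) J" using polar_J_ex1[of "coord F i p"] i by simp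
    then show ?thesis unfolding J_def by (rule theI')
  qed
  show thesis
  proof (rule that[OF J])
    fix i u assume i: "i \<in> indices F"
    interpret polar_field "coord F i ` patch F i" "\<lambda>z. \<omega> i (param F i z)" "\<lambda>z. b i (param F i z)" by (rule pf[OF i])
    show "smooth_on (coord F i ` patch F i) (\<lambda>z. J i (param F i z) u)"
      by (rule smooth_polar_J) (use J i in \<open>simp add: charts_at_def\<close>)
  next
    fix i j p u assume i: "i \<in> charts_at F p" and j: "j \<in> charts_at F p"
    note lin = linear_leaf_deriv[OF i j] linear_leaf_deriv[OF j i]
    \<comment> \<open>The structure transported from chart \<open>i\<close> to chart
      \<open>j\<close> is polar for the same form and metric, so uniqueness identifies it with
      \<open>J j p\<close>.\<close>
    have "polar_J (\<omega> j p) (b j p) (\<lambda>u. leaf_deriv i j p (J i p (leaf_deriv j i p u)))"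
      unfolding polar_J_def
    proof (intro conjI allI impI)
      have Ji: "linear (J i p)" "\<And>u. J i p (J i p u) = - u" "\<And>u v. \<omega> i p (J i p u) (J i p v) = \<omega> i p u v"
        "\<And>u. u \<noteq> 0 \<Longrightarrow> \<omega> i p u (J i p u) > 0" "\<And>u v. b i p (J i p u) (J i p v) = b i p u v"
        using J[OF i] unfolding polar_J_def by blast+
      show "linear (\<lambda>u. leaf_deriv i j p (J i p (leaf_deriv j i p u)))"
        using linear_compose[OF linear_compose[OF lin(2) Ji(1)] lin(1)] by (simp add: o_def)
      fix u v
      show "leaf_deriv i j p (J i p (leaf_deriv j i p (leaf_deriv i j p (J i p (leaf_deriv j i p u))))) = - u"
        by (simp add: leaf_deriv_inverse[OF i j] leaf_deriv_inverse[OF j i] Ji(2) linear_neg[OF lin(1)])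
      show "\<omega> j p (leaf_deriv i j p (J i p (leaf_deriv j i p u))) (leaf_deriv i j p (J i p (leaf_deriv j i p v))) = \<omega> j p u v"
        unfolding inv(2)[OF i j, symmetric] Ji(3) by (rule inv(2)[OF j i, symmetric])
      show "b j p (leaf_deriv i j p (J i p (leaf_deriv j i p u))) (leaf_deriv i j p (J i p (leaf_deriv j i p v))) = b j p u v"
        unfolding inv(1)[OF i j, symmetric] Ji(5) by (rule inv(1)[OF j i, symmetric])
      assume "u \<noteq> 0"
      then have "leaf_deriv j i p u \<noteq> 0" using leaf_deriv_eq_0[OF j i] by blast
      from Ji(4)[OF this]
      show "\<omega> j p u (leaf_deriv i j p (J i p (leaf_deriv j i p u))) > 0"
        unfolding inv(2)[OF j i, of u] leaf_deriv_inverse[OF i j] .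
    qed
    from polar_J_unique[OF wD[OF j] bD[OF j] this J[OF j]]
    show "leaf_deriv i j p (J i p u) = J j p (leaf_deriv i j p u)"
      by (simp add: fun_eq_iff) (metis leaf_deriv_inverse[OF i j])
  qed
qed

theorem leaf_metric_polar:
  assumes b: "leaf_metric b" and w: "leafwise_2form F \<omega>"
    and J: "\<And>i p. i \<in> charts_at F p \<Longrightarrow> polar_J (\<omega> i p) (b i p) (J i p)"
    "\<And>i u. i \<in> indices F \<Longrightarrow> smooth_on (coord F i ` patch F i) (\<lambda>z. J i (param F i z) u)"
    "\<And>i j p u. i \<in> charts_at F p \<Longrightarrow> j \<in> charts_at F p \<Longrightarrow> leaf_deriv i j p (J i p u) = J j p (leaf_deriv i j p u)"
  shows "leaf_metric (\<lambda>i p u v. \<omega> i p u (J i p v))"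
  unfolding leaf_metric_def
proof (intro conjI ballI allI impI)
  note wD = leafwise_2formD(1,2)[OF w]
  {
    fix i p u assume "i \<in> indices F" "p \<in> patch F i"
    then have i: "i \<in> charts_at F p" by (simp add: charts_at_def)
    have lin: "linear (J i p)" using J(1)[OF i] by (simp add: polar_J_def)
    show "bilinear (\<lambda>u v. \<omega> i p u (J i p v))"
      unfolding bilinear_def
      by (auto intro!: linearI simp: bilinear_ladd[OF wD(1)[OF i]] bilinear_radd[OF wD(1)[OF i]] bilinear_lmul[OF wD(1)[OF i]]
          bilinear_rmul[OF wD(1)[OF i]] linear_add[OF lin] linear_scale[OF lin])
    show "\<omega> i p u (J i p v) = \<omega> i p v (J i p u)" for v by (rule polar_J_symmetric[OF wD[OF i] J(1)[OF i]])
    show "u \<noteq> 0 \<Longrightarrow> 0 < \<omega> i p u (J i p u)" using J(1)[OF i] by (simp add: polar_J_def)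
  }
  {
    fix i u v assume i: "i \<in> indices F"
    show "smooth_on (coord F i ` patch F i) (\<lambda>z. \<omega> i (param F i z) u (J i (param F i z) v))"
    proof (rule smooth_on_linear_field[OF open_chart[OF i] _ smooth_leafwise_2form[OF w i] J(2)[OF i]])
      fix z assume "z \<in> coord F i ` patch F i"
      then have "i \<in> charts_at F (param F i z)" using i by (simp add: charts_at_def)
      from wD(1)[OF this] show "linear (\<omega> i (param F i z) u)" by (simp add: bilinear_def)
    qed
  }
  fix p i j u v assume i: "i \<in> charts_at F p" and j: "j \<in> charts_at F p"
  have "\<omega> i p u (J i p v) = \<omega> j p (leaf_deriv i j p u) (leaf_deriv i j p (J i p v))"
    by (rule leafwise_2formD(3)[OF w i j])
  then show "\<omega> i p u (J i p v) = \<omega> j p (leaf_deriv i j p u) (J j p (leaf_deriv i j p v))"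
    using J(3)[OF i j] by simp
qed

end

section \<open>Uniform local geometry of the leaves\<close>

lemma dd_cong:
  assumes "open S" "x \<in> S" "\<And>y. y \<in> S \<Longrightarrow> f y = h y"
  shows "dd f x = dd h x"
proof -
  have "(f has_derivative D) (at x) \<longleftrightarrow> (h has_derivative D) (at x)" for D
    using has_derivative_transform_within_open[OF _ assms(1,2)] assms(3) by metis
  then show ?thesis by (simp add: frechet_derivative_def)
qed

lemma chr_cong:
  assumes "open S" "x \<in> S" "\<And>y. y \<in> S \<Longrightarrow> G y = H y"
  shows "chr G x = chr H x"
proof -
  have "dd (\<lambda>y. G y u v) x = dd (\<lambda>y. H y u v) x" for u v
    by (rule dd_cong[OF assms(1,2)]) (simp add: assms(3))
  then show ?thesis by (simp add: chr_def koszul_def assms(2,3) fun_eq_iff)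
qed

lemma rcurv_cong:
  assumes "open S" "x \<in> S" "\<And>y. y \<in> S \<Longrightarrow> \<Gamma> y = \<Delta> y"
  shows "rcurv \<Gamma> x = rcurv \<Delta> x"
proof -
  have "dd (\<lambda>y. \<Gamma> y u v) x = dd (\<lambda>y. \<Delta> y u v) x" for u v
    by (rule dd_cong[OF assms(1,2)]) (simp add: assms(3))
  then show ?thesis by (simp add: rcurv_def assms(2,3) fun_eq_iff)
qed

text \<open>Differentiation along a slice is ambient differentiation in the directions
  \<open>(h, 0)\<close>. Through this, Christoffel symbols and curvature of the slices become smooth
  in the transverse coordinate too.\<close>

lemma dd_slice:
  assumes "(f has_derivative D) (at (x, t))"
  shows "dd (\<lambda>y. f (y, t)) x h = D (h, 0)"
proof -
  have "((\<lambda>y. (y, t)) has_derivative (\<lambda>u. (u, 0))) (at x)" by (auto intro!: derivative_eq_intros)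
  from has_derivative_compose[OF this assms] show ?thesis by (simp add: dd_eq)
qed

lemma linear_norm_le_Basis:
  fixes f :: "'e::euclidean_space \<Rightarrow> 'b::real_normed_vector"
  assumes "linear f"
  shows "norm (f u) \<le> (\<Sum>a\<in>Basis. norm (f a)) * norm u"
proof -
  have "f u = f (\<Sum>a\<in>Basis. (u \<bullet> a) *\<^sub>R a)" by (simp add: euclidean_representation)
  also have "\<dots> = (\<Sum>a\<in>Basis. (u \<bullet> a) *\<^sub>R f a)" by (simp add: linear_sum[OF assms] linear_scale[OF assms])
  finally have "norm (f u) \<le> (\<Sum>a\<in>Basis. norm ((u \<bullet> a) *\<^sub>R f a))" by (metis norm_sum)
  also have "\<dots> \<le> (\<Sum>a\<in>Basis. norm u * norm (f a))"
    by (rule sum_mono) (simp add: Basis_le_norm mult_right_mono)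
  finally show ?thesis by (simp add: sum_distrib_left[symmetric] mult.commute)
qed

lemma quadrilinear_bound:
  fixes f :: "'e::euclidean_space \<Rightarrow> 'e \<Rightarrow> 'e \<Rightarrow> 'e \<Rightarrow> real"
  assumes 1: "\<And>v w z. linear (\<lambda>u. f u v w z)" and 2: "\<And>u w z. linear (\<lambda>v. f u v w z)"
    and 3: "\<And>u v z. linear (\<lambda>w. f u v w z)" and 4: "\<And>u v w. linear (f u v w)"
  shows "\<bar>f u v w z\<bar> \<le> (\<Sum>a\<in>Basis. \<Sum>b\<in>Basis. \<Sum>c\<in>Basis. \<Sum>d\<in>Basis. \<bar>f a b c d\<bar>) * norm u * norm v * norm w * norm z"
proof -
  have "\<bar>f u v w z\<bar> \<le> (\<Sum>a\<in>Basis. \<bar>f a v w z\<bar>) * norm u"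
    using linear_norm_le_Basis[OF 1, of u v w z] by simp
  also have "\<dots> \<le> (\<Sum>a\<in>Basis. (\<Sum>b\<in>Basis. \<bar>f a b w z\<bar>) * norm v) * norm u"
    using linear_norm_le_Basis[OF 2] by (intro mult_right_mono sum_mono) auto
  also have "\<dots> \<le> (\<Sum>a\<in>Basis. (\<Sum>b\<in>Basis. (\<Sum>c\<in>Basis. \<bar>f a b c z\<bar>) * norm w) * norm v) * norm u"
    using linear_norm_le_Basis[OF 3] by (intro mult_right_mono sum_mono) auto
  also have "\<dots> \<le> (\<Sum>a\<in>Basis. (\<Sum>b\<in>Basis. (\<Sum>c\<in>Basis. (\<Sum>d\<in>Basis. \<bar>f a b c d\<bar>) * norm z) * norm w) * norm v) * norm u"
    using linear_norm_le_Basis[OF 4] by (intro mult_right_mono sum_mono) auto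
  finally show ?thesis unfolding sum_distrib_right[symmetric] by (simp only: mult_ac)
qed

section \<open>Metrics on slices that vary smoothly with the transverse coordinate\<close>

locale metric_family =
  fixes U :: "('e::euclidean_space \<times> real) set" and G :: "'e \<times> real \<Rightarrow> 'e \<Rightarrow> 'e \<Rightarrow> real"
  assumes open_U: "open U" and bil: "\<And>z. z \<in> U \<Longrightarrow> bilinear (G z)"
    and smooth_G: "\<And>u v. smooth_on U (\<lambda>z. G z u v)"
    and G_sym: "\<And>z u v. z \<in> U \<Longrightarrow> G z u v = G z v u"
    and G_pos: "\<And>z u. z \<in> U \<Longrightarrow> u \<noteq> 0 \<Longrightarrow> G z u u > 0"
begin

definition Gam :: "'e \<times> real \<Rightarrow> 'e \<Rightarrow> 'e \<Rightarrow> 'e" where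
  "Gam z = chr (\<lambda>y. G (y, snd z)) (fst z)"

definition Rm :: "'e \<times> real \<Rightarrow> 'e \<Rightarrow> 'e \<Rightarrow> 'e \<Rightarrow> 'e" where
  "Rm z = rcurv (chr (\<lambda>y. G (y, snd z))) (fst z)"

lemma slice: "chart_metric {x. (x, t) \<in> U} (\<lambda>y. G (y, t))"
proof
  have "open ((\<lambda>x. (x, t)) -` U)" by (intro open_vimage continuous_intros open_U)
  then show op: "open {x. (x, t) \<in> U}" by (simp add: vimage_def)
  fix u v
  show "smooth_on {x. (x, t) \<in> U} (\<lambda>x. G (x, t) u v)"
    by (rule smooth_on_compose[OF op open_U smooth_G]) (intro smooth_on_Pair smooth_on_ident smooth_on_const op, auto)
qed (use bil G_sym G_pos in auto)

lemma bilinear_Gam: "z \<in> U \<Longrightarrow> bilinear (Gam z)"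
  unfolding Gam_def using chart_metric.bilinear_chr[OF slice, of "fst z" "snd z"] by simp

text \<open>The Koszul formula of a slice involves derivatives of the metric along that slice only,
  which are jointly smooth by \<open>dd_slice\<close>; \<open>smooth_on_riesz\<close> passes this on
  to its solution.\<close>

lemma smooth_Gam: "smooth_on U (\<lambda>z. Gam z u v)"
proof (rule smooth_on_riesz[OF open_U bil G_pos smooth_G])
  let ?k = "\<lambda>z w. (dd (\<lambda>z. G z v w) z (u, 0) + dd (\<lambda>z. G z u w) z (v, 0) - dd (\<lambda>z. G z u v) z (w, 0)) / 2"
  show "smooth_on U (\<lambda>z. ?k z w)" for w
    by (intro smooth_on_divide smooth_on_diff smooth_on_add smooth_on_frechet_derivative smooth_G open_U smooth_on_const) auto
  show "G z (Gam z u v) w = ?k z w" if z: "z \<in> U" for z w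
  proof -
    have d: "dd (\<lambda>y. G (y, snd z) a b) (fst z) h = dd (\<lambda>z. G z a b) z (h, 0)" for a b h
      using dd_slice[of "\<lambda>z. G z a b" _ "fst z" "snd z" h] smooth_on_has_derivative[OF smooth_G z, of a b] by simp
    show ?thesis
      using chart_metric.chr_koszul[OF slice, of "fst z" "snd z" u v w] z by (simp add: Gam_def koszul_def d)
  qed
qed

lemma smooth_G_apply:
  assumes "smooth_on U a" "smooth_on U b"
  shows "smooth_on U (\<lambda>z. G z (a z) (b z))"
proof (rule smooth_on_linear_field[where A="\<lambda>z. G z (a z)", OF open_U _ _ assms(2)])
  show "smooth_on U (\<lambda>z. G z (a z) v)" for v
    by (rule smooth_on_linear_field[where A="\<lambda>z u. G z u v", OF open_U _ smooth_G assms(1)])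
      (use bil in \<open>auto simp: bilinear_def\<close>)
qed (use bil in \<open>auto simp: bilinear_def\<close>)

lemma smooth_Rm: "smooth_on U (\<lambda>z. Rm z u v w)"
proof (rule smooth_on_cong[OF open_U])
  have GG: "smooth_on U (\<lambda>z. Gam z a (Gam z b c))" for a b c
    by (rule smooth_on_linear_field[where A="\<lambda>z. Gam z a", OF open_U _ smooth_Gam smooth_Gam]) (use bilinear_Gam in \<open>auto simp: bilinear_def\<close>)
  show "smooth_on U (\<lambda>z. dd (\<lambda>z. Gam z v w) z (u, 0) - dd (\<lambda>z. Gam z u w) z (v, 0) + Gam z u (Gam z v w) - Gam z v (Gam z u w))"
    by (intro smooth_on_diff smooth_on_add smooth_on_frechet_derivative smooth_Gam open_U GG)
  fix z assume z: "z \<in> U"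
  have "dd (\<lambda>y. Gam (y, snd z) a b) (fst z) h = dd (\<lambda>z. Gam z a b) z (h, 0)" for a b h
    using dd_slice[of "\<lambda>z. Gam z a b" _ "fst z" "snd z" h] smooth_on_has_derivative[OF smooth_Gam z, of a b] by simp
  then show "dd (\<lambda>z. Gam z v w) z (u, 0) - dd (\<lambda>z. Gam z u w) z (v, 0) + Gam z u (Gam z v w) - Gam z v (Gam z u w) = Rm z u v w"
    by (simp add: Rm_def rcurv_def Gam_def)
qed

lemma local_lower_bound:
  assumes K: "compact K" "K \<subseteq> U"
  obtains m where "m > 0" "\<And>z u. z \<in> K \<Longrightarrow> m * (norm u)\<^sup>2 \<le> G z u u"
proof (cases "K = {}")
  case True
  then show thesis using that[of 1] by simp
next
  case False
  let ?f = "\<lambda>(z, u). G z u u"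
  let ?h = "\<lambda>(z, u). \<Sum>a\<in>Basis. \<Sum>b\<in>Basis. ((u \<bullet> a) * (u \<bullet> b)) *\<^sub>R G z a b"
  have cG: "continuous_on K (\<lambda>z. G z a b)" for a b
    using smooth_on_imp_continuous_on[OF smooth_on_subset[OF smooth_G K(2)]] .
  have "continuous_on (K \<times> sphere 0 1) (\<lambda>x. G (fst x) a b)" for a b
    by (rule continuous_on_compose2[OF cG]) (auto intro: continuous_intros)
  then have "continuous_on (K \<times> sphere 0 1) ?h"
    unfolding case_prod_unfold by (intro continuous_intros)
  moreover have "?h x = ?f x" if "x \<in> K \<times> sphere 0 1" for x
    using that bilinear_euclidean_sum[OF bil, of "fst x" "snd x" "snd x"] K(2) by (auto simp: case_prod_unfold)
  ultimately have "continuous_on (K \<times> sphere 0 1) ?f" by (rule continuous_on_eq)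
  moreover have "compact (K \<times> sphere (0::'e) 1)" "K \<times> sphere (0::'e) 1 \<noteq> {}"
    using K False by (auto intro: compact_Times)
  ultimately obtain x0 where x0: "x0 \<in> K \<times> sphere 0 1" "\<forall>y\<in>K \<times> sphere 0 1. ?f x0 \<le> ?f y"
    using continuous_attains_inf[of "K \<times> sphere (0::'e) 1" ?f] by blast
  obtain z0 u0 where e: "x0 = (z0, u0)" by (cases x0) blast
  have zu: "z0 \<in> K" "u0 \<in> sphere 0 1" using x0(1) by (auto simp: e)
  have zu': "G z0 u0 u0 \<le> G z u u" if "z \<in> K" "u \<in> sphere 0 1" for z u
    using bspec[OF x0(2), of "(z, u)"] that by (simp add: e)
  show thesis
  proof (rule that)
    have "u0 \<noteq> 0" using zu(2) by auto
    then show "G z0 u0 u0 > 0" using G_pos zu(1) K(2) by blast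
    fix z u assume z: "z \<in> K"
    then have b: "bilinear (G z)" using bil K(2) by blast
    show "G z0 u0 u0 * (norm u)\<^sup>2 \<le> G z u u"
    proof (cases "u = 0")
      case True
      then show ?thesis by (simp add: bilinear_lzero[OF b])
    next
      case False
      have "G z0 u0 u0 \<le> G z (u /\<^sub>R norm u) (u /\<^sub>R norm u)" by (rule zu'[OF z]) (use False in simp)
      also have "\<dots> = G z u u / (norm u)\<^sup>2" by (simp add: bilinear_lmul[OF b] bilinear_rmul[OF b] power2_eq_square divide_simps)
      finally show ?thesis using False by (simp add: field_simps)
    qed
  qed
qed

lemma local_curvature_bound:
  assumes K: "compact K" "K \<subseteq> U"
  obtains C where "C \<ge> 0" "\<And>z u v. z \<in> K \<Longrightarrow> G z (Rm z u v v) u \<le> C * (norm u)\<^sup>2 * (norm v)\<^sup>2"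
proof -
  let ?S = "\<lambda>z. \<Sum>a\<in>Basis. \<Sum>b\<in>Basis. \<Sum>c\<in>Basis. \<Sum>d\<in>Basis. \<bar>G z (Rm z a b c) d\<bar>"
  have "continuous_on K (\<lambda>z. G z (Rm z a b c) d)" for a b c d
    by (rule smooth_on_imp_continuous_on[OF smooth_on_subset[OF smooth_G_apply[OF smooth_Rm smooth_on_const] K(2)]])
  then have "continuous_on K ?S" by (intro continuous_intros)
  then have "bounded (?S ` K)" using compact_continuous_image[OF _ K(1)] compact_imp_bounded by blast
  then obtain C where "\<forall>x\<in>?S ` K. norm x \<le> C" unfolding bounded_iff by blast
  then have "\<bar>?S z\<bar> \<le> C" if "z \<in> K" for z using that by simp
  then have C: "?S z \<le> C" if "z \<in> K" for z using that abs_le_D1 by blast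
  show thesis
  proof (rule that[of "max C 0"])
    fix z u v assume z: "z \<in> K"
    then have zU: "z \<in> U" using K(2) by blast
    then have zs: "fst z \<in> {x. (x, snd z) \<in> U}" by simp
    note lin = chart_metric.rcurv_linear[OF slice zs, folded Rm_def]
    have Gl: "linear (\<lambda>w. G z w a)" "linear (G z a)" for a using bil[OF zU] by (auto simp: bilinear_def)
    have "\<bar>G z (Rm z u v v) u\<bar> \<le> ?S z * norm u * norm v * norm v * norm u"
    proof (rule quadrilinear_bound)
      show "linear (\<lambda>u. G z (Rm z u v w) y)" "linear (\<lambda>v. G z (Rm z u v w) y)" "linear (\<lambda>w. G z (Rm z u v w) y)" for u v w y
        using linear_compose[OF lin(1) Gl(1)] linear_compose[OF lin(2) Gl(1)] linear_compose[OF lin(3) Gl(1)] by (simp_all add: o_def)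
    qed (rule Gl)
    also have "\<dots> = ?S z * ((norm u)\<^sup>2 * (norm v)\<^sup>2)" by (simp add: power2_eq_square mult_ac)
    also have "\<dots> \<le> max C 0 * ((norm u)\<^sup>2 * (norm v)\<^sup>2)"
      using C[OF z] by (intro mult_right_mono) auto
    finally show "G z (Rm z u v v) u \<le> max C 0 * (norm u)\<^sup>2 * (norm v)\<^sup>2" by (simp add: mult.assoc)
  qed simp
qed

end

section \<open>Transfer from foliated charts to the leaves, and uniformity by compactness\<close>

context foliated begin

lemma leaf_chart_iff: "i \<in> indices F \<Longrightarrow> x \<in> coord (leafX L) (i, t) ` patch (leafX L) (i, t) \<longleftrightarrow> (x, t) \<in> coord F i ` patch F i \<and> param F i (x, t) \<in> L"
  unfolding leaf_chart' mem_Collect_eq by (rule overlap_iff)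

lemma smooth_on_leaf_chart:
  assumes L: "leaf_open L" and i: "i \<in> indices F" and f: "smooth_on (coord F i ` patch F i) (\<lambda>z. f (param F i z))"
  shows "smooth_on (coord (leafX L) (i, t) ` patch (leafX L) (i, t)) (\<lambda>x. f (param (leafX L) (i, t) x))"
proof -
  have op: "open (coord (leafX L) (i, t) ` patch (leafX L) (i, t))"
    using L i by (simp add: leaf_open_def leaf_chart' del: leaf_simps)
  have "smooth_on (coord (leafX L) (i, t) ` patch (leafX L) (i, t)) (\<lambda>x. f (param F i (x, t)))"
  proof (rule smooth_on_compose[OF op open_chart[OF i] f])
    show "smooth_on (coord (leafX L) (i, t) ` patch (leafX L) (i, t)) (\<lambda>x. (x, t))"
      by (intro smooth_on_Pair smooth_on_ident smooth_on_const op)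
    show "(\<lambda>x. (x, t)) ` coord (leafX L) (i, t) ` patch (leafX L) (i, t) \<subseteq> coord F i ` patch F i"
      using leaf_chart_iff[OF i] by blast
  qed
  then show ?thesis
    by (rule smooth_on_cong[OF op]) (simp add: leaf_param[OF i] leaf_chart'[OF i] del: leaf_simps)
qed

lemma leaf_riemannian:
  assumes L: "leaf_open L" and g: "leaf_metric g"
  shows "riemannian_metric (leafX L) (leaf_restriction g)"
  unfolding riemannian_metric_def smooth_2tensor_def
proof (intro conjI ballI allI impI)
  {
    fix k p u assume "k \<in> indices (leafX L)" "p \<in> patch (leafX L) k"
    then obtain i t where k: "k = (i, t)" "i \<in> charts_at F p" by (cases k) (auto simp: charts_at_def)
    show "bilinear (leaf_restriction g k p)" "leaf_restriction g k p u v = leaf_restriction g k p v u"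
      "u \<noteq> 0 \<Longrightarrow> 0 < leaf_restriction g k p u u" for v
      using leaf_metricD(1-3)[OF g k(2)] by (simp_all add: k(1) leaf_restriction_def)
  }
  fix k u v assume "k \<in> indices (leafX L)"
  then obtain i t where k: "k = (i, t)" "i \<in> indices F" by (cases k) auto
  show "smooth_on (coord (leafX L) k ` patch (leafX L) k) (\<lambda>x. leaf_restriction g k (param (leafX L) k x) u v)"
    unfolding k(1) leaf_restriction_def using smooth_on_leaf_chart[OF L k(2) smooth_leaf_metric[OF g k(2)]] by simp
next
  fix p k l u v assume kl: "k \<in> charts_at (leafX L) p" "l \<in> charts_at (leafX L) p"
  obtain i t j s where e: "k = (i, t)" "l = (j, s)" by (cases k, cases l) auto
  have ij: "i \<in> charts_at F p" "j \<in> charts_at F p" using kl by (auto simp: e leaf_charts_at)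
  have d: "transition_deriv (leafX L) (i, t) (j, s) p u = leaf_deriv i j p u" for u
    unfolding leaf_deriv_def by (rule leaf_transition_deriv[OF L kl[unfolded e]])
  show "leaf_restriction g k p u v = leaf_restriction g l p (transition_deriv (leafX L) k l p u) (transition_deriv (leafX L) k l p v)"
    unfolding e d using leaf_metricD(4)[OF g ij] by (simp add: leaf_restriction_def)
qed

lemma metric_family:
  assumes g: "leaf_metric g" and i: "i \<in> indices F"
  shows "metric_family (coord F i ` patch F i) (\<lambda>z. g i (param F i z))"
proof
  show "open (coord F i ` patch F i)" by (rule open_chart[OF i])
  show "smooth_on (coord F i ` patch F i) (\<lambda>z. g i (param F i z) u v)" for u v by (rule smooth_leaf_metric[OF g i])
  fix z u v assume "z \<in> coord F i ` patch F i"
  then have z: "i \<in> charts_at F (param F i z)" using i by (simp add: charts_at_def)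
  show "bilinear (g i (param F i z))" "g i (param F i z) u v = g i (param F i z) v u"
    "u \<noteq> 0 \<Longrightarrow> 0 < g i (param F i z) u u"
    by (rule leaf_metricD[OF g z] | assumption)+
qed

lemma leaf_christoffel:
  assumes L: "leaf_open L" and g: "leaf_metric g" and i: "i \<in> indices F" and p: "p \<in> patch F i" "p \<in> L" "coord F i p = (x, t)"
  shows "christoffel (leafX L) (leaf_restriction g) (i, t) p = metric_family.Gam (\<lambda>z. g i (param F i z)) (x, t)"
    "riemann_curvature (leafX L) (leaf_restriction g) (i, t) p = metric_family.Rm (\<lambda>z. g i (param F i z)) (x, t)"
proof -
  interpret X: riemannian "leafX L" "leaf_restriction g"
    by (intro riemannian.intro smooth_atlas_on.intro riemannian_axioms.intro leaf_smooth_atlas leaf_riemannian L g)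
  interpret metric_family "coord F i ` patch F i" "\<lambda>z. g i (param F i z)" by (rule metric_family[OF g i])
  let ?S = "coord (leafX L) (i, t) ` patch (leafX L) (i, t)"
  have k: "(i, t) \<in> indices (leafX L)" "p \<in> patch (leafX L) (i, t)" using i p by auto
  have op: "open ?S" by (rule X.open_chart[OF k(1)])
  have x: "x = coord (leafX L) (i, t) p" using p(3) by simp
  have xS: "x \<in> ?S" unfolding x using k(2) by (rule imageI)
  have eq: "leaf_restriction g (i, t) (param (leafX L) (i, t) y) = g i (param F i (y, t))" if "y \<in> ?S" for y
    using that by (simp add: leaf_restriction_def leaf_param[OF i] leaf_chart'[OF i] del: leaf_simps)
  have c: "chr (\<lambda>y. leaf_restriction g (i, t) (param (leafX L) (i, t) y)) y = chr (\<lambda>y. g i (param F i (y, t))) y" if "y \<in> ?S" for y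
    by (rule chr_cong[OF op that eq])
  show "christoffel (leafX L) (leaf_restriction g) (i, t) p = Gam (x, t)"
    unfolding X.christoffel_eq[OF k] Gam_def x[symmetric] using c[OF xS] by simp
  show "riemann_curvature (leafX L) (leaf_restriction g) (i, t) p = Rm (x, t)"
    unfolding X.riemann_curvature_eq[OF k] Rm_def x[symmetric] using rcurv_cong[OF op xS c] by simp
qed

text \<open>The normal charts are obtained for every radius up to \<open>\<epsilon>0\<close>, and
  for all leaves through \<open>V\<close>, so that the least radius of a finite cover serves
  everywhere. For a given \<open>\<epsilon>\<close> the ball of initial velocities is the metric
  one, as the injectivity radius demands.\<close>

lemma locally_uniform_geometry:
  assumes g: "leaf_metric g" and i: "i \<in> charts_at F q"
  obtains V \<epsilon>0 K where "openin (atlas_topology F) V" "q \<in> V" "\<epsilon>0 > 0"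
    "\<And>p L \<epsilon>. p \<in> V \<Longrightarrow> L \<in> leaves F \<Longrightarrow> p \<in> L \<Longrightarrow> 0 < \<epsilon> \<Longrightarrow> \<epsilon> \<le> \<epsilon>0 \<Longrightarrow>
        normal_chart (leafX L) (leaf_restriction g) (i, snd (coord F i p)) p \<epsilon>"
    "\<And>p L u v. p \<in> V \<Longrightarrow> L \<in> leaves F \<Longrightarrow> p \<in> L \<Longrightarrow> u \<noteq> v \<Longrightarrow> independent {u, v :: 'e} \<Longrightarrow>
        sectional_curvature (leafX L) (leaf_restriction g) (i, snd (coord F i p)) p u v \<le> K"
proof -
  let ?U = "coord F i ` patch F i" and ?G = "\<lambda>z. g i (param F i z)"
  have iF: "i \<in> indices F" and q: "q \<in> patch F i" using i by (auto simp: charts_at_def)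
  interpret metric_family ?U ?G by (rule metric_family[OF g iF])
  define z0 where "z0 = coord F i q"
  have z0: "z0 \<in> ?U" using q by (simp add: z0_def)
  obtain r \<delta> c d where r: "r > 0" "\<delta> > 0" "ball z0 r \<subseteq> ?U"
    and init: "\<And>x t v. (x, t) \<in> ball z0 r \<Longrightarrow> norm v < \<delta> \<Longrightarrow> c x t v 0 = x \<and> d x t v 0 = v"
    and ode: "\<And>x t v s. (x, t) \<in> ball z0 r \<Longrightarrow> norm v < \<delta> \<Longrightarrow> \<bar>s\<bar> < 2 \<Longrightarrow> (c x t v s, t) \<in> ?U \<and>
        (c x t v has_vector_derivative d x t v s) (at s) \<and>
        (d x t v has_vector_derivative - Gam (c x t v s, t) (d x t v s) (d x t v s)) (at s)"
    and sm: "\<And>x t. (x, t) \<in> ball z0 r \<Longrightarrow> smooth_on UNIV (\<lambda>v. c x t v 1)"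
    and half: "\<And>x t v w. (x, t) \<in> ball z0 r \<Longrightarrow> norm v < \<delta> \<Longrightarrow> norm w < \<delta> \<Longrightarrow>
        norm ((c x t v 1 - c x t w 1) - (v - w)) \<le> 1/2 * norm (v - w)"
    by (rule local_geodesics[OF open_U z0 bilinear_Gam smooth_Gam]) (assumption | rule that)+
  let ?K = "cball z0 (r/2)"
  have KU: "?K \<subseteq> ?U" using r by (auto simp: subset_eq)
  obtain m where m: "m > 0" "\<And>z u. z \<in> ?K \<Longrightarrow> m * (norm u)\<^sup>2 \<le> ?G z u u"
    by (rule local_lower_bound[OF compact_cball KU]) blast
  obtain C where C: "C \<ge> 0" "\<And>z u v. z \<in> ?K \<Longrightarrow> ?G z (Rm z u v v) u \<le> C * (norm u)\<^sup>2 * (norm v)\<^sup>2"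
    by (rule local_curvature_bound[OF compact_cball KU]) blast
  let ?V = "param F i ` ball z0 (r/2)"
  have VD: "coord F i p \<in> ball z0 (r/2)" "p \<in> patch F i" if p: "p \<in> ?V" for p
  proof -
    obtain z where z: "z \<in> ball z0 (r/2)" "p = param F i z" using p by blast
    then have "z \<in> ?U" using KU by auto
    then show "coord F i p \<in> ball z0 (r/2)" "p \<in> patch F i" using z by simp_all
  qed
  show thesis
  \<comment> \<open>As \<open>m\<close> times the squared Euclidean norm is below the squared
    length, a length below \<open>\<delta> * sqrt m\<close> forces Euclidean norm below
    \<open>\<delta>\<close>, the range of \<open>local_geodesics\<close>. The curvature constant is
    that of \<open>sectional_bound\<close>.\<close>
  proof (rule that[of ?V "\<delta> * sqrt m" "C / m\<^sup>2"])
    show "openin (atlas_topology F) ?V" by (rule openin_param_image[OF iF]) (use KU in auto)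
    show "q \<in> ?V" using r(1) q iF by (intro image_eqI[of _ _ z0]) (auto simp: z0_def)
    show "\<delta> * sqrt m > 0" using r m by simp
  next
    fix p L \<epsilon> assume p: "p \<in> ?V" "L \<in> leaves F" "p \<in> L" and \<epsilon>: "0 < \<epsilon>" "\<epsilon> \<le> \<delta> * sqrt m"
    note Lo = leaf_is_open[OF p(2)]
    obtain x t where xt: "coord F i p = (x, t)" by (cases "coord F i p")
    have p': "p \<in> patch F i" by (rule VD(2)[OF p(1)])
    then have pe: "param F i (x, t) = p" using iF by (metis xt param_coord)
    have zK: "(x, t) \<in> ?K" and zr: "(x, t) \<in> ball z0 r" and zU: "(x, t) \<in> ?U"
      using VD(1)[OF p(1)] r(1,3) unfolding xt by (auto simp: subset_eq)
    have T: "tnorm (leaf_restriction g) (i, t) p v = sqrt (?G (x, t) v v)" for v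
      by (simp add: tnorm_def leaf_restriction_def pe)
    define B where "B = {v. tnorm (leaf_restriction g) (i, t) p v < \<epsilon>}"
    have small: "norm v < \<delta>" if "v \<in> B" for v
    proof -
      have "sqrt (m * (norm v)\<^sup>2) \<le> sqrt (?G (x, t) v v)" by (intro real_sqrt_le_mono m zK)
      also have "\<dots> < \<delta> * sqrt m" using that \<epsilon> by (simp add: B_def T)
      finally have "sqrt m * norm v < sqrt m * \<delta>" by (simp add: real_sqrt_mult mult.commute)
      then show ?thesis using m(1) by simp
    qed
    have "open B"
      unfolding B_def T
      by (rule open_Collect_less) (intro continuous_intros continuous_on_quadratic bil[OF zU])+
    have sB: "smooth_on B (\<lambda>v. c x t v 1)" by (rule smooth_on_subset[OF sm[OF zr]]) simp
    have hB: "norm ((c x t v 1 - c x t w 1) - (v - w)) \<le> 1/2 * norm (v - w)" if "v \<in> B" "w \<in> B" for v w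
      by (rule half[OF zr small[OF that(1)] small[OF that(2)]])
    have inv: "inj_on (\<lambda>v. c x t v 1) B" "open ((\<lambda>v. c x t v 1) ` B)" "smooth_on ((\<lambda>v. c x t v 1) ` B) (inv_into B (\<lambda>v. c x t v 1))"
      by (rule smooth_inverse_near_identity[OF \<open>open B\<close> sB]; rule hB; assumption)+
    have stay: "(c x t v s, t) \<in> ?U" "param F i (c x t v s, t) \<in> L" if v: "norm v < \<delta>" and s: "\<bar>s\<bar> < 2" for v s
    proof -
      show "(c x t v s, t) \<in> ?U" using ode[OF zr v s] by blast
      have "isCont (c x t v) \<tau>" if "\<bar>\<tau>\<bar> < 2" for \<tau>
        using ode[OF zr v that] has_vector_derivative_continuous by blast
      then have "continuous_on {-2<..<2} (c x t v)"
        by (intro continuous_at_imp_continuous_on) auto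
      then have con: "connected (c x t v ` {-2<..<2})" by (rule connected_continuous_image) simp
      show "param F i (c x t v s, t) \<in> L"
      proof (rule plaque_in_leaf[OF p(2) iF con])
        show "(y, t) \<in> ?U" if "y \<in> c x t v ` {-2<..<2}" for y using that ode[OF zr v] by auto
        show "x \<in> c x t v ` {-2<..<2}" using init[OF zr v] by (intro image_eqI[of _ _ 0]) auto
        show "param F i (x, t) \<in> L" using pe p(3) by simp
        show "c x t v s \<in> c x t v ` {-2<..<2}" by (rule imageI) (use s in auto)
      qed
    qed
    show "normal_chart (leafX L) (leaf_restriction g) (i, snd (coord F i p)) p \<epsilon>"
      unfolding normal_chart_def xt snd_conv B_def[symmetric]
    proof (rule conjI[OF _ exI[of _ "c x t", OF exI[of _ "d x t"]]]; (intro conjI allI impI)?)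
      show "(i, t) \<in> charts_at (leafX L) p" using iF p' p(3) xt by (simp add: leaf_charts_at charts_at_def)
      fix v assume "tnorm (leaf_restriction g) (i, t) p v < \<epsilon>"
      then have v: "norm v < \<delta>" by (intro small) (simp add: B_def)
      show "c x t v 0 = coord (leafX L) (i, t) p" "d x t v 0 = v" using init[OF zr v] xt by simp_all
      fix s :: real assume s: "\<bar>s\<bar> < 2"
      let ?y = "c x t v s"
      note st = stay[OF v s]
      show ch: "?y \<in> coord (leafX L) (i, t) ` patch (leafX L) (i, t)" unfolding leaf_chart_iff[OF iF] using st by simp
      show "(c x t v has_vector_derivative d x t v s) (at s)" using ode[OF zr v s] by blast
      have "param (leafX L) (i, t) ?y = param F i (?y, t)"
        by (rule leaf_param[OF iF]) (use ch in \<open>simp add: leaf_chart'[OF iF] del: leaf_simps\<close>)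
      then have "christoffel (leafX L) (leaf_restriction g) (i, t) (param (leafX L) (i, t) ?y) = Gam (?y, t)"
        using leaf_christoffel(1)[OF Lo g iF _ st(2)] st(1) by simp
      then show "(d x t v has_vector_derivative
          - christoffel (leafX L) (leaf_restriction g) (i, t) (param (leafX L) (i, t) ?y) (d x t v s) (d x t v s)) (at s)"
        using ode[OF zr v s] by simp
    qed (rule inv sB)+
  next
    fix p L and u v :: 'e assume p: "p \<in> ?V" "L \<in> leaves F" "p \<in> L" and uv: "u \<noteq> v" "independent {u, v}"
    note Lo = leaf_is_open[OF p(2)]
    obtain x t where xt: "coord F i p = (x, t)" by (cases "coord F i p")
    have p': "p \<in> patch F i" by (rule VD(2)[OF p(1)])
    then have pe: "param F i (x, t) = p" using iF by (metis xt param_coord)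
    have zK: "(x, t) \<in> ?K" and zU: "x \<in> {x. (x, t) \<in> ?U}"
      using VD(1)[OF p(1)] KU unfolding xt by (auto simp: subset_eq)
    note sb = chart_metric.sectional_bound[OF slice zU m(1) m(2)[OF zK] C(1) _ uv]
    have R: "Rm (x, t) = rcurv (chr (\<lambda>y. ?G (y, t))) x" by (simp add: Rm_def)
    have "?G (x, t) (Rm (x, t) u v v) u / (?G (x, t) u u * ?G (x, t) v v - (?G (x, t) u v)\<^sup>2) \<le> C / m\<^sup>2"
      unfolding R by (rule sb) (rule C(2)[OF zK, unfolded R])
    then show "sectional_curvature (leafX L) (leaf_restriction g) (i, snd (coord F i p)) p u v \<le> C / m\<^sup>2"
      unfolding sectional_curvature_def xt snd_conv leaf_christoffel(2)[OF Lo g iF p' p(3) xt]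
      by (simp add: leaf_restriction_def pe)
  qed
qed

theorem uniform_geometry:
  assumes g: "leaf_metric g" and K: "compact_space (atlas_topology F)"
  obtains \<epsilon> K where "\<epsilon> > 0"
    "\<And>p L. L \<in> leaves F \<Longrightarrow> p \<in> L \<Longrightarrow> \<exists>k. normal_chart (leafX L) (leaf_restriction g) k p \<epsilon> \<and>
        (\<forall>u v. u \<noteq> v \<and> independent {u, v} \<longrightarrow> sectional_curvature (leafX L) (leaf_restriction g) k p u v \<le> K)"
proof -
  define good where "good \<epsilon> K p \<longleftrightarrow> (\<forall>L\<in>leaves F. p \<in> L \<longrightarrow> (\<exists>k. normal_chart (leafX L) (leaf_restriction g) k p \<epsilon> \<and>
        (\<forall>u v. u \<noteq> v \<and> independent {u, v} \<longrightarrow> sectional_curvature (leafX L) (leaf_restriction g) k p u v \<le> K)))" for \<epsilon> K p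
  have "\<exists>V \<epsilon>0 K0. openin (atlas_topology F) V \<and> q \<in> V \<and> \<epsilon>0 > 0 \<and> (\<forall>p\<in>V. \<forall>\<epsilon> K. 0 < \<epsilon> \<longrightarrow> \<epsilon> \<le> \<epsilon>0 \<longrightarrow> K0 \<le> K \<longrightarrow> good \<epsilon> K p)"
    if q: "q \<in> points F" for q
  proof -
    obtain i where i: "i \<in> charts_at F q" using points_chart[OF q] by (auto simp: charts_at_def)
    obtain V \<epsilon>0 K0 where V: "openin (atlas_topology F) V" "q \<in> V" "\<epsilon>0 > 0"
      "\<And>p L \<epsilon>. p \<in> V \<Longrightarrow> L \<in> leaves F \<Longrightarrow> p \<in> L \<Longrightarrow> 0 < \<epsilon> \<Longrightarrow> \<epsilon> \<le> \<epsilon>0 \<Longrightarrow>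
          normal_chart (leafX L) (leaf_restriction g) (i, snd (coord F i p)) p \<epsilon>"
      "\<And>p L u v. p \<in> V \<Longrightarrow> L \<in> leaves F \<Longrightarrow> p \<in> L \<Longrightarrow> u \<noteq> v \<Longrightarrow> independent {u, v :: 'e} \<Longrightarrow>
          sectional_curvature (leafX L) (leaf_restriction g) (i, snd (coord F i p)) p u v \<le> K0"
      by (rule locally_uniform_geometry[OF g i]) (assumption | rule that)+
    have "good \<epsilon> K p" if "p \<in> V" "0 < \<epsilon>" "\<epsilon> \<le> \<epsilon>0" "K0 \<le> K" for p \<epsilon> K
      unfolding good_def
    proof (intro ballI impI exI conjI allI)
      fix L and u v :: 'e assume L: "L \<in> leaves F" "p \<in> L"
      show "normal_chart (leafX L) (leaf_restriction g) (i, snd (coord F i p)) p \<epsilon>" by (rule V(4)[OF that(1) L that(2,3)])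
      assume "u \<noteq> v \<and> independent {u, v}"
      then show "sectional_curvature (leafX L) (leaf_restriction g) (i, snd (coord F i p)) p u v \<le> K"
        using V(5)[OF that(1) L, of u v] that(4) by auto
    qed
    then show ?thesis using V(1-3) by blast
  qed
  then obtain V \<epsilon>0 K0 where V: "\<And>q. q \<in> points F \<Longrightarrow> openin (atlas_topology F) (V q) \<and> q \<in> V q \<and> \<epsilon>0 q > (0::real) \<and>
      (\<forall>p\<in>V q. \<forall>\<epsilon> K. 0 < \<epsilon> \<longrightarrow> \<epsilon> \<le> \<epsilon>0 q \<longrightarrow> K0 q \<le> K \<longrightarrow> good \<epsilon> K p)"
    by metis
  have "\<forall>U\<in>V ` points F. openin (atlas_topology F) U" using V by blast
  moreover have "topspace (atlas_topology F) \<subseteq> \<Union>(V ` points F)" unfolding topspace_eq using V by blast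
  ultimately obtain \<V> where \<V>: "finite \<V>" "\<V> \<subseteq> V ` points F" "topspace (atlas_topology F) \<subseteq> \<Union>\<V>"
    using K unfolding compact_space_alt by meson
  obtain Q where Q: "finite Q" "Q \<subseteq> points F" "\<V> = V ` Q"
    using finite_subset_image[OF \<V>(1,2)] by blast
  \<comment> \<open>The elements 1 here and 0 in \<open>K1\<close> keep the minimum and the maximum
    over nonempty sets, also when the manifold is empty.\<close>
  define \<epsilon> where "\<epsilon> = Min (insert 1 (\<epsilon>0 ` Q))"
  define K1 where "K1 = Max (insert 0 (K0 ` Q))"
  show thesis
  proof (rule that[of \<epsilon> K1])
    show \<epsilon>: "\<epsilon> > 0" unfolding \<epsilon>_def using Q V by auto
    fix p L assume L: "L \<in> leaves F" "p \<in> L"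
    then have "p \<in> points F" using leaf_is_open by (auto simp: leaf_open_def)
    then obtain q where q: "q \<in> Q" "p \<in> V q" using \<V>(3) Q(3) topspace_eq by auto
    have "\<epsilon> \<le> \<epsilon>0 q" "K0 q \<le> K1" unfolding \<epsilon>_def K1_def using Q(1) q(1) by auto
    then have "good \<epsilon> K1 p" using V q Q(2) \<epsilon> by blast
    then show "\<exists>k. normal_chart (leafX L) (leaf_restriction g) k p \<epsilon> \<and>
        (\<forall>u v. u \<noteq> v \<and> independent {u, v} \<longrightarrow> sectional_curvature (leafX L) (leaf_restriction g) k p u v \<le> K1)"
      using L unfolding good_def by blast
  qed
qed

theorem leaf_bounded_geometry:
  assumes g: "leaf_metric g" and K: "compact_space (atlas_topology F)" and H: "Hausdorff_space (atlas_topology F)"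
    and L: "L \<in> leaves F"
  shows "complete_metric (leafX L) (leaf_restriction g)" "GB2 (leafX L) (leaf_restriction g)"
proof -
  note Lo = leaf_is_open[OF L]
  obtain \<epsilon> C where \<epsilon>: "\<epsilon> > 0" and geo: "\<And>p L. L \<in> leaves F \<Longrightarrow> p \<in> L \<Longrightarrow> \<exists>k. normal_chart (leafX L) (leaf_restriction g) k p \<epsilon> \<and>
        (\<forall>u v. u \<noteq> v \<and> independent {u, v} \<longrightarrow> sectional_curvature (leafX L) (leaf_restriction g) k p u v \<le> C)"
    by (rule uniform_geometry[OF g K]) (assumption | rule that)+
  interpret X: riemannian "leafX L" "leaf_restriction g"
    by (intro riemannian.intro smooth_atlas_on.intro riemannian_axioms.intro leaf_smooth_atlas leaf_riemannian Lo g)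
  interpret X: uniformly_normal "leafX L" "leaf_restriction g" \<epsilon>
  proof unfold_locales
    show "Hausdorff_space (atlas_topology (leafX L))" by (rule leaf_Hausdorff[OF Lo H])
    fix p assume "p \<in> points (leafX L)"
    then show "\<exists>k. normal_chart (leafX L) (leaf_restriction g) k p \<epsilon>" unfolding leaf_simps(1) using geo[OF L] by blast
  qed (rule \<epsilon>)
  show "complete_metric (leafX L) (leaf_restriction g)" by (rule X.complete)
  show "GB2 (leafX L) (leaf_restriction g)"
    unfolding GB2_def
  proof (rule conjI[OF exI[of _ C] exI[of _ \<epsilon>]]; intro conjI ballI allI impI)
    show "0 < \<epsilon>" by (rule \<epsilon>)
    show "injectivity_radius (leafX L) (leaf_restriction g) \<ge> ereal \<epsilon>" by (rule X.injectivity_radius_ge)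
    fix k p and u v :: 'e assume k: "k \<in> indices (leafX L)" "p \<in> patch (leafX L) k" and uv: "u \<noteq> v \<and> independent {u, v}"
    then have kc: "k \<in> charts_at (leafX L) p" by (simp add: charts_at_def)
    have "p \<in> L" using X.patch_subset[OF k(1)] k(2) by auto
    from geo[OF L this] obtain l where l: "normal_chart (leafX L) (leaf_restriction g) l p \<epsilon>"
      "\<forall>u v. u \<noteq> v \<and> independent {u, v} \<longrightarrow> sectional_curvature (leafX L) (leaf_restriction g) l p u v \<le> C" by (elim exE conjE)
    have lc: "l \<in> charts_at (leafX L) p" using l(1) by (simp add: normal_chart_def)
    \<comment> \<open>At each point the curvature bound is known in one chart \<open>l\<close> of
      the leaf. The transition differential is injective, so it preserves independence, and it
      preserves the sectional curvature.\<close>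
    let ?T = "transition_deriv (leafX L) k l p"
    have lin: "linear ?T" by (rule X.linear_transition_deriv[OF kc lc])
    have inj: "inj ?T" using X.transition_deriv_inverse[OF kc lc] by (metis injI)
    have "independent (?T ` {u, v})"
      by (rule linear_independent_injective_image[OF lin]) (use uv inj in \<open>auto intro: inj_on_subset\<close>)
    moreover have "?T u \<noteq> ?T v" using inj uv by (simp add: inj_eq)
    ultimately have "sectional_curvature (leafX L) (leaf_restriction g) l p (?T u) (?T v) \<le> C" using l(2) by simp
    then show "sectional_curvature (leafX L) (leaf_restriction g) k p u v \<le> C"
      unfolding X.sectional_curvature_transform[OF kc lc] .
  qed
qed

end

section \<open>Leaves of symplectic foliations\<close>

lemma bilinear_cauchy_schwarz:
  fixes b :: "'e::euclidean_space \<Rightarrow> 'e \<Rightarrow> real"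
  assumes b: "bilinear b" "\<And>u v. b u v = b v u" "\<And>u. u \<noteq> 0 \<Longrightarrow> b u u > 0"
  shows "\<bar>b u v\<bar> \<le> sqrt (b u u) * sqrt (b v v)"
proof (cases "v = 0")
  case True
  then show ?thesis by (simp add: bilinear_rzero[OF b(1)])
next
  case False
  note bs = bilinear_ladd[OF b(1)] bilinear_radd[OF b(1)] bilinear_lmul[OF b(1)] bilinear_rmul[OF b(1)] bilinear_lsub[OF b(1)] bilinear_rsub[OF b(1)]
  have vv: "b v v > 0" by (rule b(3)[OF False])
  let ?x = "b v v *\<^sub>R u - b u v *\<^sub>R v"
  have "b ?x ?x \<ge> 0" using b(3)[of ?x] by (cases "?x = 0") (auto simp: bilinear_lzero[OF b(1)])
  also have "b ?x ?x = b v v * (b u u * b v v - (b u v)\<^sup>2)"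
    using b(2)[of v u] by (simp add: bs algebra_simps power2_eq_square)
  finally have "(b u v)\<^sup>2 \<le> b u u * b v v" using vv by (simp add: zero_le_mult_iff)
  then have "sqrt ((b u v)\<^sup>2) \<le> sqrt (b u u * b v v)" by (rule real_sqrt_le_mono)
  then show ?thesis by (simp add: real_sqrt_mult)
qed

lemma (in foliated) leaf_polar_structure:
  assumes L: "leaf_open L"
    and J: "\<And>i p. i \<in> charts_at F p \<Longrightarrow> polar_J (\<omega> i p) (b i p) (J i p)"
    "\<And>i u. i \<in> indices F \<Longrightarrow> smooth_on (coord F i ` patch F i) (\<lambda>z. J i (param F i z) u)"
    "\<And>i j p u. i \<in> charts_at F p \<Longrightarrow> j \<in> charts_at F p \<Longrightarrow> leaf_deriv i j p (J i p u) = J j p (leaf_deriv i j p u)"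
  shows "almost_complex_structure (leafX L) (\<lambda>(i, t). J i)" "compatible_with (leafX L) (leaf_restriction \<omega>) (\<lambda>(i, t). J i)"
proof -
  have P: "polar_J (\<omega> (fst k) p) (b (fst k) p) (J (fst k) p)" if "k \<in> indices (leafX L)" "p \<in> patch (leafX L) k" for k p
    by (rule J(1)) (use that in \<open>cases k; auto simp: charts_at_def\<close>)
  show "compatible_with (leafX L) (leaf_restriction \<omega>) (\<lambda>(i, t). J i)"
    unfolding compatible_with_def leaf_restriction_def case_prod_unfold
    using P by (simp add: polar_J_def)
  show "almost_complex_structure (leafX L) (\<lambda>(i, t). J i)"
    unfolding almost_complex_structure_def smooth_endomorphism_def
  proof (intro conjI ballI allI)
    fix k p assume kp: "k \<in> indices (leafX L)" "p \<in> patch (leafX L) k"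
    show "linear ((case k of (i, t) \<Rightarrow> J i) p)" using P[OF kp] by (simp add: case_prod_unfold polar_J_def)
    show "(case k of (i, t) \<Rightarrow> J i) p ((case k of (i, t) \<Rightarrow> J i) p u) = - u" for u
      using P[OF kp] by (simp add: case_prod_unfold polar_J_def)
  next
    fix k u assume "k \<in> indices (leafX L)"
    then obtain i t where k: "k = (i, t)" "i \<in> indices F" by (cases k) auto
    show "smooth_on (coord (leafX L) k ` patch (leafX L) k) (\<lambda>x. (case k of (i, t) \<Rightarrow> J i) (param (leafX L) k x) u)"
      unfolding k(1) prod.case by (rule smooth_on_leaf_chart[OF L k(2) J(2)[OF k(2)]])
  next
    fix p k l u assume kl: "k \<in> charts_at (leafX L) p" "l \<in> charts_at (leafX L) p"
    obtain i t j s where e: "k = (i, t)" "l = (j, s)" by (cases k, cases l) auto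
    have ij: "i \<in> charts_at F p" "j \<in> charts_at F p" using kl by (auto simp: e leaf_charts_at)
    have d: "transition_deriv (leafX L) (i, t) (j, s) p u = leaf_deriv i j p u" for u
      unfolding leaf_deriv_def by (rule leaf_transition_deriv[OF L kl[unfolded e]])
    show "transition_deriv (leafX L) k l p ((case k of (i, t) \<Rightarrow> J i) p u) =
        (case l of (i, t) \<Rightarrow> J i) p (transition_deriv (leafX L) k l p u)"
      unfolding e prod.case d by (rule J(3)[OF ij])
  qed
qed

text \<open>Both constants are 1. The first inequality is an equality by the choice of the metric.
  For the second, the metric applied to \<open>u\<close> and \<open>J v\<close> is minus the form
  applied to \<open>u\<close> and \<open>v\<close>, and \<open>J\<close> preserves lengths, so it is
  the Cauchy-Schwarz inequality.\<close>

lemma GB1_compatible: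
  assumes J: "almost_complex_structure X J" "compatible_with X \<omega> J"
    and g: "riemannian_metric X (\<lambda>i p u v. \<omega> i p u (J i p v))" and w: "symplectic_form X \<omega>"
  shows "GB1 X \<omega> J (\<lambda>i p u v. \<omega> i p u (J i p v))"
  unfolding GB1_def
proof (intro exI[of _ "1::real"] conjI ballI allI)
  fix i p u v assume i: "i \<in> indices X" "p \<in> patch X i"
  let ?g = "\<lambda>u v. \<omega> i p u (J i p v)"
  have G: "bilinear ?g" "\<And>u v. ?g u v = ?g v u" "\<And>u. u \<noteq> 0 \<Longrightarrow> ?g u u > 0"
    using g i unfolding riemannian_metric_def smooth_2tensor_def by blast+
  have J2: "J i p (J i p v) = - v" and Jw: "\<omega> i p (J i p v) (J i p (J i p v)) = \<omega> i p v (J i p v)"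
    using J i unfolding almost_complex_structure_def compatible_with_def by blast+
  have "\<forall>i\<in>indices X. \<forall>p\<in>patch X i. bilinear (\<omega> i p)"
    using w unfolding symplectic_form_def smooth_2tensor_def by (elim conjE)
  then have b: "bilinear (\<omega> i p)" using i by blast
  have nn: "?g u u \<ge> 0" by (cases "u = 0") (auto simp: bilinear_lzero[OF b] less_imp_le[OF G(3)])
  then show "\<omega> i p u (J i p u) \<ge> 1 * (tnorm (\<lambda>i p u v. \<omega> i p u (J i p v)) i p u)\<^sup>2" by (simp add: tnorm_def)
  have "\<bar>?g u (J i p v)\<bar> \<le> sqrt (?g u u) * sqrt (?g (J i p v) (J i p v))" by (rule bilinear_cauchy_schwarz[OF G])
  then show "\<bar>\<omega> i p u v\<bar> \<le> 1 * tnorm (\<lambda>i p u v. \<omega> i p u (J i p v)) i p u * tnorm (\<lambda>i p u v. \<omega> i p u (J i p v)) i p v"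
    unfolding Jw by (simp add: J2 bilinear_rneg[OF b] tnorm_def)
qed simp_all

lemma (in foliated) finite_chart_cover:
  assumes "compact_space (atlas_topology F)"
  obtains I where "finite I" "I \<subseteq> indices F" "points F \<subseteq> (\<Union>i\<in>I. patch F i)"
proof -
  have "\<forall>U\<in>patch F ` indices F. openin (atlas_topology F) U" using openin_patch by blast
  moreover have "topspace (atlas_topology F) \<subseteq> \<Union>(patch F ` indices F)" unfolding topspace_eq using points_chart by blast
  ultimately obtain \<V> where \<V>: "finite \<V>" "\<V> \<subseteq> patch F ` indices F" "topspace (atlas_topology F) \<subseteq> \<Union>\<V>"
    using assms unfolding compact_space_alt by meson
  then show thesis using finite_subset_image[OF \<V>(1,2)] that topspace_eq by metis
qed

theorem lemma17:
  fixes M :: "('k, 'a, 'e::euclidean_space \<times> real) atlas"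
    and F :: "('i, 'a, 'e \<times> real) atlas"
    and \<omega> :: "'i \<Rightarrow> 'a \<Rightarrow> 'e \<Rightarrow> 'e \<Rightarrow> real"
    and L :: "'a set"
  assumes "closed_manifold M"
    and "symplectic_foliation M F \<omega>"
    and "L \<in> leaves F"
  shows "strongly_geometrically_bounded (leaf_manifold F L) (leaf_restriction \<omega>)"
proof -
  have fol: "foliation M F" and w: "leafwise_2form F \<omega>"
    and sympl: "\<And>L. L \<in> leaves F \<Longrightarrow> symplectic_form (leaf_manifold F L) (leaf_restriction \<omega>)"
    using assms(2) by (auto simp: symplectic_foliation_def)
  interpret foliated F
    using fol unfolding foliation_def by unfold_locales blast+
  have "smooth_atlas M" "points M = points F" "smoothly_compatible M F"
    using fol assms(1) by (simp_all add: foliation_def closed_manifold_def smooth_manifold_def)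
  from compatible_topology_eq[OF this(1) atlas this(2,3)]
  have H: "Hausdorff_space (atlas_topology F)" and K: "compact_space (atlas_topology F)"
    using assms(1) by (simp_all add: closed_manifold_def smooth_manifold_def)
  obtain b where b: "leaf_metric b" by (rule leaf_metric_exists[OF H K])
  \<comment> \<open>Nondegeneracy is part of the hypothesis on the leaves. Every point lies on some
    leaf, so it holds for the form in every foliated chart.\<close>
  have nd: "u = 0" if i: "i \<in> charts_at F p" and u: "\<And>v. \<omega> i p u v = 0" for i p u
  proof -
    have "p \<in> points F" using i patch_subset by (auto simp: charts_at_def)
    then obtain L' where L': "L' \<in> leaves F" "p \<in> L'"
      using X0.topspace_eq Union_connected_components_of[of "atlas_topology (leafX (points F))"] unfolding leaves_def by fastforce
    let ?k = "(i, snd (coord F i p))"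
    have "?k \<in> indices (leafX L')" "p \<in> patch (leafX L') ?k" using i L'(2) by (auto simp: charts_at_def)
    then have "(\<forall>v. leaf_restriction \<omega> ?k p u v = 0) \<longrightarrow> u = 0"
      using sympl[OF L'(1)] unfolding symplectic_form_def by blast
    then show ?thesis using u by (simp add: leaf_restriction_def)
  qed
  obtain J where J: "\<And>i p. i \<in> charts_at F p \<Longrightarrow> polar_J (\<omega> i p) (b i p) (J i p)"
    "\<And>i u. i \<in> indices F \<Longrightarrow> smooth_on (coord F i ` patch F i) (\<lambda>z. J i (param F i z) u)"
    "\<And>i j p u. i \<in> charts_at F p \<Longrightarrow> j \<in> charts_at F p \<Longrightarrow> leaf_deriv i j p (J i p u) = J j p (leaf_deriv i j p u)"
    by (rule leafwise_polar_exists[OF b w nd]) (assumption | rule that)+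
  define g where "g i p u v = \<omega> i p u (J i p v)" for i p u v
  have g: "leaf_metric g" unfolding g_def[abs_def] by (rule leaf_metric_polar[OF b w J])
  let ?J = "\<lambda>(i, t). J i"
  note Lo = leaf_is_open[OF assms(3)]
  have gL: "leaf_restriction g = (\<lambda>i p u v. leaf_restriction \<omega> i p u (?J i p v))"
    by (auto simp: fun_eq_iff leaf_restriction_def g_def)
  have ac: "almost_complex_structure (leafX L) ?J" and comp: "compatible_with (leafX L) (leaf_restriction \<omega>) ?J"
    by (rule leaf_polar_structure[OF Lo J]; assumption)+
  obtain I where I: "finite I" "I \<subseteq> indices F" "points F \<subseteq> (\<Union>i\<in>I. patch F i)" by (rule finite_chart_cover[OF K])
  have sm: "symplectic_manifold (leafX L) (leaf_restriction \<omega>)"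
    unfolding symplectic_manifold_def smooth_manifold_def
    by (intro conjI leaf_smooth_atlas[OF Lo] leaf_Hausdorff[OF Lo H] leaf_countable_basis[OF I assms(3)] sympl[OF assms(3)])
  have "GB1 (leafX L) (leaf_restriction \<omega>) ?J (leaf_restriction g)"
    unfolding gL by (rule GB1_compatible[OF ac comp leaf_riemannian[OF Lo g, unfolded gL] sympl[OF assms(3)]])
  then have "geometrically_bounded_triple (leafX L) (leaf_restriction \<omega>) ?J (leaf_restriction g)"
    unfolding geometrically_bounded_triple_def using sm ac leaf_bounded_geometry[OF g K H assms(3)] by blast
  then show ?thesis
    unfolding strongly_geometrically_bounded_def using sm ac comp gL by auto
qed

end
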